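(* Let $E$ be a finite directed graph with at least one cycle, with vertex matrix $A$. Let $K=\bigcup_{C\in \mathrm{mc}(E)}C$, and let $H:=\{v\in E^0:KE^*v\neq\emptyset\}$ be the hereditary closure of $K$. (a) Let $C\in \mathrm{mc}(E)$ be a minimal critical component, and let $x^C$ be the unimodular Perron--Frobenius eigenvector of the irreducible matrix $A_C$ (the one with $\|x^C\|_1=1$). Define a vector $z^C\in [0,\infty)^{E^0\setminus H}$ by $$z^C:=\rho(A)^{-1}\big(1-\rho(A)^{-1}A_{E^0\setminus H}\big)^{-1}A_{E^0\setminus H,\,C}\,x^C.$$ Then there is a KMS$_{\ln\rho(A)}$ state $\psi_C$ of $(\mathcal{T}C^*(E),\alpha)$ such that for all $\mu,\nu\in E^*$ $$\psi_C(s_\mu s_\nu^* )=\delta_{\mu,\nu}\,\rho(A)^{-|\mu|}(1+\|z^C\|_1)^{-1}\begin{cases} z^C_{s(\mu)}&\text{if } s(\mu)\in E^0\setminus H\\ x^C_{s(\mu)}&\text{if } s(\mu)\in C\\ 0&\text{if } s(\mu)\in H\setminus C.\end{cases}$$ The state $\psi_C$ factors through a KMS$_{\ln\rho(A)}$ state $\bar\psi_C$ of $(C^*(E),\alpha)$. (b) The map $t\mapsto \sum_{C\in \mathrm{mc}(E)}t_C\psi_C$ is an affine isomorphism of $$S_E:=\Big\{t\in[0,1]^{\mathrm{mc}(E)}:\sum_{C\in \mathrm{mc}(E)} t_C=1\Big\}$$ onto a simplex $\Sigma_{\mathrm{mc}(E)}$ of KMS$_{\ln\rho(A)}$ states of $(\mathcal{T}C^*(E),\alpha)$.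 Every KMS$_{\ln\rho(A)}$ state of $(\mathcal{T}C^*(E),\alpha)$ is a convex combination of a state of the form $\phi\circ q_H$, where $\phi$ is a KMS$_{\ln\rho(A)}$ state of $(\mathcal{T}C^*(E\setminus H),\alpha)$, and a state in $\Sigma_{\mathrm{mc}(E)}$.
   Context: Graphs. A finite directed graph $E=(E^0,E^1,r,s)$ has finite sets $E^0$ (vertices), $E^1$ (edges) and range and source maps $r,s:E^1\to E^0$. A path of length $n\ge1$ is $\mu=\mu_1\cdots\mu_n$ with $\mu_i\in E^1$ and $s(\mu_i)=r(\mu_{i+1})$; $r(\mu)=r(\mu_1)$, $s(\mu)=s(\mu_n)$, $|\mu|=n$. Vertices are paths of length $0$. $E^n$ is the set of paths of length $n$, $E^*=\bigcup_{n\ge0}E^n$. For $v,w\in E^0$ (or subsets of $E^0$), $vE^nw=\{\mu\in E^n:r(\mu)=v,\ s(\mu)=w\}$, and similarly $vE^1$, $vE^*w$, $KE^*v$, etc. A cycle is a path of length $\ge 1$ with equal range and source. Matrices and components. The vertex matrix is $A(v,w)=|vE^1w|$. For $C,D\subset E^0$, $A_{C,D}$ is the $C\times D$ block and $A_C=A_{C,C}$; $\rho$ is spectral radius (with $\rho=0$ for the empty matrix). Write $v\le w$ iff $vE^*w\ne\emptyset$, and $v\sim w$ iff $v\le w$ and $w\le v$; the $\sim$-classes are the strongly connected components, and $\le$ descends to a partial order on them. A component is trivial if it is a single vertex with no loop; otherwise $A_C$ is irreducible. The critical components are those $C$ with $\rho(A_C)=\rho(A)$; $\mathrm{mc}(E)$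 is the set of minimal critical components, i.e. those critical components minimal for $\le$ among the critical components. Hereditary sets. $H\subset E^0$ is hereditary if $v\in H$ and $vE^*w\ne\emptyset$ imply $w\in H$; the hereditary closure of a set is the smallest hereditary set containing it. For hereditary $H$, $E\setminus H:=(E^0\setminus H,s^{-1}(E^0\setminus H),r,s)$. If $H=E^0$ then $\mathcal{T}C^*(E\setminus H)=\{0\}$ has no states and the corresponding term in a convex combination is absent. Algebras. $\mathcal{T}C^*(E)$ is the universal $C^*$-algebra generated by mutually orthogonal projections $\{p_v:v\in E^0\}$ and partial isometries $\{s_e:e\in E^1\}$ with $s_e^*s_e=p_{s(e)}$ and $p_v\ge\sum_{e\in vE^1}s_es_e^*$ for all $v$. Put $s_\mu=s_{\mu_1}\cdots s_{\mu_n}$, $s_v=p_v$. $C^*(E)$ is the quotient of $\mathcal{T}C^*(E)$ by the ideal generated by $\{p_v-\sum_{r(e)=v}s_es_e^*: v\in E^0,\ vE^1\ne\emptyset\}$, with quotient map $\pi_E$. For hereditary $H$, $q_H:\mathcal{T}C^*(E)\to\mathcal{T}C^*(E\setminus H)$ is the surjective homomorphism with $q_H(p_v)=p_v$ if $v\notin H$ and $0$ if $v\in H$; $q_H(s_e)=s_e$ if $s(e)\notin H$ and $0$ if $s(e)\in H$. A state of $\mathcal{T}C^*(E)$ factors through $C^*(E)$ if it has the form $\bar\phi\circ\pi_E$. Dynamics and KMS states. $\alpha$ denotes the action of $\mathbb{R}$ (on any $\mathcal{T}C^*(E)$ or $C^*(E)$) with $\alpha_t(p_v)=p_v$, $\alpha_t(s_e)=e^{it}s_e$.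 A KMS$_\beta$ state is a state $\phi$ with $\phi(ab)=\phi(b\alpha_{i\beta}(a))$ for all analytic $a,b$ (KMS$_0$ states are the $\alpha$-invariant traces). On $\mathcal{T}C^*(E)$ this is equivalent to $\phi(s_\mu s_\nu^* )=\delta_{\mu,\nu}e^{-\beta|\mu|}\phi(p_{s(\mu)})$ for all $\mu,\nu\in E^*$; a state of $C^*(E)$ is KMS$_\beta$ iff its composition with $\pi_E$ is. *)

theory Defs
  imports
    "HOL-Analysis.Analysis"
    "HOL-Algebra.QuotRing"
    "HOL-Algebra.Module"
    "HOL-Library.Function_Algebras"
    "Graph_Theory.Digraph"
begin

section \<open>Finite directed graphs\<close>

text \<open>
  The source map is \<^const>\<open>tail\<close> and the range map is \<^const>\<open>head\<close>.  Paths follow the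
  convention in which an edge points from its source to its range and consecutive edges satisfy
  \<open>s(\<mu>\<^sub>i) = r(\<mu>\<^sub>i\<^sub>+\<^sub>1)\<close>, so they are traversed against the arrows (this is the reverse of
  the arc walks of \<open>Graph_Theory\<close>).  A path is the pair of its range and its list of edges, so that
  the paths \<open>(v, [])\<close> of length 0 are the vertices.
\<close>

fun is_path :: "('v, 'e) pre_digraph \<Rightarrow> 'v \<Rightarrow> 'e list \<Rightarrow> 'v \<Rightarrow> bool" where
  "is_path E v [] w \<longleftrightarrow> v \<in> verts E \<and> v = w"
| "is_path E v (e # es) w \<longleftrightarrow> e \<in> arcs E \<and> head E e = v \<and> is_path E (tail E e) es w"

definition paths :: "('v, 'e) pre_digraph \<Rightarrow> ('v \<times> 'e list) set" where
  "paths E = {(v, es). \<exists>w. is_path E v es w}"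

definition path_source :: "('v, 'e) pre_digraph \<Rightarrow> 'v \<times> 'e list \<Rightarrow> 'v" where
  "path_source E \<mu> = (if snd \<mu> = [] then fst \<mu> else tail E (last (snd \<mu>)))"

definition path_length :: "'v \<times> 'e list \<Rightarrow> nat" where
  "path_length \<mu> = length (snd \<mu>)"

definition has_cycle :: "('v, 'e) pre_digraph \<Rightarrow> bool" where
  "has_cycle E \<longleftrightarrow> (\<exists>v es. es \<noteq> [] \<and> is_path E v es v)"

definition vertex_le :: "('v, 'e) pre_digraph \<Rightarrow> 'v \<Rightarrow> 'v \<Rightarrow> bool" where
  "vertex_le E v w \<longleftrightarrow> (\<exists>es. is_path E v es w)"

definition strong_components :: "('v, 'e) pre_digraph \<Rightarrow> 'v set set" where
  "strong_components E =
     verts E // {(v, w). v \<in> verts E \<and> w \<in> verts E \<and> vertex_le E v w \<and> vertex_le E w v}"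

definition component_le :: "('v, 'e) pre_digraph \<Rightarrow> 'v set \<Rightarrow> 'v set \<Rightarrow> bool" where
  "component_le E C D \<longleftrightarrow> (\<exists>v\<in>C. \<exists>w\<in>D. vertex_le E v w)"

definition hereditary :: "('v, 'e) pre_digraph \<Rightarrow> 'v set \<Rightarrow> bool" where
  "hereditary E H \<longleftrightarrow> H \<subseteq> verts E \<and> (\<forall>v\<in>H. \<forall>w. vertex_le E v w \<longrightarrow> w \<in> H)"

definition hereditary_closure :: "('v, 'e) pre_digraph \<Rightarrow> 'v set \<Rightarrow> 'v set" where
  "hereditary_closure E K = \<Inter>{H. hereditary E H \<and> K \<subseteq> H}"

definition graph_minus :: "('v, 'e) pre_digraph \<Rightarrow> 'v set \<Rightarrow> ('v, 'e) pre_digraph" where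
  "graph_minus E H =
     \<lparr>verts = verts E - H, arcs = {e \<in> arcs E. tail E e \<in> verts E - H}, tail = tail E, head = head E\<rparr>"


section \<open>Matrices indexed by finite sets\<close>

text \<open>
  A \<open>C \<times> D\<close> matrix is a function of two arguments of which only the values on \<open>C \<times> D\<close> matter; in
  particular the block \<open>A\<^sub>C\<^sub>,\<^sub>D\<close> of a matrix is the same function, considered on \<open>C \<times> D\<close>.
\<close>

definition vertex_matrix :: "('v, 'e) pre_digraph \<Rightarrow> 'v \<Rightarrow> 'v \<Rightarrow> real" where
  "vertex_matrix E v w = real (card {e \<in> arcs E. head E e = v \<and> tail E e = w})"

definition mat_eigenvalue :: "('v \<Rightarrow> 'v \<Rightarrow> real) \<Rightarrow> 'v set \<Rightarrow> complex \<Rightarrow> bool" where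
  "mat_eigenvalue M C l \<longleftrightarrow>
     (\<exists>x :: 'v \<Rightarrow> complex. (\<exists>v\<in>C. x v \<noteq> 0) \<and>
        (\<forall>v\<in>C. (\<Sum>w\<in>C. of_real (M v w) * x w) = l * x v))"

definition mat_spectral_radius :: "('v \<Rightarrow> 'v \<Rightarrow> real) \<Rightarrow> 'v set \<Rightarrow> real" where
  "mat_spectral_radius M C = (if C = {} then 0 else Max (norm ` {l. mat_eigenvalue M C l}))"

definition mat_is_inverse :: "'v set \<Rightarrow> ('v \<Rightarrow> 'v \<Rightarrow> real) \<Rightarrow> ('v \<Rightarrow> 'v \<Rightarrow> real) \<Rightarrow> bool" where
  "mat_is_inverse D M N \<longleftrightarrow>
     (\<forall>v\<in>D. \<forall>w\<in>D. (\<Sum>u\<in>D. M v u * N u w) = (if v = w then 1 else 0) \<and>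
                    (\<Sum>u\<in>D. N v u * M u w) = (if v = w then 1 else 0))"

definition mat_invertible :: "'v set \<Rightarrow> ('v \<Rightarrow> 'v \<Rightarrow> real) \<Rightarrow> bool" where
  "mat_invertible D M \<longleftrightarrow> (\<exists>N. mat_is_inverse D M N)"

text \<open>The inverse is extended by 0 outside \<open>D \<times> D\<close> to make it unique as a function.\<close>

definition mat_inverse :: "'v set \<Rightarrow> ('v \<Rightarrow> 'v \<Rightarrow> real) \<Rightarrow> 'v \<Rightarrow> 'v \<Rightarrow> real" where
  "mat_inverse D M =
     (THE N. mat_is_inverse D M N \<and> (\<forall>v w. v \<notin> D \<or> w \<notin> D \<longrightarrow> N v w = 0))"


section \<open>Minimal critical components\<close>

definition graph_rho :: "('v, 'e) pre_digraph \<Rightarrow> real" where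
  "graph_rho E = mat_spectral_radius (vertex_matrix E) (verts E)"

definition critical_components :: "('v, 'e) pre_digraph \<Rightarrow> 'v set set" where
  "critical_components E =
     {C \<in> strong_components E. mat_spectral_radius (vertex_matrix E) C = graph_rho E}"

definition mc :: "('v, 'e) pre_digraph \<Rightarrow> 'v set set" where
  "mc E = {C \<in> critical_components E. \<forall>D\<in>critical_components E. component_le E D C \<longrightarrow> D = C}"

definition mc_union :: "('v, 'e) pre_digraph \<Rightarrow> 'v set" where
  "mc_union E = \<Union>(mc E)"

definition mc_hull :: "('v, 'e) pre_digraph \<Rightarrow> 'v set" where
  "mc_hull E = {v \<in> verts E. \<exists>w\<in>mc_union E. vertex_le E w v}"

lemma is_path_verts: "is_path E v es w \<Longrightarrow> w \<in> verts E"
  by (induction es arbitrary: v) auto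

lemma is_path_append: "is_path E u es v \<Longrightarrow> is_path E v fs w \<Longrightarrow> is_path E u (es @ fs) w"
  by (induction es arbitrary: u) auto

lemma mc_hull_eq_hereditary_closure: "mc_hull E = hereditary_closure E (mc_union E)"
proof
  have K: "mc_union E \<subseteq> verts E"
    by (auto simp: mc_union_def mc_def critical_components_def strong_components_def quotient_def)
  have "mc_union E \<subseteq> mc_hull E"
  proof
    fix v assume v: "v \<in> mc_union E"
    with K have "is_path E v [] v" by auto
    with v K show "v \<in> mc_hull E"
      unfolding mc_hull_def vertex_le_def by blast
  qed
  moreover have "hereditary E (mc_hull E)"
    unfolding hereditary_def
  proof (intro conjI ballI allI impI)
    show "mc_hull E \<subseteq> verts E" by (auto simp: mc_hull_def)
    fix v w assume "v \<in> mc_hull E" "vertex_le E v w"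
    then obtain u es fs where "u \<in> mc_union E" "is_path E u es v" "is_path E v fs w"
      unfolding mc_hull_def vertex_le_def by auto
    then have "u \<in> mc_union E" "is_path E u (es @ fs) w" "w \<in> verts E"
      by (auto intro: is_path_append dest: is_path_verts)
    then show "w \<in> mc_hull E"
      unfolding mc_hull_def vertex_le_def by blast
  qed
  ultimately show "hereditary_closure E (mc_union E) \<subseteq> mc_hull E"
    unfolding hereditary_closure_def by blast
  show "mc_hull E \<subseteq> hereditary_closure E (mc_union E)"
    unfolding hereditary_closure_def mc_hull_def hereditary_def by blast
qed

definition pf_vector :: "('v, 'e) pre_digraph \<Rightarrow> 'v set \<Rightarrow> 'v \<Rightarrow> real" where
  "pf_vector E C =
     (THE x. (\<forall>v\<in>C. 0 < x v) \<and> (\<forall>v. v \<notin> C \<longrightarrow> x v = 0) \<and>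
        (\<forall>v\<in>C. (\<Sum>w\<in>C. vertex_matrix E v w * x w) =
                mat_spectral_radius (vertex_matrix E) C * x v) \<and>
        (\<Sum>v\<in>C. \<bar>x v\<bar>) = 1)"

definition z_matrix :: "('v, 'e) pre_digraph \<Rightarrow> 'v \<Rightarrow> 'v \<Rightarrow> real" where
  "z_matrix E v w = (if v = w then 1 else 0) - inverse (graph_rho E) * vertex_matrix E v w"

definition z_vector :: "('v, 'e) pre_digraph \<Rightarrow> 'v set \<Rightarrow> 'v \<Rightarrow> real" where
  "z_vector E C v =
     inverse (graph_rho E) *
     (\<Sum>w\<in>verts E - mc_hull E. mat_inverse (verts E - mc_hull E) (z_matrix E) v w *
        (\<Sum>u\<in>C. vertex_matrix E w u * pf_vector E C u))"


section \<open>\<open>C\<^sup>*\<close>-algebras\<close>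

record 'a cstar = "(complex, 'a) module" +
  adj :: "'a \<Rightarrow> 'a"
  cnorm :: "'a \<Rightarrow> real"

text \<open>
  All algebras considered are unital (the zero algebra is allowed), but homomorphisms are not
  required to preserve the unit.
\<close>

locale cstar_algebra = ring A for A :: "'a cstar" (structure) +
  assumes smult_closed: "x \<in> carrier A \<Longrightarrow> c \<odot> x \<in> carrier A"
    and smult_l_distr: "x \<in> carrier A \<Longrightarrow> (c + d) \<odot> x = c \<odot> x \<oplus> d \<odot> x"
    and smult_r_distr: "x \<in> carrier A \<Longrightarrow> y \<in> carrier A \<Longrightarrow> c \<odot> (x \<oplus> y) = c \<odot> x \<oplus> c \<odot> y"
    and smult_assoc1: "x \<in> carrier A \<Longrightarrow> (c * d) \<odot> x = c \<odot> (d \<odot> x)"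
    and smult_one: "x \<in> carrier A \<Longrightarrow> 1 \<odot> x = x"
    and smult_mult_left: "x \<in> carrier A \<Longrightarrow> y \<in> carrier A \<Longrightarrow> (c \<odot> x) \<otimes> y = c \<odot> (x \<otimes> y)"
    and smult_mult_right: "x \<in> carrier A \<Longrightarrow> y \<in> carrier A \<Longrightarrow> x \<otimes> (c \<odot> y) = c \<odot> (x \<otimes> y)"
    and adj_closed: "x \<in> carrier A \<Longrightarrow> adj A x \<in> carrier A"
    and adj_adj: "x \<in> carrier A \<Longrightarrow> adj A (adj A x) = x"
    and adj_add: "x \<in> carrier A \<Longrightarrow> y \<in> carrier A \<Longrightarrow> adj A (x \<oplus> y) = adj A x \<oplus> adj A y"
    and adj_smult: "x \<in> carrier A \<Longrightarrow> adj A (c \<odot> x) = cnj c \<odot> adj A x"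
    and adj_mult: "x \<in> carrier A \<Longrightarrow> y \<in> carrier A \<Longrightarrow> adj A (x \<otimes> y) = adj A y \<otimes> adj A x"
    and cnorm_nonneg: "x \<in> carrier A \<Longrightarrow> 0 \<le> cnorm A x"
    and cnorm_eq_zero: "x \<in> carrier A \<Longrightarrow> cnorm A x = 0 \<longleftrightarrow> x = \<zero>"
    and cnorm_triangle: "x \<in> carrier A \<Longrightarrow> y \<in> carrier A \<Longrightarrow> cnorm A (x \<oplus> y) \<le> cnorm A x + cnorm A y"
    and cnorm_smult: "x \<in> carrier A \<Longrightarrow> cnorm A (c \<odot> x) = cmod c * cnorm A x"
    and cnorm_mult: "x \<in> carrier A \<Longrightarrow> y \<in> carrier A \<Longrightarrow> cnorm A (x \<otimes> y) \<le> cnorm A x * cnorm A y"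
    and cstar_identity: "x \<in> carrier A \<Longrightarrow> cnorm A (adj A x \<otimes> x) = (cnorm A x)\<^sup>2"
    and complete:
      "(\<And>n::nat. X n \<in> carrier A) \<Longrightarrow>
       (\<And>\<epsilon>. \<epsilon> > 0 \<Longrightarrow> \<exists>N. \<forall>m\<ge>N. \<forall>n\<ge>N. cnorm A (X m \<ominus> X n) < \<epsilon>) \<Longrightarrow>
       \<exists>x\<in>carrier A. (\<lambda>n. cnorm A (X n \<ominus> x)) \<longlonglongrightarrow> 0"

definition star_hom :: "'a cstar \<Rightarrow> 'b cstar \<Rightarrow> ('a \<Rightarrow> 'b) \<Rightarrow> bool" where
  "star_hom A B h \<longleftrightarrow>
     h \<in> carrier A \<rightarrow> carrier B \<and>
     (\<forall>x\<in>carrier A. \<forall>y\<in>carrier A. h (x \<oplus>\<^bsub>A\<^esub> y) = h x \<oplus>\<^bsub>B\<^esub> h y) \<and>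
     (\<forall>x\<in>carrier A. \<forall>y\<in>carrier A. h (x \<otimes>\<^bsub>A\<^esub> y) = h x \<otimes>\<^bsub>B\<^esub> h y) \<and>
     (\<forall>c. \<forall>x\<in>carrier A. h (c \<odot>\<^bsub>A\<^esub> x) = c \<odot>\<^bsub>B\<^esub> h x) \<and>
     (\<forall>x\<in>carrier A. h (adj A x) = adj B (h x))"

definition norm_closed :: "'a cstar \<Rightarrow> 'a set \<Rightarrow> bool" where
  "norm_closed A S \<longleftrightarrow>
     (\<forall>X x. (\<forall>n::nat. X n \<in> S) \<and> x \<in> carrier A \<and> (\<lambda>n. cnorm A (X n \<ominus>\<^bsub>A\<^esub> x)) \<longlonglongrightarrow> 0 \<longrightarrow> x \<in> S)"

definition cstar_subalgebra :: "'a cstar \<Rightarrow> 'a set \<Rightarrow> bool" where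
  "cstar_subalgebra A S \<longleftrightarrow>
     S \<subseteq> carrier A \<and> \<zero>\<^bsub>A\<^esub> \<in> S \<and>
     (\<forall>x\<in>S. \<forall>y\<in>S. x \<oplus>\<^bsub>A\<^esub> y \<in> S \<and> x \<otimes>\<^bsub>A\<^esub> y \<in> S) \<and>
     (\<forall>c. \<forall>x\<in>S. c \<odot>\<^bsub>A\<^esub> x \<in> S) \<and> (\<forall>x\<in>S. adj A x \<in> S) \<and> norm_closed A S"

definition cstar_le :: "'a cstar \<Rightarrow> 'a \<Rightarrow> 'a \<Rightarrow> bool" where
  "cstar_le A x y \<longleftrightarrow> (\<exists>c\<in>carrier A. y \<ominus>\<^bsub>A\<^esub> x = adj A c \<otimes>\<^bsub>A\<^esub> c)"

definition is_projection :: "'a cstar \<Rightarrow> 'a \<Rightarrow> bool" where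
  "is_projection A x \<longleftrightarrow> x \<in> carrier A \<and> x \<otimes>\<^bsub>A\<^esub> x = x \<and> adj A x = x"

definition is_partial_isometry :: "'a cstar \<Rightarrow> 'a \<Rightarrow> bool" where
  "is_partial_isometry A x \<longleftrightarrow> x \<in> carrier A \<and> x \<otimes>\<^bsub>A\<^esub> adj A x \<otimes>\<^bsub>A\<^esub> x = x"

definition closed_ideal_generated :: "'a cstar \<Rightarrow> 'a set \<Rightarrow> 'a set" where
  "closed_ideal_generated A S = \<Inter>{I. ideal I A \<and> norm_closed A I \<and> S \<subseteq> I}"

text \<open>
  The quotient by a closed ideal extends the ring \<open>A Quot I\<close> of cosets; the coset \<open>I\<close> + \<open>x\<close> has norm
  \<open>inf {\<parallel>y\<parallel> | y \<in> I + x}\<close>.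
\<close>

definition cstar_quotient :: "'a cstar \<Rightarrow> 'a set \<Rightarrow> 'a set cstar" where
  "cstar_quotient A I =
     \<lparr>carrier = carrier (A Quot I), mult = mult (A Quot I), one = one (A Quot I),
      zero = zero (A Quot I), add = add (A Quot I),
      smult = (\<lambda>c X. \<Union>x\<in>X. I +>\<^bsub>A\<^esub> (c \<odot>\<^bsub>A\<^esub> x)),
      adj = (\<lambda>X. \<Union>x\<in>X. I +>\<^bsub>A\<^esub> adj A x),
      cnorm = (\<lambda>X. Inf (cnorm A ` X))\<rparr>"


section \<open>Toeplitz algebras and graph algebras\<close>

definition toeplitz_family ::
  "('v, 'e) pre_digraph \<Rightarrow> 'a cstar \<Rightarrow> ('v \<Rightarrow> 'a) \<Rightarrow> ('e \<Rightarrow> 'a) \<Rightarrow> bool" where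
  "toeplitz_family E A p s \<longleftrightarrow>
     (\<forall>v\<in>verts E. is_projection A (p v)) \<and>
     (\<forall>v\<in>verts E. \<forall>w\<in>verts E. v \<noteq> w \<longrightarrow> p v \<otimes>\<^bsub>A\<^esub> p w = \<zero>\<^bsub>A\<^esub>) \<and>
     (\<forall>e\<in>arcs E. is_partial_isometry A (s e)) \<and>
     (\<forall>e\<in>arcs E. adj A (s e) \<otimes>\<^bsub>A\<^esub> s e = p (tail E e)) \<and>
     (\<forall>v\<in>verts E.
        cstar_le A (\<Oplus>\<^bsub>A\<^esub>e\<in>{e \<in> arcs E. head E e = v}. s e \<otimes>\<^bsub>A\<^esub> adj A (s e)) (p v))"

text \<open>
  The universal property has to be tested on \<open>C\<^sup>*\<close>-algebras whose carriers live in one fixed type.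
  The \<open>C\<^sup>*\<close>-algebra generated by the family of a finite graph is separable, so it has at most
  continuum many elements and an isomorphic copy (with unit \<open>\<Sum>\<^sub>v p\<^sub>v\<close>) with carrier in the
  following type; hence testing on all \<open>C\<^sup>*\<close>-algebras over this type amounts to testing on
  all \<open>C\<^sup>*\<close>-algebras.
\<close>

type_synonym test = "(nat \<Rightarrow> complex) \<Rightarrow> nat \<Rightarrow> complex"

definition toeplitz_algebra ::
  "('v, 'e) pre_digraph \<Rightarrow> 'a cstar \<Rightarrow> ('v \<Rightarrow> 'a) \<Rightarrow> ('e \<Rightarrow> 'a) \<Rightarrow> bool" where
  "toeplitz_algebra E A p s \<longleftrightarrow>
     cstar_algebra A \<and> toeplitz_family E A p s \<and>
     (\<forall>S. cstar_subalgebra A S \<and> p ` verts E \<union> s ` arcs E \<subseteq> S \<longrightarrow> S = carrier A) \<and>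
     (\<forall>(B :: test cstar) P S. cstar_algebra B \<and> toeplitz_family E B P S \<longrightarrow>
        (\<exists>h. star_hom A B h \<and> (\<forall>v\<in>verts E. h (p v) = P v) \<and> (\<forall>e\<in>arcs E. h (s e) = S e)))"

fun edges_elem :: "'a cstar \<Rightarrow> ('e \<Rightarrow> 'a) \<Rightarrow> 'e \<Rightarrow> 'e list \<Rightarrow> 'a" where
  "edges_elem A s e [] = s e"
| "edges_elem A s e (f # fs) = s e \<otimes>\<^bsub>A\<^esub> edges_elem A s f fs"

definition path_elem :: "'a cstar \<Rightarrow> ('v \<Rightarrow> 'a) \<Rightarrow> ('e \<Rightarrow> 'a) \<Rightarrow> 'v \<times> 'e list \<Rightarrow> 'a" where
  "path_elem A p s \<mu> = (case snd \<mu> of [] \<Rightarrow> p (fst \<mu>) | e # es \<Rightarrow> edges_elem A s e es)"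

definition ck_ideal ::
  "('v, 'e) pre_digraph \<Rightarrow> 'a cstar \<Rightarrow> ('v \<Rightarrow> 'a) \<Rightarrow> ('e \<Rightarrow> 'a) \<Rightarrow> 'a set" where
  "ck_ideal E A p s = closed_ideal_generated A
     {p v \<ominus>\<^bsub>A\<^esub> (\<Oplus>\<^bsub>A\<^esub>e\<in>{e \<in> arcs E. head E e = v}. s e \<otimes>\<^bsub>A\<^esub> adj A (s e)) | v.
        v \<in> verts E \<and> {e \<in> arcs E. head E e = v} \<noteq> {}}"

text \<open>Both depend on a choice \<open>(A, p, s)\<close> of the Toeplitz algebra of \<open>E\<close>.\<close>

definition graph_algebra ::
  "('v, 'e) pre_digraph \<Rightarrow> 'a cstar \<Rightarrow> ('v \<Rightarrow> 'a) \<Rightarrow> ('e \<Rightarrow> 'a) \<Rightarrow> 'a set cstar" where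
  "graph_algebra E A p s = cstar_quotient A (ck_ideal E A p s)"

definition graph_quotient_map ::
  "('v, 'e) pre_digraph \<Rightarrow> 'a cstar \<Rightarrow> ('v \<Rightarrow> 'a) \<Rightarrow> ('e \<Rightarrow> 'a) \<Rightarrow> 'a \<Rightarrow> 'a set" where
  "graph_quotient_map E A p s a = ck_ideal E A p s +>\<^bsub>A\<^esub> a"

definition hereditary_quotient_map ::
  "('v, 'e) pre_digraph \<Rightarrow> 'v set \<Rightarrow> 'a cstar \<Rightarrow> ('v \<Rightarrow> 'a) \<Rightarrow> ('e \<Rightarrow> 'a) \<Rightarrow>
   'b cstar \<Rightarrow> ('v \<Rightarrow> 'b) \<Rightarrow> ('e \<Rightarrow> 'b) \<Rightarrow> ('a \<Rightarrow> 'b) \<Rightarrow> bool" where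
  "hereditary_quotient_map E H A p s B p' s' q \<longleftrightarrow>
     star_hom A B q \<and>
     (\<forall>v\<in>verts E. q (p v) = (if v \<notin> H then p' v else \<zero>\<^bsub>B\<^esub>)) \<and>
     (\<forall>e\<in>arcs E. q (s e) = (if tail E e \<notin> H then s' e else \<zero>\<^bsub>B\<^esub>))"


section \<open>Dynamics and KMS states\<close>

text \<open>
  These conditions determine \<open>\<alpha>\<close> on an algebra generated by \<open>p\<close> and \<open>s\<close>; the group law and strong
  continuity follow from them.
\<close>

definition gauge_dynamics ::
  "('v, 'e) pre_digraph \<Rightarrow> 'a cstar \<Rightarrow> ('v \<Rightarrow> 'a) \<Rightarrow> ('e \<Rightarrow> 'a) \<Rightarrow> (real \<Rightarrow> 'a \<Rightarrow> 'a) \<Rightarrow> bool" where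
  "gauge_dynamics E A p s \<alpha> \<longleftrightarrow>
     (\<forall>t. star_hom A A (\<alpha> t) \<and>
        (\<forall>v\<in>verts E. \<alpha> t (p v) = p v) \<and> (\<forall>e\<in>arcs E. \<alpha> t (s e) = cis t \<odot>\<^bsub>A\<^esub> s e))"

definition entire_function :: "'a cstar \<Rightarrow> (complex \<Rightarrow> 'a) \<Rightarrow> bool" where
  "entire_function A F \<longleftrightarrow>
     (\<forall>z. F z \<in> carrier A) \<and>
     (\<forall>z. \<exists>D\<in>carrier A.
        ((\<lambda>w. cnorm A ((inverse w \<odot>\<^bsub>A\<^esub> (F (z + w) \<ominus>\<^bsub>A\<^esub> F z)) \<ominus>\<^bsub>A\<^esub> D)) \<longlongrightarrow> 0) (at 0))"

text \<open>
  An element \<open>a\<close> is analytic if it has an entire extension \<open>F\<close> of its orbit, and then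
  \<open>\<alpha>\<^sub>z(a) = F z\<close>; such an \<open>F\<close> is unique.
\<close>

definition analytic_extension ::
  "'a cstar \<Rightarrow> (real \<Rightarrow> 'a \<Rightarrow> 'a) \<Rightarrow> 'a \<Rightarrow> (complex \<Rightarrow> 'a) \<Rightarrow> bool" where
  "analytic_extension A \<alpha> a F \<longleftrightarrow> entire_function A F \<and> (\<forall>t. F (of_real t) = \<alpha> t a)"

text \<open>
  Functionals are extended by 0 outside the carrier, so that they are equal as functions if they
  are equal on the algebra.
\<close>

definition state :: "'a cstar \<Rightarrow> ('a \<Rightarrow> complex) \<Rightarrow> bool" where
  "state A \<phi> \<longleftrightarrow>
     (\<forall>x. x \<notin> carrier A \<longrightarrow> \<phi> x = 0) \<and>
     (\<forall>x\<in>carrier A. \<forall>y\<in>carrier A. \<phi> (x \<oplus>\<^bsub>A\<^esub> y) = \<phi> x + \<phi> y) \<and>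
     (\<forall>c. \<forall>x\<in>carrier A. \<phi> (c \<odot>\<^bsub>A\<^esub> x) = c * \<phi> x) \<and>
     (\<forall>x\<in>carrier A. \<phi> (adj A x \<otimes>\<^bsub>A\<^esub> x) \<in> \<real> \<and> 0 \<le> Re (\<phi> (adj A x \<otimes>\<^bsub>A\<^esub> x))) \<and>
     (\<forall>x\<in>carrier A. cmod (\<phi> x) \<le> cnorm A x) \<and>
     Sup {cmod (\<phi> x) | x. x \<in> carrier A \<and> cnorm A x \<le> 1} = 1"

definition kms_state ::
  "'a cstar \<Rightarrow> (real \<Rightarrow> 'a \<Rightarrow> 'a) \<Rightarrow> real \<Rightarrow> ('a \<Rightarrow> complex) \<Rightarrow> bool" where
  "kms_state A \<alpha> \<beta> \<phi> \<longleftrightarrow>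
     state A \<phi> \<and>
     (\<forall>a\<in>carrier A. \<forall>b\<in>carrier A. \<forall>F G.
        analytic_extension A \<alpha> a F \<and> analytic_extension A \<alpha> b G \<longrightarrow>
        \<phi> (a \<otimes>\<^bsub>A\<^esub> b) = \<phi> (b \<otimes>\<^bsub>A\<^esub> F (\<i> * of_real \<beta>))) \<and>
     (\<beta> = 0 \<longrightarrow> (\<forall>t. \<forall>a\<in>carrier A. \<phi> (\<alpha> t a) = \<phi> a))"


section \<open>Simplices of functionals\<close>

instantiation "fun" :: (type, real_vector) real_vector
begin

definition "scaleR r f = (\<lambda>x. r *\<^sub>R f x)" for f :: "'a \<Rightarrow> 'b"

instance
  by standard (auto simp: scaleR_fun_def fun_eq_iff algebra_simps)

end

definition is_simplex :: "'a::real_vector set \<Rightarrow> bool" where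
  "is_simplex S \<longleftrightarrow> (\<exists>V. finite V \<and> V \<noteq> {} \<and> \<not> affine_dependent V \<and> S = convex hull V)"

definition affine_isomorphism ::
  "'a::real_vector set \<Rightarrow> 'b::real_vector set \<Rightarrow> ('a \<Rightarrow> 'b) \<Rightarrow> bool" where
  "affine_isomorphism S T f \<longleftrightarrow>
     bij_betw f S T \<and>
     (\<forall>x\<in>S. \<forall>y\<in>S. \<forall>u\<in>{0..1}. f ((1 - u) *\<^sub>R x + u *\<^sub>R y) = (1 - u) *\<^sub>R f x + u *\<^sub>R f y)"

text \<open>Elements of \<open>[0,1]\<^sup>I\<close> are extended by 0 outside the index set \<open>I\<close>.\<close>

definition weights :: "'i set \<Rightarrow> ('i \<Rightarrow> real) set" where
  "weights I = {t. (\<forall>i\<in>I. 0 \<le> t i \<and> t i \<le> 1) \<and> (\<forall>i. i \<notin> I \<longrightarrow> t i = 0) \<and> (\<Sum>i\<in>I. t i) = 1}"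

end

theory Submission
  imports
    Defs
    "HOL-Real_Asymp.Real_Asymp"
    "HOL-Library.Sublist"
    "HOL-Complex_Analysis.Complex_Analysis"
begin

text \<open>
  Throughout, \<open>r = \<rho>(A)\<close>. Everything rests on a correspondence: the KMS states at \<open>ln r\<close> of a
  Toeplitz algebra are exactly the functionals with \<open>\<phi>(s\<^sub>\<mu> s\<^sub>\<nu>\<^sup>*) = \<delta>\<^sub>\<mu>\<^sub>\<nu> r\<^sup>-\<^sup>|\<^sup>\<mu>\<^sup>| m\<^sub>s\<^sub>(\<^sub>\<mu>\<^sub>)\<close>
  for a nonnegative vector \<open>m\<close> on the vertices with sum 1 that is subinvariant, \<open>A m \<le> r m\<close>,
  and such a state lives on the graph algebra if \<open>m\<close> is invariant.

  One direction (\<open>kms_state_imp_kms_values\<close>, \<open>kms_values_subinvariant\<close>) is a computation with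
  elements that the dynamics scales. For the converse (\<open>kms_values_exists\<close>) the universal
  property provides the representation on the \<open>\<ell>\<^sup>2\<close>-space of the finite paths, and the
  functional is a limit of combinations of vector states in which a path of length \<open>n\<close> is
  weighted by \<open>r\<^sup>-\<^sup>n\<close> times the defect of \<open>m\<close>. It satisfies the KMS condition for all analytic
  elements, because the Fourier coefficients of \<open>\<psi>(\<gamma>\<^sub>t(a) b)\<close> and \<open>\<psi>(b \<gamma>\<^sub>t(a))\<close> differ by
  powers of \<open>r\<close> (\<open>kms_condition\<close>). This argument is carried out for a homomorphic image of the
  Toeplitz algebra, so that it also yields the factorization (\<open>kms_state_factors\<close>). That
  \<open>p\<^sub>v \<ge> \<Sum> s\<^sub>e s\<^sub>e\<^sup>*\<close> has the expected algebraic consequences needs that \<open>d\<^sup>*d\<close> is never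
  negative in a \<open>C\<^sup>*\<close>-algebra (\<open>kaplansky\<close>).

  What remains is linear algebra. By Perron--Frobenius theory the vectors \<open>z\<^sup>C + x\<^sup>C\<close> of the
  minimal critical components are invariant, which gives the \<open>\<psi>\<^sub>C\<close>; evaluation at the
  projections of the vertices of \<open>C\<close> shows that they are the vertices of a simplex. A
  subinvariant vector is a combination of them plus a subinvariant vector supported outside
  \<open>H\<close> (\<open>subinvariant_decomposition\<close>), and the latter is the vector of a KMS state of the
  Toeplitz algebra of \<open>E \ H\<close> (\<open>kms_state_decomposition\<close>).
\<close>

abbreviation edges_into :: "('v, 'e) pre_digraph \<Rightarrow> 'v \<Rightarrow> 'e set" where
  "edges_into E v \<equiv> {e \<in> arcs E. head E e = v}"

section \<open>Positive functionals on *-algebras\<close>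

text \<open>The algebraic part of the axioms, which passes to quotients at once.\<close>

locale star_algebra = ring A for A :: "'a cstar" (structure) +
  assumes scal_closed [simp, intro]: "x \<in> carrier A \<Longrightarrow> c \<odot> x \<in> carrier A"
    and scal_l_distr: "x \<in> carrier A \<Longrightarrow> (c + d) \<odot> x = c \<odot> x \<oplus> d \<odot> x"
    and scal_r_distr: "x \<in> carrier A \<Longrightarrow> y \<in> carrier A \<Longrightarrow> c \<odot> (x \<oplus> y) = c \<odot> x \<oplus> c \<odot> y"
    and scal_scal: "x \<in> carrier A \<Longrightarrow> c \<odot> (d \<odot> x) = (c * d) \<odot> x"
    and scal_one [simp]: "x \<in> carrier A \<Longrightarrow> 1 \<odot> x = x"
    and scal_mult_left: "x \<in> carrier A \<Longrightarrow> y \<in> carrier A \<Longrightarrow> (c \<odot> x) \<otimes> y = c \<odot> (x \<otimes> y)"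
    and scal_mult_right: "x \<in> carrier A \<Longrightarrow> y \<in> carrier A \<Longrightarrow> x \<otimes> (c \<odot> y) = c \<odot> (x \<otimes> y)"
    and star_closed [simp, intro]: "x \<in> carrier A \<Longrightarrow> adj A x \<in> carrier A"
    and star_star [simp]: "x \<in> carrier A \<Longrightarrow> adj A (adj A x) = x"
    and star_add: "x \<in> carrier A \<Longrightarrow> y \<in> carrier A \<Longrightarrow> adj A (x \<oplus> y) = adj A x \<oplus> adj A y"
    and star_scal: "x \<in> carrier A \<Longrightarrow> adj A (c \<odot> x) = cnj c \<odot> adj A x"
    and star_mult: "x \<in> carrier A \<Longrightarrow> y \<in> carrier A \<Longrightarrow> adj A (x \<otimes> y) = adj A y \<otimes> adj A x"
begin

lemma scal_zero [simp]: "c \<odot> \<zero> = \<zero>"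
proof -
  have "c \<odot> \<zero> \<oplus> c \<odot> \<zero> = c \<odot> \<zero>" using scal_r_distr[of \<zero> \<zero> c] by simp
  then show ?thesis using add.r_cancel_one[of "c \<odot> \<zero>" "c \<odot> \<zero>"] by simp
qed

lemma zero_scal [simp]: "x \<in> carrier A \<Longrightarrow> 0 \<odot> x = \<zero>"
  using scal_l_distr[of x 0 0] add.r_cancel_one[of "0 \<odot> x" "0 \<odot> x"] by simp

lemma minus_eq_scal: "x \<in> carrier A \<Longrightarrow> \<ominus> x = (- 1) \<odot> x"
  using scal_l_distr[of x "-1" 1] minus_equality[of "(-1) \<odot> x" x] by simp

lemma diff_eq_scal: "x \<in> carrier A \<Longrightarrow> y \<in> carrier A \<Longrightarrow> x \<ominus> y = x \<oplus> (- 1) \<odot> y"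
  by (simp add: a_minus_def minus_eq_scal)

lemma star_zero [simp]: "adj A \<zero> = \<zero>"
  using star_scal[of \<zero> 0] by simp

lemma star_one [simp]: "adj A \<one> = \<one>"
proof -
  have "adj A \<one> = adj A (adj A \<one> \<otimes> \<one>)" using star_mult[of "adj A \<one>" \<one>] by simp
  also have "\<dots> = \<one>" by simp
  finally show ?thesis .
qed

lemma star_diff: "x \<in> carrier A \<Longrightarrow> y \<in> carrier A \<Longrightarrow> adj A (x \<ominus> y) = adj A x \<ominus> adj A y"
  by (simp add: diff_eq_scal star_add star_scal)

lemma diff_self [simp]: "x \<in> carrier A \<Longrightarrow> x \<ominus> x = \<zero>"
  by (simp add: a_minus_def r_neg)

lemma diff_zero [simp]: "x \<in> carrier A \<Longrightarrow> x \<ominus> \<zero> = x"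
  by (simp add: a_minus_def)

lemma scal_diff: "x \<in> carrier A \<Longrightarrow> y \<in> carrier A \<Longrightarrow> c \<odot> (x \<ominus> y) = c \<odot> x \<ominus> c \<odot> y"
  by (simp add: diff_eq_scal scal_r_distr scal_scal)

lemma diff_eq_zero_iff: "x \<in> carrier A \<Longrightarrow> y \<in> carrier A \<Longrightarrow> x \<ominus> y = \<zero> \<longleftrightarrow> x = y"
  using minus_equality[of x "\<ominus> y"] by (auto simp: a_minus_def r_neg)

lemma mult_diff_right: "x \<in> carrier A \<Longrightarrow> y \<in> carrier A \<Longrightarrow> z \<in> carrier A \<Longrightarrow> x \<otimes> (y \<ominus> z) = x \<otimes> y \<ominus> x \<otimes> z"
  by (simp add: diff_eq_scal r_distr scal_mult_right)

lemma mult_diff_left: "x \<in> carrier A \<Longrightarrow> y \<in> carrier A \<Longrightarrow> z \<in> carrier A \<Longrightarrow> (y \<ominus> z) \<otimes> x = y \<otimes> x \<ominus> z \<otimes> x"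
  by (simp add: diff_eq_scal l_distr scal_mult_left)

lemma diff_add_diff: "x \<in> carrier A \<Longrightarrow> y \<in> carrier A \<Longrightarrow> z \<in> carrier A \<Longrightarrow> (x \<ominus> y) \<oplus> (y \<ominus> z) = x \<ominus> z"
  by (simp add: a_minus_def a_assoc) (metis a_assoc a_inv_closed l_neg l_zero)

lemma add_diff_cancel: "x \<in> carrier A \<Longrightarrow> y \<in> carrier A \<Longrightarrow> y \<oplus> (x \<ominus> y) = x"
  by (simp add: a_minus_def) (metis a_comm a_assoc a_inv_closed l_neg r_zero)

lemma add_diff_add:
  "x \<in> carrier A \<Longrightarrow> y \<in> carrier A \<Longrightarrow> u \<in> carrier A \<Longrightarrow> v \<in> carrier A \<Longrightarrow>
    (x \<oplus> y) \<ominus> (u \<oplus> v) = (x \<ominus> u) \<oplus> (y \<ominus> v)"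
  by (simp add: diff_eq_scal scal_r_distr a_ac)

definition positive_functional :: "('a \<Rightarrow> complex) \<Rightarrow> bool" where
  "positive_functional \<phi> \<longleftrightarrow>
     (\<forall>x\<in>carrier A. \<forall>y\<in>carrier A. \<phi> (x \<oplus> y) = \<phi> x + \<phi> y) \<and>
     (\<forall>c. \<forall>x\<in>carrier A. \<phi> (c \<odot> x) = c * \<phi> x) \<and>
     (\<forall>x\<in>carrier A. \<phi> (adj A x \<otimes> x) \<in> \<real> \<and> 0 \<le> Re (\<phi> (adj A x \<otimes> x)))"

context
  fixes \<phi> assumes \<phi>: "positive_functional \<phi>"
begin

lemma pos_add: "x \<in> carrier A \<Longrightarrow> y \<in> carrier A \<Longrightarrow> \<phi> (x \<oplus> y) = \<phi> x + \<phi> y"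
  and pos_scal: "x \<in> carrier A \<Longrightarrow> \<phi> (c \<odot> x) = c * \<phi> x"
  and pos_real: "x \<in> carrier A \<Longrightarrow> \<phi> (adj A x \<otimes> x) \<in> \<real>"
  and pos_nonneg: "x \<in> carrier A \<Longrightarrow> 0 \<le> Re (\<phi> (adj A x \<otimes> x))"
  using \<phi> by (auto simp: positive_functional_def)

lemma pos_zero: "\<phi> \<zero> = 0" using pos_scal[of \<zero> 0] by simp

lemma pos_diff: "x \<in> carrier A \<Longrightarrow> y \<in> carrier A \<Longrightarrow> \<phi> (x \<ominus> y) = \<phi> x - \<phi> y"
  by (simp add: diff_eq_scal pos_add pos_scal)

lemma pos_quadratic:
  assumes x: "x \<in> carrier A" "y \<in> carrier A"
  shows "\<phi> (adj A (x \<oplus> c \<odot> y) \<otimes> (x \<oplus> c \<odot> y)) =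
    \<phi> (adj A x \<otimes> x) + c * \<phi> (adj A x \<otimes> y) + cnj c * \<phi> (adj A y \<otimes> x) + (cnj c * c) * \<phi> (adj A y \<otimes> y)"
  using x by (simp add: star_add star_scal l_distr r_distr scal_mult_left scal_mult_right scal_scal
      pos_add pos_scal algebra_simps)

lemma pos_hermitian:
  assumes x: "x \<in> carrier A" "y \<in> carrier A"
  shows "\<phi> (adj A y \<otimes> x) = cnj (\<phi> (adj A x \<otimes> y))"
proof -
  have real: "c * \<phi> (adj A x \<otimes> y) + cnj c * \<phi> (adj A y \<otimes> x) \<in> \<real>" if c: "cnj c * c \<in> \<real>" for c
  proof -
    have "c * \<phi> (adj A x \<otimes> y) + cnj c * \<phi> (adj A y \<otimes> x)
       = \<phi> (adj A (x \<oplus> c \<odot> y) \<otimes> (x \<oplus> c \<odot> y)) - \<phi> (adj A x \<otimes> x) - (cnj c * c) * \<phi> (adj A y \<otimes> y)"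
      using pos_quadratic[OF x] by simp
    then show ?thesis using pos_real x c by (auto intro!: Reals_diff Reals_mult)
  qed
  from real[of 1] real[of \<i>] show ?thesis
    by (auto simp: complex_is_Real_iff complex_eq_iff)
qed

lemma pos_star:
  assumes "x \<in> carrier A" shows "\<phi> (adj A x) = cnj (\<phi> x)"
  using pos_hermitian[of "\<one>" x] assms by simp

lemma pos_cauchy_schwarz:
  assumes x: "x \<in> carrier A" "y \<in> carrier A"
  shows "(cmod (\<phi> (adj A x \<otimes> y)))\<^sup>2 \<le> Re (\<phi> (adj A x \<otimes> x)) * Re (\<phi> (adj A y \<otimes> y))"
proof -
  define a b d where "a = Re (\<phi> (adj A x \<otimes> x))" and "b = \<phi> (adj A x \<otimes> y)" and "d = Re (\<phi> (adj A y \<otimes> y))"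
  have quad: "0 \<le> a - 2 * t * (cmod b)\<^sup>2 + t\<^sup>2 * (cmod b)\<^sup>2 * d" for t :: real
  proof -
    let ?c = "- of_real t * cnj b"
    have "0 \<le> Re (\<phi> (adj A (x \<oplus> ?c \<odot> y) \<otimes> (x \<oplus> ?c \<odot> y)))" using x by (intro pos_nonneg) auto
    also have "\<dots> = a + Re (?c * b) + Re (cnj ?c * cnj b) + Re ((cnj ?c * ?c) * \<phi> (adj A y \<otimes> y))"
      unfolding pos_quadratic[OF x] pos_hermitian[OF x] by (simp only: a_def b_def plus_complex.sel)
    also have "Re ((cnj ?c * ?c) * \<phi> (adj A y \<otimes> y)) = t\<^sup>2 * (cmod b)\<^sup>2 * d"
    proof -
      have "cnj ?c * ?c = of_real (t\<^sup>2 * (cmod b)\<^sup>2)"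
      proof -
        have "cnj ?c * ?c = (of_real t)\<^sup>2 * (b * cnj b)" by (simp add: power2_eq_square algebra_simps)
        also have "\<dots> = of_real (t\<^sup>2 * (cmod b)\<^sup>2)"
          by (simp only: complex_norm_square[symmetric] of_real_power[symmetric] of_real_mult[symmetric])
        finally show ?thesis .
      qed
      then show ?thesis by (simp add: d_def)
    qed
    also have "Re (?c * b) = - t * (cmod b)\<^sup>2" unfolding cmod_power2 by (simp add: power2_eq_square algebra_simps)
    also have "Re (cnj ?c * cnj b) = - t * (cmod b)\<^sup>2" unfolding cmod_power2 by (simp add: power2_eq_square algebra_simps)
    finally show ?thesis by simp
  qed
  have d0: "0 \<le> d" unfolding d_def using pos_nonneg x by simp
  have "(cmod b)\<^sup>2 \<le> a * d"
  proof (cases "d = 0")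
    case True
    have "b = 0"
    proof (rule ccontr)
      assume "b \<noteq> 0"
      then have "0 < (cmod b)\<^sup>2" by simp
      moreover have "0 \<le> a - 2 * ((a + 1) / (2 * (cmod b)\<^sup>2)) * (cmod b)\<^sup>2"
        using quad[of "(a + 1) / (2 * (cmod b)\<^sup>2)"] True by simp
      ultimately show False by simp
    qed
    then show ?thesis using True by simp
  next
    case False
    with d0 have d: "0 < d" by simp
    have "0 \<le> a - 2 * (1 / d) * (cmod b)\<^sup>2 + (1 / d)\<^sup>2 * (cmod b)\<^sup>2 * d" by (rule quad)
    also have "\<dots> = a - (cmod b)\<^sup>2 / d" using d by (simp add: field_simps power2_eq_square)
    finally show ?thesis using d by (simp add: field_simps)
  qed
  then show ?thesis by (simp add: a_def b_def d_def)
qed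

end

lemma pos_finsum:
  assumes \<phi>: "positive_functional \<phi>" and F: "finite F" "f \<in> F \<rightarrow> carrier A"
  shows "\<phi> (\<Oplus>i\<in>F. f i) = (\<Sum>i\<in>F. \<phi> (f i))"
  using F
proof (induction F rule: finite_induct)
  case (insert i F)
  then have f: "f \<in> F \<rightarrow> carrier A" "f i \<in> carrier A" by auto
  have "(\<Oplus>j\<in>insert i F. f j) = f i \<oplus> (\<Oplus>j\<in>F. f j)" by (rule finsum_insert[OF insert.hyps f])
  then show ?case using pos_add[OF \<phi> f(2) finsum_closed[OF f(1)]] insert.IH[OF f(1)] insert.hyps by simp
qed (simp add: pos_zero[OF \<phi>])

lemma positive_functional_scale_add:
  assumes "positive_functional \<phi>" "positive_functional \<psi>" "0 \<le> (c::real)" "0 \<le> (d::real)"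
  shows "positive_functional (\<lambda>a. of_real c * \<phi> a + of_real d * \<psi> a)"
  using assms unfolding positive_functional_def by (auto simp: algebra_simps intro!: Reals_add Reals_mult)

end


section \<open>Norm and positivity in a \<open>C\<^sup>*\<close>-algebra\<close>

sublocale cstar_algebra \<subseteq> star_algebra
  by unfold_locales
    (auto simp: smult_closed smult_l_distr smult_r_distr smult_assoc1 smult_one smult_mult_left smult_mult_right
      adj_closed adj_adj adj_add adj_smult adj_mult)

context cstar_algebra
begin

lemma norm_zero [simp]: "cnorm A \<zero> = 0" using cnorm_eq_zero by simp

lemma norm_minus: "x \<in> carrier A \<Longrightarrow> y \<in> carrier A \<Longrightarrow> cnorm A (x \<ominus> y) = cnorm A (y \<ominus> x)"
proof -
  assume xy: "x \<in> carrier A" "y \<in> carrier A"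
  then have "x \<ominus> y = (-1) \<odot> (y \<ominus> x)" by (simp add: diff_eq_scal scal_r_distr scal_scal a_comm)
  then show ?thesis using xy cnorm_smult[of "y \<ominus> x" "-1"] by simp
qed

lemma norm_triangle_diff:
  "x \<in> carrier A \<Longrightarrow> y \<in> carrier A \<Longrightarrow> z \<in> carrier A \<Longrightarrow> cnorm A (x \<ominus> z) \<le> cnorm A (x \<ominus> y) + cnorm A (y \<ominus> z)"
  using cnorm_triangle[of "x \<ominus> y" "y \<ominus> z"] by (simp add: diff_add_diff)

lemma norm_diff_le: "x \<in> carrier A \<Longrightarrow> y \<in> carrier A \<Longrightarrow> cnorm A (x \<ominus> y) \<le> cnorm A x + cnorm A y"
  using norm_triangle_diff[of x \<zero> y] norm_minus[of \<zero> y] by simp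

lemma norm_le_add_diff: "x \<in> carrier A \<Longrightarrow> y \<in> carrier A \<Longrightarrow> cnorm A x \<le> cnorm A y + cnorm A (x \<ominus> y)"
  using cnorm_triangle[of y "x \<ominus> y"] by (simp add: add_diff_cancel)

lemma norm_star: assumes "x \<in> carrier A" shows "cnorm A (adj A x) = cnorm A x"
proof -
  have le: "cnorm A y \<le> cnorm A (adj A y)" if y: "y \<in> carrier A" for y
  proof -
    have "(cnorm A y)\<^sup>2 \<le> cnorm A (adj A y) * cnorm A y"
      using cstar_identity[OF y] cnorm_mult[of "adj A y" y] y by simp
    then show ?thesis using cnorm_nonneg[OF y] cnorm_nonneg[of "adj A y"] y
      by (cases "cnorm A y = 0") (auto simp: power2_eq_square)
  qed
  show ?thesis using le[of x] le[of "adj A x"] assms by simp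
qed

lemma norm_square_self_adjoint: "x \<in> carrier A \<Longrightarrow> adj A x = x \<Longrightarrow> cnorm A (x \<otimes> x) = (cnorm A x)\<^sup>2"
  using cstar_identity[of x] by simp

lemma norm_projection_le: assumes "x \<in> carrier A" "adj A x = x" "x \<otimes> x = x" shows "cnorm A x \<le> 1"
proof -
  have "cnorm A x = (cnorm A x)\<^sup>2" using norm_square_self_adjoint[of x] assms by simp
  then have "cnorm A x * (1 - cnorm A x) = 0" by (simp add: power2_eq_square algebra_simps)
  then show ?thesis by auto
qed

lemma norm_one_le: "cnorm A \<one> \<le> 1" by (rule norm_projection_le) auto

lemma norm_scal_one_le: "cnorm A (c \<odot> \<one>) \<le> cmod c"
  using cnorm_smult[of "\<one>" c] norm_one_le by (simp add: mult_left_le)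

definition tends :: "(nat \<Rightarrow> 'a) \<Rightarrow> 'a \<Rightarrow> bool" where
  "tends X x \<longleftrightarrow> (\<forall>n. X n \<in> carrier A) \<and> x \<in> carrier A \<and> (\<lambda>n. cnorm A (X n \<ominus> x)) \<longlonglongrightarrow> 0"

lemma tendsI:
  assumes "\<And>n. X n \<in> carrier A" "x \<in> carrier A" "\<And>n. cnorm A (X n \<ominus> x) \<le> f n" "f \<longlonglongrightarrow> 0"
  shows "tends X x"
  unfolding tends_def using assms(1,2)
  by (auto intro!: Lim_null_comparison[OF _ assms(4)] simp: cnorm_nonneg assms(3))

lemma tends_unique: assumes "tends X x" "tends X y" shows "x = y"
proof -
  have c: "x \<in> carrier A" "y \<in> carrier A" "\<And>n. X n \<in> carrier A" using assms by (auto simp: tends_def)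
  have "(\<lambda>n. cnorm A (X n \<ominus> x) + cnorm A (X n \<ominus> y)) \<longlonglongrightarrow> 0 + 0"
    using assms by (intro tendsto_add) (auto simp: tends_def)
  moreover have "cnorm A (x \<ominus> y) \<le> cnorm A (X n \<ominus> x) + cnorm A (X n \<ominus> y)" for n
    using norm_triangle_diff[of x "X n" y] norm_minus[of x "X n"] c by simp
  ultimately have "cnorm A (x \<ominus> y) \<le> 0" by (intro LIMSEQ_le_const) auto
  then show ?thesis using c cnorm_eq_zero[of "x \<ominus> y"] cnorm_nonneg[of "x \<ominus> y"] diff_eq_zero_iff by auto
qed

lemma tends_const: "x \<in> carrier A \<Longrightarrow> tends (\<lambda>_. x) x" by (simp add: tends_def)

lemma tends_add: assumes "tends X x" "tends Y y" shows "tends (\<lambda>n. X n \<oplus> Y n) (x \<oplus> y)"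
proof (rule tendsI)
  have c: "x \<in> carrier A" "y \<in> carrier A" "\<And>n. X n \<in> carrier A" "\<And>n. Y n \<in> carrier A"
    using assms by (auto simp: tends_def)
  then show "X n \<oplus> Y n \<in> carrier A" "x \<oplus> y \<in> carrier A" for n by auto
  show "cnorm A (X n \<oplus> Y n \<ominus> (x \<oplus> y)) \<le> cnorm A (X n \<ominus> x) + cnorm A (Y n \<ominus> y)" for n
    using c by (simp add: add_diff_add cnorm_triangle)
  show "(\<lambda>n. cnorm A (X n \<ominus> x) + cnorm A (Y n \<ominus> y)) \<longlonglongrightarrow> 0"
    using assms tendsto_add[of _ 0 sequentially _ 0] by (auto simp: tends_def)
qed

lemma tends_scal: assumes "tends X x" shows "tends (\<lambda>n. c \<odot> X n) (c \<odot> x)"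
proof (rule tendsI)
  have c: "x \<in> carrier A" "\<And>n. X n \<in> carrier A" using assms by (auto simp: tends_def)
  then show "c \<odot> X n \<in> carrier A" "c \<odot> x \<in> carrier A" for n by auto
  show "cnorm A (c \<odot> X n \<ominus> c \<odot> x) \<le> cmod c * cnorm A (X n \<ominus> x)" for n
    using c cnorm_smult[of "X n \<ominus> x" c] by (simp add: scal_diff)
  show "(\<lambda>n. cmod c * cnorm A (X n \<ominus> x)) \<longlonglongrightarrow> 0"
    using assms tendsto_mult_right_zero by (auto simp: tends_def)
qed

lemma tends_star: assumes "tends X x" shows "tends (\<lambda>n. adj A (X n)) (adj A x)"
  using assms norm_star[of "_ \<ominus> x"] by (auto simp: tends_def star_diff[symmetric])

lemma tends_mult: assumes "tends X x" "tends Y y" shows "tends (\<lambda>n. X n \<otimes> Y n) (x \<otimes> y)"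
proof (rule tendsI)
  have c: "x \<in> carrier A" "y \<in> carrier A" "\<And>n. X n \<in> carrier A" "\<And>n. Y n \<in> carrier A"
    using assms by (auto simp: tends_def)
  then show "X n \<otimes> Y n \<in> carrier A" "x \<otimes> y \<in> carrier A" for n by auto
  show "cnorm A (X n \<otimes> Y n \<ominus> x \<otimes> y) \<le>
    cnorm A (X n \<ominus> x) * (cnorm A y + cnorm A (Y n \<ominus> y)) + cnorm A x * cnorm A (Y n \<ominus> y)" for n
  proof -
    have "cnorm A (X n \<otimes> Y n \<ominus> x \<otimes> y) \<le> cnorm A (X n \<otimes> Y n \<ominus> x \<otimes> Y n) + cnorm A (x \<otimes> Y n \<ominus> x \<otimes> y)"
      using c by (intro norm_triangle_diff) auto
    also have "\<dots> = cnorm A ((X n \<ominus> x) \<otimes> Y n) + cnorm A (x \<otimes> (Y n \<ominus> y))"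
      using c by (simp add: mult_diff_left mult_diff_right)
    also have "\<dots> \<le> cnorm A (X n \<ominus> x) * cnorm A (Y n) + cnorm A x * cnorm A (Y n \<ominus> y)"
      using c by (intro add_mono cnorm_mult) auto
    also have "\<dots> \<le> cnorm A (X n \<ominus> x) * (cnorm A y + cnorm A (Y n \<ominus> y)) + cnorm A x * cnorm A (Y n \<ominus> y)"
      using c by (intro add_right_mono mult_left_mono norm_le_add_diff cnorm_nonneg) auto
    finally show ?thesis .
  qed
  have "(\<lambda>n. cnorm A (X n \<ominus> x) * (cnorm A y + cnorm A (Y n \<ominus> y)) + cnorm A x * cnorm A (Y n \<ominus> y))
     \<longlonglongrightarrow> 0 * (cnorm A y + 0) + cnorm A x * 0"
    using assms by (intro tendsto_intros) (auto simp: tends_def)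
  then show "(\<lambda>n. cnorm A (X n \<ominus> x) * (cnorm A y + cnorm A (Y n \<ominus> y)) + cnorm A x * cnorm A (Y n \<ominus> y)) \<longlonglongrightarrow> 0"
    by simp
qed

lemma tends_Suc: "tends X x \<Longrightarrow> tends (\<lambda>n. X (Suc n)) x"
  using filterlim_sequentially_Suc[of "\<lambda>n. cnorm A (X n \<ominus> x)"] by (auto simp: tends_def)

lemma geometric_converges:
  assumes X: "\<And>n. X n \<in> carrier A" and q: "0 \<le> q" "q < 1"
    and le: "\<And>n. cnorm A (X (Suc n) \<ominus> X n) \<le> q ^ n"
  shows "\<exists>x. tends X x"
proof -
  have dist: "cnorm A (X (n + k) \<ominus> X n) \<le> q ^ n / (1 - q)" for n k
  proof -
    have "cnorm A (X (n + k) \<ominus> X n) \<le> (\<Sum>i<k. q ^ (n + i))"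
    proof (induction k)
      case (Suc k)
      have "cnorm A (X (n + Suc k) \<ominus> X n) \<le> cnorm A (X (Suc (n + k)) \<ominus> X (n + k)) + cnorm A (X (n + k) \<ominus> X n)"
        using X norm_triangle_diff by simp
      with Suc le[of "n + k"] show ?case by simp
    qed (use X in simp)
    also have "\<dots> = q ^ n * (\<Sum>i<k. q ^ i)" by (simp add: power_add sum_distrib_left)
    also have "\<dots> \<le> q ^ n * (1 / (1 - q))"
      using q sum_gp_strict[of q k] by (intro mult_left_mono) (auto simp: divide_right_mono)
    finally show ?thesis by simp
  qed
  have lim: "(\<lambda>n. q ^ n / (1 - q)) \<longlonglongrightarrow> 0" using q by (auto intro!: tendsto_eq_intros LIMSEQ_realpow_zero)
  have "\<exists>N. \<forall>m\<ge>N. \<forall>n\<ge>N. cnorm A (X m \<ominus> X n) < e" if "e > 0" for e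
  proof -
    obtain N where N: "\<And>n. n \<ge> N \<Longrightarrow> q ^ n / (1 - q) < e"
      using order_tendstoD(2)[OF lim \<open>e > 0\<close>] by (auto simp: eventually_sequentially)
    have *: "cnorm A (X m \<ominus> X n) < e" if "n \<ge> N" "m \<ge> n" for m n
      using dist[of n "m - n"] N[OF that(1)] that by simp
    have "cnorm A (X m \<ominus> X n) < e" if "m \<ge> N" "n \<ge> N" for m n
      using *[of n m] *[of m n] norm_minus[OF X X, of m n] that by (cases "n \<le> m") auto
    then show ?thesis by blast
  qed
  then obtain x where "x \<in> carrier A" "(\<lambda>n. cnorm A (X n \<ominus> x)) \<longlonglongrightarrow> 0"
    using complete[of X, OF X] by blast
  then show ?thesis using X by (auto simp: tends_def)
qed

text \<open>
  The square root is \<open>1 - y\<close> where \<open>y\<close> is the fixed point of \<open>y \<mapsto> (x + y\<^sup>2) / 2\<close>, a contraction of the ball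
  whose radius \<open>q\<close> is the smaller fixed point of \<open>q \<mapsto> (\<parallel>x\<parallel> + q\<^sup>2) / 2\<close>.
\<close>

lemma square_root_one_minus:
  assumes x: "x \<in> carrier A" "adj A x = x" "cnorm A x < 1"
  shows "\<exists>y\<in>carrier A. adj A y = y \<and> y \<otimes> y = \<one> \<ominus> x \<and> (\<forall>z\<in>carrier A. z \<otimes> x = x \<otimes> z \<longrightarrow> z \<otimes> y = y \<otimes> z)"
proof -
  define q where "q = 1 - sqrt (1 - cnorm A x)"
  have q: "0 \<le> q" "q < 1" using x cnorm_nonneg[OF x(1)] by (auto simp: q_def real_sqrt_le_1_iff)
  have "(1 - q)\<^sup>2 = 1 - cnorm A x" using x by (simp add: q_def)
  then have qq: "cnorm A x + q\<^sup>2 = 2 * q" by (simp add: power2_eq_square algebra_simps)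
  define Y where "Y = rec_nat \<zero> (\<lambda>_ y. (1/2) \<odot> (x \<oplus> y \<otimes> y))"
  have Y0: "Y 0 = \<zero>" and YS: "Y (Suc n) = (1/2) \<odot> (x \<oplus> Y n \<otimes> Y n)" for n by (auto simp: Y_def)
  have Y: "Y n \<in> carrier A" for n by (induction n) (auto simp: Y0 YS x)
  have Yq: "cnorm A (Y n) \<le> q" for n
  proof (induction n)
    case (Suc n)
    have "cnorm A (x \<oplus> Y n \<otimes> Y n) \<le> cnorm A x + cnorm A (Y n) * cnorm A (Y n)"
      using x Y cnorm_triangle[of x "Y n \<otimes> Y n"] cnorm_mult[of "Y n" "Y n"] by fastforce
    also have "\<dots> \<le> cnorm A x + q * q" using Suc q cnorm_nonneg[OF Y] by (intro add_left_mono mult_mono) auto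
    finally show ?case using qq x Y by (simp add: YS cnorm_smult power2_eq_square)
  qed (use q in \<open>simp add: Y0\<close>)
  have diff: "cnorm A (Y (Suc n) \<ominus> Y n) \<le> q ^ n" for n
  proof (induction n)
    case 0
    show ?case using Yq[of 1] q Y by (simp add: Y0)
  next
    case (Suc n)
    let ?a = "Y (Suc n)" and ?b = "Y n"
    have "?a \<otimes> ?a \<ominus> ?b \<otimes> ?b = (?a \<otimes> (?a \<ominus> ?b)) \<oplus> ((?a \<ominus> ?b) \<otimes> ?b)"
      using Y by (simp add: mult_diff_left mult_diff_right diff_add_diff)
    then have "cnorm A (?a \<otimes> ?a \<ominus> ?b \<otimes> ?b) \<le> cnorm A (?a \<otimes> (?a \<ominus> ?b)) + cnorm A ((?a \<ominus> ?b) \<otimes> ?b)"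
      using Y cnorm_triangle by simp
    also have "\<dots> \<le> cnorm A ?a * cnorm A (?a \<ominus> ?b) + cnorm A (?a \<ominus> ?b) * cnorm A ?b"
      using Y by (intro add_mono cnorm_mult) auto
    also have "\<dots> \<le> q * q ^ n + q ^ n * q"
      using Y Yq Suc q by (intro add_mono mult_mono) (auto simp: cnorm_nonneg)
    finally have le: "cnorm A (?a \<otimes> ?a \<ominus> ?b \<otimes> ?b) \<le> 2 * q ^ Suc n" by simp
    have "Y (Suc (Suc n)) \<ominus> ?a = (1/2) \<odot> ((x \<oplus> ?a \<otimes> ?a) \<ominus> (x \<oplus> ?b \<otimes> ?b))"
      using x Y by (simp add: YS[of "Suc n"] YS[of n] scal_diff)
    also have "(x \<oplus> ?a \<otimes> ?a) \<ominus> (x \<oplus> ?b \<otimes> ?b) = ?a \<otimes> ?a \<ominus> ?b \<otimes> ?b"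
      using x Y by (simp add: add_diff_add)
    finally show ?case using le Y by (simp add: cnorm_smult)
  qed
  obtain w where w: "tends Y w" using geometric_converges[OF Y q diff] by auto
  then have wc: "w \<in> carrier A" by (simp add: tends_def)
  have "tends (\<lambda>n. Y (Suc n)) ((1/2) \<odot> (x \<oplus> w \<otimes> w))"
    unfolding YS using w x by (intro tends_scal tends_add tends_const tends_mult) auto
  then have fix_w: "w = (1/2) \<odot> (x \<oplus> w \<otimes> w)" using tends_unique tends_Suc[OF w] by blast
  have "adj A (Y n) = Y n" for n
    by (induction n) (use Y x in \<open>simp_all add: Y0 YS star_scal star_add star_mult\<close>)
  then have w_sa: "adj A w = w" using tends_unique[OF tends_star[OF w]] w by simp
  have comm: "z \<otimes> w = w \<otimes> z" if z: "z \<in> carrier A" "z \<otimes> x = x \<otimes> z" for z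
  proof -
    have "z \<otimes> Y n = Y n \<otimes> z" for n
    proof (induction n)
      case (Suc n)
      have "z \<otimes> (Y n \<otimes> Y n) = Y n \<otimes> Y n \<otimes> z" using Suc Y z by (metis m_assoc)
      then show ?case using z Y x by (simp add: YS scal_mult_left scal_mult_right l_distr r_distr)
    qed (use z in \<open>simp add: Y0\<close>)
    then show ?thesis
      using tends_unique[OF tends_mult[OF tends_const[OF z(1)] w]] tends_mult[OF w tends_const[OF z(1)]] by simp
  qed
  show ?thesis
  proof (intro bexI[of _ "\<one> \<ominus> w"] conjI ballI impI)
    have "2 \<odot> w = x \<oplus> w \<otimes> w" using arg_cong[OF fix_w, of "\<lambda>u. 2 \<odot> u"] x wc by (simp add: scal_scal)
    then have "x = 2 \<odot> w \<ominus> w \<otimes> w" using x wc by (simp add: a_minus_def a_assoc r_neg)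
    then have "\<one> \<ominus> x = \<one> \<ominus> (2 \<odot> w \<ominus> w \<otimes> w)" by simp
    also have "\<dots> = (\<one> \<ominus> w) \<otimes> (\<one> \<ominus> w)"
    proof -
      have 2: "(-2) \<odot> w = (-1) \<odot> w \<oplus> (-1) \<odot> w" using scal_l_distr[OF wc, of "-1" "-1"] by simp
      show ?thesis using wc
        by (simp add: diff_eq_scal scal_r_distr scal_scal l_distr r_distr scal_mult_left scal_mult_right 2 a_ac)
    qed
    finally show "(\<one> \<ominus> w) \<otimes> (\<one> \<ominus> w) = \<one> \<ominus> x" ..
    fix z assume z: "z \<in> carrier A" "z \<otimes> x = x \<otimes> z"
    then show "z \<otimes> (\<one> \<ominus> w) = (\<one> \<ominus> w) \<otimes> z" using comm wc by (simp add: mult_diff_left mult_diff_right)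
  qed (use wc w_sa in \<open>auto simp: star_diff\<close>)
qed

text \<open>After scaling, \<open>1 - x\<close> is the square of a self-adjoint element, on which \<open>\<phi>\<close> is nonnegative.\<close>

lemma pos_self_adjoint_le:
  assumes \<phi>: "positive_functional \<phi>" and x: "x \<in> carrier A" "adj A x = x"
  shows "Re (\<phi> x) \<le> Re (\<phi> \<one>) * cnorm A x"
proof -
  have one: "0 \<le> Re (\<phi> \<one>)" using pos_nonneg[OF \<phi>, of \<one>] by simp
  have "Re (\<phi> x) \<le> Re (\<phi> \<one>) * t" if t: "cnorm A x < t" for t
  proof -
    have t0: "0 < t" using t cnorm_nonneg[OF x(1)] by simp
    let ?x = "of_real (1 / t) \<odot> x"
    have "cnorm A ?x < 1" using t t0 x by (simp add: cnorm_smult norm_divide)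
    then obtain y where y: "y \<in> carrier A" "adj A y = y" "y \<otimes> y = \<one> \<ominus> ?x"
      using square_root_one_minus[of ?x] x by (auto simp: star_scal)
    have "0 \<le> Re (\<phi> (\<one> \<ominus> ?x))" using pos_nonneg[OF \<phi> y(1)] y by simp
    also have "\<dots> = Re (\<phi> \<one>) - Re (\<phi> x) / t" using x by (simp add: pos_diff[OF \<phi>] pos_scal[OF \<phi>])
    finally show ?thesis using t0 by (simp add: field_simps)
  qed
  then have *: "Re (\<phi> x) \<le> Re (\<phi> \<one>) * (cnorm A x + e)" if "0 < e" for e using that by simp
  show ?thesis
  proof (rule field_le_epsilon)
    fix e :: real assume e: "0 < e"
    have "Re (\<phi> \<one>) * (e / (Re (\<phi> \<one>) + 1)) \<le> e" using one e by (simp add: field_simps)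
    then show "Re (\<phi> x) \<le> Re (\<phi> \<one>) * cnorm A x + e"
      using *[of "e / (Re (\<phi> \<one>) + 1)"] one e by (simp add: distrib_left)
  qed
qed

lemma pos_square_le:
  assumes \<phi>: "positive_functional \<phi>" and x: "x \<in> carrier A"
  shows "Re (\<phi> (adj A x \<otimes> x)) \<le> Re (\<phi> \<one>) * (cnorm A x)\<^sup>2"
  using pos_self_adjoint_le[OF \<phi>, of "adj A x \<otimes> x"] x by (simp add: star_mult cstar_identity)

lemma pos_bounded:
  assumes \<phi>: "positive_functional \<phi>" and x: "x \<in> carrier A"
  shows "cmod (\<phi> x) \<le> Re (\<phi> \<one>) * cnorm A x"
proof -
  have one: "0 \<le> Re (\<phi> \<one>)" using pos_nonneg[OF \<phi>, of \<one>] by simp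
  have "(cmod (\<phi> x))\<^sup>2 \<le> Re (\<phi> \<one>) * Re (\<phi> (adj A x \<otimes> x))"
    using pos_cauchy_schwarz[OF \<phi>, of \<one> x] x by simp
  also have "\<dots> \<le> Re (\<phi> \<one>) * (Re (\<phi> \<one>) * (cnorm A x)\<^sup>2)"
    by (intro mult_left_mono pos_square_le \<phi> x one)
  also have "\<dots> = (Re (\<phi> \<one>) * cnorm A x)\<^sup>2" by (simp add: power2_eq_square)
  finally show ?thesis by (rule power2_le_imp_le) (use one cnorm_nonneg[OF x] in simp)
qed

text \<open>The norm of a positive functional is its value at \<open>\<one>\<close>.\<close>

lemma state_iff:
  "state A \<phi> \<longleftrightarrow> (\<forall>x. x \<notin> carrier A \<longrightarrow> \<phi> x = 0) \<and> positive_functional \<phi> \<and> \<phi> \<one> = 1" (is "_ \<longleftrightarrow> ?R")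
proof
  assume s: "state A \<phi>"
  then have \<phi>: "positive_functional \<phi>" unfolding state_def positive_functional_def by blast
  let ?S = "{cmod (\<phi> x) | x. x \<in> carrier A \<and> cnorm A x \<le> 1}"
  have one: "\<phi> \<one> \<in> \<real>" "0 \<le> Re (\<phi> \<one>)" using pos_real[OF \<phi>, of \<one>] pos_nonneg[OF \<phi>, of \<one>] by auto
  have bd: "cmod (\<phi> x) \<le> cnorm A x" if "x \<in> carrier A" for x using s that by (auto simp: state_def)
  have "Re (\<phi> \<one>) \<le> 1" using bd[of \<one>] norm_one_le complex_Re_le_cmod[of "\<phi> \<one>"] by simp
  moreover have "1 \<le> Re (\<phi> \<one>)"
  proof -
    have "1 = Sup ?S" using s by (simp add: state_def)
    also have "\<dots> \<le> Re (\<phi> \<one>)"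
    proof (rule cSup_least)
      have "cmod (\<phi> \<zero>) \<in> ?S" by force
      then show "?S \<noteq> {}" by blast
      fix t assume "t \<in> ?S"
      then obtain x where x: "x \<in> carrier A" "cnorm A x \<le> 1" "t = cmod (\<phi> x)" by auto
      have "t \<le> Re (\<phi> \<one>) * cnorm A x" using pos_bounded[OF \<phi> x(1)] x by simp
      also have "\<dots> \<le> Re (\<phi> \<one>)" using x one by (simp add: mult_left_le)
      finally show "t \<le> Re (\<phi> \<one>)" .
    qed
    finally show ?thesis .
  qed
  ultimately have "\<phi> \<one> = 1" using one by (simp add: complex_is_Real_iff complex_eq_iff)
  with s \<phi> show ?R by (auto simp: state_def)
next
  assume R: ?R
  then have \<phi>: "positive_functional \<phi>" and one: "\<phi> \<one> = 1" by auto
  have bd: "cmod (\<phi> x) \<le> cnorm A x" if "x \<in> carrier A" for x using pos_bounded[OF \<phi> that] one by simp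
  have "Sup {cmod (\<phi> x) | x. x \<in> carrier A \<and> cnorm A x \<le> 1} = 1"
  proof (rule cSup_eq_maximum)
    show "1 \<in> {cmod (\<phi> x) | x. x \<in> carrier A \<and> cnorm A x \<le> 1}"
      using one norm_one_le by (auto intro!: exI[of _ \<one>])
  qed (use bd in force)
  with R bd show "state A \<phi>" unfolding state_def positive_functional_def by blast
qed

end


section \<open>Projections below a projection\<close>

context cstar_algebra
begin

lemma norm_power_two_power:
  assumes e: "e \<in> carrier A" "adj A e = e"
  shows "adj A (e [^] (n::nat)) = e [^] n" "cnorm A (e [^] ((2::nat) ^ j)) = cnorm A e ^ (2 ^ j)"
proof -
  have comm: "e \<otimes> e [^] n = e [^] n \<otimes> e" for n :: nat
    using nat_pow_mult[OF e(1), of 1 n] nat_pow_mult[OF e(1), of n 1] e by (simp add: add.commute)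
  show sa: "adj A (e [^] n) = e [^] n" for n :: nat
    by (induction n) (use e comm in \<open>simp_all add: star_mult\<close>)
  show "cnorm A (e [^] ((2::nat) ^ j)) = cnorm A e ^ (2 ^ j)"
  proof (induction j)
    case (Suc j)
    have "e [^] ((2::nat) ^ Suc j) = e [^] ((2::nat) ^ j) \<otimes> e [^] ((2::nat) ^ j)"
      using nat_pow_mult[OF e(1), of "2 ^ j" "2 ^ j"] by (simp add: mult_2)
    then show ?case using Suc norm_square_self_adjoint[OF _ sa] e
      by (simp add: power_mult[symmetric] mult.commute)
  qed (use e in simp)
qed

text \<open>The norms of the powers of a self-adjoint element grow exactly geometrically along powers of two.\<close>

lemma norm_le_one_if_linear_growth:
  assumes e: "e \<in> carrier A" "adj A e = e"
    and le: "\<And>n::nat. n \<ge> 1 \<Longrightarrow> cnorm A (e [^] n) \<le> a + b * real n"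
  shows "cnorm A e \<le> 1"
proof (rule ccontr)
  define l where "l = cnorm A e"
  assume "\<not> cnorm A e \<le> 1"
  then have l: "1 < l" by (simp add: l_def)
  have "(\<lambda>n. (a + b * real n) / l ^ n) \<longlonglongrightarrow> 0" using l by real_asymp
  then have "eventually (\<lambda>n. (a + b * real n) / l ^ n < 1) sequentially"
    by (rule order_tendstoD) simp
  then obtain N where N: "\<And>n. n \<ge> N \<Longrightarrow> (a + b * real n) / l ^ n < 1"
    by (auto simp: eventually_sequentially)
  have "(a + b * real (2 ^ N)) / l ^ (2 ^ N) < 1" by (rule N) (simp add: less_imp_le)
  then have "a + b * real (2 ^ N) < l ^ (2 ^ N)" using l by (simp add: divide_less_eq)
  moreover have "l ^ (2 ^ N) \<le> a + b * real (2 ^ N)"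
    using le[of "2 ^ N"] norm_power_two_power(2)[OF e, of N] by (simp add: l_def)
  ultimately show False by simp
qed

text \<open>
  Positivity expressed by norms: the spectrum of the self-adjoint element \<open>a\<close> lies in \<open>[0, 2t]\<close>.
\<close>

definition norm_positive :: "'a \<Rightarrow> bool" where
  "norm_positive a \<longleftrightarrow> a \<in> carrier A \<and> adj A a = a \<and>
     (\<exists>t::real. 0 \<le> t \<and> cnorm A (of_real t \<odot> \<one> \<ominus> a) \<le> t)"

lemma norm_positive_carrier [simp]: "norm_positive a \<Longrightarrow> a \<in> carrier A"
  and norm_positive_star [simp]: "norm_positive a \<Longrightarrow> adj A a = a"
  by (auto simp: norm_positive_def)

lemma norm_positive_larger:
  assumes "a \<in> carrier A" "cnorm A (of_real t \<odot> \<one> \<ominus> a) \<le> t" "t \<le> u"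
  shows "cnorm A (of_real u \<odot> \<one> \<ominus> a) \<le> u"
proof -
  have "of_real u \<odot> \<one> \<ominus> a = of_real (u - t) \<odot> \<one> \<oplus> (of_real t \<odot> \<one> \<ominus> a)"
    using assms(1) scal_l_distr[of \<one> "of_real (u - t)" "of_real t"] by (simp add: a_minus_def a_assoc)
  then have "cnorm A (of_real u \<odot> \<one> \<ominus> a) \<le> cnorm A (of_real (u - t) \<odot> \<one>) + cnorm A (of_real t \<odot> \<one> \<ominus> a)"
    using assms(1) cnorm_triangle by simp
  also have "cnorm A (of_real (u - t) \<odot> \<one>) \<le> u - t"
    using norm_scal_one_le[of "of_real (u - t)"] assms(3) norm_of_real[of "u - t", where ?'a = complex] by (simp del: norm_of_real of_real_diff)
  finally show ?thesis using assms(2) by simp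
qed

lemma norm_positive_zero: "norm_positive \<zero>"
  unfolding norm_positive_def by (intro conjI exI[of _ 0]) auto

lemma norm_positive_add:
  assumes "norm_positive a" "norm_positive b" shows "norm_positive (a \<oplus> b)"
proof -
  obtain t u where tu: "0 \<le> t" "cnorm A (of_real t \<odot> \<one> \<ominus> a) \<le> t" "0 \<le> u" "cnorm A (of_real u \<odot> \<one> \<ominus> b) \<le> u"
    using assms unfolding norm_positive_def by blast
  have c: "a \<in> carrier A" "b \<in> carrier A" using assms by auto
  have "of_real (t + u) \<odot> \<one> \<ominus> (a \<oplus> b) = (of_real t \<odot> \<one> \<ominus> a) \<oplus> (of_real u \<odot> \<one> \<ominus> b)"
    using c scal_l_distr[of \<one> "of_real t" "of_real u"] by (simp add: add_diff_add)
  then have "cnorm A (of_real (t + u) \<odot> \<one> \<ominus> (a \<oplus> b)) \<le> t + u"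
    using c tu cnorm_triangle[of "of_real t \<odot> \<one> \<ominus> a" "of_real u \<odot> \<one> \<ominus> b"] by simp
  then show ?thesis unfolding norm_positive_def using c tu assms
    by (intro conjI exI[of _ "t + u"]) (auto simp: star_add)
qed

lemma norm_positive_scal:
  assumes "norm_positive a" "0 \<le> s" shows "norm_positive (of_real s \<odot> a)"
proof -
  obtain t where t: "0 \<le> t" "cnorm A (of_real t \<odot> \<one> \<ominus> a) \<le> t"
    using assms unfolding norm_positive_def by blast
  have a: "a \<in> carrier A" using assms by auto
  have "of_real (s * t) \<odot> \<one> \<ominus> of_real s \<odot> a = of_real s \<odot> (of_real t \<odot> \<one> \<ominus> a)"
    using a by (simp add: scal_diff scal_scal)
  then have "cnorm A (of_real (s * t) \<odot> \<one> \<ominus> of_real s \<odot> a) \<le> s * t"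
    using a t assms(2) by (simp add: cnorm_smult mult_left_mono)
  then show ?thesis unfolding norm_positive_def using a t assms
    by (intro conjI exI[of _ "s * t"]) (auto simp: star_scal)
qed

lemma norm_positive_finsum:
  assumes "finite I" "\<And>i. i \<in> I \<Longrightarrow> norm_positive (f i)"
  shows "norm_positive (\<Oplus>i\<in>I. f i)"
  using assms
proof (induction I rule: finite_induct)
  case (insert i I)
  then have "(\<Oplus>i\<in>insert i I. f i) = f i \<oplus> (\<Oplus>i\<in>I. f i)"
    by (intro finsum_insert) auto
  then show ?case using insert by (auto intro: norm_positive_add)
qed (simp add: norm_positive_zero)

text \<open>For commuting self-adjoint \<open>a\<close> and \<open>b\<close>, the sum of squares is \<open>(a + ib)\<^sup>*(a + ib)\<close>, and \<open>b\<close> is the imaginary part.\<close>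

lemma norm_square_le_sum_squares:
  assumes a: "a \<in> carrier A" "adj A a = a" and b: "b \<in> carrier A" "adj A b = b" and ab: "a \<otimes> b = b \<otimes> a"
  shows "(cnorm A b)\<^sup>2 \<le> cnorm A (a \<otimes> a \<oplus> b \<otimes> b)"
proof -
  let ?w = "a \<oplus> \<i> \<odot> b"
  have w: "?w \<in> carrier A" using a b by simp
  have "adj A ?w \<otimes> ?w = a \<otimes> a \<oplus> b \<otimes> b"
  proof -
    have ba: "b \<otimes> a \<in> carrier A" using a b by simp
    have "adj A ?w \<otimes> ?w = (a \<oplus> (-\<i>) \<odot> b) \<otimes> (a \<oplus> \<i> \<odot> b)" using a b by (simp add: star_add star_scal)
    also have "\<dots> = (a \<otimes> a \<oplus> \<i> \<odot> (b \<otimes> a)) \<oplus> ((-\<i>) \<odot> (b \<otimes> a) \<oplus> b \<otimes> b)"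
      using a b by (simp add: l_distr r_distr scal_mult_left scal_mult_right scal_scal scal_r_distr ab a_ac)
    also have "\<dots> = a \<otimes> a \<oplus> (\<i> \<odot> (b \<otimes> a) \<oplus> (-\<i>) \<odot> (b \<otimes> a)) \<oplus> b \<otimes> b"
      using a b by (simp add: a_assoc)
    also have "\<i> \<odot> (b \<otimes> a) \<oplus> (-\<i>) \<odot> (b \<otimes> a) = \<zero>" using scal_l_distr[OF ba, of \<i> "-\<i>"] ba by simp
    finally show ?thesis using a b by simp
  qed
  then have n: "cnorm A (a \<otimes> a \<oplus> b \<otimes> b) = (cnorm A ?w)\<^sup>2" using cstar_identity[OF w] by simp
  have "?w \<ominus> adj A ?w = (2 * \<i>) \<odot> b"
  proof -
    have "?w \<ominus> adj A ?w = (a \<oplus> \<i> \<odot> b) \<ominus> (a \<oplus> (-\<i>) \<odot> b)" using a b by (simp add: star_add star_scal)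
    also have "\<dots> = \<i> \<odot> b \<oplus> \<i> \<odot> b" using a b
      by (simp add: add_diff_add) (simp add: diff_eq_scal scal_scal)
    also have "\<dots> = (2 * \<i>) \<odot> b" using scal_l_distr[OF b(1), of \<i> \<i>] by simp
    finally show ?thesis .
  qed
  then have "2 * cnorm A b = cnorm A (?w \<ominus> adj A ?w)" using b by (simp add: cnorm_smult norm_mult)
  also have "\<dots> \<le> 2 * cnorm A ?w" using norm_diff_le[OF w, of "adj A ?w"] w norm_star[OF w] by simp
  finally have "cnorm A b \<le> cnorm A ?w" by simp
  then show ?thesis unfolding n using cnorm_nonneg b by (intro power_mono) auto
qed

lemma norm_positive_square:
  assumes u: "u \<in> carrier A" "adj A u = u" shows "norm_positive (u \<otimes> u)"
proof -
  define s where "s = cnorm A u + 1"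
  have s: "0 < s" "cnorm A u < s" using cnorm_nonneg[OF u(1)] by (auto simp: s_def)
  define v where "v = of_real (1 / s) \<odot> u"
  have v: "v \<in> carrier A" "adj A v = v" "cnorm A v < 1"
    using u s by (auto simp: v_def star_scal cnorm_smult norm_divide)
  have vv: "v \<otimes> v \<in> carrier A" "adj A (v \<otimes> v) = v \<otimes> v" using v by (auto simp: star_mult)
  have "cnorm A (v \<otimes> v) < 1"
    using v norm_square_self_adjoint[OF v(1,2)] cnorm_nonneg[OF v(1)] by (simp add: power_less_one_iff abs_square_less_1)
  then obtain w where w: "w \<in> carrier A" "adj A w = w" "w \<otimes> w = \<one> \<ominus> v \<otimes> v" "v \<otimes> w = w \<otimes> v"
    using square_root_one_minus[OF vv] v by (auto simp: m_assoc)
  have "(cnorm A w)\<^sup>2 \<le> cnorm A (v \<otimes> v \<oplus> w \<otimes> w)"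
    by (rule norm_square_le_sum_squares) (use v w in auto)
  also have "v \<otimes> v \<oplus> w \<otimes> w = \<one>" unfolding w(3) using vv by (simp add: add_diff_cancel)
  finally have "cnorm A (\<one> \<ominus> v \<otimes> v) \<le> 1"
    using norm_square_self_adjoint[OF w(1,2)] w(3) norm_one_le by simp
  then have "norm_positive (v \<otimes> v)" unfolding norm_positive_def using vv by (intro conjI exI[of _ 1]) auto
  then have "norm_positive (of_real (s\<^sup>2) \<odot> (v \<otimes> v))" by (rule norm_positive_scal) simp
  moreover have "of_real (s\<^sup>2) \<odot> (v \<otimes> v) = u \<otimes> u"
    using u s by (simp add: v_def scal_mult_left scal_mult_right scal_scal power2_eq_square)
  ultimately show ?thesis by simp
qed

lemma norm_positive_antisym:
  assumes h: "norm_positive h" "norm_positive (\<ominus> h)"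
  shows "h = \<zero>"
proof -
  have hc: "h \<in> carrier A" "adj A h = h" using h by auto
  obtain t u where t: "0 \<le> t" "cnorm A (of_real t \<odot> \<one> \<ominus> h) \<le> t"
    and u: "0 \<le> u" "cnorm A (of_real u \<odot> \<one> \<ominus> (\<ominus> h)) \<le> u"
    using h unfolding norm_positive_def by blast
  define T where "T = max t u"
  have T: "0 \<le> T" "cnorm A (of_real T \<odot> \<one> \<ominus> h) \<le> T" "cnorm A (of_real T \<odot> \<one> \<ominus> (\<ominus> h)) \<le> T"
    using t u norm_positive_larger[OF hc(1) t(2), of T] norm_positive_larger[OF _ u(2), of T] hc by (auto simp: T_def)
  have "cnorm A h \<le> 3 * d" if d: "0 < d" for d :: real
  proof -
    \<comment> \<open>\<open>d + h\<close> and \<open>d - h\<close> have commuting square roots.\<close>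
    define c where "c = T + d"
    have c: "0 < c" "T < c" using T d by (auto simp: c_def)
    define x where "x = of_real (1 / c) \<odot> (of_real T \<odot> \<one> \<ominus> h)"
    define y where "y = of_real (1 / c) \<odot> (of_real T \<odot> \<one> \<ominus> (\<ominus> h))"
    have x: "x \<in> carrier A" "adj A x = x" "cnorm A x < 1"
      using T c hc by (auto simp: x_def star_scal star_diff cnorm_smult norm_divide divide_less_eq)
    have y: "y \<in> carrier A" "adj A y = y" "cnorm A y < 1"
      using T c hc by (auto simp: y_def star_scal star_diff cnorm_smult norm_divide divide_less_eq minus_eq_scal)
    have xy: "x \<otimes> y = y \<otimes> x"
      using hc by (simp add: x_def y_def minus_eq_scal diff_eq_scal scal_r_distr scal_mult_left scal_mult_right
          scal_scal l_distr r_distr a_ac)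
    obtain a where a: "a \<in> carrier A" "adj A a = a" "a \<otimes> a = \<one> \<ominus> x" "\<And>z. z \<in> carrier A \<Longrightarrow> z \<otimes> x = x \<otimes> z \<Longrightarrow> z \<otimes> a = a \<otimes> z"
      using square_root_one_minus[OF x] by blast
    obtain b where b: "b \<in> carrier A" "adj A b = b" "b \<otimes> b = \<one> \<ominus> y" "\<And>z. z \<in> carrier A \<Longrightarrow> z \<otimes> y = y \<otimes> z \<Longrightarrow> z \<otimes> b = b \<otimes> z"
      using square_root_one_minus[OF y] by blast
    have "a \<otimes> b = b \<otimes> a" using b(4)[OF a(1)] a(4)[OF y(1)] xy by simp
    then have "(cnorm A a)\<^sup>2 \<le> cnorm A (b \<otimes> b \<oplus> a \<otimes> a)"
      using norm_square_le_sum_squares[OF b(1,2) a(1,2)] by simp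
    also have "b \<otimes> b \<oplus> a \<otimes> a = of_real (2 * d / c) \<odot> \<one>"
    proof -
      have 1: "x \<oplus> y = of_real (2 * T / c) \<odot> \<one>"
      proof -
        have "x \<oplus> y = of_real (1 / c) \<odot> ((of_real T \<odot> \<one> \<ominus> h) \<oplus> (of_real T \<odot> \<one> \<oplus> h))"
          using hc by (simp add: x_def y_def scal_r_distr a_minus_def)
        also have "(of_real T \<odot> \<one> \<ominus> h) \<oplus> (of_real T \<odot> \<one> \<oplus> h) = of_real T \<odot> \<one> \<oplus> of_real T \<odot> \<one>"
          using hc by (simp add: a_minus_def a_ac r_neg r_neg1 r_neg2)
        also have "\<dots> = of_real (2 * T) \<odot> \<one>" using scal_l_distr[of \<one> "of_real T" "of_real T"] by simp
        finally show ?thesis by (simp add: scal_scal)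
      qed
      have "b \<otimes> b \<oplus> a \<otimes> a = (\<one> \<oplus> \<one>) \<ominus> (x \<oplus> y)"
        unfolding a(3) b(3) using x y by (simp add: add_diff_add[symmetric] a_comm)
      also have "\<dots> = (2 - of_real (2 * T / c)) \<odot> \<one>"
        unfolding 1 using scal_l_distr[of \<one> 1 1] scal_l_distr[of \<one> 2 "- of_real (2 * T / c)"]
        by (simp add: diff_eq_scal scal_scal)
      also have "2 - complex_of_real (2 * T / c) = of_real (2 * d / c)"
      proof -
        have "2 - 2 * T / c = 2 * d / c" using c(1) unfolding c_def by (simp add: field_simps)
        from arg_cong[OF this, of complex_of_real] show ?thesis by simp
      qed
      finally show ?thesis .
    qed
    also have "cnorm A (of_real (2 * d / c) \<odot> \<one>) \<le> 2 * d / c"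
      using norm_scal_one_le[of "of_real (2 * d / c)"] c d by (simp add: norm_divide norm_mult)
    finally have "cnorm A (a \<otimes> a) \<le> 2 * d / c" using norm_square_self_adjoint[OF a(1,2)] by simp
    moreover have dh: "of_real c \<odot> (a \<otimes> a) = of_real d \<odot> \<one> \<oplus> h"
    proof -
      have "of_real c \<odot> (a \<otimes> a) = of_real c \<odot> \<one> \<ominus> (of_real T \<odot> \<one> \<ominus> h)"
        unfolding a(3) using c hc by (simp add: x_def scal_diff scal_scal)
      also have "\<dots> = (of_real c \<odot> \<one> \<oplus> (- of_real T) \<odot> \<one>) \<oplus> h"
        using hc by (simp add: diff_eq_scal scal_r_distr scal_scal a_assoc)
      also have "of_real c \<odot> \<one> \<oplus> (- of_real T) \<odot> \<one> = of_real d \<odot> \<one>"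
        using scal_l_distr[of \<one> "of_real c" "- of_real T"] by (simp add: c_def)
      finally show ?thesis .
    qed
    ultimately have "cnorm A (of_real d \<odot> \<one> \<oplus> h) \<le> 2 * d"
      using c cnorm_smult[of "a \<otimes> a" "of_real c"] a(1) by (simp add: dh[symmetric] pos_le_divide_eq mult.commute)
    moreover have "h = (of_real d \<odot> \<one> \<oplus> h) \<ominus> of_real d \<odot> \<one>"
      using hc by (simp add: a_minus_def a_ac r_neg r_neg1 r_neg2)
    then have "cnorm A h \<le> cnorm A (of_real d \<odot> \<one> \<oplus> h) + cnorm A (of_real d \<odot> \<one>)"
      using norm_diff_le[of "of_real d \<odot> \<one> \<oplus> h" "of_real d \<odot> \<one>"] hc by simp
    ultimately show ?thesis using norm_scal_one_le[of "of_real d"] d by simp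
  qed
  from this[of "cnorm A h / 6"] have "cnorm A h \<le> 0" using cnorm_nonneg[OF hc(1)] by force
  then show ?thesis using cnorm_eq_zero[OF hc(1)] cnorm_nonneg[OF hc(1)] by simp
qed

text \<open>
  Kaplansky's step: \<open>d\<^sup>*d\<close> is never negative.  If \<open>h = - d\<^sup>*d\<close> is positive then so is
  \<open>k = d d\<^sup>*\<close>, because \<open>d\<^sup>*d + d d\<^sup>*\<close> is a sum of squares.  From \<open>d\<^sup>* (1 - k/t)\<^sup>n d = - (1 + h/t)\<^sup>n h\<close>,
  where the left-hand side stays bounded, the powers of \<open>1 + h/t\<close> grow at most linearly, so that
  \<open>\<parallel>1 + h/t\<parallel> \<le> 1\<close> and \<open>-h\<close> is positive as well.
\<close>

lemma kaplansky:
  assumes d: "d \<in> carrier A" and h: "norm_positive (\<ominus> (adj A d \<otimes> d))"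
  shows "d = \<zero>"
proof -
  define c where "c = adj A d \<otimes> d"
  define k where "k = d \<otimes> adj A d"
  have c: "c \<in> carrier A" "adj A c = c" and k: "k \<in> carrier A" "adj A k = k"
    using d by (auto simp: c_def k_def star_mult)
  have kpos: "norm_positive k"
  proof -
    define u v where "u = d \<oplus> adj A d" and "v = \<i> \<odot> (d \<ominus> adj A d)"
    have u: "u \<in> carrier A" "adj A u = u" using d by (auto simp: u_def star_add a_comm)
    have v: "v \<in> carrier A" "adj A v = v"
      using d by (auto simp: v_def star_scal star_diff) (simp add: diff_eq_scal scal_r_distr scal_scal a_comm)
    have "norm_positive (of_real (1/2) \<odot> (u \<otimes> u \<oplus> v \<otimes> v \<oplus> (of_real 2 \<odot> (\<ominus> c))))"
      using h u v by (intro norm_positive_scal norm_positive_add norm_positive_square) (auto simp: c_def)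
    moreover have "u \<otimes> u \<oplus> v \<otimes> v = of_real 2 \<odot> k \<oplus> of_real 2 \<odot> c"
    proof -
      define a b where "a = d \<otimes> d" and "b = adj A d \<otimes> adj A d"
      have ab: "a \<in> carrier A" "b \<in> carrier A" using d by (auto simp: a_def b_def)
      have uu: "u \<otimes> u = (a \<oplus> b) \<oplus> (k \<oplus> c)"
        using d by (simp add: u_def a_def b_def k_def c_def l_distr r_distr a_ac)
      have "(d \<ominus> adj A d) \<otimes> (d \<ominus> adj A d) = (a \<oplus> b) \<ominus> (k \<oplus> c)"
        using d by (simp add: a_def b_def k_def c_def diff_eq_scal l_distr r_distr scal_mult_left scal_mult_right
            scal_scal scal_r_distr a_ac)
      moreover have "v \<otimes> v = (-1) \<odot> ((d \<ominus> adj A d) \<otimes> (d \<ominus> adj A d))"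
        using d by (simp add: v_def scal_mult_left scal_mult_right scal_scal)
      ultimately have vv: "v \<otimes> v = (k \<oplus> c) \<ominus> (a \<oplus> b)"
        using ab c k by (simp add: diff_eq_scal scal_r_distr scal_scal a_ac)
      have "u \<otimes> u \<oplus> v \<otimes> v = (k \<oplus> c) \<oplus> ((a \<oplus> b) \<oplus> ((k \<oplus> c) \<ominus> (a \<oplus> b)))"
        unfolding uu vv using ab c k by (simp add: a_minus_def a_ac)
      also have "\<dots> = (k \<oplus> c) \<oplus> (k \<oplus> c)" using ab c k by (simp add: add_diff_cancel)
      also have "\<dots> = of_real 2 \<odot> (k \<oplus> c)" using scal_l_distr[of "k \<oplus> c" 1 1] c k by simp
      finally show ?thesis using c k by (simp add: scal_r_distr)
    qed
    ultimately have "norm_positive (of_real (1/2) \<odot> (of_real 2 \<odot> k \<oplus> of_real 2 \<odot> c \<oplus> of_real 2 \<odot> (\<ominus> c)))" by simp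
    also have "of_real 2 \<odot> k \<oplus> of_real 2 \<odot> c \<oplus> of_real 2 \<odot> (\<ominus> c) = of_real 2 \<odot> (k \<oplus> (c \<oplus> (\<ominus> c)))"
      using c k by (simp add: scal_r_distr a_assoc)
    also have "\<dots> = of_real 2 \<odot> k" using c k by (simp add: r_neg)
    finally show ?thesis using k by (simp add: scal_scal)
  qed
  then obtain t where t: "0 \<le> t" "cnorm A (of_real t \<odot> \<one> \<ominus> k) \<le> t" unfolding norm_positive_def by blast
  define s where "s = t + 1"
  have s: "0 < s" "cnorm A (of_real s \<odot> \<one> \<ominus> k) \<le> s"
    using t norm_positive_larger[OF k(1) t(2), of s] by (auto simp: s_def)
  define F where "F = \<one> \<ominus> of_real (1 / s) \<odot> k"
  define e where "e = \<one> \<ominus> of_real (1 / s) \<odot> c"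
  have F: "F \<in> carrier A" and e: "e \<in> carrier A" "adj A e = e"
    using c k by (auto simp: F_def e_def star_diff star_scal)
  have "F = of_real (1 / s) \<odot> (of_real s \<odot> \<one> \<ominus> k)" using s k by (simp add: F_def scal_diff scal_scal)
  then have Fn: "cnorm A F \<le> 1" using s k by (simp add: cnorm_smult norm_divide)
  have Fpow: "cnorm A (F [^] n) \<le> 1" for n :: nat
  proof (induction n)
    case (Suc n)
    have "cnorm A (F [^] Suc n) \<le> cnorm A (F [^] n) * cnorm A F" using F cnorm_mult[of "F [^] n" F] by simp
    also have "\<dots> \<le> 1" using Suc Fn F by (simp add: mult_le_one cnorm_nonneg)
    finally show ?case .
  qed (use norm_one_le in simp)
  have intertwine: "adj A d \<otimes> F [^] n = e [^] n \<otimes> adj A d" for n :: nat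
  proof (induction n)
    case (Suc n)
    have 1: "adj A d \<otimes> F = e \<otimes> adj A d"
      using d by (simp add: F_def e_def c_def k_def mult_diff_left mult_diff_right scal_mult_left scal_mult_right m_assoc)
    have "adj A d \<otimes> F [^] Suc n = (adj A d \<otimes> F [^] n) \<otimes> F" using d F by (simp add: m_assoc)
    also have "\<dots> = e [^] n \<otimes> (adj A d \<otimes> F)" unfolding Suc using d F e by (simp add: m_assoc)
    also have "\<dots> = e [^] Suc n \<otimes> adj A d" unfolding 1 using d e by (simp add: m_assoc)
    finally show ?case .
  qed (use d in simp)
  have bound: "cnorm A (e [^] n \<otimes> c) \<le> (cnorm A d)\<^sup>2" for n :: nat
  proof -
    have "e [^] n \<otimes> c = adj A d \<otimes> F [^] n \<otimes> d" unfolding intertwine using d e by (simp add: c_def m_assoc)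
    also have "cnorm A \<dots> \<le> cnorm A (adj A d \<otimes> F [^] n) * cnorm A d" using d F by (intro cnorm_mult) auto
    also have "cnorm A (adj A d \<otimes> F [^] n) \<le> cnorm A (adj A d) * cnorm A (F [^] n)" using d F by (intro cnorm_mult) auto
    also have "\<dots> \<le> cnorm A d * 1" using Fpow d F by (intro mult_mono) (auto simp: norm_star cnorm_nonneg)
    finally show ?thesis using d by (simp add: power2_eq_square mult_right_mono cnorm_nonneg)
  qed
  have "cnorm A e \<le> 1"
  proof (rule norm_le_one_if_linear_growth[OF e])
    fix n :: nat
    show "cnorm A (e [^] n) \<le> 1 + (cnorm A d)\<^sup>2 / s * real n"
    proof (induction n)
      case (Suc n)
      have "e [^] Suc n = e [^] n \<ominus> of_real (1 / s) \<odot> (e [^] n \<otimes> c)"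
        using e(1) c by (simp add: e_def[symmetric]) (simp add: e_def mult_diff_right scal_mult_right)
      then have "cnorm A (e [^] Suc n) \<le> cnorm A (e [^] n) + cnorm A (of_real (1 / s) \<odot> (e [^] n \<otimes> c))"
        using e c norm_diff_le[of "e [^] n" "of_real (1 / s) \<odot> (e [^] n \<otimes> c)"] by simp
      also have "cnorm A (of_real (1 / s) \<odot> (e [^] n \<otimes> c)) \<le> (cnorm A d)\<^sup>2 / s"
        using s bound[of n] e c by (simp add: cnorm_smult norm_divide divide_right_mono)
      finally show ?case using Suc by (simp add: algebra_simps add_divide_distrib)
    qed (use norm_one_le in simp)
  qed
  then have "norm_positive (of_real (1 / s) \<odot> c)"
    unfolding norm_positive_def e_def using c by (intro conjI exI[of _ 1]) (auto simp: star_scal)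
  then have "norm_positive (of_real s \<odot> (of_real (1 / s) \<odot> c))" by (rule norm_positive_scal) (use s in simp)
  then have "norm_positive c" using s c by (simp add: scal_scal)
  then have "c = \<zero>" using norm_positive_antisym[of c] h by (simp add: c_def)
  then have "(cnorm A d)\<^sup>2 = 0" using cstar_identity[OF d] by (simp add: c_def)
  then show ?thesis using cnorm_eq_zero[OF d] by simp
qed

lemma norm_positive_finsum_eq_zero:
  assumes I: "finite I" "\<And>i. i \<in> I \<Longrightarrow> norm_positive (f i)" "(\<Oplus>i\<in>I. f i) = \<zero>" "j \<in> I"
  shows "f j = \<zero>"
proof (rule norm_positive_antisym)
  show fj: "norm_positive (f j)" using I by simp
  have rest: "norm_positive (\<Oplus>i\<in>I - {j}. f i)" using I by (intro norm_positive_finsum) auto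
  have "(\<Oplus>i\<in>insert j (I - {j}). f i) = f j \<oplus> (\<Oplus>i\<in>I - {j}. f i)"
    using I by (intro finsum_insert) auto
  also have "insert j (I - {j}) = I" using I by auto
  finally have "(\<Oplus>i\<in>I - {j}. f i) \<oplus> f j = \<zero>" using I(3) rest fj by (simp add: a_comm)
  then have "\<ominus> f j = (\<Oplus>i\<in>I - {j}. f i)" using rest fj by (intro minus_equality) auto
  with rest show "norm_positive (\<ominus> f j)" by simp
qed

text \<open>The powers of \<open>1 - XqX = (1 - X) + X(1 - q)X\<close> stay bounded by 2, so its norm is at most 1.\<close>

lemma norm_positive_corner:
  assumes X: "is_projection A X" and q: "is_projection A q"
  shows "norm_positive (X \<otimes> q \<otimes> X)"
proof -
  have Xc: "X \<in> carrier A" "X \<otimes> X = X" "adj A X = X" and qc: "q \<in> carrier A" "q \<otimes> q = q" "adj A q = q"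
    using X q by (auto simp: is_projection_def)
  let ?P = "\<one> \<ominus> X" and ?r = "\<one> \<ominus> q"
  define y where "y = X \<otimes> ?r \<otimes> X"
  have y: "y \<in> carrier A" "adj A y = y" using Xc qc by (auto simp: y_def star_mult star_diff m_assoc)
  have r: "cnorm A ?r \<le> 1" using qc
    by (intro norm_projection_le) (auto simp: star_diff mult_diff_left mult_diff_right)
  have P: "?P \<in> carrier A" "?P \<otimes> ?P = ?P" "cnorm A ?P \<le> 1" using Xc
    by (auto intro!: norm_projection_le simp: star_diff mult_diff_left mult_diff_right)
  have "X \<otimes> y = y" using Xc qc by (simp add: y_def m_assoc[symmetric])
  moreover have "y \<otimes> X = y" using Xc qc by (simp add: y_def m_assoc)
  ultimately have Py: "?P \<otimes> y = \<zero>" "y \<otimes> ?P = \<zero>" using Xc y by (simp_all add: mult_diff_left mult_diff_right)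
  have nX: "cnorm A X \<le> 1" using Xc by (intro norm_projection_le) auto
  have ny: "cnorm A y \<le> 1"
  proof -
    have "cnorm A y \<le> cnorm A (X \<otimes> ?r) * cnorm A X" unfolding y_def using Xc qc by (intro cnorm_mult) auto
    also have "\<dots> \<le> (cnorm A X * cnorm A ?r) * cnorm A X"
      using Xc qc by (intro mult_right_mono cnorm_mult cnorm_nonneg) auto
    also have "\<dots> \<le> 1" using nX r Xc qc by (intro mult_le_one mult_nonneg_nonneg cnorm_nonneg) auto
    finally show ?thesis .
  qed
  define e where "e = ?P \<oplus> y"
  have ec: "e \<in> carrier A" "adj A e = e" using P y Xc by (auto simp: e_def star_add star_diff)
  have pow: "e [^] Suc n = ?P \<oplus> y [^] Suc n \<and> cnorm A (y [^] Suc n) \<le> 1" for n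
  proof (induction n)
    case 0
    show ?case using P y ny by (simp add: e_def)
  next
    case (Suc n)
    have "e [^] Suc (Suc n) = (?P \<oplus> y [^] Suc n) \<otimes> (?P \<oplus> y)"
      unfolding nat_pow_Suc[of e "Suc n"] using Suc by (simp add: e_def)
    also have "\<dots> = ?P \<oplus> y [^] Suc (Suc n)"
      using P y Py(1) by (simp add: l_distr r_distr Py m_assoc del: nat_pow_Suc)
    finally have 1: "e [^] Suc (Suc n) = ?P \<oplus> y [^] Suc (Suc n)" .
    have "cnorm A (y [^] Suc (Suc n)) \<le> cnorm A (y [^] Suc n) * cnorm A y"
      unfolding nat_pow_Suc[of y "Suc n"] using y by (intro cnorm_mult) auto
    also have "\<dots> \<le> 1" using Suc ny y by (intro mult_le_one cnorm_nonneg) auto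
    finally show ?case using 1 by simp
  qed
  have "cnorm A e \<le> 1"
  proof (rule norm_le_one_if_linear_growth[OF ec, where a = 2 and b = 0])
    fix n :: nat assume "1 \<le> n"
    then obtain m where "n = Suc m" by (cases n) auto
    then show "cnorm A (e [^] n) \<le> 2 + 0 * real n"
      using pow[of m] cnorm_triangle[of ?P "y [^] Suc m"] P y by fastforce
  qed
  moreover have "e = \<one> \<ominus> X \<otimes> q \<otimes> X"
    using Xc qc by (simp add: e_def y_def mult_diff_left mult_diff_right diff_add_diff)
  ultimately show ?thesis
    unfolding norm_positive_def using Xc qc by (intro conjI exI[of _ 1]) (auto simp: star_mult m_assoc)
qed

text \<open>
  Cutting \<open>P - \<Sum> q\<^sub>i = c\<^sup>*c\<close> down by \<open>1 - P\<close> gives a sum of positive elements that is the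
  negative of a square, so that all its terms vanish by Kaplansky's step; the corner of the
  same relation in \<open>q\<^sub>i\<close> then makes the projections orthogonal.
\<close>

lemma projections_below_projection:
  assumes I: "finite I" and P: "is_projection A P" and q: "\<And>i. i \<in> I \<Longrightarrow> is_projection A (q i)"
    and le: "cstar_le A (\<Oplus>i\<in>I. q i) P"
  shows "i \<in> I \<Longrightarrow> P \<otimes> q i = q i" "i \<in> I \<Longrightarrow> j \<in> I \<Longrightarrow> i \<noteq> j \<Longrightarrow> q i \<otimes> q j = \<zero>"
proof -
  have Pc: "P \<in> carrier A" "P \<otimes> P = P" "adj A P = P" using P by (auto simp: is_projection_def)
  have qc: "q i \<in> carrier A" "q i \<otimes> q i = q i" "adj A (q i) = q i" if "i \<in> I" for i
    using q[OF that] by (auto simp: is_projection_def)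
  obtain c where c: "c \<in> carrier A" "P \<ominus> (\<Oplus>i\<in>I. q i) = adj A c \<otimes> c" using le by (auto simp: cstar_le_def)
  have sumc: "(\<Oplus>i\<in>I. q i) \<in> carrier A" using qc by (intro finsum_closed) auto
  \<comment> \<open>Compressing the inequality by a projection \<open>X\<close> turns it into an instance of Kaplansky's step.\<close>
  have compress: "X \<otimes> P \<otimes> X \<ominus> (\<Oplus>i\<in>I. X \<otimes> q i \<otimes> X) = adj A (c \<otimes> X) \<otimes> (c \<otimes> X)"
    if X: "is_projection A X" for X
  proof -
    have Xc: "X \<in> carrier A" "adj A X = X" using X by (auto simp: is_projection_def)
    have "adj A (c \<otimes> X) \<otimes> (c \<otimes> X) = X \<otimes> (P \<ominus> (\<Oplus>i\<in>I. q i)) \<otimes> X"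
      unfolding c(2) using c(1) Xc by (simp add: star_mult m_assoc)
    also have "\<dots> = X \<otimes> P \<otimes> X \<ominus> X \<otimes> (\<Oplus>i\<in>I. q i) \<otimes> X"
      using Xc Pc sumc by (simp add: mult_diff_left mult_diff_right)
    also have "X \<otimes> (\<Oplus>i\<in>I. q i) = (\<Oplus>i\<in>I. X \<otimes> q i)"
      using I Xc qc by (intro finsum_rdistr) auto
    also have "(\<Oplus>i\<in>I. X \<otimes> q i) \<otimes> X = (\<Oplus>i\<in>I. X \<otimes> q i \<otimes> X)"
      using I Xc qc by (intro finsum_ldistr) auto
    finally show ?thesis ..
  qed
  have zero: "q i \<otimes> X = \<zero>" if X: "is_projection A X" and i: "i \<in> I" and z: "X \<otimes> q i \<otimes> X = \<zero>" for X i
  proof -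
    have Xc: "X \<in> carrier A" "adj A X = X" using X by (auto simp: is_projection_def)
    have "adj A (q i \<otimes> X) \<otimes> (q i \<otimes> X) = X \<otimes> (q i \<otimes> q i) \<otimes> X"
      using Xc qc(1,3)[OF i] by (simp add: star_mult m_assoc)
    then have "(cnorm A (q i \<otimes> X))\<^sup>2 = 0" using cstar_identity[of "q i \<otimes> X"] z qc[OF i] Xc by simp
    then show ?thesis using cnorm_eq_zero[of "q i \<otimes> X"] qc[OF i] Xc by simp
  qed
  have below: "P \<otimes> q i = q i" if i: "i \<in> I" for i
  proof -
    let ?X = "\<one> \<ominus> P"
    have X: "is_projection A ?X" using Pc by (auto simp: is_projection_def star_diff mult_diff_left mult_diff_right)
    have Xc: "?X \<in> carrier A" using Pc by simp
    have pos: "norm_positive (\<Oplus>i\<in>I. ?X \<otimes> q i \<otimes> ?X)"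
      by (intro norm_positive_finsum I norm_positive_corner X q)
    have "?X \<otimes> P \<otimes> ?X = \<zero>" using Pc by (simp add: mult_diff_left mult_diff_right)
    then have neg: "adj A (c \<otimes> ?X) \<otimes> (c \<otimes> ?X) = \<ominus> (\<Oplus>i\<in>I. ?X \<otimes> q i \<otimes> ?X)"
      using compress[OF X] pos by (simp add: a_minus_def)
    then have "c \<otimes> ?X = \<zero>" using pos c Xc by (intro kaplansky) auto
    then have "(\<Oplus>i\<in>I. ?X \<otimes> q i \<otimes> ?X) = \<zero>" using neg pos by (metis minus_minus minus_zero norm_positive_carrier r_null star_zero zero_closed)
    then have "?X \<otimes> q i \<otimes> ?X = \<zero>"
      using norm_positive_finsum_eq_zero[OF I _ _ i, of "\<lambda>i. ?X \<otimes> q i \<otimes> ?X"] norm_positive_corner[OF X q] by blast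
    then have "q i \<otimes> ?X = \<zero>" by (rule zero[OF X i])
    then have "q i = q i \<otimes> P" using Pc qc[OF i] by (simp add: mult_diff_right diff_eq_zero_iff)
    then have "adj A (q i) = adj A (q i \<otimes> P)" by simp
    then show ?thesis using Pc qc[OF i] by (simp add: star_mult)
  qed
  then show "i \<in> I \<Longrightarrow> P \<otimes> q i = q i" .
  show "q i \<otimes> q j = \<zero>" if ij: "i \<in> I" "j \<in> I" "i \<noteq> j"
  proof -
    let ?X = "q j" and ?J = "I - {j}"
    have X: "is_projection A ?X" by (rule q[OF ij(2)])
    have pos: "norm_positive (\<Oplus>i\<in>?J. ?X \<otimes> q i \<otimes> ?X)"
      using I q by (intro norm_positive_finsum norm_positive_corner X) auto
    have J: "I = insert j ?J" using ij by auto
    have "(\<Oplus>i\<in>insert j ?J. ?X \<otimes> q i \<otimes> ?X) = ?X \<otimes> q j \<otimes> ?X \<oplus> (\<Oplus>i\<in>?J. ?X \<otimes> q i \<otimes> ?X)"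
      using I qc ij by (intro finsum_insert) auto
    then have sum: "(\<Oplus>i\<in>I. ?X \<otimes> q i \<otimes> ?X) = ?X \<oplus> (\<Oplus>i\<in>?J. ?X \<otimes> q i \<otimes> ?X)"
      using J qc[OF ij(2)] by simp
    have "?X \<otimes> P \<otimes> ?X = ?X" using below[OF ij(2)] qc[OF ij(2)] Pc by (simp add: m_assoc)
    then have "?X \<ominus> (?X \<oplus> (\<Oplus>i\<in>?J. ?X \<otimes> q i \<otimes> ?X)) = adj A (c \<otimes> ?X) \<otimes> (c \<otimes> ?X)"
      using compress[OF X] sum by simp
    moreover have "?X \<ominus> (?X \<oplus> (\<Oplus>i\<in>?J. ?X \<otimes> q i \<otimes> ?X)) = \<ominus> (\<Oplus>i\<in>?J. ?X \<otimes> q i \<otimes> ?X)"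
      using pos qc[OF ij(2)] by (simp add: a_minus_def minus_add r_neg2)
    ultimately have neg: "adj A (c \<otimes> ?X) \<otimes> (c \<otimes> ?X) = \<ominus> (\<Oplus>i\<in>?J. ?X \<otimes> q i \<otimes> ?X)" by simp
    then have "c \<otimes> ?X = \<zero>" using pos c qc[OF ij(2)] by (intro kaplansky) auto
    then have "(\<Oplus>i\<in>?J. ?X \<otimes> q i \<otimes> ?X) = \<zero>" using neg pos by (metis minus_minus minus_zero norm_positive_carrier r_null star_zero zero_closed)
    then have "?X \<otimes> q i \<otimes> ?X = \<zero>"
      using norm_positive_finsum_eq_zero[of ?J "\<lambda>i. ?X \<otimes> q i \<otimes> ?X" i] norm_positive_corner[OF X q] I ij by blast
    then show ?thesis by (rule zero[OF X ij(1)])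
  qed
qed

end


section \<open>Square-summable families\<close>

definition l2 :: "('i \<Rightarrow> complex) set" where
  "l2 = {x. (\<lambda>i. (cmod (x i))\<^sup>2) summable_on UNIV}"

definition l2norm :: "('i \<Rightarrow> complex) \<Rightarrow> real" where
  "l2norm x = sqrt (\<Sum>\<^sub>\<infinity>i. (cmod (x i))\<^sup>2)"

definition l2inner :: "('i \<Rightarrow> complex) \<Rightarrow> ('i \<Rightarrow> complex) \<Rightarrow> complex" where
  "l2inner x y = (\<Sum>\<^sub>\<infinity>i. cnj (x i) * y i)"

lemma l2norm_nonneg [simp]: "0 \<le> l2norm x"
  by (simp add: l2norm_def infsum_nonneg)

lemma L2_set_le_l2norm:
  assumes "x \<in> l2" "finite F" shows "L2_set (\<lambda>i. cmod (x i)) F \<le> l2norm x"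
  unfolding L2_set_def l2norm_def using assms
  by (intro real_sqrt_le_mono finite_sum_le_infsum) (auto simp: l2_def)

lemma l2I:
  assumes C: "\<And>F. finite F \<Longrightarrow> L2_set (\<lambda>i. cmod (x i)) F \<le> C"
  shows "x \<in> l2" "l2norm x \<le> C"
proof -
  have C0: "0 \<le> C" using C[of "{}"] by simp
  have le: "(\<Sum>i\<in>F. (cmod (x i))\<^sup>2) \<le> C\<^sup>2" if "finite F" for F
  proof -
    have "(\<Sum>i\<in>F. (cmod (x i))\<^sup>2) = (L2_set (\<lambda>i. cmod (x i)) F)\<^sup>2"
      unfolding L2_set_def by (simp add: sum_nonneg)
    also have "\<dots> \<le> C\<^sup>2" using C[OF that] by (intro power_mono) auto
    finally show ?thesis .
  qed
  have s: "(\<lambda>i. (cmod (x i))\<^sup>2) summable_on UNIV"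
    using le by (intro nonneg_bdd_above_summable_on bdd_aboveI[of _ "C\<^sup>2"]) auto
  then show "x \<in> l2" by (simp add: l2_def)
  have "(\<Sum>\<^sub>\<infinity>i. (cmod (x i))\<^sup>2) \<le> C\<^sup>2" using s le by (intro infsum_le_finite_sums) auto
  then show "l2norm x \<le> C" unfolding l2norm_def using C0 by (simp add: real_le_lsqrt infsum_nonneg)
qed

lemma l2_zero: "(\<lambda>_. 0) \<in> l2" "l2norm (\<lambda>_. 0) = 0"
  by (simp_all add: l2_def l2norm_def)

lemma l2_add:
  assumes "x \<in> l2" "y \<in> l2"
  shows "(\<lambda>i. x i + y i) \<in> l2" "l2norm (\<lambda>i. x i + y i) \<le> l2norm x + l2norm y"
proof -
  have "L2_set (\<lambda>i. cmod (x i + y i)) F \<le> l2norm x + l2norm y" if F: "finite F" for F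
  proof -
    have "L2_set (\<lambda>i. cmod (x i + y i)) F \<le> L2_set (\<lambda>i. cmod (x i) + cmod (y i)) F"
      by (intro L2_set_mono norm_triangle_ineq) auto
    also have "\<dots> \<le> L2_set (\<lambda>i. cmod (x i)) F + L2_set (\<lambda>i. cmod (y i)) F" by (rule L2_set_triangle_ineq)
    also have "\<dots> \<le> l2norm x + l2norm y" by (intro add_mono L2_set_le_l2norm assms F)
    finally show ?thesis .
  qed
  then show "(\<lambda>i. x i + y i) \<in> l2" "l2norm (\<lambda>i. x i + y i) \<le> l2norm x + l2norm y" by (auto intro: l2I)
qed

lemma l2_scale:
  assumes "x \<in> l2"
  shows "(\<lambda>i. c * x i) \<in> l2" "l2norm (\<lambda>i. c * x i) = cmod c * l2norm x"
proof -
  have *: "(\<lambda>i. (cmod (c * x i))\<^sup>2) = (\<lambda>i. (cmod c)\<^sup>2 * (cmod (x i))\<^sup>2)"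
    by (simp add: norm_mult power_mult_distrib)
  show "(\<lambda>i. c * x i) \<in> l2" unfolding l2_def mem_Collect_eq *
    using assms by (intro summable_on_cmult_right) (simp add: l2_def)
  show "l2norm (\<lambda>i. c * x i) = cmod c * l2norm x"
    unfolding l2norm_def * by (simp add: infsum_cmult_right' real_sqrt_mult)
qed

lemma l2_diff:
  assumes "x \<in> l2" "y \<in> l2" shows "(\<lambda>i. x i - y i) \<in> l2"
  using l2_add(1)[OF assms(1) l2_scale(1)[OF assms(2), of "-1"]] by simp

lemma l2norm_eq_0:
  assumes "x \<in> l2" "l2norm x = 0" shows "x = (\<lambda>_. 0)"
proof
  fix i
  have "L2_set (\<lambda>i. cmod (x i)) {i} \<le> 0" using L2_set_le_l2norm[OF assms(1), of "{i}"] assms(2) by simp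
  then show "x i = 0" by simp
qed

lemma cmod_le_l2norm: "x \<in> l2 \<Longrightarrow> cmod (x i) \<le> l2norm x"
  using L2_set_le_l2norm[of x "{i}"] by simp

lemma l2inner_abs_summable:
  assumes "x \<in> l2" "y \<in> l2"
  shows "(\<lambda>i. norm (cnj (x i) * y i)) summable_on UNIV" "cmod (l2inner x y) \<le> l2norm x * l2norm y"
proof -
  have le: "(\<Sum>i\<in>F. norm (cnj (x i) * y i)) \<le> l2norm x * l2norm y" if F: "finite F" for F
  proof -
    have "(\<Sum>i\<in>F. norm (cnj (x i) * y i)) = (\<Sum>i\<in>F. \<bar>cmod (x i)\<bar> * \<bar>cmod (y i)\<bar>)" by (simp add: norm_mult)
    also have "\<dots> \<le> L2_set (\<lambda>i. cmod (x i)) F * L2_set (\<lambda>i. cmod (y i)) F" by (rule L2_set_mult_ineq)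
    also have "\<dots> \<le> l2norm x * l2norm y" by (intro mult_mono L2_set_le_l2norm assms F) auto
    finally show ?thesis .
  qed
  show s: "(\<lambda>i. norm (cnj (x i) * y i)) summable_on UNIV"
    using le by (intro nonneg_bdd_above_summable_on bdd_aboveI[of _ "l2norm x * l2norm y"]) auto
  have "cmod (l2inner x y) \<le> (\<Sum>\<^sub>\<infinity>i. norm (cnj (x i) * y i))"
    unfolding l2inner_def by (rule norm_infsum_bound[OF s])
  also have "\<dots> \<le> l2norm x * l2norm y" using s le by (intro infsum_le_finite_sums) auto
  finally show "cmod (l2inner x y) \<le> l2norm x * l2norm y" .
qed

lemma l2inner_summable: "x \<in> l2 \<Longrightarrow> y \<in> l2 \<Longrightarrow> (\<lambda>i. cnj (x i) * y i) summable_on UNIV"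
  by (rule abs_summable_summable[OF l2inner_abs_summable(1)])

lemma l2inner_add_right:
  "x \<in> l2 \<Longrightarrow> y \<in> l2 \<Longrightarrow> z \<in> l2 \<Longrightarrow> l2inner x (\<lambda>i. y i + z i) = l2inner x y + l2inner x z"
  unfolding l2inner_def by (simp add: distrib_left infsum_add l2inner_summable)

lemma l2inner_scale_right: "l2inner x (\<lambda>i. c * y i) = c * l2inner x y"
  unfolding l2inner_def by (subst infsum_cmult_right'[symmetric]) (simp add: mult_ac)

lemma l2inner_cnj: "l2inner y x = cnj (l2inner x y)"
  unfolding l2inner_def by (subst infsum_cnj[symmetric]) (simp add: mult.commute)

lemma l2inner_add_left:
  "x \<in> l2 \<Longrightarrow> y \<in> l2 \<Longrightarrow> z \<in> l2 \<Longrightarrow> l2inner (\<lambda>i. y i + z i) x = l2inner y x + l2inner z x"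
  using l2inner_add_right[of x y z] by (simp add: l2inner_cnj[of _ x])

lemma l2inner_scale_left: "l2inner (\<lambda>i. c * y i) x = cnj c * l2inner y x"
  using l2inner_scale_right[of x c y] by (simp add: l2inner_cnj[of _ x])

lemma l2inner_self: assumes "x \<in> l2" shows "l2inner x x = of_real ((l2norm x)\<^sup>2)"
proof -
  have "l2inner x x = (\<Sum>\<^sub>\<infinity>i. of_real ((cmod (x i))\<^sup>2))"
    unfolding l2inner_def by (intro infsum_cong) (metis complex_norm_square mult.commute)
  also have "\<dots> = of_real (\<Sum>\<^sub>\<infinity>i. (cmod (x i))\<^sup>2)" using assms by (intro infsumI has_sum_of_real has_sum_infsum) (simp add: l2_def)
  also have "(\<Sum>\<^sub>\<infinity>i. (cmod (x i))\<^sup>2) = (l2norm x)\<^sup>2" by (simp add: l2norm_def infsum_nonneg)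
  finally show ?thesis .
qed

definition l2unit :: "'i \<Rightarrow> 'i \<Rightarrow> complex" where "l2unit i = (\<lambda>j. if j = i then 1 else 0)"

lemma l2unit_mem: "l2unit i \<in> l2"
proof -
  have "((\<lambda>j. (cmod (l2unit i j))\<^sup>2) summable_on UNIV) \<longleftrightarrow> ((\<lambda>j. (cmod (l2unit i j))\<^sup>2) summable_on {i})"
    by (rule summable_on_cong_neutral) (auto simp: l2unit_def)
  then show ?thesis by (simp add: l2_def)
qed

lemma l2inner_unit: "l2inner (l2unit i) x = x i"
proof -
  have "l2inner (l2unit i) x = (\<Sum>\<^sub>\<infinity>j\<in>{i}. cnj (l2unit i j) * x j)"
    unfolding l2inner_def by (rule infsum_cong_neutral) (auto simp: l2unit_def)
  then show ?thesis by (simp add: l2unit_def)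
qed

lemma l2_pointwise_limit:
  assumes "\<And>m. X m \<in> l2" "\<And>i. (\<lambda>m. X m i) \<longlonglongrightarrow> x i" "\<And>m. m \<ge> N \<Longrightarrow> l2norm (X m) \<le> C"
  shows "x \<in> l2" "l2norm x \<le> C"
proof -
  have "L2_set (\<lambda>i. cmod (x i)) F \<le> C" if F: "finite F" for F
  proof (rule LIMSEQ_le_const2)
    show "(\<lambda>m. L2_set (\<lambda>i. cmod (X m i)) F) \<longlonglongrightarrow> L2_set (\<lambda>i. cmod (x i)) F"
      unfolding L2_set_def by (intro tendsto_intros assms)
    show "\<exists>N. \<forall>n\<ge>N. L2_set (\<lambda>i. cmod (X n i)) F \<le> C"
      using L2_set_le_l2norm[OF assms(1) F] assms(3) order_trans by blast
  qed
  then show "x \<in> l2" "l2norm x \<le> C" by (auto intro: l2I)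
qed


section \<open>The \<open>C\<^sup>*\<close>-algebra of bounded operators on \<open>\<ell>\<^sup>2\<close>\<close>

text \<open>
  An operator belongs to the algebra if it is bounded and has an adjoint; this makes it linear.
\<close>

type_synonym 'i operator = "('i \<Rightarrow> complex) \<Rightarrow> 'i \<Rightarrow> complex"

definition adjoint_pair :: "'i operator \<Rightarrow> 'i operator \<Rightarrow> bool" where
  "adjoint_pair T S \<longleftrightarrow> (\<forall>x\<in>l2. T x \<in> l2 \<and> S x \<in> l2) \<and> (\<forall>x\<in>l2. \<forall>y\<in>l2. l2inner (T x) y = l2inner x (S y))"

definition bounded_operators :: "'i operator set" where
  "bounded_operators = {T. (\<forall>x. x \<notin> l2 \<longrightarrow> T x = (\<lambda>_. 0)) \<and>
     (\<exists>C\<ge>0. \<forall>x\<in>l2. l2norm (T x) \<le> C * l2norm x) \<and> (\<exists>S. adjoint_pair T S)}"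

definition operator_norm :: "'i operator \<Rightarrow> real" where
  "operator_norm T = Inf {C. 0 \<le> C \<and> (\<forall>x\<in>l2. l2norm (T x) \<le> C * l2norm x)}"

definition operator_adjoint :: "'i operator \<Rightarrow> 'i operator" where
  "operator_adjoint T y = (if y \<in> l2 then (\<lambda>i. l2inner (T (l2unit i)) y) else (\<lambda>_. 0))"

definition l2_operators :: "'i operator cstar" where
  "l2_operators = \<lparr>carrier = bounded_operators, mult = (\<lambda>T S x. T (S x)),
     one = (\<lambda>x. if x \<in> l2 then x else (\<lambda>_. 0)), zero = (\<lambda>_ _. 0), add = (\<lambda>T S x i. T x i + S x i),
     smult = (\<lambda>c T x i. c * T x i), adj = operator_adjoint, cnorm = operator_norm\<rparr>"

lemma adjoint_pair_operator_adjoint: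
  assumes "adjoint_pair T S" shows "y \<in> l2 \<Longrightarrow> S y = operator_adjoint T y"
proof
  fix i assume y: "y \<in> l2"
  have "S y i = l2inner (l2unit i) (S y)" by (simp add: l2inner_unit)
  also have "\<dots> = l2inner (T (l2unit i)) y" using assms y l2unit_mem[of i] unfolding adjoint_pair_def by metis
  finally show "S y i = operator_adjoint T y i" using y by (simp add: operator_adjoint_def)
qed

lemma bounded_operators_adjoint_pair: "T \<in> bounded_operators \<Longrightarrow> adjoint_pair T (operator_adjoint T)"
proof -
  assume "T \<in> bounded_operators"
  then obtain S where S: "adjoint_pair T S" by (auto simp: bounded_operators_def)
  then show ?thesis using adjoint_pair_operator_adjoint[OF S] by (simp add: adjoint_pair_def)
qed

context
  fixes T :: "'i operator" assumes T: "T \<in> bounded_operators"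
begin

lemma op_l2: "x \<in> l2 \<Longrightarrow> T x \<in> l2" "x \<in> l2 \<Longrightarrow> operator_adjoint T x \<in> l2"
  and op_inner: "x \<in> l2 \<Longrightarrow> y \<in> l2 \<Longrightarrow> l2inner (T x) y = l2inner x (operator_adjoint T y)"
  using bounded_operators_adjoint_pair[OF T] by (auto simp: adjoint_pair_def)

lemma op_outside: "x \<notin> l2 \<Longrightarrow> T x = (\<lambda>_. 0)"
  using T by (auto simp: bounded_operators_def)

lemma op_coord: "x \<in> l2 \<Longrightarrow> T x i = l2inner (operator_adjoint T (l2unit i)) x"
  using op_inner[of x "l2unit i"] l2unit_mem[of i] l2inner_unit[of i "T x"] l2inner_cnj[of "T x" "l2unit i"]
    l2inner_cnj[of x "operator_adjoint T (l2unit i)"] by simp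

lemma op_add: "x \<in> l2 \<Longrightarrow> y \<in> l2 \<Longrightarrow> T (\<lambda>i. x i + y i) = (\<lambda>i. T x i + T y i)"
  by (rule ext) (simp add: op_coord l2_add l2inner_add_right op_l2 l2unit_mem)

lemma op_scale: "x \<in> l2 \<Longrightarrow> T (\<lambda>i. c * x i) = (\<lambda>i. c * T x i)"
  by (rule ext) (simp add: op_coord l2_scale l2inner_scale_right)

lemma op_zero: "T (\<lambda>_. 0) = (\<lambda>_. 0)"
  using op_scale[OF l2_zero(1), of 0] by simp

lemma op_norm_bound: assumes x: "x \<in> l2" shows "l2norm (T x) \<le> operator_norm T * l2norm x"
proof (cases "l2norm x = 0")
  case True
  then show ?thesis using l2norm_eq_0[OF x] op_zero l2_zero by simp
next
  case False
  then have pos: "0 < l2norm x" using l2norm_nonneg[of x] by linarith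
  obtain C where "0 \<le> C" "\<forall>x\<in>l2. l2norm (T x) \<le> C * l2norm x" using T by (auto simp: bounded_operators_def)
  then have "l2norm (T x) / l2norm x \<le> operator_norm T"
    unfolding operator_norm_def using x pos by (intro cInf_greatest) (auto simp: divide_le_eq)
  then show ?thesis using pos by (simp add: divide_le_eq)
qed

lemma op_norm_nonneg: "0 \<le> operator_norm T"
proof -
  obtain C where "0 \<le> C" "\<forall>x\<in>l2. l2norm (T x) \<le> C * l2norm x" using T by (auto simp: bounded_operators_def)
  then show ?thesis unfolding operator_norm_def by (intro cInf_greatest) auto
qed

end

lemma operator_norm_le:
  assumes "0 \<le> C" "\<And>x. x \<in> l2 \<Longrightarrow> l2norm (T x) \<le> C * l2norm x"
  shows "operator_norm T \<le> C"
  unfolding operator_norm_def using assms by (intro cInf_lower bdd_belowI[of _ 0]) auto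

lemma bounded_operatorsI:
  assumes "\<And>x. x \<notin> l2 \<Longrightarrow> T x = (\<lambda>_. 0)" "0 \<le> C" "\<And>x. x \<in> l2 \<Longrightarrow> l2norm (T x) \<le> C * l2norm x"
    "\<And>x. x \<in> l2 \<Longrightarrow> T x \<in> l2" "\<And>x. x \<in> l2 \<Longrightarrow> S x \<in> l2"
    "\<And>x y. x \<in> l2 \<Longrightarrow> y \<in> l2 \<Longrightarrow> l2inner (T x) y = l2inner x (S y)"
  shows "T \<in> bounded_operators" "operator_norm T \<le> C" "\<And>y. y \<in> l2 \<Longrightarrow> operator_adjoint T y = S y"
proof -
  have S: "adjoint_pair T S" using assms by (auto simp: adjoint_pair_def)
  then show "T \<in> bounded_operators" unfolding bounded_operators_def using assms by blast
  show "operator_norm T \<le> C" using assms by (intro operator_norm_le)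
  show "\<And>y. y \<in> l2 \<Longrightarrow> operator_adjoint T y = S y" using adjoint_pair_operator_adjoint[OF S] by simp
qed

lemma bounded_operators_eqI:
  assumes "T \<in> bounded_operators" "S \<in> bounded_operators" "\<And>x. x \<in> l2 \<Longrightarrow> T x = S x"
  shows "T = S"
proof
  fix x show "T x = S x"
    using assms(3) by (cases "x \<in> l2") (simp_all add: op_outside[OF assms(1)] op_outside[OF assms(2)])
qed

lemma operator_adjoint_outside: "y \<notin> l2 \<Longrightarrow> operator_adjoint T y = (\<lambda>_. 0)"
  by (simp add: operator_adjoint_def)

lemma op_adjoint:
  assumes T: "T \<in> bounded_operators"
  shows "operator_adjoint T \<in> bounded_operators" "operator_norm (operator_adjoint T) \<le> operator_norm T"
    "operator_adjoint (operator_adjoint T) = T"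
proof -
  let ?S = "operator_adjoint T"
  have le: "l2norm (?S y) \<le> operator_norm T * l2norm y" if y: "y \<in> l2" for y
  proof -
    have Sy: "?S y \<in> l2" by (rule op_l2[OF T y])
    have "(l2norm (?S y))\<^sup>2 = cmod (l2inner (?S y) (?S y))" using Sy by (simp add: l2inner_self norm_power)
    also have "\<dots> = cmod (l2inner (T (?S y)) y)" using op_inner[OF T Sy y] by simp
    also have "\<dots> \<le> l2norm (T (?S y)) * l2norm y" by (intro l2inner_abs_summable op_l2[OF T] Sy y)
    also have "\<dots> \<le> operator_norm T * l2norm (?S y) * l2norm y"
      by (intro mult_right_mono op_norm_bound[OF T] Sy) auto
    finally have "l2norm (?S y) * l2norm (?S y) \<le> (operator_norm T * l2norm y) * l2norm (?S y)"
      by (simp add: power2_eq_square mult_ac)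
    then show ?thesis using op_norm_nonneg[OF T] l2norm_nonneg[of "?S y"] l2norm_nonneg[of y]
      by (cases "l2norm (?S y) = 0") (auto simp: mult_le_cancel_right)
  qed
  have *: "l2inner (?S x) y = l2inner x (T y)" if "x \<in> l2" "y \<in> l2" for x y
    using op_inner[OF T that(2,1)] l2inner_cnj by metis
  note I = bounded_operatorsI[OF operator_adjoint_outside op_norm_nonneg[OF T] le op_l2(2)[OF T] op_l2(1)[OF T] *]
  show "?S \<in> bounded_operators" "operator_norm ?S \<le> operator_norm T" using I(1,2) by auto
  show "operator_adjoint ?S = T"
  proof
    fix x show "operator_adjoint ?S x = T x"
      using I(3)[of x] op_outside[OF T, of x] operator_adjoint_outside[of x ?S] by (cases "x \<in> l2") auto
  qed
qed

lemma op_mult: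
  assumes T: "T \<in> bounded_operators" and S: "S \<in> bounded_operators"
  shows "(\<lambda>x. T (S x)) \<in> bounded_operators" "operator_norm (\<lambda>x. T (S x)) \<le> operator_norm T * operator_norm S"
    "operator_adjoint (\<lambda>x. T (S x)) = (\<lambda>x. operator_adjoint S (operator_adjoint T x))"
proof -
  have out: "T (S x) = (\<lambda>_. 0)" if "x \<notin> l2" for x using op_outside[OF S that] op_zero[OF T] by simp
  have le: "l2norm (T (S x)) \<le> operator_norm T * operator_norm S * l2norm x" if x: "x \<in> l2" for x
  proof -
    have "l2norm (T (S x)) \<le> operator_norm T * l2norm (S x)" by (intro op_norm_bound[OF T] op_l2[OF S] x)
    also have "\<dots> \<le> operator_norm T * (operator_norm S * l2norm x)"
      by (intro mult_left_mono op_norm_bound[OF S] x op_norm_nonneg[OF T])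
    finally show ?thesis by (simp add: mult_ac)
  qed
  have inner: "l2inner (T (S x)) y = l2inner x (operator_adjoint S (operator_adjoint T y))" if "x \<in> l2" "y \<in> l2" for x y
    using that by (simp add: op_inner[OF T] op_inner[OF S] op_l2[OF S] op_l2[OF T])
  have nonneg: "0 \<le> operator_norm T * operator_norm S" using op_norm_nonneg T S by (intro mult_nonneg_nonneg)
  note I = bounded_operatorsI[OF out nonneg le _ _ inner]
  show "(\<lambda>x. T (S x)) \<in> bounded_operators" "operator_norm (\<lambda>x. T (S x)) \<le> operator_norm T * operator_norm S"
    using I(1,2) op_l2[OF T] op_l2[OF S] by auto
  show "operator_adjoint (\<lambda>x. T (S x)) = (\<lambda>x. operator_adjoint S (operator_adjoint T x))"
  proof
    fix x show "operator_adjoint (\<lambda>x. T (S x)) x = operator_adjoint S (operator_adjoint T x)"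
    proof (cases "x \<in> l2")
      case True
      then show ?thesis using I(3) op_l2[OF T] op_l2[OF S] by auto
    next
      case False
      then show ?thesis using op_zero[OF op_adjoint(1)[OF S]] by (simp add: operator_adjoint_outside)
    qed
  qed
qed

lemma op_plus:
  assumes T: "T \<in> bounded_operators" and S: "S \<in> bounded_operators"
  shows "(\<lambda>x i. T x i + S x i) \<in> bounded_operators" "operator_norm (\<lambda>x i. T x i + S x i) \<le> operator_norm T + operator_norm S"
    "operator_adjoint (\<lambda>x i. T x i + S x i) = (\<lambda>x i. operator_adjoint T x i + operator_adjoint S x i)"
proof -
  have out: "(\<lambda>i. T x i + S x i) = (\<lambda>_. 0)" if "x \<notin> l2" for x using op_outside[OF S that] op_outside[OF T that] by simp
  have le: "l2norm (\<lambda>i. T x i + S x i) \<le> (operator_norm T + operator_norm S) * l2norm x" if x: "x \<in> l2" for x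
    using l2_add(2)[OF op_l2(1)[OF T x] op_l2(1)[OF S x]] op_norm_bound[OF T x] op_norm_bound[OF S x]
    by (simp add: distrib_right)
  have inner: "l2inner (\<lambda>i. T x i + S x i) y = l2inner x (\<lambda>i. operator_adjoint T y i + operator_adjoint S y i)"
    if "x \<in> l2" "y \<in> l2" for x y
    using that by (simp add: l2inner_add_left l2inner_add_right op_inner[OF T] op_inner[OF S] op_l2[OF S] op_l2[OF T])
  have nonneg: "0 \<le> operator_norm T + operator_norm S" using op_norm_nonneg T S by (intro add_nonneg_nonneg)
  note I = bounded_operatorsI[OF out nonneg le _ _ inner]
  have l2: "(\<lambda>i. T x i + S x i) \<in> l2" "(\<lambda>i. operator_adjoint T x i + operator_adjoint S x i) \<in> l2" if "x \<in> l2" for x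
    using that by (auto intro!: l2_add op_l2[OF T] op_l2[OF S])
  show "(\<lambda>x i. T x i + S x i) \<in> bounded_operators" "operator_norm (\<lambda>x i. T x i + S x i) \<le> operator_norm T + operator_norm S"
    using I(1,2) l2 by auto
  show "operator_adjoint (\<lambda>x i. T x i + S x i) = (\<lambda>x i. operator_adjoint T x i + operator_adjoint S x i)"
  proof
    fix x show "operator_adjoint (\<lambda>x i. T x i + S x i) x = (\<lambda>i. operator_adjoint T x i + operator_adjoint S x i)"
      using I(3) l2 by (cases "x \<in> l2") (auto simp: operator_adjoint_outside)
  qed
qed

lemma op_scal:
  assumes T: "T \<in> bounded_operators"
  shows "(\<lambda>x i. c * T x i) \<in> bounded_operators" "operator_norm (\<lambda>x i. c * T x i) \<le> cmod c * operator_norm T"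
    "operator_adjoint (\<lambda>x i. c * T x i) = (\<lambda>x i. cnj c * operator_adjoint T x i)"
proof -
  have out: "(\<lambda>i. c * T x i) = (\<lambda>_. 0)" if "x \<notin> l2" for x using op_outside[OF T that] by simp
  have le: "l2norm (\<lambda>i. c * T x i) \<le> (cmod c * operator_norm T) * l2norm x" if x: "x \<in> l2" for x
    using l2_scale(2)[OF op_l2(1)[OF T x], of c] op_norm_bound[OF T x] by (simp add: mult.assoc mult_left_mono)
  have inner: "l2inner (\<lambda>i. c * T x i) y = l2inner x (\<lambda>i. cnj c * operator_adjoint T y i)"
    if "x \<in> l2" "y \<in> l2" for x y
    using that by (simp add: l2inner_scale_left l2inner_scale_right op_inner[OF T])
  have nonneg: "0 \<le> cmod c * operator_norm T" using op_norm_nonneg T by (intro mult_nonneg_nonneg) auto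
  note I = bounded_operatorsI[OF out nonneg le _ _ inner]
  have l2: "(\<lambda>i. c * T x i) \<in> l2" "(\<lambda>i. cnj c * operator_adjoint T x i) \<in> l2" if "x \<in> l2" for x
    using that by (auto intro!: l2_scale op_l2[OF T])
  show "(\<lambda>x i. c * T x i) \<in> bounded_operators" "operator_norm (\<lambda>x i. c * T x i) \<le> cmod c * operator_norm T"
    using I(1,2) l2 by auto
  show "operator_adjoint (\<lambda>x i. c * T x i) = (\<lambda>x i. cnj c * operator_adjoint T x i)"
  proof
    fix x show "operator_adjoint (\<lambda>x i. c * T x i) x = (\<lambda>i. cnj c * operator_adjoint T x i)"
      using I(3) l2 by (cases "x \<in> l2") (auto simp: operator_adjoint_outside)
  qed
qed

lemma op_norm_scal:
  assumes T: "T \<in> bounded_operators"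
  shows "operator_norm (\<lambda>x i. c * T x i) = cmod c * operator_norm T"
proof (cases "c = 0")
  case True
  then have "operator_norm (\<lambda>x i. c * T x i) = 0"
    using op_scal(2)[OF T, of 0] op_norm_nonneg[OF op_scal(1)[OF T, of 0]] by simp
  with True show ?thesis by simp
next
  case False
  have "operator_norm T = operator_norm (\<lambda>x i. inverse c * (c * T x i))" using False by (simp add: mult.assoc[symmetric])
  also have "\<dots> \<le> cmod (inverse c) * operator_norm (\<lambda>x i. c * T x i)" by (rule op_scal(2)[OF op_scal(1)[OF T]])
  finally have "operator_norm T \<le> inverse (cmod c) * operator_norm (\<lambda>x i. c * T x i)" by (simp add: norm_inverse)
  from mult_left_mono[OF this, of "cmod c"] have "cmod c * operator_norm T \<le> operator_norm (\<lambda>x i. c * T x i)"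
    using False by (simp add: mult.assoc[symmetric])
  with op_scal(2)[OF T, of c] show ?thesis by simp
qed

lemma op_zero_operator:
  "((\<lambda>_ _. 0) :: 'i operator) \<in> bounded_operators" "operator_norm ((\<lambda>_ _. 0) :: 'i operator) = 0"
proof -
  show *: "((\<lambda>_ _. 0) :: 'i operator) \<in> bounded_operators"
    by (rule bounded_operatorsI[where C = 0 and S = "\<lambda>_ _. 0"]) (auto simp: l2_zero l2inner_def)
  have "operator_norm ((\<lambda>_ _. 0) :: 'i operator) \<le> 0" by (rule operator_norm_le) (auto simp: l2_zero)
  with op_norm_nonneg[OF *] show "operator_norm ((\<lambda>_ _. 0) :: 'i operator) = 0" by simp
qed

lemma op_identity: "(\<lambda>x. if x \<in> l2 then x else (\<lambda>_. 0)) \<in> bounded_operators"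
  by (rule bounded_operatorsI[where C = 1 and S = "\<lambda>x. x"]) auto

lemma op_norm_eq_0: "T \<in> bounded_operators \<Longrightarrow> operator_norm T = 0 \<Longrightarrow> T = (\<lambda>_ _. 0)"
proof (rule bounded_operators_eqI)
  fix x assume T: "T \<in> bounded_operators" "operator_norm T = 0" and x: "(x :: 'a \<Rightarrow> complex) \<in> l2"
  then have "l2norm (T x) = 0" using op_norm_bound[OF T(1) x] l2norm_nonneg[of "T x"] by simp
  then show "T x = (\<lambda>_. 0)" by (intro l2norm_eq_0 op_l2[OF T(1)] x)
qed (auto simp: op_zero_operator)

lemma op_cstar_identity:
  assumes T: "T \<in> bounded_operators"
  shows "operator_norm (\<lambda>x. operator_adjoint T (T x)) = (operator_norm T)\<^sup>2"
proof (rule antisym)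
  let ?P = "\<lambda>x. operator_adjoint T (T x)"
  have P: "?P \<in> bounded_operators" by (rule op_mult(1)[OF op_adjoint(1)[OF T] T])
  have "operator_norm ?P \<le> operator_norm (operator_adjoint T) * operator_norm T" by (rule op_mult(2)[OF op_adjoint(1)[OF T] T])
  also have "\<dots> \<le> operator_norm T * operator_norm T" by (intro mult_right_mono op_adjoint(2) op_norm_nonneg T)
  finally show "operator_norm ?P \<le> (operator_norm T)\<^sup>2" by (simp add: power2_eq_square)
  have "operator_norm T \<le> sqrt (operator_norm ?P)"
  proof (rule operator_norm_le)
    fix x :: "'a \<Rightarrow> complex" assume x: "x \<in> l2"
    have "(l2norm (T x))\<^sup>2 = cmod (l2inner (T x) (T x))" using op_l2(1)[OF T x] by (simp add: l2inner_self norm_power)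
    also have "\<dots> = cmod (l2inner x (?P x))" using op_inner[OF T x op_l2(1)[OF T x]] by simp
    also have "\<dots> \<le> l2norm x * l2norm (?P x)" by (intro l2inner_abs_summable op_l2[OF P] x)
    also have "\<dots> \<le> l2norm x * (operator_norm ?P * l2norm x)" by (intro mult_left_mono op_norm_bound[OF P] x) auto
    also have "\<dots> = (sqrt (operator_norm ?P) * l2norm x)\<^sup>2"
      using op_norm_nonneg[OF P] by (simp add: power_mult_distrib power2_eq_square mult_ac)
    finally show "l2norm (T x) \<le> sqrt (operator_norm ?P) * l2norm x"
      by (rule power2_le_imp_le) (simp add: op_norm_nonneg[OF P])
  qed (simp add: op_norm_nonneg[OF P])
  then have "(operator_norm T)\<^sup>2 \<le> (sqrt (operator_norm ?P))\<^sup>2" by (intro power_mono op_norm_nonneg T)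
  then show "(operator_norm T)\<^sup>2 \<le> operator_norm ?P" using op_norm_nonneg[OF P] by simp
qed

lemma op_diff:
  assumes "T \<in> bounded_operators" "S \<in> bounded_operators"
  shows "(\<lambda>x i. T x i - S x i) \<in> bounded_operators"
  using op_plus(1)[OF assms(1) op_scal(1)[OF assms(2), of "-1"]] by simp

text \<open>
  A Cauchy sequence converges pointwise on \<open>\<ell>\<^sup>2\<close> together with the sequence of its adjoints,
  at a rate that is uniform on the unit ball, and the two limits are adjoint to each other.
\<close>

lemma op_complete:
  fixes X :: "nat \<Rightarrow> 'i operator"
  assumes X: "\<And>n. X n \<in> bounded_operators"
    and cauchy: "\<And>e. e > 0 \<Longrightarrow> \<exists>N. \<forall>m\<ge>N. \<forall>n\<ge>N. operator_norm (\<lambda>x i. X m x i - X n x i) < e"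
  shows "\<exists>T\<in>bounded_operators. (\<lambda>n. operator_norm (\<lambda>x i. X n x i - T x i)) \<longlonglongrightarrow> 0"
proof -
  define T where "T = (\<lambda>x. if x \<in> l2 then (\<lambda>i. lim (\<lambda>n. X n x i)) else (\<lambda>_. 0))"
  define S where "S = (\<lambda>x. if x \<in> l2 then (\<lambda>i. lim (\<lambda>n. operator_adjoint (X n) x i)) else (\<lambda>_. 0))"
  have est: "l2norm (\<lambda>i. Y m x i - Y n x i) \<le> operator_norm (\<lambda>x i. Y m x i - Y n x i) * l2norm x"
    if "x \<in> l2" "\<And>n. Y n \<in> bounded_operators" for x m n and Y :: "nat \<Rightarrow> 'i operator"
    using op_norm_bound[OF op_diff[OF that(2)[of m] that(2)[of n]] that(1)] by simp
  \<comment> \<open>The same estimate is needed for the operators and for their adjoints.\<close>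
  have lim: "(\<lambda>n. Y n x i) \<longlonglongrightarrow> lim (\<lambda>n. Y n x i) \<and> (\<lambda>i. lim (\<lambda>n. Y n x i)) \<in> l2 \<and>
      (\<forall>e>0. \<exists>N. \<forall>n\<ge>N. \<forall>x\<in>l2. l2norm (\<lambda>i. Y n x i - lim (\<lambda>n. Y n x i)) \<le> e * l2norm x)"
    if x: "x \<in> l2" and Y: "\<And>n. Y n \<in> bounded_operators"
      and c: "\<And>e. e > 0 \<Longrightarrow> \<exists>N. \<forall>m\<ge>N. \<forall>n\<ge>N. operator_norm (\<lambda>x i. Y m x i - Y n x i) < e"
    for Y :: "nat \<Rightarrow> 'i operator" and x i
  proof -
    have conv: "(\<lambda>n. Y n x i) \<longlonglongrightarrow> lim (\<lambda>n. Y n x i)" if x: "x \<in> l2" for x i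
    proof -
      have "Cauchy (\<lambda>n. Y n x i)"
      proof (rule CauchyI)
        fix e :: real assume e: "0 < e"
        define d where "d = e / (l2norm x + 1)"
        have d: "0 < d" using e l2norm_nonneg[of x] by (auto simp: d_def intro!: divide_pos_pos add_nonneg_pos)
        then obtain N where N: "\<forall>m\<ge>N. \<forall>n\<ge>N. operator_norm (\<lambda>x i. Y m x i - Y n x i) < d" using c by blast
        have "norm (Y m x i - Y n x i) < e" if "m \<ge> N" "n \<ge> N" for m n
        proof -
          have "norm (Y m x i - Y n x i) \<le> l2norm (\<lambda>i. Y m x i - Y n x i)"
            using cmod_le_l2norm[OF l2_diff[OF op_l2(1)[OF Y x] op_l2(1)[OF Y x]]] .
          also have "\<dots> \<le> operator_norm (\<lambda>x i. Y m x i - Y n x i) * l2norm x" by (rule est[OF x Y])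
          also have "\<dots> \<le> d * l2norm x" using N that by (intro mult_right_mono) (auto simp: less_imp_le)
          also have "\<dots> < d * (l2norm x + 1)" using d by simp
          also have "\<dots> = e" using l2norm_nonneg[of x] by (simp add: d_def add_nonneg_eq_0_iff)
          finally show ?thesis .
        qed
        then show "\<exists>M. \<forall>m\<ge>M. \<forall>n\<ge>M. norm (Y m x i - Y n x i) < e" by blast
      qed
      then show ?thesis by (simp add: Cauchy_convergent_iff convergent_LIMSEQ_iff)
    qed
    have unif: "\<exists>N. \<forall>n\<ge>N. \<forall>x\<in>l2. (\<lambda>i. Y n x i - lim (\<lambda>n. Y n x i)) \<in> l2 \<and>
        l2norm (\<lambda>i. Y n x i - lim (\<lambda>n. Y n x i)) \<le> e * l2norm x" if e: "e > 0" for e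
    proof -
      obtain N where N: "\<forall>m\<ge>N. \<forall>n\<ge>N. operator_norm (\<lambda>x i. Y m x i - Y n x i) < e" using c[OF e] by blast
      have "(\<lambda>i. Y n x i - lim (\<lambda>n. Y n x i)) \<in> l2 \<and> l2norm (\<lambda>i. Y n x i - lim (\<lambda>n. Y n x i)) \<le> e * l2norm x"
        if n: "n \<ge> N" and x: "x \<in> l2" for n x
      proof -
        have 1: "(\<lambda>i. Y n x i - Y m x i) \<in> l2" for m by (intro l2_diff op_l2[OF Y] x)
        have 2: "(\<lambda>m. Y n x i - Y m x i) \<longlonglongrightarrow> Y n x i - lim (\<lambda>n. Y n x i)" for i
          by (intro tendsto_intros conv x)
        have 3: "l2norm (\<lambda>i. Y n x i - Y m x i) \<le> e * l2norm x" if "m \<ge> N" for m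
        proof -
          have "l2norm (\<lambda>i. Y n x i - Y m x i) \<le> operator_norm (\<lambda>x i. Y n x i - Y m x i) * l2norm x" by (rule est[OF x Y])
          also have "\<dots> \<le> e * l2norm x" using N that n by (intro mult_right_mono) (auto simp: less_imp_le)
          finally show ?thesis .
        qed
        show ?thesis using l2_pointwise_limit[where X = "\<lambda>m i. Y n x i - Y m x i", OF 1 2 3] by blast
      qed
      then show ?thesis by blast
    qed
    obtain N where N: "\<forall>n\<ge>N. \<forall>x\<in>l2. (\<lambda>i. Y n x i - lim (\<lambda>n. Y n x i)) \<in> l2" using unif[of 1] by auto
    have "(\<lambda>i. Y N x i - (Y N x i - lim (\<lambda>n. Y n x i))) \<in> l2" by (rule l2_diff[OF op_l2(1)[OF Y x]]) (use N x in auto)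
    then have "(\<lambda>i. lim (\<lambda>n. Y n x i)) \<in> l2" by simp
    then show ?thesis using conv[OF x] unif by blast
  qed
  have Sc: "\<exists>N. \<forall>m\<ge>N. \<forall>n\<ge>N. operator_norm (\<lambda>x i. operator_adjoint (X m) x i - operator_adjoint (X n) x i) < e"
    if "e > 0" for e
  proof -
    have "operator_norm (\<lambda>x i. operator_adjoint (X m) x i - operator_adjoint (X n) x i)
        \<le> operator_norm (\<lambda>x i. X m x i - X n x i)" for m n
      using op_adjoint(2)[OF op_diff[OF X X, of m n]] op_plus(3)[OF X op_scal(1)[OF X, of "-1"], of m n]
        op_scal(3)[OF X, of "-1" n] by simp
    then show ?thesis using cauchy[OF that] by (meson le_less_trans)
  qed
  note limX = lim[OF _ X cauchy] and limS = lim[OF _ op_adjoint(1)[OF X] Sc]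
  have Tl2: "T x \<in> l2" "S x \<in> l2" if "x \<in> l2" for x using limX[OF that] limS[OF that] that by (auto simp: T_def S_def)
  have T_close: "\<exists>N. \<forall>n\<ge>N. \<forall>x\<in>l2. l2norm (\<lambda>i. X n x i - T x i) \<le> e * l2norm x" if "e > 0" for e
    using limX[OF l2_zero(1)] that by (simp add: T_def cong: ball_cong)
  have S_close: "\<exists>N. \<forall>n\<ge>N. \<forall>x\<in>l2. l2norm (\<lambda>i. operator_adjoint (X n) x i - S x i) \<le> e * l2norm x" if "e > 0" for e
    using limS[OF l2_zero(1)] that by (simp add: S_def cong: ball_cong)
  have inner_lim: "(\<lambda>n. l2inner x (Y n)) \<longlonglongrightarrow> l2inner x y"
    if x0: "x \<in> l2" and y0: "y \<in> l2" and Y0: "\<And>n. Y n \<in> l2" and cl: "\<And>e. e > 0 \<Longrightarrow> \<exists>N. \<forall>n\<ge>N. l2norm (\<lambda>i. Y n i - y i) \<le> e"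
    for x y :: "'i \<Rightarrow> complex" and Y
  proof (rule LIMSEQ_I)
    fix e :: real assume e: "0 < e"
    define d where "d = e / (l2norm x + 1)"
    have d: "0 < d" using e l2norm_nonneg[of x] by (auto simp: d_def intro!: divide_pos_pos add_nonneg_pos)
    then obtain N where N: "\<forall>n\<ge>N. l2norm (\<lambda>i. Y n i - y i) \<le> d" using cl by blast
    have "norm (l2inner x (Y n) - l2inner x y) < e" if n: "n \<ge> N" for n
    proof -
      have "l2inner x (Y n) - l2inner x y = l2inner x (\<lambda>i. Y n i - y i)"
        using l2inner_add_right[OF x0 Y0[of n] l2_scale(1)[OF y0, of "-1"]]
          l2inner_scale_right[of x "-1" y] by simp
      then have "norm (l2inner x (Y n) - l2inner x y) \<le> l2norm x * l2norm (\<lambda>i. Y n i - y i)"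
        using l2inner_abs_summable(2)[OF x0 l2_diff[OF Y0 y0]] by simp
      also have "\<dots> \<le> l2norm x * d" using N n by (intro mult_left_mono) auto
      also have "\<dots> < (l2norm x + 1) * d" using d by simp
      also have "\<dots> = e" using l2norm_nonneg[of x] by (simp add: d_def add_nonneg_eq_0_iff)
      finally show ?thesis .
    qed
    then show "\<exists>N. \<forall>n\<ge>N. norm (l2inner x (Y n) - l2inner x y) < e" by blast
  qed
  have scaled: "\<exists>N. \<forall>n\<ge>N. l2norm (\<lambda>i. Y n x i - y x i) \<le> e"
    if x0: "x \<in> l2" and e0: "e > 0" and cl: "\<And>e. e > 0 \<Longrightarrow> \<exists>N. \<forall>n\<ge>N. \<forall>x\<in>l2. l2norm (\<lambda>i. Y n x i - y x i) \<le> e * l2norm x"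
    for e x and Y :: "nat \<Rightarrow> 'i operator" and y
  proof -
    have p: "0 < l2norm x + 1" using l2norm_nonneg[of x] by linarith
    then have "0 < e / (l2norm x + 1)" using e0 by simp
    then obtain N where N: "\<forall>n\<ge>N. \<forall>x'\<in>l2. l2norm (\<lambda>i. Y n x' i - y x' i) \<le> e / (l2norm x + 1) * l2norm x'"
      using cl by blast
    have "e / (l2norm x + 1) * l2norm x \<le> e" using p e0 by (simp add: field_simps)
    then show ?thesis using N x0 order_trans by blast
  qed
  have pair: "l2inner (T x) y = l2inner x (S y)" if x: "x \<in> l2" and y: "y \<in> l2" for x y
  proof -
    have "(\<lambda>n. l2inner x (operator_adjoint (X n) y)) \<longlonglongrightarrow> l2inner x (S y)"
      by (intro inner_lim x Tl2 y op_l2[OF X] scaled[OF y _ S_close])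
    moreover have "(\<lambda>n. cnj (l2inner y (X n x))) \<longlonglongrightarrow> cnj (l2inner y (T x))"
      by (intro tendsto_cnj inner_lim x Tl2 y op_l2[OF X] scaled[OF x _ T_close])
    then have "(\<lambda>n. l2inner x (operator_adjoint (X n) y)) \<longlonglongrightarrow> l2inner (T x) y"
      using op_inner[OF X x y] by (simp only: l2inner_cnj[of _ y, symmetric])
    ultimately show ?thesis by (rule LIMSEQ_unique[rotated])
  qed
  obtain N where N: "\<forall>n\<ge>N. \<forall>x\<in>l2. l2norm (\<lambda>i. X n x i - T x i) \<le> 1 * l2norm x" using T_close[of 1] by auto
  have bound: "l2norm (T x) \<le> (operator_norm (X N) + 1) * l2norm x" if x: "x \<in> l2" for x
  proof -
    have "l2norm (\<lambda>i. X N x i + (-1) * (X N x i - T x i)) \<le> l2norm (X N x) + l2norm (\<lambda>i. (-1) * (X N x i - T x i))"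
      using x by (intro l2_add(2) l2_scale l2_diff op_l2[OF X] Tl2)
    also have "l2norm (\<lambda>i. (-1) * (X N x i - T x i)) = l2norm (\<lambda>i. X N x i - T x i)"
      using l2_scale(2)[OF l2_diff[OF op_l2(1)[OF X x] Tl2(1)[OF x]], of "-1"] by simp
    also have "l2norm (X N x) + l2norm (\<lambda>i. X N x i - T x i) \<le> operator_norm (X N) * l2norm x + 1 * l2norm x"
      using N x by (intro add_mono op_norm_bound[OF X]) auto
    finally show ?thesis by (simp add: distrib_right)
  qed
  have T: "T \<in> bounded_operators"
    by (rule bounded_operatorsI(1)[OF _ _ bound Tl2(1) Tl2(2) pair]) (auto simp: T_def op_norm_nonneg[OF X])
  have "(\<lambda>n. operator_norm (\<lambda>x i. X n x i - T x i)) \<longlonglongrightarrow> 0"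
  proof (rule LIMSEQ_I)
    fix e :: real assume e: "0 < e"
    obtain N where N: "\<forall>n\<ge>N. \<forall>x\<in>l2. l2norm (\<lambda>i. X n x i - T x i) \<le> (e / 2) * l2norm x" using T_close[of "e / 2"] e by auto
    have "norm (operator_norm (\<lambda>x i. X n x i - T x i) - 0) < e" if "n \<ge> N" for n
      using operator_norm_le[of "e / 2" "\<lambda>x i. X n x i - T x i"] N that e op_norm_nonneg[OF op_diff[OF X T]] by simp
    then show "\<exists>N. \<forall>n\<ge>N. norm (operator_norm (\<lambda>x i. X n x i - T x i) - 0) < e" by blast
  qed
  with T show ?thesis by blast
qed

lemma l2_operators_simps [simp]:
  "carrier l2_operators = bounded_operators" "T \<otimes>\<^bsub>l2_operators\<^esub> S = (\<lambda>x. T (S x))"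
  "\<one>\<^bsub>l2_operators\<^esub> = (\<lambda>x. if x \<in> l2 then x else (\<lambda>_. 0))" "\<zero>\<^bsub>l2_operators\<^esub> = (\<lambda>_ _. 0)"
  "T \<oplus>\<^bsub>l2_operators\<^esub> S = (\<lambda>x i. T x i + S x i)" "c \<odot>\<^bsub>l2_operators\<^esub> T = (\<lambda>x i. c * T x i)"
  "adj l2_operators = operator_adjoint" "cnorm l2_operators = operator_norm"
  by (simp_all add: l2_operators_def)

lemma ring_l2_operators: "ring (l2_operators :: 'i operator cstar)"
proof (rule ringI)
  show "abelian_group (l2_operators :: 'i operator cstar)"
  proof (rule abelian_groupI)
    fix T :: "'i operator" assume T: "T \<in> carrier l2_operators"
    then show "\<exists>S\<in>carrier l2_operators. S \<oplus>\<^bsub>l2_operators\<^esub> T = \<zero>\<^bsub>l2_operators\<^esub>"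
      using op_scal(1)[of T "-1"] by (intro bexI[of _ "\<lambda>x i. (-1) * T x i"]) auto
  qed (auto simp: op_plus op_zero_operator add_ac)
  show "Group.monoid (l2_operators :: 'i operator cstar)"
  proof (rule monoidI)
    fix T :: "'i operator" assume T: "T \<in> carrier l2_operators"
    then have "T x \<in> l2" for x by (cases "x \<in> l2") (auto simp: op_l2 op_outside l2_zero)
    then show "\<one>\<^bsub>l2_operators\<^esub> \<otimes>\<^bsub>l2_operators\<^esub> T = T" by simp
    show "T \<otimes>\<^bsub>l2_operators\<^esub> \<one>\<^bsub>l2_operators\<^esub> = T"
      using T by (auto simp: fun_eq_iff op_zero op_outside)
  qed (auto simp: op_mult op_identity)
  fix T S R :: "'i operator" assume *: "T \<in> carrier l2_operators" "S \<in> carrier l2_operators" "R \<in> carrier l2_operators"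
  show "(T \<oplus>\<^bsub>l2_operators\<^esub> S) \<otimes>\<^bsub>l2_operators\<^esub> R = T \<otimes>\<^bsub>l2_operators\<^esub> R \<oplus>\<^bsub>l2_operators\<^esub> S \<otimes>\<^bsub>l2_operators\<^esub> R" by simp
  show "R \<otimes>\<^bsub>l2_operators\<^esub> (T \<oplus>\<^bsub>l2_operators\<^esub> S) = R \<otimes>\<^bsub>l2_operators\<^esub> T \<oplus>\<^bsub>l2_operators\<^esub> R \<otimes>\<^bsub>l2_operators\<^esub> S"
  proof
    fix x show "(R \<otimes>\<^bsub>l2_operators\<^esub> (T \<oplus>\<^bsub>l2_operators\<^esub> S)) x = (R \<otimes>\<^bsub>l2_operators\<^esub> T \<oplus>\<^bsub>l2_operators\<^esub> R \<otimes>\<^bsub>l2_operators\<^esub> S) x"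
      using * by (cases "x \<in> l2") (auto simp: op_add op_l2 op_outside op_zero)
  qed
qed

theorem cstar_algebra_l2_operators: "cstar_algebra (l2_operators :: 'i operator cstar)"
proof -
  interpret ring "l2_operators :: 'i operator cstar" by (rule ring_l2_operators)
  have minus: "T \<ominus>\<^bsub>l2_operators\<^esub> S = (\<lambda>x i. T x i - S x i)"
    if S: "S \<in> bounded_operators" for T S :: "'i operator"
  proof -
    have "\<ominus>\<^bsub>l2_operators\<^esub> S = (\<lambda>x i. (-1) * S x i)"
      using S op_scal(1)[OF S, of "-1"] by (intro minus_equality) auto
    then show ?thesis by (simp add: a_minus_def)
  qed
  show ?thesis
  proof (unfold_locales)
    fix T :: "'i operator" and c :: complex assume T: "T \<in> carrier l2_operators"
    fix S :: "'i operator" assume S: "S \<in> carrier l2_operators"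
    show "T \<otimes>\<^bsub>l2_operators\<^esub> (c \<odot>\<^bsub>l2_operators\<^esub> S) = c \<odot>\<^bsub>l2_operators\<^esub> (T \<otimes>\<^bsub>l2_operators\<^esub> S)"
    proof
      fix x show "(T \<otimes>\<^bsub>l2_operators\<^esub> (c \<odot>\<^bsub>l2_operators\<^esub> S)) x = (c \<odot>\<^bsub>l2_operators\<^esub> (T \<otimes>\<^bsub>l2_operators\<^esub> S)) x"
        using T S by (cases "x \<in> l2") (auto simp: op_scale op_l2 op_outside op_zero)
    qed
  next
    fix X :: "nat \<Rightarrow> 'i operator"
    assume X: "\<And>n. X n \<in> carrier l2_operators"
      and c: "\<And>e. e > 0 \<Longrightarrow> \<exists>N. \<forall>m\<ge>N. \<forall>n\<ge>N. cnorm l2_operators (X m \<ominus>\<^bsub>l2_operators\<^esub> X n) < e"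
    have X': "\<And>n. X n \<in> bounded_operators" using X by simp
    have "\<exists>T\<in>bounded_operators. (\<lambda>n. operator_norm (\<lambda>x i. X n x i - T x i)) \<longlonglongrightarrow> 0"
      using c unfolding minus[OF X'] by (intro op_complete X') simp
    then obtain T where "T \<in> bounded_operators" "(\<lambda>n. operator_norm (\<lambda>x i. X n x i - T x i)) \<longlonglongrightarrow> 0" by blast
    then show "\<exists>x\<in>carrier l2_operators. (\<lambda>n. cnorm l2_operators (X n \<ominus>\<^bsub>l2_operators\<^esub> x)) \<longlonglongrightarrow> 0"
      by (intro bexI[of _ T]) (simp_all add: minus)
  qed (auto simp: op_scal op_adjoint op_plus op_mult op_norm_nonneg op_norm_scal op_cstar_identity op_zero_operator
        op_norm_eq_0 distrib_left distrib_right mult.assoc)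
qed


section \<open>Partial permutations as operators\<close>

definition inverse_maps :: "('i \<Rightarrow> 'i option) \<Rightarrow> ('i \<Rightarrow> 'i option) \<Rightarrow> bool" where
  "inverse_maps f g \<longleftrightarrow> (\<forall>i j. f i = Some j \<longleftrightarrow> g j = Some i)"

definition shift_operator :: "('i \<Rightarrow> 'i option) \<Rightarrow> 'i operator" where
  "shift_operator f x = (if x \<in> l2 then (\<lambda>i. case f i of None \<Rightarrow> 0 | Some j \<Rightarrow> x j) else (\<lambda>_. 0))"

lemma inverse_maps_sym: "inverse_maps f g \<Longrightarrow> inverse_maps g f"
  by (auto simp: inverse_maps_def)

lemma shift_operator_l2:
  assumes "inverse_maps f g" "x \<in> l2"
  shows "shift_operator f x \<in> l2" "l2norm (shift_operator f x) \<le> l2norm x"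
proof -
  have "L2_set (\<lambda>i. cmod (shift_operator f x i)) F \<le> l2norm x" if F: "finite F" for F
  proof -
    let ?G = "{i \<in> F. f i \<noteq> None}"
    have inj: "inj_on (\<lambda>i. the (f i)) ?G"
    proof (rule inj_onI)
      fix i j assume "i \<in> ?G" "j \<in> ?G" "the (f i) = the (f j)"
      then obtain k where "f i = Some k" "f j = Some k" by auto
      then show "i = j" using assms(1) by (simp add: inverse_maps_def)
    qed
    have "(\<Sum>i\<in>F. (cmod (shift_operator f x i))\<^sup>2) = (\<Sum>i\<in>?G. (cmod (x (the (f i))))\<^sup>2)"
      using F assms(2) by (intro sum.mono_neutral_cong_right) (auto simp: shift_operator_def split: option.splits)
    also have "\<dots> = (\<Sum>k\<in>(\<lambda>i. the (f i)) ` ?G. (cmod (x k))\<^sup>2)" by (subst sum.reindex[OF inj]) simp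
    finally have "L2_set (\<lambda>i. cmod (shift_operator f x i)) F = L2_set (\<lambda>i. cmod (x i)) ((\<lambda>i. the (f i)) ` ?G)"
      by (simp add: L2_set_def)
    then show ?thesis using L2_set_le_l2norm[OF assms(2)] F by simp
  qed
  then show "shift_operator f x \<in> l2" "l2norm (shift_operator f x) \<le> l2norm x" by (auto intro: l2I)
qed

lemma shift_operator_bounded:
  assumes fg: "inverse_maps f g"
  shows "shift_operator f \<in> bounded_operators" "operator_adjoint (shift_operator f) = shift_operator g"
proof -
  have inner: "l2inner (shift_operator f x) y = l2inner x (shift_operator g y)" if x: "x \<in> l2" and y: "y \<in> l2" for x y
  proof -
    let ?D = "{i. f i \<noteq> None}" and ?R = "{j. g j \<noteq> None}"
    have bij: "bij_betw (\<lambda>i. the (f i)) ?D ?R"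
      using fg unfolding inverse_maps_def
      by (intro bij_betw_byWitness[where f' = "\<lambda>j. the (g j)"]) (auto; metis option.sel option.simps(3))+
    have "l2inner (shift_operator f x) y = (\<Sum>\<^sub>\<infinity>i\<in>?D. cnj (x (the (f i))) * y (the (g (the (f i)))))"
      unfolding l2inner_def
    proof (rule infsum_cong_neutral)
      fix i assume "i \<in> UNIV \<inter> ?D"
      then obtain j where j: "f i = Some j" by auto
      moreover have "g j = Some i" using fg j by (simp add: inverse_maps_def)
      ultimately show "cnj (shift_operator f x i) * y i = cnj (x (the (f i))) * y (the (g (the (f i))))"
        using x by (simp add: shift_operator_def)
    qed (use x in \<open>auto simp: shift_operator_def\<close>)
    also have "\<dots> = (\<Sum>\<^sub>\<infinity>j\<in>?R. cnj (x j) * y (the (g j)))"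
      by (rule infsum_reindex_bij_betw[OF bij, of "\<lambda>j. cnj (x j) * y (the (g j))"])
    also have "\<dots> = l2inner x (shift_operator g y)"
      unfolding l2inner_def using y
      by (intro infsum_cong_neutral) (auto simp: shift_operator_def split: option.splits)
    finally show ?thesis .
  qed
  have bound: "l2norm (shift_operator f x) \<le> 1 * l2norm x" if "x \<in> l2" for x
    using shift_operator_l2(2)[OF fg that] by simp
  have out: "shift_operator f x = (\<lambda>_. 0)" if "x \<notin> l2" for x using that by (simp add: shift_operator_def)
  note I = bounded_operatorsI[OF out zero_le_one bound shift_operator_l2(1)[OF fg]
      shift_operator_l2(1)[OF inverse_maps_sym[OF fg]] inner]
  show "shift_operator f \<in> bounded_operators" by (rule I(1))
  have "operator_adjoint (shift_operator f) y = shift_operator g y" if "y \<in> l2" for y by (rule I(3)) (use that in auto)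
  then show "operator_adjoint (shift_operator f) = shift_operator g"
    by (intro ext) (metis operator_adjoint_outside shift_operator_def)
qed

lemma shift_operator_mult:
  assumes "inverse_maps g g'"
  shows "shift_operator f \<otimes>\<^bsub>l2_operators\<^esub> shift_operator g = shift_operator (\<lambda>i. Option.bind (f i) g)"
proof
  fix x show "(shift_operator f \<otimes>\<^bsub>l2_operators\<^esub> shift_operator g) x = shift_operator (\<lambda>i. Option.bind (f i) g) x"
  proof (cases "x \<in> l2")
    case True
    then have 1: "(\<lambda>i. case g i of None \<Rightarrow> 0 | Some j \<Rightarrow> x j) \<in> l2"
      using shift_operator_l2(1)[OF assms True] by (simp add: shift_operator_def)
    show ?thesis
    proof
      fix i show "(shift_operator f \<otimes>\<^bsub>l2_operators\<^esub> shift_operator g) x i = shift_operator (\<lambda>i. Option.bind (f i) g) x i"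
        using True 1 by (cases "f i") (simp_all add: shift_operator_def)
    qed
  qed (auto simp: shift_operator_def l2_zero fun_eq_iff split: option.splits)
qed


section \<open>Relations in the Toeplitz algebra\<close>

lemma paths_Nil [simp]: "(v, []) \<in> paths E \<longleftrightarrow> v \<in> verts E"
  by (auto simp: paths_def)

lemma paths_Cons: "(v, e # es) \<in> paths E \<longleftrightarrow> e \<in> arcs E \<and> head E e = v \<and> (tail E e, es) \<in> paths E"
  by (auto simp: paths_def)

lemma path_source_Nil [simp]: "path_source E (v, []) = v"
  by (simp add: path_source_def)

lemma path_source_Cons [simp]: "path_source E (v, e # es) = path_source E (tail E e, es)"
  by (simp add: path_source_def)

lemma path_source_snoc [simp]: "path_source E (v, es @ [e]) = tail E e"
  by (simp add: path_source_def)

lemma path_length_simps [simp]: "path_length (v, es) = length es"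
  by (simp add: path_length_def)

lemma path_source_in_verts: "(v, es) \<in> paths E \<Longrightarrow> path_source E (v, es) \<in> verts E"
  by (induction es arbitrary: v) (auto simp: paths_Cons)

lemma paths_snoc:
  assumes "fin_digraph E" "e \<in> arcs E"
  shows "(v, es @ [e]) \<in> paths E \<longleftrightarrow> (v, es) \<in> paths E \<and> path_source E (v, es) = head E e"
proof -
  interpret fin_digraph E by fact
  show ?thesis using assms(2) by (induction es arbitrary: v) (auto simp: paths_Cons)
qed

lemma path_fst_in_verts:
  assumes "fin_digraph E" "\<mu> \<in> paths E" shows "fst \<mu> \<in> verts E"
proof -
  interpret fin_digraph E by fact
  show ?thesis using assms(2) by (cases \<mu>; cases "snd \<mu>") (auto simp: paths_Cons)
qed

locale toeplitz = cstar_algebra A for A :: "'a cstar" (structure) +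
  fixes E :: "('v, 'e) pre_digraph" and p :: "'v \<Rightarrow> 'a" and s :: "'e \<Rightarrow> 'a"
  assumes fin_digraph: "fin_digraph E"
    and family: "toeplitz_family E A p s"
    and generated: "\<And>S. cstar_subalgebra A S \<Longrightarrow> p ` verts E \<union> s ` arcs E \<subseteq> S \<Longrightarrow> S = carrier A"
begin

sublocale E: fin_digraph E by (rule fin_digraph)

abbreviation "pe \<equiv> path_elem A p s"
abbreviation "src \<equiv> path_source E"

lemmas family_conjs = family[unfolded toeplitz_family_def]

lemma p_facts:
  assumes "v \<in> verts E"
  shows "p v \<in> carrier A" "p v \<otimes> p v = p v" "adj A (p v) = p v" "is_projection A (p v)"
  using bspec[OF family_conjs[THEN conjunct1] assms] by (simp_all add: is_projection_def)

lemma p_orthogonal: "v \<in> verts E \<Longrightarrow> w \<in> verts E \<Longrightarrow> v \<noteq> w \<Longrightarrow> p v \<otimes> p w = \<zero>"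
  using family_conjs[THEN conjunct2, THEN conjunct1] by simp

lemma s_partial_isometry: "e \<in> arcs E \<Longrightarrow> is_partial_isometry A (s e)"
  using family_conjs[THEN conjunct2, THEN conjunct2, THEN conjunct1] by simp

lemma s_carrier [simp]: "e \<in> arcs E \<Longrightarrow> s e \<in> carrier A"
  and s_isometry: "e \<in> arcs E \<Longrightarrow> s e \<otimes> adj A (s e) \<otimes> s e = s e"
  using s_partial_isometry by (simp_all add: is_partial_isometry_def)

lemma s_star_s: "e \<in> arcs E \<Longrightarrow> adj A (s e) \<otimes> s e = p (tail E e)"
  using family_conjs[THEN conjunct2, THEN conjunct2, THEN conjunct2, THEN conjunct1] by simp

lemma range_sum_le: "v \<in> verts E \<Longrightarrow> cstar_le A (\<Oplus>e\<in>edges_into E v. s e \<otimes> adj A (s e)) (p v)"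
  using family_conjs[THEN conjunct2, THEN conjunct2, THEN conjunct2, THEN conjunct2] by simp

lemma range_projection:
  assumes e: "e \<in> arcs E" shows "is_projection A (s e \<otimes> adj A (s e))"
proof -
  have "(s e \<otimes> adj A (s e)) \<otimes> (s e \<otimes> adj A (s e)) = (s e \<otimes> adj A (s e) \<otimes> s e) \<otimes> adj A (s e)"
    using e by (simp add: m_assoc)
  also have "\<dots> = s e \<otimes> adj A (s e)" by (simp add: s_isometry e)
  finally show ?thesis using e by (simp add: is_projection_def star_mult)
qed

lemma range_projections_below:
  assumes v: "v \<in> verts E"
  shows "e \<in> arcs E \<Longrightarrow> head E e = v \<Longrightarrow> p v \<otimes> (s e \<otimes> adj A (s e)) = s e \<otimes> adj A (s e)"
    and "e \<in> arcs E \<Longrightarrow> head E e = v \<Longrightarrow> f \<in> arcs E \<Longrightarrow> head E f = v \<Longrightarrow> e \<noteq> f \<Longrightarrow>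
      (s e \<otimes> adj A (s e)) \<otimes> (s f \<otimes> adj A (s f)) = \<zero>"
proof -
  let ?I = "edges_into E v"
  have fin: "finite ?I" by simp
  have proj: "is_projection A (s e \<otimes> adj A (s e))" if "e \<in> ?I" for e using that by (intro range_projection) simp
  note * = projections_below_projection[where I = ?I and P = "p v" and q = "\<lambda>e. s e \<otimes> adj A (s e)",
      OF fin p_facts(4)[OF v] proj range_sum_le[OF v]]
  show "e \<in> arcs E \<Longrightarrow> head E e = v \<Longrightarrow> p v \<otimes> (s e \<otimes> adj A (s e)) = s e \<otimes> adj A (s e)"
    by (rule *(1)) simp_all
  show "e \<in> arcs E \<Longrightarrow> head E e = v \<Longrightarrow> f \<in> arcs E \<Longrightarrow> head E f = v \<Longrightarrow> e \<noteq> f \<Longrightarrow>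
      (s e \<otimes> adj A (s e)) \<otimes> (s f \<otimes> adj A (s f)) = \<zero>"
    by (rule *(2)) simp_all
qed

lemma p_head_s: assumes e: "e \<in> arcs E" shows "p (head E e) \<otimes> s e = s e"
proof -
  have h: "head E e \<in> verts E" using e by simp
  have "p (head E e) \<otimes> s e = p (head E e) \<otimes> (s e \<otimes> adj A (s e)) \<otimes> s e"
    using s_isometry[OF e] e p_facts(1)[OF h] by (simp add: m_assoc)
  also have "\<dots> = s e" using range_projections_below(1)[OF h e refl] s_isometry[OF e] by simp
  finally show ?thesis .
qed

lemma s_p_tail: assumes e: "e \<in> arcs E" shows "s e \<otimes> p (tail E e) = s e"
  using s_isometry[OF e] e by (simp add: s_star_s[symmetric] m_assoc)

lemma p_s: assumes "e \<in> arcs E" "v \<in> verts E" shows "p v \<otimes> s e = (if v = head E e then s e else \<zero>)"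
proof (cases "v = head E e")
  case False
  have h: "head E e \<in> verts E" using assms by simp
  have "p v \<otimes> s e = p v \<otimes> (p (head E e) \<otimes> s e)" by (simp add: p_head_s assms)
  also have "\<dots> = (p v \<otimes> p (head E e)) \<otimes> s e" using assms p_facts(1)[OF h] p_facts(1) by (simp add: m_assoc)
  finally show ?thesis using p_orthogonal[OF assms(2) h False] assms False by simp
qed (use p_head_s assms in simp)

lemma s_star_s_orthogonal:
  assumes e: "e \<in> arcs E" and f: "f \<in> arcs E" and ef: "e \<noteq> f" shows "adj A (s e) \<otimes> s f = \<zero>"
proof (cases "head E e = head E f")
  case True
  have h: "head E e \<in> verts E" using e by simp
  have "adj A (s e) = adj A (s e \<otimes> adj A (s e) \<otimes> s e)" by (simp add: s_isometry e)
  also have "\<dots> = adj A (s e) \<otimes> (s e \<otimes> adj A (s e))" using e by (simp add: star_mult m_assoc)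
  finally have 1: "adj A (s e) = adj A (s e) \<otimes> (s e \<otimes> adj A (s e))" .
  have "adj A (s e) \<otimes> s f = (adj A (s e) \<otimes> (s e \<otimes> adj A (s e))) \<otimes> (s f \<otimes> adj A (s f) \<otimes> s f)"
    using 1 s_isometry[OF f] by simp
  also have "\<dots> = adj A (s e) \<otimes> ((s e \<otimes> adj A (s e)) \<otimes> (s f \<otimes> adj A (s f))) \<otimes> s f"
    using e f by (simp add: m_assoc)
  also have "\<dots> = \<zero>" using range_projections_below(2)[OF h e refl f True[symmetric] ef] e f by simp
  finally show ?thesis .
next
  case False
  have h: "head E e \<in> verts E" using e by simp
  have "adj A (s e) \<otimes> s f = adj A (p (head E e) \<otimes> s e) \<otimes> s f" by (simp add: p_head_s e)
  also have "\<dots> = adj A (s e) \<otimes> (p (head E e) \<otimes> s f)" using e f p_facts[OF h] by (simp add: star_mult m_assoc)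
  finally show ?thesis using p_s[OF f h] False e by simp
qed

lemma pe_Nil [simp]: "pe (v, []) = p v"
  by (simp add: path_elem_def)

lemma pe_Cons: "(v, e # es) \<in> paths E \<Longrightarrow> pe (v, e # es) = s e \<otimes> pe (tail E e, es)"
  by (cases es) (auto simp: path_elem_def paths_Cons s_p_tail)

lemma pe_carrier [simp]: "\<mu> \<in> paths E \<Longrightarrow> pe \<mu> \<in> carrier A"
proof (cases \<mu>)
  case (Pair v es)
  have "(v, es) \<in> paths E \<Longrightarrow> pe (v, es) \<in> carrier A"
    by (induction es arbitrary: v) (auto simp: p_facts pe_Cons paths_Cons)
  then show "\<mu> \<in> paths E \<Longrightarrow> pe \<mu> \<in> carrier A" using Pair by simp
qed

lemma p_pe: assumes "(v, es) \<in> paths E" "u \<in> verts E" shows "p u \<otimes> pe (v, es) = (if u = v then pe (v, es) else \<zero>)"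
proof (cases es)
  case Nil
  then show ?thesis using assms by (auto simp: p_facts p_orthogonal)
next
  case (Cons e fs)
  then have e: "e \<in> arcs E" "head E e = v" "(tail E e, fs) \<in> paths E" using assms by (auto simp: paths_Cons)
  then have "p u \<otimes> pe (v, es) = (p u \<otimes> s e) \<otimes> pe (tail E e, fs)"
    using assms Cons p_facts(1)[OF assms(2)] by (simp add: pe_Cons m_assoc)
  then show ?thesis using p_s[OF e(1) assms(2)] e assms Cons by (simp add: pe_Cons)
qed

lemma pe_p: "(v, es) \<in> paths E \<Longrightarrow> u \<in> verts E \<Longrightarrow> pe (v, es) \<otimes> p u = (if u = src (v, es) then pe (v, es) else \<zero>)"
proof (induction es arbitrary: v)
  case Nil
  then show ?case by (auto simp: p_facts p_orthogonal)
next
  case (Cons e es)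
  then have e: "e \<in> arcs E" "(tail E e, es) \<in> paths E" by (auto simp: paths_Cons)
  then show ?case using Cons p_facts(1)[of u] by (simp add: pe_Cons m_assoc)
qed

lemma s_pe:
  assumes "e \<in> arcs E" "(v, es) \<in> paths E"
  shows "s e \<otimes> pe (v, es) = (if v = tail E e then pe (head E e, e # es) else \<zero>)"
proof -
  have t: "tail E e \<in> verts E" using assms by simp
  have "s e \<otimes> pe (v, es) = s e \<otimes> (p (tail E e) \<otimes> pe (v, es))"
    using assms p_facts(1)[OF t] by (simp add: m_assoc[symmetric] s_p_tail)
  then show ?thesis using p_pe[OF assms(2) t] assms by (auto simp: pe_Cons paths_Cons)
qed

lemma pe_s:
  "e \<in> arcs E \<Longrightarrow> (v, es) \<in> paths E \<Longrightarrow> pe (v, es) \<otimes> s e = (if src (v, es) = head E e then pe (v, es @ [e]) else \<zero>)"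
proof (induction es arbitrary: v)
  case Nil
  then show ?case using p_s[of e v] by (simp add: path_elem_def)
next
  case (Cons f es)
  then have f: "f \<in> arcs E" "(tail E f, es) \<in> paths E" "head E f = v" by (auto simp: paths_Cons)
  have "pe (v, f # es) \<otimes> s e = s f \<otimes> (pe (tail E f, es) \<otimes> s e)" using Cons f by (simp add: pe_Cons m_assoc)
  also have "\<dots> = (if src (tail E f, es) = head E e then s f \<otimes> pe (tail E f, es @ [e]) else \<zero>)"
    using Cons.IH[OF Cons.prems(1) f(2)] f by simp
  also have "\<dots> = (if src (v, f # es) = head E e then pe (v, (f # es) @ [e]) else \<zero>)"
    using f Cons.prems paths_snoc[OF fin_digraph Cons.prems(1), of "tail E f" es]
    by (auto simp: pe_Cons paths_Cons)
  finally show ?case .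
qed

lemma s_star_pe:
  assumes "e \<in> arcs E" "(v, es) \<in> paths E"
  shows "adj A (s e) \<otimes> pe (v, es) = (case es of [] \<Rightarrow> (if v = head E e then adj A (s e) else \<zero>)
     | f # fs \<Rightarrow> if e = f then pe (tail E e, fs) else \<zero>)"
proof (cases es)
  case Nil
  have h: "head E e \<in> verts E" using assms by simp
  have "adj A (s e) \<otimes> p v = adj A (p v \<otimes> s e)" using assms Nil by (simp add: star_mult p_facts)
  then show ?thesis using p_s[OF assms(1), of v] assms Nil by simp
next
  case (Cons f fs)
  then have f: "f \<in> arcs E" "(tail E f, fs) \<in> paths E" using assms by (auto simp: paths_Cons)
  have t: "tail E f \<in> verts E" using f by simp
  have "adj A (s e) \<otimes> pe (v, es) = (adj A (s e) \<otimes> s f) \<otimes> pe (tail E f, fs)"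
    using assms f Cons by (simp add: pe_Cons m_assoc)
  also have "\<dots> = (if e = f then pe (tail E e, fs) else \<zero>)"
    using s_star_s_orthogonal[OF assms(1) f(1)] s_star_s[OF f(1)] p_pe[OF f(2) t] f by auto
  finally show ?thesis using Cons by simp
qed


section \<open>The dense subspace spanned by \<open>s\<^sub>\<mu> s\<^sub>\<nu>\<^sup>*\<close>\<close>

definition sig :: "'v \<times> 'e list \<Rightarrow> 'v \<times> 'e list \<Rightarrow> 'a" where
  "sig \<mu> \<nu> = pe \<mu> \<otimes> adj A (pe \<nu>)"

inductive_set tspan :: "'a set" where
  zero: "\<zero> \<in> tspan"
| add: "\<mu> \<in> paths E \<Longrightarrow> \<nu> \<in> paths E \<Longrightarrow> x \<in> tspan \<Longrightarrow> c \<odot> sig \<mu> \<nu> \<oplus> x \<in> tspan"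

lemma sig_carrier [simp]: "\<mu> \<in> paths E \<Longrightarrow> \<nu> \<in> paths E \<Longrightarrow> sig \<mu> \<nu> \<in> carrier A"
  by (simp add: sig_def)

lemma tspan_carrier [simp]: "x \<in> tspan \<Longrightarrow> x \<in> carrier A"
  by (induction rule: tspan.induct) auto

lemma tspan_sig: "\<mu> \<in> paths E \<Longrightarrow> \<nu> \<in> paths E \<Longrightarrow> sig \<mu> \<nu> \<in> tspan"
  using tspan.add[OF _ _ tspan.zero, of \<mu> \<nu> 1] by simp

lemma tspan_add: "x \<in> tspan \<Longrightarrow> y \<in> tspan \<Longrightarrow> x \<oplus> y \<in> tspan"
proof (induction rule: tspan.induct)
  case (add \<mu> \<nu> x c)
  then show ?case using tspan.add[of \<mu> \<nu> "x \<oplus> y" c] by (simp add: a_assoc)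
qed simp

lemma tspan_scal: "x \<in> tspan \<Longrightarrow> d \<odot> x \<in> tspan"
  by (induction rule: tspan.induct) (auto simp: scal_r_distr scal_scal intro: tspan.intros)

lemma sig_star: "\<mu> \<in> paths E \<Longrightarrow> \<nu> \<in> paths E \<Longrightarrow> adj A (sig \<mu> \<nu>) = sig \<nu> \<mu>"
  by (simp add: sig_def star_mult)

lemma tspan_star: "x \<in> tspan \<Longrightarrow> adj A x \<in> tspan"
  by (induction rule: tspan.induct) (auto simp: star_add star_scal sig_star intro: tspan.intros)

lemma tspan_left_mult:
  assumes g: "g \<in> carrier A" and sig: "\<And>\<mu> \<nu>. \<mu> \<in> paths E \<Longrightarrow> \<nu> \<in> paths E \<Longrightarrow> g \<otimes> sig \<mu> \<nu> \<in> tspan"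
  shows "x \<in> tspan \<Longrightarrow> g \<otimes> x \<in> tspan"
proof (induction rule: tspan.induct)
  case (add \<mu> \<nu> x c)
  then have "g \<otimes> (c \<odot> sig \<mu> \<nu> \<oplus> x) = c \<odot> (g \<otimes> sig \<mu> \<nu>) \<oplus> g \<otimes> x"
    using g by (simp add: r_distr scal_mult_right)
  then show ?case using add sig by (simp add: tspan_add tspan_scal)
qed (use g in \<open>simp add: tspan.zero\<close>)

lemma p_sig:
  assumes "u \<in> verts E" "(v, es) \<in> paths E" "\<nu> \<in> paths E"
  shows "p u \<otimes> sig (v, es) \<nu> = (if u = v then sig (v, es) \<nu> else \<zero>)"
  using p_pe[OF assms(2,1)] assms p_facts(1)[OF assms(1)] by (simp add: sig_def m_assoc[symmetric])

lemma s_sig: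
  assumes "e \<in> arcs E" "(v, es) \<in> paths E" "\<nu> \<in> paths E"
  shows "s e \<otimes> sig (v, es) \<nu> = (if v = tail E e then sig (head E e, e # es) \<nu> else \<zero>)"
  using s_pe[OF assms(1,2)] assms by (simp add: sig_def m_assoc[symmetric])

lemma star_pe_eq_sig:
  assumes "\<nu> \<in> paths E" shows "adj A (pe \<nu>) = sig (src \<nu>, []) \<nu>"
proof -
  obtain v es where \<nu>: "\<nu> = (v, es)" by (cases \<nu>)
  have u: "src \<nu> \<in> verts E" using path_source_in_verts[of v es E] assms \<nu> by simp
  have "pe \<nu> = pe \<nu> \<otimes> p (src \<nu>)" using pe_p[of v es "src \<nu>"] u assms \<nu> by simp
  then have "adj A (pe \<nu>) = adj A (pe \<nu> \<otimes> p (src \<nu>))" by simp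
  then show ?thesis using assms u by (simp add: sig_def star_mult p_facts)
qed

text \<open>
  Together with \<open>p_sig\<close> and \<open>s_sig\<close> this shows that the span of the \<open>s\<^sub>\<mu> s\<^sub>\<nu>\<^sup>*\<close> is invariant
  under multiplication by the generators.
\<close>

lemma s_star_sig:
  assumes "e \<in> arcs E" "(v, es) \<in> paths E" "(w, fs) \<in> paths E"
  shows "adj A (s e) \<otimes> sig (v, es) (w, fs) = (case es of
       [] \<Rightarrow> (if v = head E e \<and> src (w, fs) = head E e then sig (tail E e, []) (w, fs @ [e]) else \<zero>)
     | f # es' \<Rightarrow> if e = f then sig (tail E e, es') (w, fs) else \<zero>)"
proof (cases es)
  case Nil
  have "adj A (s e) \<otimes> sig (v, es) (w, fs) = (if v = head E e then adj A (s e) \<otimes> adj A (pe (w, fs)) else \<zero>)"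
    using s_star_pe[OF assms(1,2)] assms Nil by (simp add: sig_def m_assoc[symmetric] p_facts)
  also have "adj A (s e) \<otimes> adj A (pe (w, fs)) = adj A (pe (w, fs) \<otimes> s e)" using assms by (simp add: star_mult)
  also have "\<dots> = (if src (w, fs) = head E e then sig (tail E e, []) (w, fs @ [e]) else \<zero>)"
    using pe_s[OF assms(1,3)] star_pe_eq_sig[of "(w, fs @ [e])"] paths_snoc[OF fin_digraph assms(1), of w fs] assms by simp
  finally show ?thesis using Nil by simp
next
  case (Cons f es')
  then show ?thesis using s_star_pe[OF assms(1,2)] assms
    by (auto simp add: sig_def m_assoc[symmetric] paths_Cons)
qed

lemma tspan_mult_generators:
  assumes "x \<in> tspan"
  shows "u \<in> verts E \<Longrightarrow> p u \<otimes> x \<in> tspan" "e \<in> arcs E \<Longrightarrow> s e \<otimes> x \<in> tspan" "e \<in> arcs E \<Longrightarrow> adj A (s e) \<otimes> x \<in> tspan"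
proof -
  show "p u \<otimes> x \<in> tspan" if "u \<in> verts E"
    using assms by (rule tspan_left_mult[rotated 2]) (use that in \<open>auto simp: p_sig p_facts tspan_sig tspan.zero\<close>)
  show "s e \<otimes> x \<in> tspan" if "e \<in> arcs E"
    using assms by (rule tspan_left_mult[rotated 2]) (use that in \<open>auto simp: s_sig tspan_sig tspan.zero paths_Cons\<close>)
  show "adj A (s e) \<otimes> x \<in> tspan" if e: "e \<in> arcs E"
  proof (rule tspan_left_mult[OF _ _ assms])
    fix \<mu> \<nu> assume "\<mu> \<in> paths E" "\<nu> \<in> paths E"
    then show "adj A (s e) \<otimes> sig \<mu> \<nu> \<in> tspan"
      using e paths_snoc[OF fin_digraph e] by (cases \<mu>; cases \<nu>; cases "snd \<mu>")
        (auto simp: s_star_sig tspan_sig tspan.zero paths_Cons)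
  qed (use e in simp)
qed

lemma tspan_mult_pe:
  assumes "x \<in> tspan" "(v, es) \<in> paths E"
  shows "pe (v, es) \<otimes> x \<in> tspan" "adj A (pe (v, es)) \<otimes> x \<in> tspan"
proof -
  show "pe (v, es) \<otimes> x \<in> tspan" using assms(2)
  proof (induction es arbitrary: v)
    case (Cons e es)
    then show ?case using assms(1) tspan_mult_generators(2)[OF Cons.IH] by (auto simp: paths_Cons pe_Cons m_assoc)
  qed (use assms(1) in \<open>auto intro: tspan_mult_generators\<close>)
  show "adj A (pe (v, es)) \<otimes> x \<in> tspan" using assms(2,1)
  proof (induction es arbitrary: v x)
    case (Cons e es)
    then have e: "e \<in> arcs E" "(tail E e, es) \<in> paths E" by (auto simp: paths_Cons)
    have "adj A (pe (v, e # es)) \<otimes> x = adj A (pe (tail E e, es)) \<otimes> (adj A (s e) \<otimes> x)"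
      using Cons.prems e by (simp add: pe_Cons star_mult m_assoc)
    then show ?case using Cons.IH[OF e(2) tspan_mult_generators(3)[OF Cons.prems(2) e(1)]] by simp
  qed (auto intro: tspan_mult_generators simp: p_facts)
qed

lemma tspan_mult: assumes "x \<in> tspan" "y \<in> tspan" shows "x \<otimes> y \<in> tspan"
  using assms
proof (induction rule: tspan.induct)
  case (add \<mu> \<nu> x c)
  have "sig \<mu> \<nu> \<otimes> y = pe \<mu> \<otimes> (adj A (pe \<nu>) \<otimes> y)" using add by (simp add: sig_def m_assoc)
  moreover have "\<dots> \<in> tspan"
    using tspan_mult_pe(1)[OF tspan_mult_pe(2)[OF add(5), of "fst \<nu>" "snd \<nu>"], of "fst \<mu>" "snd \<mu>"] add by simp
  ultimately show ?case using add by (simp add: l_distr scal_mult_left tspan_add tspan_scal)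
qed (simp add: tspan.zero)

text \<open>The limits of sequences in the span form a \<open>C\<^sup>*\<close>-subalgebra that contains the generators.\<close>

theorem tspan_dense:
  assumes "x \<in> carrier A" shows "\<exists>Y. (\<forall>n. Y n \<in> tspan) \<and> tends Y x"
proof -
  define W where "W = {x. \<exists>Y. (\<forall>n. Y n \<in> tspan) \<and> tends Y x}"
  have "cstar_subalgebra A W"
    unfolding cstar_subalgebra_def
  proof (intro conjI ballI allI)
    show "W \<subseteq> carrier A" by (auto simp: W_def tends_def)
    show "\<zero> \<in> W" unfolding W_def using tspan.zero tends_const[of \<zero>] by (auto intro!: exI[of _ "\<lambda>_. \<zero>"])
    fix x assume "x \<in> W"
    then obtain X where X: "\<forall>n. X n \<in> tspan" "tends X x" by (auto simp: W_def)
    show "c \<odot> x \<in> W" for c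
      unfolding W_def using X by (auto intro!: exI[of _ "\<lambda>n. c \<odot> X n"] tspan_scal tends_scal)
    show "adj A x \<in> W"
      unfolding W_def using X by (auto intro!: exI[of _ "\<lambda>n. adj A (X n)"] tspan_star tends_star)
    fix y assume "y \<in> W"
    then obtain Y where Y: "\<forall>n. Y n \<in> tspan" "tends Y y" by (auto simp: W_def)
    show "x \<oplus> y \<in> W"
      unfolding W_def using X Y by (auto intro!: exI[of _ "\<lambda>n. X n \<oplus> Y n"] tspan_add tends_add)
    show "x \<otimes> y \<in> W"
      unfolding W_def using X Y by (auto intro!: exI[of _ "\<lambda>n. X n \<otimes> Y n"] tspan_mult tends_mult)
  next
    show "norm_closed A W" unfolding norm_closed_def
    proof (intro allI impI, elim conjE)
      fix X x assume X: "\<forall>n::nat. X n \<in> W" and x: "x \<in> carrier A" "(\<lambda>n. cnorm A (X n \<ominus> x)) \<longlonglongrightarrow> 0"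
      have "\<exists>y\<in>tspan. cnorm A (y \<ominus> X n) < 1 / real (Suc n)" for n
      proof -
        obtain Y where Y: "\<forall>k. Y k \<in> tspan" "tends Y (X n)" using X by (auto simp: W_def)
        then have "eventually (\<lambda>k. cnorm A (Y k \<ominus> X n) < 1 / real (Suc n)) sequentially"
          by (intro order_tendstoD(2)) (auto simp: tends_def)
        then obtain k where "cnorm A (Y k \<ominus> X n) < 1 / real (Suc n)" by (auto simp: eventually_sequentially)
        then show ?thesis using Y by blast
      qed
      then obtain Y where Y: "\<And>n. Y n \<in> tspan" "\<And>n. cnorm A (Y n \<ominus> X n) < 1 / real (Suc n)" by metis
      have Xc: "X n \<in> carrier A" for n using X by (auto simp: W_def tends_def)
      have "tends Y x"
      proof (rule tendsI)
        show "cnorm A (Y n \<ominus> x) \<le> 1 / real (Suc n) + cnorm A (X n \<ominus> x)" for n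
          using norm_triangle_diff[of "Y n" "X n" x] Y(2)[of n] Y(1)[of n] Xc[of n] x by simp
        show "(\<lambda>n. 1 / real (Suc n) + cnorm A (X n \<ominus> x)) \<longlonglongrightarrow> 0"
          using tendsto_add[OF LIMSEQ_inverse_real_of_nat x(2)] by (simp add: inverse_eq_divide)
      qed (use Y x in auto)
      then show "x \<in> W" using Y by (auto simp: W_def)
    qed
  qed
  moreover have "p v \<in> W" if "v \<in> verts E" for v
    unfolding W_def using that tspan_sig[of "(v, [])" "(v, [])"] p_facts[OF that]
    by (auto intro!: exI[of _ "\<lambda>_. p v"] tends_const simp: sig_def)
  moreover have "s e \<in> W" if "e \<in> arcs E" for e
    unfolding W_def using that tspan_sig[of "(head E e, [e])" "(tail E e, [])"] s_p_tail[OF that]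
    by (auto intro!: exI[of _ "\<lambda>_. s e"] tends_const simp: sig_def p_facts paths_Cons path_elem_def)
  ultimately have "W = carrier A" by (intro generated) auto
  with assms show ?thesis by (auto simp: W_def)
qed

lemma dense_induct:
  assumes "x \<in> carrier A" "\<And>y. y \<in> tspan \<Longrightarrow> P y"
    and "\<And>Y y. (\<And>n. P (Y n)) \<Longrightarrow> (\<And>n. Y n \<in> tspan) \<Longrightarrow> tends Y y \<Longrightarrow> P y"
  shows "P x"
  using tspan_dense[OF assms(1)] assms(2,3) by blast

text \<open>
  The sum of the vertex projections is a left unit for every \<open>s\<^sub>\<mu> s\<^sub>\<nu>\<^sup>*\<close>, hence for all limits
  of their combinations.
\<close>

lemma one_eq_sum_p: "\<one> = (\<Oplus>v\<in>verts E. p v)"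
proof -
  let ?P = "\<Oplus>v\<in>verts E. p v"
  have P: "?P \<in> carrier A" by (intro finsum_closed) (auto simp: p_facts)
  have gen: "?P \<otimes> sig \<mu> \<nu> = sig \<mu> \<nu>" if \<mu>: "\<mu> \<in> paths E" and \<nu>: "\<nu> \<in> paths E" for \<mu> \<nu>
  proof -
    obtain v es where v: "\<mu> = (v, es)" by (cases \<mu>)
    have "?P \<otimes> sig \<mu> \<nu> = (\<Oplus>u\<in>verts E. p u \<otimes> sig \<mu> \<nu>)"
      using \<mu> \<nu> by (intro finsum_ldistr) (auto simp: p_facts)
    also have "\<dots> = (\<Oplus>u\<in>verts E. if v = u then sig \<mu> \<nu> else \<zero>)"
      using \<mu> \<nu> v by (intro finsum_cong') (auto simp: p_sig)
    also have "\<dots> = sig \<mu> \<nu>"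
      using \<mu> \<nu> v path_fst_in_verts[OF fin_digraph \<mu>] by (intro add.finprod_singleton) auto
    finally show ?thesis .
  qed
  have span: "?P \<otimes> x = x" if "x \<in> tspan" for x
    using that by (induction rule: tspan.induct) (use P gen in \<open>simp_all add: r_distr scal_mult_right\<close>)
  have "?P \<otimes> x = x" if "x \<in> carrier A" for x
    using that
  proof (rule dense_induct)
    fix Y y assume "\<And>n. ?P \<otimes> Y n = Y n" "tends Y y"
    then show "?P \<otimes> y = y" using tends_mult[OF tends_const[OF P] \<open>tends Y y\<close>] tends_unique by simp
  qed (rule span)
  from this[of \<one>] P show ?thesis by simp
qed

lemma pos_continuous:
  assumes \<phi>: "positive_functional \<phi>" and Y: "tends Y y" shows "(\<lambda>n. \<phi> (Y n)) \<longlonglongrightarrow> \<phi> y"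
proof -
  have c: "Y n \<in> carrier A" "y \<in> carrier A" for n using Y by (auto simp: tends_def)
  have "(\<lambda>n. Re (\<phi> \<one>) * cnorm A (Y n \<ominus> y)) \<longlonglongrightarrow> 0"
    using Y tendsto_mult_right_zero by (auto simp: tends_def)
  moreover have "norm (\<phi> (Y n) - \<phi> y) \<le> Re (\<phi> \<one>) * cnorm A (Y n \<ominus> y)" for n
    using pos_bounded[OF \<phi> minus_closed[OF c(1)[of n] c(2)]] by (simp add: pos_diff[OF \<phi> c(1) c(2)])
  ultimately have "(\<lambda>n. \<phi> (Y n) - \<phi> y) \<longlonglongrightarrow> 0"
    by (rule Lim_null_comparison[OF always_eventually[OF allI], rotated])
  then show ?thesis by (simp add: LIM_zero_iff)
qed

lemma pos_eqI:
  assumes "positive_functional \<phi>" "positive_functional \<psi>"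
    and "\<And>\<mu> \<nu>. \<mu> \<in> paths E \<Longrightarrow> \<nu> \<in> paths E \<Longrightarrow> \<phi> (sig \<mu> \<nu>) = \<psi> (sig \<mu> \<nu>)"
    and "x \<in> carrier A"
  shows "\<phi> x = \<psi> x"
  using assms(4)
proof (rule dense_induct)
  fix y assume "y \<in> tspan"
  then show "\<phi> y = \<psi> y"
    by (induction rule: tspan.induct)
      (simp_all add: pos_zero[OF assms(1)] pos_zero[OF assms(2)] pos_add[OF assms(1)] pos_add[OF assms(2)]
        pos_scal[OF assms(1)] pos_scal[OF assms(2)] assms(3))
next
  fix Y y assume *: "\<And>n. \<phi> (Y n) = \<psi> (Y n)" "tends Y y"
  then show "\<phi> y = \<psi> y"
    using LIMSEQ_unique[OF pos_continuous[OF assms(1) *(2)]] pos_continuous[OF assms(2) *(2)] by simp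
qed

lemma pos_one_eq_sum:
  assumes "positive_functional \<phi>" shows "\<phi> \<one> = (\<Sum>v\<in>verts E. \<phi> (p v))"
  unfolding one_eq_sum_p by (rule pos_finsum[OF assms E.finite_verts]) (use p_facts(1) in auto)

text \<open>
  The functionals that will turn out to be the KMS states: a weight \<open>m v\<close> on the vertices
  determines them.
\<close>

definition kms_values :: "real \<Rightarrow> ('v \<Rightarrow> real) \<Rightarrow> ('a \<Rightarrow> complex) \<Rightarrow> bool" where
  "kms_values r m \<phi> \<longleftrightarrow> positive_functional \<phi> \<and>
     (\<forall>\<mu>\<in>paths E. \<forall>\<nu>\<in>paths E. \<phi> (sig \<mu> \<nu>) = (if \<mu> = \<nu> then of_real (inverse r ^ path_length \<mu> * m (src \<mu>)) else 0))"

text \<open>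
  On the spanning elements both sides are computed by the relations: they vanish unless both
  paths agree up to the edge \<open>e\<close>, and then they differ by the factor \<open>r\<^sup>-\<^sup>1\<close> of one additional
  edge.
\<close>

lemma kms_values_s_commute:
  assumes \<phi>: "kms_values r m \<phi>" and r: "0 < r" and e: "e \<in> arcs E" and y: "y \<in> carrier A"
  shows "\<phi> (s e \<otimes> y) = inverse (of_real r) * \<phi> (y \<otimes> s e)"
  using y
proof (rule dense_induct)
  have pos: "positive_functional \<phi>" using \<phi> by (simp add: kms_values_def)
  have val: "\<phi> (sig \<mu> \<nu>) = (if \<mu> = \<nu> then of_real (inverse r ^ path_length \<mu> * m (src \<mu>)) else 0)"
    if "\<mu> \<in> paths E" "\<nu> \<in> paths E" for \<mu> \<nu> using \<phi> that by (simp add: kms_values_def)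
  have gen: "\<phi> (s e \<otimes> sig (v, es) (w, fs)) = inverse (of_real r) * \<phi> (sig (v, es) (w, fs) \<otimes> s e)"
    if \<mu>: "(v, es) \<in> paths E" and \<nu>: "(w, fs) \<in> paths E" for v es w fs
  proof -
    have right: "sig (v, es) (w, fs) \<otimes> s e = adj A (adj A (s e) \<otimes> sig (w, fs) (v, es))"
      using \<mu> \<nu> e by (simp add: star_mult sig_star)
    have left: "s e \<otimes> sig (v, es) (w, fs) = (if v = tail E e then sig (head E e, e # es) (w, fs) else \<zero>)"
      by (rule s_sig[OF e \<mu> \<nu>])
    have p1: "v = tail E e \<Longrightarrow> (head E e, e # es) \<in> paths E" using e \<mu> by (simp add: paths_Cons)
    show ?thesis
    proof (cases fs)
      case Nil
      have "src (v, es) = head E e \<Longrightarrow> (v, es @ [e]) \<in> paths E" using paths_snoc[OF fin_digraph e] \<mu> by simp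
      then have "\<phi> (sig (v, es) (w, fs) \<otimes> s e) = 0"
        unfolding right s_star_sig[OF e \<nu> \<mu>] using Nil e \<mu> by (auto simp: sig_star val pos_zero[OF pos])
      moreover have "\<phi> (s e \<otimes> sig (v, es) (w, fs)) = 0"
        unfolding left using Nil \<nu> p1 by (auto simp: val pos_zero[OF pos])
      ultimately show ?thesis by simp
    next
      case (Cons f fs')
      then have f: "f \<in> arcs E" "head E f = w" "(tail E f, fs') \<in> paths E" using \<nu> by (auto simp: paths_Cons)
      have "\<phi> (sig (v, es) (w, fs) \<otimes> s e) = (if e = f \<and> v = tail E e \<and> es = fs'
          then of_real (inverse r ^ length es * m (src (v, es))) else 0)"
        unfolding right s_star_sig[OF e \<nu> \<mu>] using Cons f \<mu> by (auto simp: sig_star val pos_zero[OF pos])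
      moreover have "\<phi> (s e \<otimes> sig (v, es) (w, fs)) = (if e = f \<and> v = tail E e \<and> es = fs'
          then of_real (inverse r ^ Suc (length es) * m (src (v, es))) else 0)"
        unfolding left using \<nu> p1 f Cons by (auto simp: val pos_zero[OF pos])
      ultimately show ?thesis by simp
    qed
  qed
  fix y assume "y \<in> tspan"
  then show "\<phi> (s e \<otimes> y) = inverse (of_real r) * \<phi> (y \<otimes> s e)"
  proof (induction rule: tspan.induct)
    case (add \<mu> \<nu> x c)
    then show ?case using e gen[of "fst \<mu>" "snd \<mu>" "fst \<nu>" "snd \<nu>"]
      by (simp add: l_distr r_distr scal_mult_left scal_mult_right pos_add[OF pos] pos_scal[OF pos] algebra_simps)
  qed (use e in \<open>simp add: pos_zero[OF pos]\<close>)
next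
  have pos: "positive_functional \<phi>" using \<phi> by (simp add: kms_values_def)
  fix Y y assume *: "\<And>n. \<phi> (s e \<otimes> Y n) = inverse (of_real r) * \<phi> (Y n \<otimes> s e)" "tends Y y"
  have "(\<lambda>n. \<phi> (s e \<otimes> Y n)) \<longlonglongrightarrow> \<phi> (s e \<otimes> y)"
    using e by (intro pos_continuous[OF pos] tends_mult tends_const *) auto
  moreover have "(\<lambda>n. inverse (of_real r) * \<phi> (Y n \<otimes> s e)) \<longlonglongrightarrow> inverse (of_real r) * \<phi> (y \<otimes> s e)"
    using e by (intro tendsto_mult tendsto_const pos_continuous[OF pos] tends_mult tends_const *) auto
  ultimately show "\<phi> (s e \<otimes> y) = inverse (of_real r) * \<phi> (y \<otimes> s e)" using * LIMSEQ_unique by simp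
qed

text \<open>The KMS relation for an element that \<open>\<alpha>\<^sub>t\<close> multiplies by \<open>e\<^sup>i\<^sup>k\<^sup>t\<close>, against all elements.\<close>

definition kms_commutes :: "real \<Rightarrow> ('a \<Rightarrow> complex) \<Rightarrow> int \<Rightarrow> 'a \<Rightarrow> bool" where
  "kms_commutes r \<phi> k x \<longleftrightarrow> (\<forall>y\<in>carrier A. \<phi> (x \<otimes> y) = of_real r powi (- k) * \<phi> (y \<otimes> x))"

lemma kms_commutesD: "kms_commutes r \<phi> k x \<Longrightarrow> y \<in> carrier A \<Longrightarrow> \<phi> (x \<otimes> y) = of_real r powi (- k) * \<phi> (y \<otimes> x)"
  by (simp only: kms_commutes_def)

lemma kms_commutes_mult:
  assumes "kms_commutes r \<phi> k x" "kms_commutes r \<phi> l y" "x \<in> carrier A" "y \<in> carrier A" "0 < r"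
  shows "kms_commutes r \<phi> (k + l) (x \<otimes> y)"
  unfolding kms_commutes_def
proof
  fix z assume z: "z \<in> carrier A"
  have "\<phi> (x \<otimes> y \<otimes> z) = of_real r powi (- k) * \<phi> (y \<otimes> (z \<otimes> x))"
    using kms_commutesD[OF assms(1), of "y \<otimes> z"] assms(3,4) z by (simp add: m_assoc)
  also have "\<phi> (y \<otimes> (z \<otimes> x)) = of_real r powi (- l) * \<phi> (z \<otimes> x \<otimes> y)"
    using kms_commutesD[OF assms(2), of "z \<otimes> x"] assms(3,4) z by simp
  also have "of_real r powi (- k) * (of_real r powi (- l) * \<phi> (z \<otimes> x \<otimes> y)) = of_real r powi (- (k + l)) * \<phi> (z \<otimes> (x \<otimes> y))"
    using assms(3-5) z power_int_add[of "complex_of_real r" "- k" "- l"] by (simp add: m_assoc add.commute)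
  finally show "\<phi> (x \<otimes> y \<otimes> z) = of_real r powi (- (k + l)) * \<phi> (z \<otimes> (x \<otimes> y))" .
qed

lemma kms_commutes_star:
  assumes \<phi>: "positive_functional \<phi>" and x: "kms_commutes r \<phi> k x" "x \<in> carrier A" "0 < r"
  shows "kms_commutes r \<phi> (- k) (adj A x)"
  unfolding kms_commutes_def
proof
  fix y assume y: "y \<in> carrier A"
  have "\<phi> (adj A x \<otimes> y) = cnj (\<phi> (adj A y \<otimes> x))" using pos_hermitian[OF \<phi> y x(2)] pos_hermitian[OF \<phi> x(2) y] by simp
  also have "\<phi> (adj A y \<otimes> x) = of_real r powi k * \<phi> (x \<otimes> adj A y)"
    using kms_commutesD[OF x(1), of "adj A y"] x(2,3) y by (simp add: power_int_minus)
  also have "cnj (of_real r powi k * \<phi> (x \<otimes> adj A y)) = of_real r powi k * \<phi> (adj A (x \<otimes> adj A y))"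
    using x(2) y by (simp add: pos_star[OF \<phi>] of_real_power_int[symmetric] del: of_real_power_int)
  also have "adj A (x \<otimes> adj A y) = y \<otimes> adj A x" using x(2) y by (simp add: star_mult)
  finally show "\<phi> (adj A x \<otimes> y) = of_real r powi (- (- k)) * \<phi> (y \<otimes> adj A x)" by simp
qed

lemma kms_values_commutes_p:
  assumes \<phi>: "kms_values r m \<phi>" and v: "v \<in> verts E" shows "kms_commutes r \<phi> 0 (p v)"
  unfolding kms_commutes_def
proof
  have pos: "positive_functional \<phi>" using \<phi> by (simp add: kms_values_def)
  fix y assume "y \<in> carrier A"
  then have "\<phi> (p v \<otimes> y) = \<phi> (y \<otimes> p v)"
  proof (rule dense_induct)
    have gen: "\<phi> (p v \<otimes> sig (u, es) (w, fs)) = \<phi> (sig (u, es) (w, fs) \<otimes> p v)"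
      if \<mu>: "(u, es) \<in> paths E" and \<nu>: "(w, fs) \<in> paths E" for u es w fs
    proof -
      have "sig (u, es) (w, fs) \<otimes> p v = adj A (p v \<otimes> sig (w, fs) (u, es))"
        using \<mu> \<nu> v by (simp add: star_mult sig_star p_facts)
      then show ?thesis unfolding p_sig[OF v \<nu> \<mu>] p_sig[OF v \<mu> \<nu>] using \<phi> \<mu> \<nu>
        by (auto simp: sig_star kms_values_def pos_zero[OF pos])
    qed
    fix y assume "y \<in> tspan"
    then show "\<phi> (p v \<otimes> y) = \<phi> (y \<otimes> p v)"
    proof (induction rule: tspan.induct)
      case (add \<mu> \<nu> x c)
      then show ?case using p_facts(1)[OF v] gen[of "fst \<mu>" "snd \<mu>" "fst \<nu>" "snd \<nu>"]
        by (simp add: l_distr r_distr scal_mult_left scal_mult_right pos_add[OF pos] pos_scal[OF pos])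
    qed (use p_facts(1)[OF v] in \<open>simp add: pos_zero[OF pos]\<close>)
  next
    fix Y y assume *: "\<And>n. \<phi> (p v \<otimes> Y n) = \<phi> (Y n \<otimes> p v)" "tends Y y"
    have "(\<lambda>n. \<phi> (p v \<otimes> Y n)) \<longlonglongrightarrow> \<phi> (p v \<otimes> y)"
      using p_facts(1)[OF v] by (intro pos_continuous[OF pos] tends_mult tends_const *) auto
    moreover have "(\<lambda>n. \<phi> (Y n \<otimes> p v)) \<longlonglongrightarrow> \<phi> (y \<otimes> p v)"
      using p_facts(1)[OF v] by (intro pos_continuous[OF pos] tends_mult tends_const *) auto
    ultimately show "\<phi> (p v \<otimes> y) = \<phi> (y \<otimes> p v)" using * LIMSEQ_unique by simp
  qed
  then show "\<phi> (p v \<otimes> y) = of_real r powi (- 0) * \<phi> (y \<otimes> p v)" by simp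
qed

lemma kms_values_commutes_pe:
  assumes \<phi>: "kms_values r m \<phi>" and r: "0 < r"
  shows "(v, es) \<in> paths E \<Longrightarrow> kms_commutes r \<phi> (int (length es)) (pe (v, es))"
proof (induction es arbitrary: v)
  case Nil
  then show ?case using kms_values_commutes_p[OF \<phi>] by simp
next
  case (Cons e es)
  then have e: "e \<in> arcs E" "(tail E e, es) \<in> paths E" by (auto simp: paths_Cons)
  have "kms_commutes r \<phi> 1 (s e)"
    unfolding kms_commutes_def using kms_values_s_commute[OF \<phi> r e(1)] by (simp add: power_int_minus)
  from kms_commutes_mult[OF this Cons.IH[OF e(2)] _ _ r] Cons.prems e show ?case
    by (simp add: pe_Cons add.commute)
qed

lemma kms_values_commutes_sig:
  assumes \<phi>: "kms_values r m \<phi>" and r: "0 < r" and \<mu>: "\<mu> \<in> paths E" "\<nu> \<in> paths E"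
  shows "kms_commutes r \<phi> (int (path_length \<mu>) - int (path_length \<nu>)) (sig \<mu> \<nu>)"
proof -
  have pos: "positive_functional \<phi>" using \<phi> by (simp add: kms_values_def)
  have "kms_commutes r \<phi> (int (path_length \<mu>)) (pe \<mu>)" "kms_commutes r \<phi> (int (path_length \<nu>)) (pe \<nu>)"
    using kms_values_commutes_pe[OF \<phi> r] \<mu> by (cases \<mu>; cases \<nu>; simp)+
  from kms_commutes_mult[OF this(1) kms_commutes_star[OF pos this(2) _ r] _ _ r] \<mu>
  show ?thesis by (simp add: sig_def)
qed

end


section \<open>The path space representation\<close>

lemma shift_operator_unit:
  assumes "inverse_maps f g"
  shows "shift_operator g (l2unit i) = (case f i of None \<Rightarrow> (\<lambda>_. 0) | Some j \<Rightarrow> l2unit j)"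
proof
  fix n
  have iff: "g n = Some i \<longleftrightarrow> f i = Some n" using assms by (simp add: inverse_maps_def)
  have "shift_operator g (l2unit i) n = (if g n = Some i then 1 else 0)"
    using l2unit_mem[of i] by (auto simp: shift_operator_def l2unit_def split: option.splits)
  also have "\<dots> = (if f i = Some n then 1 else 0)" by (simp add: iff)
  also have "\<dots> = (case f i of None \<Rightarrow> (\<lambda>_. 0) | Some j \<Rightarrow> l2unit j) n"
    by (cases "f i") (auto simp: l2unit_def)
  finally show "shift_operator g (l2unit i) n = (case f i of None \<Rightarrow> (\<lambda>_. 0) | Some j \<Rightarrow> l2unit j) n" .
qed

locale path_space =
  fixes E :: "('v, 'e) pre_digraph"
  assumes fin_digraph: "fin_digraph E"
begin

sublocale fin_digraph E by (rule fin_digraph)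

text \<open>The universal property is tested on operators on \<open>\<ell>\<^sup>2(\<nat>)\<close>, so paths are numbered.\<close>

definition path_code :: "'v \<times> 'e list \<Rightarrow> nat" where
  "path_code = to_nat_on (paths E)"

lemma inj_path_code: "inj_on path_code (paths E)"
proof -
  have "paths E \<subseteq> verts E \<times> lists (arcs E)"
  proof
    fix \<mu> assume "\<mu> \<in> paths E"
    obtain v es where \<mu>: "\<mu> = (v, es)" by (cases \<mu>)
    have "(v, es) \<in> paths E \<Longrightarrow> es \<in> lists (arcs E)" by (induction es arbitrary: v) (auto simp: paths_Cons)
    then show "\<mu> \<in> verts E \<times> lists (arcs E)"
      using \<open>\<mu> \<in> paths E\<close> path_fst_in_verts[OF fin_digraph, of \<mu>] \<mu> by auto
  qed
  moreover have "countable (verts E \<times> lists (arcs E))"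
    by (intro countable_SIGMA countable_lists uncountable_infinite countable_finite) auto
  ultimately have "countable (paths E)" using countable_subset by blast
  then show ?thesis unfolding path_code_def by (rule inj_on_to_nat_on)
qed

lemma path_code_eq_iff: "\<mu> \<in> paths E \<Longrightarrow> \<nu> \<in> paths E \<Longrightarrow> path_code \<mu> = path_code \<nu> \<longleftrightarrow> \<mu> = \<nu>"
  using inj_path_code by (auto simp: inj_on_def)

definition lift_map :: "('v \<times> 'e list \<Rightarrow> ('v \<times> 'e list) option) \<Rightarrow> nat \<Rightarrow> nat option" where
  "lift_map h n = (if n \<in> path_code ` paths E then map_option path_code (h (inv_into (paths E) path_code n)) else None)"

definition path_map :: "('v \<times> 'e list \<Rightarrow> ('v \<times> 'e list) option) \<Rightarrow> bool" where
  "path_map h \<longleftrightarrow> (\<forall>\<mu> \<nu>. h \<mu> = Some \<nu> \<longrightarrow> \<mu> \<in> paths E \<and> \<nu> \<in> paths E)"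

lemma lift_map_code: "\<mu> \<in> paths E \<Longrightarrow> lift_map h (path_code \<mu>) = map_option path_code (h \<mu>)"
  using inv_into_f_f[OF inj_path_code] by (simp add: lift_map_def)

lemma lift_map_eq_Some:
  assumes "path_map h"
  shows "lift_map h i = Some j \<longleftrightarrow> (\<exists>\<mu> \<nu>. i = path_code \<mu> \<and> j = path_code \<nu> \<and> h \<mu> = Some \<nu>)"
proof
  assume "lift_map h i = Some j"
  then obtain \<mu> where "\<mu> \<in> paths E" "i = path_code \<mu>" by (auto simp: lift_map_def split: if_splits)
  moreover from this \<open>lift_map h i = Some j\<close> obtain \<nu> where "h \<mu> = Some \<nu>" "j = path_code \<nu>"
    by (auto simp: lift_map_code)
  ultimately show "\<exists>\<mu> \<nu>. i = path_code \<mu> \<and> j = path_code \<nu> \<and> h \<mu> = Some \<nu>" by blast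
next
  assume "\<exists>\<mu> \<nu>. i = path_code \<mu> \<and> j = path_code \<nu> \<and> h \<mu> = Some \<nu>"
  then show "lift_map h i = Some j" using assms by (auto simp: path_map_def lift_map_code)
qed

lemma inverse_maps_lift:
  assumes "inverse_maps h k" "path_map h"
  shows "inverse_maps (lift_map h) (lift_map k)"
proof -
  have "path_map k" using assms by (auto simp: inverse_maps_def path_map_def)
  then show ?thesis using assms by (auto simp: inverse_maps_def lift_map_eq_Some)
qed

lemma bind_lift_map:
  assumes "path_map h" "path_map k"
  shows "(\<lambda>n. Option.bind (lift_map h n) (lift_map k)) = lift_map (\<lambda>\<mu>. Option.bind (h \<mu>) k)"
proof
  fix n
  show "Option.bind (lift_map h n) (lift_map k) = lift_map (\<lambda>\<mu>. Option.bind (h \<mu>) k) n"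
  proof (cases "n \<in> path_code ` paths E")
    case True
    then obtain \<mu> where \<mu>: "\<mu> \<in> paths E" "n = path_code \<mu>" by auto
    show ?thesis
    proof (cases "h \<mu>")
      case (Some \<nu>)
      then have "\<nu> \<in> paths E" using assms(1) unfolding path_map_def by blast
      then show ?thesis using Some \<mu> by (simp add: lift_map_code)
    qed (use \<mu> in \<open>simp add: lift_map_code\<close>)
  qed (simp add: lift_map_def)
qed

definition path_operator :: "('v \<times> 'e list \<Rightarrow> ('v \<times> 'e list) option) \<Rightarrow> nat operator" where
  "path_operator h = shift_operator (lift_map h)"

lemma path_operator_bounded:
  assumes "inverse_maps h k" "path_map h"
  shows "path_operator h \<in> bounded_operators" "operator_adjoint (path_operator h) = path_operator k"
  using shift_operator_bounded[OF inverse_maps_lift[OF assms]] by (auto simp: path_operator_def)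

lemma path_operator_mult:
  assumes "inverse_maps k k'" "path_map h" "path_map k"
  shows "path_operator h \<otimes>\<^bsub>l2_operators\<^esub> path_operator k = path_operator (\<lambda>\<mu>. Option.bind (h \<mu>) k)"
  unfolding path_operator_def shift_operator_mult[OF inverse_maps_lift[OF assms(1,3)]] bind_lift_map[OF assms(2,3)] ..

lemma path_operator_apply:
  "x \<in> l2 \<Longrightarrow> \<mu> \<in> paths E \<Longrightarrow> path_operator h x (path_code \<mu>) = (case h \<mu> of None \<Rightarrow> 0 | Some \<nu> \<Rightarrow> x (path_code \<nu>))"
  by (simp add: path_operator_def shift_operator_def lift_map_code option.case_eq_if map_option_case)

lemma path_operator_apply_outside: "n \<notin> path_code ` paths E \<Longrightarrow> path_operator h x n = 0"
  by (simp add: path_operator_def shift_operator_def lift_map_def)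

definition vertex_map :: "'v \<Rightarrow> 'v \<times> 'e list \<Rightarrow> ('v \<times> 'e list) option" where
  "vertex_map v \<mu> = (if \<mu> \<in> paths E \<and> fst \<mu> = v then Some \<mu> else None)"

definition remove_edge :: "'e \<Rightarrow> 'v \<times> 'e list \<Rightarrow> ('v \<times> 'e list) option" where
  "remove_edge e \<mu> = (if \<mu> \<in> paths E \<and> snd \<mu> \<noteq> [] \<and> hd (snd \<mu>) = e then Some (tail E e, tl (snd \<mu>)) else None)"

definition add_edge :: "'e \<Rightarrow> 'v \<times> 'e list \<Rightarrow> ('v \<times> 'e list) option" where
  "add_edge e \<mu> = (if e \<in> arcs E \<and> \<mu> \<in> paths E \<and> fst \<mu> = tail E e then Some (head E e, e # snd \<mu>) else None)"

lemma vertex_map: "inverse_maps (vertex_map v) (vertex_map v)" "path_map (vertex_map v)"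
  by (auto simp: inverse_maps_def path_map_def vertex_map_def)

lemma remove_add: "inverse_maps (remove_edge e) (add_edge e)" "path_map (remove_edge e)" "path_map (add_edge e)"
proof -
  have iff: "remove_edge e \<mu> = Some \<nu> \<longleftrightarrow> e \<in> arcs E \<and> \<nu> \<in> paths E \<and> fst \<nu> = tail E e \<and> \<mu> = (head E e, e # snd \<nu>)" for \<mu> \<nu>
  proof (cases \<mu>)
    case (Pair v es)
    then show ?thesis by (cases es; cases \<nu>) (auto simp: remove_edge_def paths_Cons)
  qed
  show "inverse_maps (remove_edge e) (add_edge e)"
    unfolding inverse_maps_def iff by (auto simp: add_edge_def)
  show "path_map (remove_edge e)" "path_map (add_edge e)"
    unfolding path_map_def iff by (auto simp: add_edge_def paths_Cons)
qed

lemma add_remove: "inverse_maps (add_edge e) (remove_edge e)"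
  by (rule inverse_maps_sym[OF remove_add(1)])

definition vertex_op :: "'v \<Rightarrow> nat operator" where "vertex_op v = path_operator (vertex_map v)"
definition edge_op :: "'e \<Rightarrow> nat operator" where "edge_op e = path_operator (remove_edge e)"

lemma vertex_op: "vertex_op v \<in> bounded_operators" "operator_adjoint (vertex_op v) = vertex_op v"
  unfolding vertex_op_def by (rule path_operator_bounded[OF vertex_map])+

lemma edge_op: "edge_op e \<in> bounded_operators" "operator_adjoint (edge_op e) = path_operator (add_edge e)"
  unfolding edge_op_def by (rule path_operator_bounded[OF remove_add(1,2)])+

lemma l2_operators_finsum:
  fixes T :: "'i \<Rightarrow> nat operator"
  assumes "finite I" "\<And>i. i \<in> I \<Longrightarrow> T i \<in> bounded_operators"
  shows "(\<Oplus>\<^bsub>l2_operators\<^esub>i\<in>I. T i) x n = (\<Sum>i\<in>I. T i x n)"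
proof -
  interpret B: cstar_algebra "l2_operators :: nat operator cstar" by (rule cstar_algebra_l2_operators)
  show ?thesis
    using assms
  proof (induction I rule: finite_induct)
    case (insert i I)
    have TI: "T \<in> I \<rightarrow> carrier l2_operators" "T i \<in> carrier l2_operators" using insert.prems by auto
    show ?case unfolding B.finsum_insert[OF insert.hyps TI] using insert by simp
  qed simp
qed

text \<open>
  An edge acts by putting itself in front of a path. Distinct edges have orthogonal ranges,
  and the defect \<open>p\<^sub>v - \<Sum> s\<^sub>e s\<^sub>e\<^sup>*\<close> is the projection to the path of length 0 at \<open>v\<close>.
\<close>

lemma toeplitz_family_path_space: "toeplitz_family E (l2_operators :: nat operator cstar) vertex_op edge_op"
proof -
  interpret B: cstar_algebra "l2_operators :: nat operator cstar" by (rule cstar_algebra_l2_operators)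
  have range_op: "edge_op e \<otimes>\<^bsub>l2_operators\<^esub> operator_adjoint (edge_op e)
      = path_operator (\<lambda>\<mu>. Option.bind (remove_edge e \<mu>) (add_edge e))" for e
    unfolding edge_op unfolding edge_op_def by (rule path_operator_mult[OF add_remove remove_add(2,3)])
  have range_map: "Option.bind (remove_edge e \<mu>) (add_edge e) =
      (if \<mu> \<in> paths E \<and> snd \<mu> \<noteq> [] \<and> hd (snd \<mu>) = e then Some \<mu> else None)" for e \<mu>
    by (cases \<mu>; cases "snd \<mu>") (auto simp: remove_edge_def add_edge_def paths_Cons)
  have pm: "path_map (\<lambda>\<mu>. Option.bind (remove_edge e \<mu>) (add_edge e))" for e
    unfolding range_map by (auto simp: path_map_def)
  show ?thesis unfolding toeplitz_family_def
  proof (intro conjI ballI impI)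
    fix v assume v: "v \<in> verts E"
    have "vertex_op v \<otimes>\<^bsub>l2_operators\<^esub> vertex_op v = path_operator (\<lambda>\<mu>. Option.bind (vertex_map v \<mu>) (vertex_map v))"
      unfolding vertex_op_def by (rule path_operator_mult[OF vertex_map(1) vertex_map(2) vertex_map(2)])
    also have "(\<lambda>\<mu>. Option.bind (vertex_map v \<mu>) (vertex_map v)) = vertex_map v"
      by (auto simp: vertex_map_def fun_eq_iff)
    finally show "is_projection l2_operators (vertex_op v)"
      by (auto simp: is_projection_def vertex_op vertex_op_def[symmetric])
    fix w assume "w \<in> verts E" "v \<noteq> w"
    have "vertex_op v \<otimes>\<^bsub>l2_operators\<^esub> vertex_op w = path_operator (\<lambda>\<mu>. Option.bind (vertex_map v \<mu>) (vertex_map w))"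
      unfolding vertex_op_def by (rule path_operator_mult[OF vertex_map(1) vertex_map(2) vertex_map(2)])
    also have "(\<lambda>\<mu>. Option.bind (vertex_map v \<mu>) (vertex_map w)) = (\<lambda>_. None)"
      using \<open>v \<noteq> w\<close> by (auto simp: vertex_map_def fun_eq_iff)
    also have "path_operator (\<lambda>_. None) = \<zero>\<^bsub>l2_operators\<^esub>"
      by (auto simp: path_operator_def shift_operator_def lift_map_def fun_eq_iff)
    finally show "vertex_op v \<otimes>\<^bsub>l2_operators\<^esub> vertex_op w = \<zero>\<^bsub>l2_operators\<^esub>" .
  next
    fix e assume e: "e \<in> arcs E"
    have "edge_op e \<otimes>\<^bsub>l2_operators\<^esub> operator_adjoint (edge_op e) \<otimes>\<^bsub>l2_operators\<^esub> edge_op e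
      = path_operator (\<lambda>\<mu>. Option.bind (Option.bind (remove_edge e \<mu>) (add_edge e)) (remove_edge e))"
      unfolding range_op unfolding edge_op_def by (rule path_operator_mult[OF remove_add(1) pm remove_add(2)])
    also have "(\<lambda>\<mu>. Option.bind (Option.bind (remove_edge e \<mu>) (add_edge e)) (remove_edge e)) = remove_edge e"
      unfolding range_map by (auto simp: fun_eq_iff remove_edge_def)
    finally show "is_partial_isometry l2_operators (edge_op e)"
      using edge_op(1) by (simp add: is_partial_isometry_def edge_op_def[symmetric] del: l2_operators_simps(2))
    have "operator_adjoint (edge_op e) \<otimes>\<^bsub>l2_operators\<^esub> edge_op e
      = path_operator (\<lambda>\<mu>. Option.bind (add_edge e \<mu>) (remove_edge e))"
      unfolding edge_op unfolding edge_op_def by (rule path_operator_mult[OF remove_add(1) remove_add(3) remove_add(2)])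
    also have "(\<lambda>\<mu>. Option.bind (add_edge e \<mu>) (remove_edge e)) = vertex_map (tail E e)"
      using e by (auto simp: fun_eq_iff add_edge_def remove_edge_def vertex_map_def paths_Cons)
    finally show "adj l2_operators (edge_op e) \<otimes>\<^bsub>l2_operators\<^esub> edge_op e = vertex_op (tail E e)"
      by (simp add: vertex_op_def)
  next
    fix v assume v: "v \<in> verts E"
    let ?I = "edges_into E v"
    let ?S = "\<Oplus>\<^bsub>l2_operators\<^esub>e\<in>?I. edge_op e \<otimes>\<^bsub>l2_operators\<^esub> adj l2_operators (edge_op e)"
    define q where "q = (\<lambda>\<mu>. if \<mu> = (v, []) then Some \<mu> else None :: ('v \<times> 'e list) option)"
    define c where "c = path_operator q"
    have q: "inverse_maps q q" "path_map q" using v by (auto simp: q_def inverse_maps_def path_map_def)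
    have c: "c \<in> bounded_operators" "operator_adjoint c = c"
      unfolding c_def by (rule path_operator_bounded[OF q])+
    have "c \<otimes>\<^bsub>l2_operators\<^esub> c = path_operator (\<lambda>\<mu>. Option.bind (q \<mu>) q)"
      unfolding c_def by (rule path_operator_mult[OF q(1) q(2) q(2)])
    also have "(\<lambda>\<mu>. Option.bind (q \<mu>) q) = q" by (auto simp: q_def fun_eq_iff)
    finally have cc: "c \<otimes>\<^bsub>l2_operators\<^esub> c = c" by (simp add: c_def)
    have rb: "edge_op e \<otimes>\<^bsub>l2_operators\<^esub> adj l2_operators (edge_op e) \<in> carrier l2_operators" for e
      using edge_op(1) B.star_closed[of "edge_op e"] by (intro B.m_closed) auto
    have S: "?S \<in> carrier l2_operators" using rb by (intro B.finsum_closed) auto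
    have "vertex_op v x n = c x n + ?S x n" if x: "x \<in> l2" for x n
    proof -
      have Sx: "?S x n = (\<Sum>e\<in>?I. path_operator (\<lambda>\<mu>. Option.bind (remove_edge e \<mu>) (add_edge e)) x n)"
        using rb by (subst l2_operators_finsum) (simp_all add: range_op[unfolded l2_operators_simps])
      show ?thesis
      proof (cases "n \<in> path_code ` paths E")
        case True
        then obtain u es where \<mu>: "(u, es) \<in> paths E" "n = path_code (u, es)" by auto
        have "?S x n = (\<Sum>e\<in>?I. if es \<noteq> [] \<and> hd es = e then x n else 0)"
          unfolding Sx unfolding \<mu>(2) path_operator_apply[OF x \<mu>(1)] range_map using \<mu>(1) by (intro sum.cong) auto
        also have "\<dots> = (if es \<noteq> [] \<and> u = v then x n else 0)"
        proof (cases es)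
          case (Cons f fs)
          then have "f \<in> arcs E" "head E f = u" using \<mu>(1) by (auto simp: paths_Cons)
          then show ?thesis using Cons by (auto simp: sum.delta)
        qed simp
        finally have 1: "?S x n = (if es \<noteq> [] \<and> u = v then x n else 0)" .
        have 2: "vertex_op v x n = (if u = v then x n else 0)" "c x n = (if (u, es) = (v, []) then x n else 0)"
          unfolding vertex_op_def c_def \<mu>(2) path_operator_apply[OF x \<mu>(1)] using \<mu>(1)
          by (auto simp: vertex_map_def q_def)
        show ?thesis unfolding 1 2 by auto
      next
        case False
        then show ?thesis unfolding Sx by (simp add: vertex_op_def c_def path_operator_apply_outside)
      qed
    qed
    then have "vertex_op v x = (c \<oplus>\<^bsub>l2_operators\<^esub> ?S) x" if "x \<in> l2" for x using that by (simp add: fun_eq_iff)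
    then have "vertex_op v = c \<oplus>\<^bsub>l2_operators\<^esub> ?S"
      using vertex_op(1)[of v] B.add.m_closed[of c ?S] c S by (intro bounded_operators_eqI) auto
    then have "vertex_op v \<ominus>\<^bsub>l2_operators\<^esub> ?S = c \<oplus>\<^bsub>l2_operators\<^esub> ?S \<oplus>\<^bsub>l2_operators\<^esub> \<ominus>\<^bsub>l2_operators\<^esub> ?S"
      by (simp only: a_minus_def)
    also have "\<dots> = c \<oplus>\<^bsub>l2_operators\<^esub> (?S \<oplus>\<^bsub>l2_operators\<^esub> \<ominus>\<^bsub>l2_operators\<^esub> ?S)"
      by (rule B.a_assoc[OF _ S B.a_inv_closed[OF S]]) (simp add: c)
    also have "\<dots> = c" unfolding B.r_neg[OF S] by (rule B.r_zero) (simp add: c)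
    finally have "vertex_op v \<ominus>\<^bsub>l2_operators\<^esub> ?S = c" .
    also have "\<dots> = adj l2_operators c \<otimes>\<^bsub>l2_operators\<^esub> c" using c cc by simp
    finally show "cstar_le l2_operators ?S (vertex_op v)"
      unfolding cstar_le_def using c by (intro bexI[of _ c]) auto
  qed
qed

end


section \<open>Functionals from subinvariant vectors\<close>

context toeplitz
begin

sublocale path_space E by unfold_locales

text \<open>The action of \<open>s\<^sub>\<kappa>\<^sup>*\<close> on the path basis.\<close>

definition strip :: "'v \<times> 'e list \<Rightarrow> 'v \<times> 'e list \<Rightarrow> ('v \<times> 'e list) option" where
  "strip \<kappa> \<mu> = (if fst \<kappa> = fst \<mu> \<and> prefix (snd \<kappa>) (snd \<mu>)
     then Some (src \<kappa>, drop (length (snd \<kappa>)) (snd \<mu>)) else None)"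

lemma strip_in_paths:
  "(v, es) \<in> paths E \<Longrightarrow> (u, fs) \<in> paths E \<Longrightarrow> strip (v, es) (u, fs) = Some \<nu> \<Longrightarrow> \<nu> \<in> paths E"
proof (induction es arbitrary: v u fs)
  case Nil
  then show ?case by (auto simp: strip_def split: if_splits)
next
  case (Cons e es)
  then obtain gs where gs: "fs = e # gs" "u = v" "prefix es gs" by (auto simp: strip_def split: if_splits elim: prefixE)
  then have "strip (tail E e, es) (tail E e, gs) = Some \<nu>" using Cons.prems(3) by (auto simp: strip_def split: if_splits)
  then show ?case using Cons gs by (auto simp: paths_Cons)
qed

lemma strip_eq_imp_eq:
  assumes "strip \<kappa> \<mu> = Some \<nu>" "strip \<xi> \<mu> = Some \<nu>" shows "\<kappa> = \<xi>"
proof -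
  have *: "fst \<kappa> = fst \<mu>" "fst \<xi> = fst \<mu>" "prefix (snd \<kappa>) (snd \<mu>)" "prefix (snd \<xi>) (snd \<mu>)"
    "drop (length (snd \<kappa>)) (snd \<mu>) = drop (length (snd \<xi>)) (snd \<mu>)"
    using assms by (auto simp: strip_def split: if_splits)
  then have le: "length (snd \<kappa>) \<le> length (snd \<mu>)" "length (snd \<xi>) \<le> length (snd \<mu>)"
    by (auto dest: prefix_length_le)
  have "length (snd \<mu>) - length (snd \<kappa>) = length (snd \<mu>) - length (snd \<xi>)"
    using arg_cong[OF *(5), of length] by simp
  then have len: "length (snd \<kappa>) = length (snd \<xi>)" using le by simp
  have "snd \<kappa> = take (length (snd \<kappa>)) (snd \<mu>)" using *(3) by (auto elim!: prefixE)
  moreover have "snd \<xi> = take (length (snd \<xi>)) (snd \<mu>)" using *(4) by (auto elim!: prefixE)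
  ultimately have "snd \<kappa> = snd \<xi>" using len by metis
  with * show ?thesis by (simp add: prod_eq_iff)
qed

context
  fixes h :: "'a \<Rightarrow> nat operator"
  assumes hom: "star_hom A l2_operators h"
    and h_p: "\<And>v. v \<in> verts E \<Longrightarrow> h (p v) = vertex_op v"
    and h_s: "\<And>e. e \<in> arcs E \<Longrightarrow> h (s e) = edge_op e"
begin

definition coefficient :: "'v \<times> 'e list \<Rightarrow> 'a \<Rightarrow> complex" where
  "coefficient \<mu> a = h a (l2unit (path_code \<mu>)) (path_code \<mu>)"

lemma h_bounded: "a \<in> carrier A \<Longrightarrow> h a \<in> bounded_operators"
  using hom by (auto simp: star_hom_def)

lemma h_mult: "a \<in> carrier A \<Longrightarrow> b \<in> carrier A \<Longrightarrow> h (a \<otimes> b) = (\<lambda>x. h a (h b x))"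
  using hom by (simp add: star_hom_def)

lemma h_star: "a \<in> carrier A \<Longrightarrow> h (adj A a) = operator_adjoint (h a)"
  using hom by (simp add: star_hom_def)

lemma coefficient_inner:
  assumes "a \<in> carrier A" "b \<in> carrier A"
  shows "coefficient \<mu> (adj A a \<otimes> b) = l2inner (h a (l2unit (path_code \<mu>))) (h b (l2unit (path_code \<mu>)))"
proof -
  let ?e = "l2unit (path_code \<mu>)"
  have "coefficient \<mu> (adj A a \<otimes> b) = l2inner ?e (operator_adjoint (h a) (h b ?e))"
    using assms by (simp add: coefficient_def h_mult h_star l2inner_unit)
  also have "\<dots> = l2inner (h a ?e) (h b ?e)"
    by (intro op_inner[symmetric] h_bounded assms l2unit_mem op_l2(1)[OF h_bounded[OF assms(2)]])
  finally show ?thesis .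
qed

lemma coefficient_positive: "positive_functional (coefficient \<mu>)"
  unfolding positive_functional_def
proof (intro conjI ballI allI)
  fix a assume a: "a \<in> carrier A"
  show "coefficient \<mu> (c \<odot> a) = c * coefficient \<mu> a" for c
    using hom a by (simp add: star_hom_def coefficient_def)
  have "coefficient \<mu> (adj A a \<otimes> a) = of_real ((l2norm (h a (l2unit (path_code \<mu>))))\<^sup>2)"
    unfolding coefficient_inner[OF a a] by (intro l2inner_self op_l2(1)[OF h_bounded[OF a]] l2unit_mem)
  then show "coefficient \<mu> (adj A a \<otimes> a) \<in> \<real>" "0 \<le> Re (coefficient \<mu> (adj A a \<otimes> a))" by simp_all
  show "coefficient \<mu> (a \<oplus> b) = coefficient \<mu> a + coefficient \<mu> b" if "b \<in> carrier A" for b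
    using hom a that by (simp add: star_hom_def coefficient_def)
qed

lemma h_star_pe_unit:
  assumes "(v, es) \<in> paths E" "(u, fs) \<in> paths E"
  shows "h (adj A (pe (v, es))) (l2unit (path_code (u, fs))) =
    (case strip (v, es) (u, fs) of None \<Rightarrow> (\<lambda>_. 0) | Some \<nu> \<Rightarrow> l2unit (path_code \<nu>))"
  using assms
proof (induction es arbitrary: v u fs)
  case Nil
  then have v: "v \<in> verts E" by simp
  have "h (adj A (pe (v, []))) = path_operator (vertex_map v)"
    using v by (simp add: p_facts h_p vertex_op_def)
  moreover have "lift_map (vertex_map v) (path_code (u, fs)) = (if u = v then Some (path_code (u, fs)) else None)"
    using Nil.prems by (simp add: lift_map_code vertex_map_def)
  ultimately show ?case
    using shift_operator_unit[OF inverse_maps_lift[OF vertex_map], of v "path_code (u, fs)"]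
    by (auto simp: path_operator_def strip_def)
next
  case (Cons e es)
  then have e: "e \<in> arcs E" "(tail E e, es) \<in> paths E" "head E e = v" by (auto simp: paths_Cons)
  let ?x = "l2unit (path_code (u, fs))"
  have "h (adj A (pe (v, e # es))) ?x = h (adj A (pe (tail E e, es))) (h (adj A (s e)) ?x)"
    using Cons.prems e by (simp add: pe_Cons star_mult h_mult)
  also have "h (adj A (s e)) = path_operator (add_edge e)"
    using e edge_op(2)[of e] by (simp add: h_star h_s)
  also have "path_operator (add_edge e) ?x = (case lift_map (remove_edge e) (path_code (u, fs)) of None \<Rightarrow> (\<lambda>_. 0) | Some j \<Rightarrow> l2unit j)"
    unfolding path_operator_def by (rule shift_operator_unit[OF inverse_maps_lift[OF remove_add(1,2)]])
  also have "lift_map (remove_edge e) (path_code (u, fs)) = map_option path_code (remove_edge e (u, fs))"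
    by (rule lift_map_code[OF Cons.prems(2)])
  finally have step: "h (adj A (pe (v, e # es))) ?x = h (adj A (pe (tail E e, es)))
     (case map_option path_code (remove_edge e (u, fs)) of None \<Rightarrow> (\<lambda>_. 0) | Some j \<Rightarrow> l2unit j)" .
  have zero: "h (adj A (pe (tail E e, es))) (\<lambda>_. 0) = (\<lambda>_. 0)"
    by (rule op_zero[OF h_bounded]) (use e in simp)
  show ?case
  proof (cases "\<exists>gs. fs = e # gs")
    case True
    then obtain gs where gs: "fs = e # gs" by auto
    then have t: "(tail E e, gs) \<in> paths E" "u = v" using Cons.prems(2) e by (auto simp: paths_Cons)
    have "h (adj A (pe (v, e # es))) ?x = h (adj A (pe (tail E e, es))) (l2unit (path_code (tail E e, gs)))"
      unfolding step using gs Cons.prems(2) by (simp add: remove_edge_def)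
    also have "\<dots> = (case strip (tail E e, es) (tail E e, gs) of None \<Rightarrow> (\<lambda>_. 0) | Some \<nu> \<Rightarrow> l2unit (path_code \<nu>))"
      by (rule Cons.IH[OF e(2) t(1)])
    also have "strip (tail E e, es) (tail E e, gs) = strip (v, e # es) (u, fs)"
      using gs t by (simp add: strip_def)
    finally show ?thesis .
  next
    case False
    then have "remove_edge e (u, fs) = None" by (cases fs) (auto simp: remove_edge_def)
    moreover have "strip (v, e # es) (u, fs) = None" using False by (cases fs) (auto simp: strip_def)
    ultimately show ?thesis unfolding step by (simp add: zero)
  qed
qed

text \<open>The vector state of the path \<open>\<mu>\<close> sees whether \<open>\<kappa>\<close> is an initial part of \<open>\<mu>\<close>.\<close>

lemma coefficient_sig:
  assumes "\<kappa> \<in> paths E" "\<xi> \<in> paths E" "\<mu> \<in> paths E"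
  shows "coefficient \<mu> (sig \<kappa> \<xi>) = (if \<kappa> = \<xi> \<and> strip \<kappa> \<mu> \<noteq> None then 1 else 0)"
proof -
  have st: "h (adj A (pe \<kappa>)) (l2unit (path_code \<mu>)) =
    (case strip \<kappa> \<mu> of None \<Rightarrow> (\<lambda>_. 0) | Some \<nu> \<Rightarrow> l2unit (path_code \<nu>))" if "\<kappa> \<in> paths E" for \<kappa>
    using h_star_pe_unit[of "fst \<kappa>" "snd \<kappa>" "fst \<mu>" "snd \<mu>"] that assms(3) by simp
  have "coefficient \<mu> (sig \<kappa> \<xi>) = l2inner (h (adj A (pe \<kappa>)) (l2unit (path_code \<mu>))) (h (adj A (pe \<xi>)) (l2unit (path_code \<mu>)))"
    using coefficient_inner[of "adj A (pe \<kappa>)" "adj A (pe \<xi>)" \<mu>] assms by (simp add: sig_def)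
  also have "\<dots> = (if \<kappa> = \<xi> \<and> strip \<kappa> \<mu> \<noteq> None then 1 else 0)"
  proof (cases "strip \<kappa> \<mu>")
    case None
    then show ?thesis unfolding st[OF assms(1)] by (simp add: l2inner_def)
  next
    case (Some \<nu>)
    then have \<nu>: "\<nu> \<in> paths E" using strip_in_paths[of "fst \<kappa>" "snd \<kappa>" "fst \<mu>" "snd \<mu>"] assms by simp
    show ?thesis
    proof (cases "strip \<xi> \<mu>")
      case None
      then show ?thesis unfolding st[OF assms(1)] st[OF assms(2)] using Some by (auto simp: l2inner_def)
    next
      case (Some \<nu>')
      then have \<nu>': "\<nu>' \<in> paths E" using strip_in_paths[of "fst \<xi>" "snd \<xi>" "fst \<mu>" "snd \<mu>"] assms by simp
      have "\<nu> = \<nu>' \<longleftrightarrow> \<kappa> = \<xi>" using strip_eq_imp_eq[of \<kappa> \<mu> \<nu> \<xi>] \<open>strip \<kappa> \<mu> = Some \<nu>\<close> Some by auto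
      moreover have "l2inner (l2unit (path_code \<nu>)) (l2unit (path_code \<nu>')) = (if \<nu> = \<nu>' then 1 else 0)"
        unfolding l2inner_unit using \<nu> \<nu>' by (simp add: l2unit_def path_code_eq_iff)
      ultimately show ?thesis unfolding st[OF assms(1)] st[OF assms(2)] using Some \<open>strip \<kappa> \<mu> = Some \<nu>\<close> by simp
    qed
  qed
  finally show ?thesis .
qed

context
  fixes r :: real and m :: "'v \<Rightarrow> real"
  assumes r: "0 < r" and m: "\<And>v. v \<in> verts E \<Longrightarrow> 0 \<le> m v"
    and sub: "\<And>v. v \<in> verts E \<Longrightarrow> (\<Sum>e\<in>edges_into E v. m (tail E e)) \<le> r * m v"
begin

definition defect :: "'v \<Rightarrow> real" where
  "defect v = m v - inverse r * (\<Sum>e\<in>edges_into E v. m (tail E e))"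

lemma defect_nonneg: "v \<in> verts E \<Longrightarrow> 0 \<le> defect v"
  using sub[of v] r by (simp add: defect_def field_simps)

text \<open>
  The tree of all extensions of \<open>\<xi>\<close> by at most \<open>k\<close> edges: an extension by \<open>n < k\<close> edges carries the
  weight \<open>r\<^sup>-\<^sup>n\<close> times the defect of subinvariance at its source, and an extension by \<open>k\<close> edges carries
  \<open>r\<^sup>-\<^sup>k\<close> times \<open>m\<close> at its source, so that the total weight is \<open>m\<close> at the source of \<open>\<xi>\<close> for every \<open>k\<close>.
\<close>

primrec tree_functional :: "nat \<Rightarrow> 'v \<times> 'e list \<Rightarrow> 'a \<Rightarrow> complex" where
  "tree_functional 0 \<xi> a = of_real (m (src \<xi>)) * coefficient \<xi> a"
| "tree_functional (Suc k) \<xi> a = of_real (defect (src \<xi>)) * coefficient \<xi> a +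
     of_real (inverse r) * (\<Sum>e\<in>{e \<in> arcs E. head E e = src \<xi>}. tree_functional k (fst \<xi>, snd \<xi> @ [e]) a)"

lemma positive_functional_sum:
  assumes "finite I" "\<And>i. i \<in> I \<Longrightarrow> positive_functional (\<phi> i)"
  shows "positive_functional (\<lambda>a. \<Sum>i\<in>I. \<phi> i a)"
  using assms unfolding positive_functional_def
  by (auto simp: sum.distrib sum_distrib_left intro!: sum_in_Reals sum_nonneg)

lemma tree_functional_positive: "\<xi> \<in> paths E \<Longrightarrow> positive_functional (tree_functional k \<xi>)"
proof (induction k arbitrary: \<xi>)
  case 0
  then have "src \<xi> \<in> verts E" using path_source_in_verts[of "fst \<xi>" "snd \<xi>"] by simp
  then show ?case using positive_functional_scale_add[OF coefficient_positive coefficient_positive m, of "src \<xi>" 0 \<xi>]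
    by (simp add: fun_eq_iff cong: arg_cong[of _ _ positive_functional])
next
  case (Suc k)
  then have "src \<xi> \<in> verts E" using path_source_in_verts[of "fst \<xi>" "snd \<xi>"] by simp
  moreover have "positive_functional (\<lambda>a. \<Sum>e\<in>{e \<in> arcs E. head E e = src \<xi>}. tree_functional k (fst \<xi>, snd \<xi> @ [e]) a)"
    using Suc paths_snoc[OF fin_digraph, of _ "fst \<xi>" "snd \<xi>"] by (intro positive_functional_sum) auto
  ultimately have "positive_functional (\<lambda>a. of_real (defect (src \<xi>)) * coefficient \<xi> a +
     of_real (inverse r) * (\<Sum>e\<in>{e \<in> arcs E. head E e = src \<xi>}. tree_functional k (fst \<xi>, snd \<xi> @ [e]) a))"
    using defect_nonneg r by (intro positive_functional_scale_add coefficient_positive) auto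
  then show ?case by simp
qed

lemma tree_functional_off_diagonal:
  assumes "\<kappa> \<in> paths E" "\<nu> \<in> paths E" "\<kappa> \<noteq> \<nu>"
  shows "\<xi> \<in> paths E \<Longrightarrow> tree_functional k \<xi> (sig \<kappa> \<nu>) = 0"
proof (induction k arbitrary: \<xi>)
  case (Suc k)
  have "tree_functional k (fst \<xi>, snd \<xi> @ [e]) (sig \<kappa> \<nu>) = 0" if "e \<in> arcs E" "head E e = src \<xi>" for e
    using Suc that paths_snoc[OF fin_digraph that(1), of "fst \<xi>" "snd \<xi>"] by simp
  then show ?case using Suc coefficient_sig[OF assms(1,2)] assms(3) by simp
qed (use coefficient_sig[OF assms(1,2)] assms(3) in simp)

lemma tree_functional_extension:
  assumes "\<kappa> \<in> paths E"
  shows "\<xi> \<in> paths E \<Longrightarrow> fst \<kappa> = fst \<xi> \<Longrightarrow> prefix (snd \<kappa>) (snd \<xi>) \<Longrightarrow>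
    tree_functional k \<xi> (sig \<kappa> \<kappa>) = of_real (m (src \<xi>))"
proof (induction k arbitrary: \<xi>)
  case 0
  then show ?case using coefficient_sig[OF assms assms] by (simp add: strip_def)
next
  case (Suc k)
  have "tree_functional k (fst \<xi>, snd \<xi> @ [e]) (sig \<kappa> \<kappa>) = of_real (m (tail E e))"
    if "e \<in> arcs E" "head E e = src \<xi>" for e
    using Suc.IH[of "(fst \<xi>, snd \<xi> @ [e])"] Suc.prems that paths_snoc[OF fin_digraph that(1), of "fst \<xi>" "snd \<xi>"]
    by (simp add: prefix_prefix)
  moreover have "coefficient \<xi> (sig \<kappa> \<kappa>) = 1" using coefficient_sig[OF assms assms] Suc.prems by (simp add: strip_def)
  ultimately have "tree_functional (Suc k) \<xi> (sig \<kappa> \<kappa>) = of_real (defect (src \<xi>)) +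
      of_real (inverse r) * (\<Sum>e\<in>{e \<in> arcs E. head E e = src \<xi>}. of_real (m (tail E e)))" by simp
  also have "\<dots> = of_real (m (src \<xi>))" by (simp add: defect_def)
  finally show ?case .
qed

lemma tree_functional_incomparable:
  assumes "\<kappa> \<in> paths E"
  shows "\<xi> \<in> paths E \<Longrightarrow> fst \<kappa> \<noteq> fst \<xi> \<or> (\<not> prefix (snd \<kappa>) (snd \<xi>) \<and> \<not> prefix (snd \<xi>) (snd \<kappa>)) \<Longrightarrow>
    tree_functional k \<xi> (sig \<kappa> \<kappa>) = 0"
proof (induction k arbitrary: \<xi>)
  case 0
  then show ?case using coefficient_sig[OF assms assms] by (auto simp: strip_def)
next
  case (Suc k)
  have "tree_functional k (fst \<xi>, snd \<xi> @ [e]) (sig \<kappa> \<kappa>) = 0" if "e \<in> arcs E" "head E e = src \<xi>" for e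
    using Suc.prems that paths_snoc[OF fin_digraph that(1), of "fst \<xi>" "snd \<xi>"]
    by (intro Suc.IH) (auto simp: prefix_snoc dest: append_prefixD)
  moreover have "coefficient \<xi> (sig \<kappa> \<kappa>) = 0" using coefficient_sig[OF assms assms] Suc.prems by (auto simp: strip_def)
  ultimately show ?case by simp
qed

text \<open>
  By descent along \<open>xs\<close>: only the subtree of the next edge contains extensions of the whole
  path, and entering it costs a factor \<open>r\<^sup>-\<^sup>1\<close>.
\<close>

lemma tree_functional_initial:
  "(v, es @ xs) \<in> paths E \<Longrightarrow> (v, es) \<in> paths E \<Longrightarrow> length xs \<le> k \<Longrightarrow>
    tree_functional k (v, es) (sig (v, es @ xs) (v, es @ xs)) = of_real (inverse r ^ length xs * m (src (v, es @ xs)))"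
proof (induction xs arbitrary: es k)
  case Nil
  then show ?case using tree_functional_extension[of "(v, es)" "(v, es)" k] by simp
next
  case (Cons x xs)
  obtain l where k: "k = Suc l" "length xs \<le> l" using Cons.prems by (cases k) auto
  let ?\<kappa> = "(v, es @ x # xs)"
  let ?I = "{e \<in> arcs E. head E e = src (v, es)}"
  have split: "(w, fs @ x # xs) \<in> paths E \<Longrightarrow> x \<in> arcs E \<and> head E x = src (w, fs)" for w fs
    by (induction fs arbitrary: w) (auto simp: paths_Cons)
  have x: "x \<in> ?I" using split[OF Cons.prems(1)] by simp
  have "coefficient (v, es) (sig ?\<kappa> ?\<kappa>) = 0"
    using coefficient_sig[OF Cons.prems(1,1,2)] by (auto simp: strip_def dest: prefix_length_le)
  then have "tree_functional k (v, es) (sig ?\<kappa> ?\<kappa>) = of_real (inverse r) * (\<Sum>e\<in>?I. tree_functional l (v, es @ [e]) (sig ?\<kappa> ?\<kappa>))"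
    using k by simp
  also have "(\<Sum>e\<in>?I. tree_functional l (v, es @ [e]) (sig ?\<kappa> ?\<kappa>))
      = (\<Sum>e\<in>?I. if e = x then tree_functional l (v, es @ [x]) (sig ?\<kappa> ?\<kappa>) else 0)"
  proof (rule sum.cong)
    fix e assume e: "e \<in> ?I"
    have "tree_functional l (v, es @ [e]) (sig ?\<kappa> ?\<kappa>) = 0" if "e \<noteq> x"
      using that e Cons.prems paths_snoc[OF fin_digraph, of e v es]
      by (intro tree_functional_incomparable) (auto dest: prefix_length_le)
    then show "tree_functional l (v, es @ [e]) (sig ?\<kappa> ?\<kappa>) = (if e = x then tree_functional l (v, es @ [x]) (sig ?\<kappa> ?\<kappa>) else 0)" by simp
  qed simp
  also have "\<dots> = tree_functional l (v, es @ [x]) (sig ?\<kappa> ?\<kappa>)" using x by (simp add: sum.delta)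
  also have "\<dots> = of_real (inverse r ^ length xs * m (src ?\<kappa>))"
    using Cons.IH[of "es @ [x]" l] k x Cons.prems paths_snoc[OF fin_digraph, of x v es] by simp
  finally show ?case by simp
qed

definition level_functional :: "nat \<Rightarrow> 'a \<Rightarrow> complex" where
  "level_functional k a = (\<Sum>v\<in>verts E. tree_functional k (v, []) a)"

lemma level_functional_positive: "positive_functional (level_functional k)"
  using positive_functional_sum[OF E.finite_verts, of "\<lambda>v. tree_functional k (v, [])"] tree_functional_positive
  by (simp add: level_functional_def[abs_def])

lemma level_functional_sig:
  assumes "\<kappa> \<in> paths E" "\<nu> \<in> paths E" "path_length \<kappa> \<le> k"
  shows "level_functional k (sig \<kappa> \<nu>) = (if \<kappa> = \<nu> then of_real (inverse r ^ path_length \<kappa> * m (src \<kappa>)) else 0)"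
proof (cases "\<kappa> = \<nu>")
  case True
  obtain v es where \<kappa>: "\<kappa> = (v, es)" by (cases \<kappa>)
  have v: "v \<in> verts E" using path_fst_in_verts[OF fin_digraph assms(1)] \<kappa> by simp
  have "level_functional k (sig \<kappa> \<kappa>) = (\<Sum>u\<in>verts E. if u = v then of_real (inverse r ^ path_length \<kappa> * m (src \<kappa>)) else 0)"
    unfolding level_functional_def
  proof (rule sum.cong)
    fix u assume u: "u \<in> verts E"
    show "tree_functional k (u, []) (sig \<kappa> \<kappa>) = (if u = v then of_real (inverse r ^ path_length \<kappa> * m (src \<kappa>)) else 0)"
      using tree_functional_incomparable[OF assms(1), of "(u, [])" k] tree_functional_initial[of v "[]" es k] u v assms \<kappa> by auto
  qed simp
  then show ?thesis using True v by (simp add: sum.delta)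
next
  case False
  then show ?thesis using tree_functional_off_diagonal[OF assms(1,2)] by (simp add: level_functional_def)
qed

lemma level_functional_one: "level_functional k \<one> = of_real (\<Sum>v\<in>verts E. m v)"
proof -
  have "level_functional k (p v) = of_real (m v)" if "v \<in> verts E" for v
    using level_functional_sig[of "(v, [])" "(v, [])" k] that p_facts[OF that] by (simp add: sig_def)
  then show ?thesis by (simp add: pos_one_eq_sum[OF level_functional_positive])
qed

text \<open>
  The values on each \<open>s\<^sub>\<mu> s\<^sub>\<nu>\<^sup>*\<close> are eventually constant, and the functionals have the same
  norm.
\<close>

lemma level_functional_convergent:
  assumes a: "a \<in> carrier A" shows "convergent (\<lambda>k. level_functional k a)"
proof -
  define M where "M = (\<Sum>v\<in>verts E. m v)"
  have M: "0 \<le> M" unfolding M_def by (intro sum_nonneg m)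
  have span: "Cauchy (\<lambda>k. level_functional k y)" if "y \<in> tspan" for y
  proof -
    have "convergent (\<lambda>k. level_functional k y)" using that
    proof (induction rule: tspan.induct)
      case zero
      show ?case by (simp add: pos_zero[OF level_functional_positive] convergent_const)
    next
      case (add \<mu> \<nu> x c)
      let ?v = "if \<mu> = \<nu> then complex_of_real (inverse r ^ path_length \<mu> * m (src \<mu>)) else 0"
      have "eventually (\<lambda>k. level_functional k (sig \<mu> \<nu>) = ?v) sequentially"
        using add level_functional_sig unfolding eventually_sequentially by blast
      then have "(\<lambda>k. level_functional k (sig \<mu> \<nu>)) \<longlonglongrightarrow> ?v" by (rule tendsto_eventually)
      then have "convergent (\<lambda>k. c * level_functional k (sig \<mu> \<nu>))"
        unfolding convergent_def using tendsto_mult_left by blast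
      then show ?case using add convergent_add
        by (simp add: pos_add[OF level_functional_positive] pos_scal[OF level_functional_positive])
    qed
    then show ?thesis by (rule convergent_Cauchy)
  qed
  have "Cauchy (\<lambda>k. level_functional k a)"
  proof (rule CauchyI)
    fix d :: real assume d: "0 < d"
    obtain Y where Y: "\<And>n. Y n \<in> tspan" "tends Y a" using tspan_dense[OF a] by auto
    have "eventually (\<lambda>n. cnorm A (Y n \<ominus> a) < d / (3 * (M + 1))) sequentially"
      using Y d M by (intro order_tendstoD(2)) (auto simp: tends_def)
    then obtain y where y: "y \<in> tspan" "cnorm A (y \<ominus> a) < d / (3 * (M + 1))"
      using Y by (auto simp: eventually_sequentially)
    have close: "norm (level_functional k y - level_functional k a) < d / 3" for k
    proof -
      have "norm (level_functional k (y \<ominus> a)) \<le> M * cnorm A (y \<ominus> a)"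
        using pos_bounded[OF level_functional_positive, of "y \<ominus> a" k] y a by (simp add: level_functional_one M_def)
      also have "\<dots> \<le> (M + 1) * cnorm A (y \<ominus> a)" using y a M by (intro mult_right_mono cnorm_nonneg) auto
      also have "\<dots> < (M + 1) * (d / (3 * (M + 1)))" using y M by (intro mult_strict_left_mono) auto
      also have "\<dots> = d / 3"
      proof -
        have "c * (d / (3 * c)) = d / 3" if "c \<noteq> 0" for c :: real using that by simp
        from this[of "M + 1"] M show ?thesis by linarith
      qed
      finally show ?thesis using y a by (simp add: pos_diff[OF level_functional_positive])
    qed
    obtain N where N: "\<And>k l. k \<ge> N \<Longrightarrow> l \<ge> N \<Longrightarrow> norm (level_functional k y - level_functional l y) < d / 3"
      using CauchyD[OF span[OF y(1)], of "d / 3"] d by auto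
    have "norm (level_functional k a - level_functional l a) < d" if "k \<ge> N" "l \<ge> N" for k l
    proof -
      have "level_functional k a - level_functional l a = (level_functional k y - level_functional l y)
         - (level_functional k y - level_functional k a) + (level_functional l y - level_functional l a)" by simp
      also have "norm \<dots> \<le> norm (level_functional k y - level_functional l y)
         + norm (level_functional k y - level_functional k a) + norm (level_functional l y - level_functional l a)"
        by (meson norm_triangle_ineq norm_triangle_ineq4 add_right_mono order_trans)
      finally show ?thesis using N[OF that] close[of k] close[of l] by simp
    qed
    then show "\<exists>N. \<forall>k\<ge>N. \<forall>l\<ge>N. norm (level_functional k a - level_functional l a) < d" by blast
  qed
  then show ?thesis by (simp add: Cauchy_convergent_iff)
qed

lemma kms_values_limit:
  "\<exists>\<phi>. kms_values r m \<phi> \<and> (\<forall>a. a \<notin> carrier A \<longrightarrow> \<phi> a = 0)"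
proof (intro exI conjI)
  let ?\<phi> = "\<lambda>a. if a \<in> carrier A then lim (\<lambda>k. level_functional k a) else 0"
  show "\<forall>a. a \<notin> carrier A \<longrightarrow> ?\<phi> a = 0" by simp
  have lim: "(\<lambda>k. level_functional k a) \<longlonglongrightarrow> ?\<phi> a" if "a \<in> carrier A" for a
    using level_functional_convergent[OF that] that by (simp add: convergent_LIMSEQ_iff)
  have eq: "?\<phi> a = x" if "a \<in> carrier A" "(\<lambda>k. level_functional k a) \<longlonglongrightarrow> x" for a x
    by (rule LIMSEQ_unique[OF lim[OF that(1)] that(2)])
  have "positive_functional ?\<phi>"
    unfolding positive_functional_def
  proof (intro conjI ballI allI)
    fix x assume x: "x \<in> carrier A"
    have xx: "adj A x \<otimes> x \<in> carrier A" using x by simp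
    show "?\<phi> (x \<oplus> y) = ?\<phi> x + ?\<phi> y" if y: "y \<in> carrier A" for y
    proof (rule eq)
      show "(\<lambda>k. level_functional k (x \<oplus> y)) \<longlonglongrightarrow> ?\<phi> x + ?\<phi> y"
        using tendsto_add[OF lim[OF x] lim[OF y]] by (simp only: pos_add[OF level_functional_positive x y])
    qed (use x y in simp)
    show "?\<phi> (c \<odot> x) = c * ?\<phi> x" for c
    proof (rule eq)
      show "(\<lambda>k. level_functional k (c \<odot> x)) \<longlonglongrightarrow> c * ?\<phi> x"
        using tendsto_mult_left[OF lim[OF x], of c] by (simp only: pos_scal[OF level_functional_positive x])
    qed (use x in simp)
    show "?\<phi> (adj A x \<otimes> x) \<in> \<real>"
    proof -
      have "(\<lambda>k. Im (level_functional k (adj A x \<otimes> x))) \<longlonglongrightarrow> Im (?\<phi> (adj A x \<otimes> x))" by (rule tendsto_Im[OF lim[OF xx]])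
      moreover have "Im (level_functional k (adj A x \<otimes> x)) = 0" for k
        using pos_real[OF level_functional_positive x, of k] by (simp only: complex_is_Real_iff)
      ultimately have "(\<lambda>k::nat. 0) \<longlonglongrightarrow> Im (?\<phi> (adj A x \<otimes> x))" by (simp only:)
      from LIMSEQ_unique[OF this tendsto_const] show ?thesis by (simp only: complex_is_Real_iff)
    qed
    show "0 \<le> Re (?\<phi> (adj A x \<otimes> x))"
      by (rule LIMSEQ_le_const[OF tendsto_Re[OF lim[OF xx]]])
        (intro exI[of _ 0] allI impI pos_nonneg[OF level_functional_positive x])
  qed
  moreover have "?\<phi> (sig \<mu> \<nu>) = (if \<mu> = \<nu> then of_real (inverse r ^ path_length \<mu> * m (src \<mu>)) else 0)"
    if "\<mu> \<in> paths E" "\<nu> \<in> paths E" for \<mu> \<nu>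
  proof (rule eq)
    have "eventually (\<lambda>k. level_functional k (sig \<mu> \<nu>) = (if \<mu> = \<nu> then of_real (inverse r ^ path_length \<mu> * m (src \<mu>)) else 0)) sequentially"
      using that level_functional_sig unfolding eventually_sequentially by blast
    then show "(\<lambda>k. level_functional k (sig \<mu> \<nu>)) \<longlonglongrightarrow> (if \<mu> = \<nu> then of_real (inverse r ^ path_length \<mu> * m (src \<mu>)) else 0)"
      by (rule tendsto_eventually)
  qed (use that in simp)
  ultimately show "kms_values r m ?\<phi>" unfolding kms_values_def by blast
qed

end

end

end

lemma toeplitz_algebra_imp_toeplitz:
  assumes "fin_digraph E" "toeplitz_algebra E A p s" shows "toeplitz A E p s"
proof -
  interpret cstar_algebra A using assms(2) by (simp add: toeplitz_algebra_def)
  have fam: "toeplitz_family E A p s"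
    and gen: "\<And>S. cstar_subalgebra A S \<Longrightarrow> p ` verts E \<union> s ` arcs E \<subseteq> S \<Longrightarrow> S = carrier A"
    using assms(2) unfolding toeplitz_algebra_def by blast+
  interpret fin_digraph E by (rule assms(1))
  show ?thesis
  proof unfold_locales
    show "toeplitz_family E A p s" by (rule fam)
    show "S = carrier A" if "cstar_subalgebra A S" "p ` verts E \<union> s ` arcs E \<subseteq> S" for S
      using that by (rule gen)
  qed
qed

text \<open>The path space representation exists on the Toeplitz algebra by its universal property.\<close>

theorem kms_values_exists:
  assumes E: "fin_digraph E" and A: "toeplitz_algebra E A p s" and r: "0 < r"
    and m: "\<And>v. v \<in> verts E \<Longrightarrow> 0 \<le> m v"
    and sub: "\<And>v. v \<in> verts E \<Longrightarrow> (\<Sum>e\<in>edges_into E v. m (tail E e)) \<le> r * m v"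
  shows "\<exists>\<phi>. toeplitz.kms_values A E p s r m \<phi> \<and> (\<forall>a. a \<notin> carrier A \<longrightarrow> \<phi> a = 0)"
proof -
  interpret toeplitz A E p s by (rule toeplitz_algebra_imp_toeplitz[OF E A])
  obtain h where h: "star_hom A (l2_operators :: test cstar) h"
    "\<forall>v\<in>verts E. h (p v) = vertex_op v" "\<forall>e\<in>arcs E. h (s e) = edge_op e"
    using A[unfolded toeplitz_algebra_def, THEN conjunct2, THEN conjunct2, THEN conjunct2, rule_format,
      OF conjI[OF cstar_algebra_l2_operators toeplitz_family_path_space]] by blast
  show ?thesis by (rule kms_values_limit[OF h(1) _ _ r m sub]) (use h in auto)
qed


section \<open>Periodic entire functions and Fourier coefficients\<close>

text \<open>The kernel is a trigonometric polynomial, so \<open>d\<close> integrates to zero against it.\<close>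

lemma trigonometric_kernel_annihilates:
  fixes d :: "real \<Rightarrow> complex"
  assumes d: "continuous_on UNIV d" and z: "\<And>n::int. integral {-pi..pi} (\<lambda>t. cis (of_int n * t) * d t) = 0"
  shows "integral {-pi..pi} (\<lambda>t. cis (of_int n * t) * ((2 + cis t + cis (- t)) / 4) ^ N * d t) = 0"
proof (induction N arbitrary: n)
  case (Suc N)
  let ?K = "\<lambda>t::real. ((2 + cis t + cis (- t)) / 4) ^ N"
  let ?f = "\<lambda>n::int. \<lambda>t. cis (of_int n * t) * ?K t * d t"
  have cont: "continuous_on {-pi..pi} (?f n)" for n
    by (intro continuous_intros continuous_on_subset[OF d]) auto
  have int: "?f n integrable_on {-pi..pi}" for n by (rule integrable_continuous_interval[OF cont])
  have "(\<lambda>t. cis (of_int n * t) * ((2 + cis t + cis (- t)) / 4) ^ Suc N * d t)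
      = (\<lambda>t. (1/2) * ?f n t + (1/4) * ?f (n + 1) t + (1/4) * ?f (n - 1) t)"
  proof
    fix t :: real
    have "cis (of_int (n + 1) * t) = cis (of_int n * t) * cis t" "cis (of_int (n - 1) * t) = cis (of_int n * t) * cis (- t)"
      by (simp_all add: cis_mult algebra_simps)
    then show "cis (of_int n * t) * ((2 + cis t + cis (- t)) / 4) ^ Suc N * d t
      = (1/2) * ?f n t + (1/4) * ?f (n + 1) t + (1/4) * ?f (n - 1) t"
      by (simp add: field_simps)
  qed
  moreover have "(?f n has_integral 0) {-pi..pi}" for n using integrable_integral[OF int[of n]] Suc.IH[of n] by simp
  then have "((\<lambda>t. (1/2) * ?f n t + (1/4) * ?f (n + 1) t + (1/4) * ?f (n - 1) t) has_integral
      ((1/2) * 0 + (1/4) * 0 + (1/4) * 0)) {-pi..pi}"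
    by (intro has_integral_add has_integral_mult_right)
  ultimately show ?case by (simp only: integral_unique) simp
qed (use z in simp)

text \<open>
  The kernels \<open>((1 + cos t) / 2)\<^sup>N\<close> are trigonometric polynomials that concentrate at \<open>0\<close>.
\<close>

lemma zero_if_fourier_coefficients_zero:
  fixes d :: "real \<Rightarrow> complex"
  assumes d: "continuous_on UNIV d" and z: "\<And>n::int. integral {-pi..pi} (\<lambda>t. cis (of_int n * t) * d t) = 0"
  shows "d 0 = 0"
proof (rule ccontr)
  assume d0: "d 0 \<noteq> 0"
  define u where "u t = Re (cnj (d 0) * d t)" for t
  define k where "k t = (1 + cos t) / 2" for t :: real
  have u0: "0 < u 0"
  proof -
    have "u 0 = (cmod (d 0))\<^sup>2" unfolding u_def cmod_power2 by (simp add: power2_eq_square)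
    then show ?thesis using d0 by simp
  qed
  have u_cont: "continuous_on UNIV u" unfolding u_def by (intro continuous_intros d)
  have k_eq: "((2 + cis t + cis (- t)) / 4) = of_real (k t)" for t
    by (simp add: k_def complex_eq_iff)
  have int0: "integral {-pi..pi} (\<lambda>t. k t ^ N * u t) = 0" for N
  proof -
    have c: "continuous_on {-pi..pi} (\<lambda>t. of_real (k t) ^ N * d t)"
      unfolding k_def by (intro continuous_intros continuous_on_subset[OF d]) auto
    then have "((\<lambda>t. of_real (k t) ^ N * d t) has_integral 0) {-pi..pi}"
      using trigonometric_kernel_annihilates[OF d z, of 0 N] integrable_integral[OF integrable_continuous_interval[OF c]]
      by (simp add: k_eq)
    then have "((\<lambda>t. cnj (d 0) * (of_real (k t) ^ N * d t)) has_integral cnj (d 0) * 0) {-pi..pi}"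
      by (rule has_integral_mult_right)
    then have "((\<lambda>t. Re (cnj (d 0) * (of_real (k t) ^ N * d t))) has_integral Re (cnj (d 0) * 0)) {-pi..pi}"
      by (rule has_integral_Re)
    moreover have "Re (cnj (d 0) * (of_real (k t) ^ N * d t)) = k t ^ N * u t" for t
      by (simp add: u_def of_real_power[symmetric] algebra_simps del: of_real_power)
    ultimately show ?thesis by (simp add: integral_unique)
  qed
  obtain e where e: "0 < e" "\<And>t. \<bar>t\<bar> < e \<Longrightarrow> u 0 / 2 < u t"
  proof -
    have "isCont u 0" using u_cont by (simp add: continuous_on_eq_continuous_at)
    then have "eventually (\<lambda>t. u 0 / 2 < u t) (at 0)"
      using u0 by (intro order_tendstoD(1)[of u "u 0"]) (auto simp: isCont_def)
    then obtain e where "0 < e" "\<forall>t. t \<noteq> 0 \<and> dist t 0 < e \<longrightarrow> u 0 / 2 < u t"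
      by (auto simp: eventually_at)
    then have "u 0 / 2 < u t" if "\<bar>t\<bar> < e" for t using u0 that by (cases "t = 0") (auto simp: dist_real_def)
    with \<open>0 < e\<close> show ?thesis by (rule that)
  qed
  define \<delta> where "\<delta> = min (e / 2) (pi / 2)"
  have \<delta>: "0 < \<delta>" "\<delta> < e" "\<delta> < pi" using e(1) pi_gt_zero unfolding \<delta>_def by linarith+
  obtain M where M: "\<And>t. t \<in> {-pi..pi} \<Longrightarrow> \<bar>u t\<bar> \<le> M"
  proof -
    have "compact (u ` {-pi..pi})" by (intro compact_continuous_image continuous_on_subset[OF u_cont]) auto
    then obtain M where "\<forall>x\<in>u ` {-pi..pi}. norm x \<le> M" using compact_imp_bounded bounded_iff by blast
    then show ?thesis by (intro that[of M]) auto
  qed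
  have M0: "0 \<le> M" using M[of 0] by simp
  define k1 k2 where "k1 = k (\<delta> / 2)" and "k2 = k \<delta>"
  have "cos \<delta> < cos (\<delta> / 2)" using \<delta> by (intro cos_monotone_0_pi) auto
  then have k12: "k2 < k1" by (simp add: k1_def k2_def k_def)
  have k0: "0 \<le> k t" for t using cos_double_cos[of "t / 2"] by (simp add: k_def)
  then have k2: "0 \<le> k2" by (simp add: k2_def)
  have near: "k1 \<le> k t" if "\<bar>t\<bar> \<le> \<delta> / 2" for t
  proof -
    have "cos (\<delta> / 2) \<le> cos \<bar>t\<bar>" using that \<delta> by (intro cos_monotone_0_pi_le) auto
    then show ?thesis by (simp add: k1_def k_def)
  qed
  have far: "k t \<le> k2" if "\<delta> \<le> \<bar>t\<bar>" "\<bar>t\<bar> \<le> pi" for t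
  proof -
    have "cos \<bar>t\<bar> \<le> cos \<delta>" using that \<delta> by (intro cos_monotone_0_pi_le) auto
    then show ?thesis by (simp add: k2_def k_def)
  qed
  have bound: "\<delta> * (u 0 / 2) * k1 ^ N \<le> 2 * pi * M * k2 ^ N" for N
  proof -
    let ?f = "\<lambda>t. k t ^ N * u t + M * k2 ^ N"
    have cont: "continuous_on S ?f" for S
      unfolding k_def by (intro continuous_intros continuous_on_subset[OF u_cont]) auto
    have nonneg: "0 \<le> ?f t" if t: "t \<in> {-pi..pi}" for t
    proof (cases "\<bar>t\<bar> < \<delta>")
      case True
      then have "0 \<le> u t" using e(2)[of t] \<delta> u0 by simp
      then show ?thesis using k0 M0 k2 by simp
    next
      case False
      then have "k t ^ N \<le> k2 ^ N" using far[of t] k0 t by (intro power_mono) auto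
      then have "k t ^ N * \<bar>u t\<bar> \<le> k2 ^ N * M" using M[OF t] k0 M0 k2 by (intro mult_mono) auto
      moreover have "k t ^ N * (- \<bar>u t\<bar>) \<le> k t ^ N * u t" using k0[of t] by (intro mult_left_mono) auto
      ultimately show ?thesis by (simp add: mult.commute)
    qed
    have "(u 0 / 2) * k1 ^ N \<le> ?f t" if t: "t \<in> {-\<delta>/2..\<delta>/2}" for t
    proof -
      have "k1 ^ N \<le> k t ^ N" using near[of t] t k12 k2 by (intro power_mono) auto
      moreover have "u 0 / 2 \<le> u t" using e(2)[of t] t \<delta> by (auto simp: less_imp_le)
      ultimately have "k1 ^ N * (u 0 / 2) \<le> k t ^ N * u t" using u0 k0 by (intro mult_mono) auto
      then show ?thesis using M0 k2 by (simp add: mult.commute add_increasing2)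
    qed
    then have "integral {-\<delta>/2..\<delta>/2} (\<lambda>_. (u 0 / 2) * k1 ^ N) \<le> integral {-\<delta>/2..\<delta>/2} ?f"
      by (intro integral_le integrable_continuous_interval cont continuous_on_const) auto
    also have "\<dots> \<le> integral {-pi..pi} ?f"
      using \<delta> nonneg by (intro integral_subset_le integrable_continuous_interval cont) auto
    also have "\<dots> = integral {-pi..pi} (\<lambda>t. k t ^ N * u t) + integral {-pi..pi} (\<lambda>_. M * k2 ^ N)"
      unfolding k_def by (intro integral_add integrable_continuous_interval continuous_intros continuous_on_subset[OF u_cont]) auto
    also have "\<dots> = 2 * pi * M * k2 ^ N" using int0[of N] by simp
    finally show ?thesis using \<delta> by (simp add: mult_ac)
  qed
  have "0 < k1" using k12 k2 by simp
  have "(\<lambda>N. 2 * pi * M * (k2 / k1) ^ N) \<longlonglongrightarrow> 2 * pi * M * 0"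
    using k12 k2 \<open>0 < k1\<close> by (intro tendsto_mult tendsto_const LIMSEQ_realpow_zero) auto
  moreover have "\<delta> * (u 0 / 2) \<le> 2 * pi * M * (k2 / k1) ^ N" for N
    using bound[of N] \<open>0 < k1\<close> by (simp add: power_divide field_simps)
  ultimately have "\<delta> * (u 0 / 2) \<le> 2 * pi * M * 0" by (intro LIMSEQ_le_const) auto
  then show False using \<delta> u0 by (simp add: mult_le_0_iff)
qed

text \<open>
  A primitive \<open>P\<close> of \<open>G\<close> grows over a period by a constant, so the integrals do not depend on
  the height.
\<close>

lemma entire_periodic_integral_shift:
  fixes G :: "complex \<Rightarrow> complex"
  assumes G: "G holomorphic_on UNIV" and per: "\<And>z. G (z + of_real (2 * pi)) = G z"
  shows "integral {-pi..pi} (\<lambda>t. G (of_real t + \<i> * of_real b)) = integral {-pi..pi} (\<lambda>t. G (of_real t))"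
proof -
  obtain P where P: "\<And>z. (P has_field_derivative G z) (at z)"
    using holomorphic_convex_primitive'[OF convex_UNIV open_UNIV G] by auto
  have int: "integral {-pi..pi} (\<lambda>t. G (of_real t + \<i> * of_real y)) = P (of_real pi + \<i> * of_real y) - P (of_real (- pi) + \<i> * of_real y)" for y
  proof (rule integral_unique, rule fundamental_theorem_of_calculus)
    fix t :: real
    have "((\<lambda>t. P (t + \<i> * of_real y)) has_field_derivative G (of_real t + \<i> * of_real y)) (at (of_real t))"
    proof -
      have "((\<lambda>t. t + \<i> * of_real y) has_field_derivative 1) (at (complex_of_real t))" by (auto intro!: derivative_eq_intros)
      from DERIV_chain2[OF P this] show ?thesis by simp
    qed
    then show "((\<lambda>t. P (of_real t + \<i> * of_real y)) has_vector_derivative G (of_real t + \<i> * of_real y)) (at t within {-pi..pi})"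
      by (rule has_vector_derivative_real_field)
  qed simp
  have "((\<lambda>z. P (z + of_real (2 * pi)) - P z) has_field_derivative 0) (at z)" for z
  proof -
    have "((\<lambda>z. P (z + of_real (2 * pi))) has_field_derivative G (z + of_real (2 * pi)) * 1) (at z)"
      by (rule DERIV_chain2[OF P]) (auto intro!: derivative_eq_intros)
    from DERIV_diff[OF this P] show ?thesis using per[of z] by simp
  qed
  then obtain c where c: "\<And>z. P (z + of_real (2 * pi)) - P z = c"
    using has_field_derivative_zero_constant[OF convex_UNIV, of "\<lambda>z. P (z + of_real (2 * pi)) - P z"] by auto
  have "P (of_real pi + \<i> * of_real y) - P (of_real (- pi) + \<i> * of_real y) = c" for y
    using c[of "of_real (- pi) + \<i> * of_real y"] by (simp add: algebra_simps)
  from this[of b] this[of 0] show ?thesis using int[of b] int[of 0] by simp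
qed

abbreviation fourier :: "(real \<Rightarrow> complex) \<Rightarrow> int \<Rightarrow> complex" where
  "fourier f n \<equiv> integral {-pi..pi} (\<lambda>t. cis (- of_int n * t) * f t)"

text \<open>
  A Fourier series \<open>\<Sum> a\<^sub>n e\<^sup>i\<^sup>n\<^sup>t\<close> of an entire function, continued to \<open>t + i ln r\<close>, has the coefficients \<open>r\<^sup>-\<^sup>n a\<^sub>n\<close>.
\<close>

lemma entire_value_from_fourier_coefficients:
  fixes f :: "complex \<Rightarrow> complex" and g :: "real \<Rightarrow> complex"
  assumes f: "f holomorphic_on UNIV" and per: "\<And>t::real. f (of_real (t + 2 * pi)) = f (of_real t)"
    and g: "continuous_on UNIV g" and r: "0 < r"
    and coeff: "\<And>n::int. fourier g n
        = of_real r powi (- n) * integral {-pi..pi} (\<lambda>t. cis (- of_int n * t) * f (of_real t))"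
  shows "g 0 = f (\<i> * of_real (ln r))"
proof -
  have fper: "f (z + of_real (2 * pi)) = f z" for z
  proof -
    have "(\<lambda>z. f (z + of_real (2 * pi)) - f z) z = 0"
    proof (rule analytic_continuation[of "\<lambda>z. f (z + of_real (2 * pi)) - f z" UNIV "range of_real" 0])
      have "(\<lambda>z. f (z + of_real (2 * pi))) holomorphic_on UNIV"
        using holomorphic_on_compose_gen[OF _ f, where f = "\<lambda>z. z + of_real (2 * pi)" and s = UNIV]
        by (simp add: o_def holomorphic_intros)
      then show "(\<lambda>z. f (z + of_real (2 * pi)) - f z) holomorphic_on UNIV" by (intro holomorphic_intros f)
      show "(0::complex) islimpt range of_real"
        unfolding islimpt_approachable
      proof (intro allI impI)
        fix e :: real assume "0 < e"
        then show "\<exists>x'\<in>range complex_of_real. x' \<noteq> 0 \<and> dist x' 0 < e"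
          by (intro bexI[of _ "of_real (e / 2)"] rangeI) (auto simp del: of_real_divide)
      qed
      fix z :: complex assume "z \<in> range of_real"
      then obtain t where "z = of_real t" by auto
      then show "f (z + of_real (2 * pi)) - f z = 0" using per[of t] by simp
    qed auto
    then show ?thesis by simp
  qed
  define d where "d t = f (of_real t + \<i> * of_real (ln r)) - g t" for t
  have f_cont: "continuous_on UNIV f" by (rule holomorphic_on_imp_continuous_on[OF f])
  have fs_cont: "continuous_on S (\<lambda>t. f (of_real t + \<i> * of_real (ln r)))" for S
    by (rule continuous_on_compose2[OF f_cont]) (auto intro!: continuous_intros)
  have "d 0 = 0"
  proof (rule zero_if_fourier_coefficients_zero)
    show "continuous_on UNIV d" unfolding d_def by (intro continuous_intros fs_cont g)
    fix n :: int
    let ?m = "- n"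
    define G where "G z = exp (- \<i> * of_int ?m * z) * f z" for z
    have "G holomorphic_on UNIV" unfolding G_def by (intro holomorphic_intros f)
    moreover have "G (z + of_real (2 * pi)) = G z" for z
    proof -
      have "exp (- \<i> * of_int ?m * (z + of_real (2 * pi))) = exp (- \<i> * of_int ?m * z) * exp (2 * of_int n * of_real pi * \<i>)"
        by (simp add: exp_add[symmetric] algebra_simps)
      also have "exp (2 * of_int n * of_real pi * \<i>) = 1" by (auto simp: exp_eq_1)
      finally show ?thesis unfolding G_def fper by simp
    qed
    ultimately have shift: "integral {-pi..pi} (\<lambda>t. G (of_real t + \<i> * of_real (ln r))) = integral {-pi..pi} (\<lambda>t. G (of_real t))"
      by (rule entire_periodic_integral_shift)
    have rp: "exp (of_int ?m * of_real (ln r)) = (of_real r :: complex) powi ?m"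
    proof -
      have "exp (of_int ?m * ln r) = r powi ?m" using r exp_power_int[of "ln r" "- n"] by simp
      from arg_cong[OF this, of complex_of_real] show ?thesis by (simp flip: exp_of_real)
    qed
    have G1: "G (of_real t) = cis (- of_int ?m * t) * f (of_real t)" for t
      by (simp add: G_def cis_conv_exp mult_ac)
    have G2: "G (of_real t + \<i> * of_real (ln r)) = of_real r powi ?m * (cis (- of_int ?m * t) * f (of_real t + \<i> * of_real (ln r)))" for t
    proof -
      have "exp (- \<i> * of_int ?m * (of_real t + \<i> * of_real (ln r))) = exp (of_int ?m * of_real (ln r)) * exp (\<i> * of_real (- of_int ?m * t))"
        by (simp add: exp_add[symmetric] algebra_simps)
      then show ?thesis unfolding G_def rp by (simp add: cis_conv_exp)
    qed
    have rne: "(of_real r :: complex) powi ?m \<noteq> 0" using r by simp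
    have "of_real r powi ?m * integral {-pi..pi} (\<lambda>t. cis (- of_int ?m * t) * f (of_real t + \<i> * of_real (ln r)))
       = integral {-pi..pi} (\<lambda>t. cis (- of_int ?m * t) * f (of_real t))"
      using shift unfolding G1 G2 by simp
    also have "\<dots> = of_real r powi ?m * fourier g ?m"
      unfolding coeff[of ?m] using r by (simp add: power_int_minus)
    finally have "integral {-pi..pi} (\<lambda>t. cis (- of_int ?m * t) * f (of_real t + \<i> * of_real (ln r)))
       = fourier g ?m" using rne r by auto
    moreover have "integral {-pi..pi} (\<lambda>t. cis (of_int n * t) * d t) =
        integral {-pi..pi} (\<lambda>t. cis (of_int n * t) * f (of_real t + \<i> * of_real (ln r)))
        - integral {-pi..pi} (\<lambda>t. cis (of_int n * t) * g t)"
      unfolding d_def right_diff_distrib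
      by (intro integral_diff integrable_continuous_interval continuous_intros fs_cont continuous_on_subset[OF g]) auto
    ultimately show "integral {-pi..pi} (\<lambda>t. cis (of_int n * t) * d t) = 0" by simp
  qed
  then show ?thesis by (simp add: d_def)
qed


section \<open>KMS states and their values\<close>

lemma integral_cis_int: "integral {-pi..pi} (\<lambda>t. cis (of_int k * t)) = (if k = 0 then 2 * pi else 0)"
proof (cases "k = 0")
  case False
  have "((\<lambda>t. cis (of_int k * t)) has_integral (cis (of_int k * pi) / (\<i> * of_int k) - cis (of_int k * (- pi)) / (\<i> * of_int k))) {-pi..pi}"
  proof (rule fundamental_theorem_of_calculus)
    fix t :: real
    have "((\<lambda>z. exp (\<i> * of_int k * z) / (\<i> * of_int k)) has_field_derivative exp (\<i> * of_int k * of_real t)) (at (of_real t))"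
      using False by (auto intro!: derivative_eq_intros)
    from has_vector_derivative_real_field[OF this]
    show "((\<lambda>t. cis (of_int k * t) / (\<i> * of_int k)) has_vector_derivative cis (of_int k * t)) (at t within {-pi..pi})"
      by (simp add: cis_conv_exp mult_ac)
  qed simp
  moreover have "cis (of_int k * pi) = cis (of_int k * (- pi))"
    by (simp add: complex_eq_iff sin_npi_int mult.commute[of _ pi])
  ultimately show ?thesis using False by (simp add: integral_unique)
qed (simp add: scaleR_conv_of_real)

text \<open>
  The homomorphism \<open>h\<close> will be the identity or the quotient map to the graph algebra, so that
  both algebras are covered by one argument. The dynamics is used only through the orbits of
  elements \<open>h a\<close>.
\<close>

locale toeplitz_orbit = toeplitz A E p s + Q: star_algebra Q
  for A :: "'a cstar" (structure) and E :: "('v, 'e) pre_digraph" and p :: "'v \<Rightarrow> 'a" and s :: "'e \<Rightarrow> 'a"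
    and Q :: "'b cstar" +
  fixes h :: "'a \<Rightarrow> 'b" and \<gamma> :: "real \<Rightarrow> 'b \<Rightarrow> 'b"
  assumes hom: "star_hom A Q h"
    and gauge: "gauge_dynamics E Q (h \<circ> p) (h \<circ> s) \<gamma>"
begin

definition orbit :: "real \<Rightarrow> 'a \<Rightarrow> 'b" where "orbit t a = \<gamma> t (h a)"

lemma h_closed [simp]: "a \<in> carrier A \<Longrightarrow> h a \<in> carrier Q"
  using hom by (auto simp: star_hom_def)

lemma h_hom:
  "a \<in> carrier A \<Longrightarrow> b \<in> carrier A \<Longrightarrow> h (a \<oplus> b) = h a \<oplus>\<^bsub>Q\<^esub> h b"
  "a \<in> carrier A \<Longrightarrow> b \<in> carrier A \<Longrightarrow> h (a \<otimes> b) = h a \<otimes>\<^bsub>Q\<^esub> h b"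
  "a \<in> carrier A \<Longrightarrow> h (c \<odot> a) = c \<odot>\<^bsub>Q\<^esub> h a"
  "a \<in> carrier A \<Longrightarrow> h (adj A a) = adj Q (h a)"
  using hom by (auto simp: star_hom_def)

lemma \<gamma>_hom: "star_hom Q Q (\<gamma> t)"
  and \<gamma>_p: "v \<in> verts E \<Longrightarrow> \<gamma> t (h (p v)) = h (p v)"
  and \<gamma>_s: "e \<in> arcs E \<Longrightarrow> \<gamma> t (h (s e)) = cis t \<odot>\<^bsub>Q\<^esub> h (s e)"
  using gauge by (auto simp: gauge_dynamics_def)

lemma orbit_closed [simp]: "a \<in> carrier A \<Longrightarrow> orbit t a \<in> carrier Q"
  using \<gamma>_hom[of t] by (auto simp: star_hom_def orbit_def)

lemma orbit_hom:
  "a \<in> carrier A \<Longrightarrow> b \<in> carrier A \<Longrightarrow> orbit t (a \<oplus> b) = orbit t a \<oplus>\<^bsub>Q\<^esub> orbit t b"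
  "a \<in> carrier A \<Longrightarrow> b \<in> carrier A \<Longrightarrow> orbit t (a \<otimes> b) = orbit t a \<otimes>\<^bsub>Q\<^esub> orbit t b"
  "a \<in> carrier A \<Longrightarrow> orbit t (c \<odot> a) = c \<odot>\<^bsub>Q\<^esub> orbit t a"
  "a \<in> carrier A \<Longrightarrow> orbit t (adj A a) = adj Q (orbit t a)"
  using \<gamma>_hom[of t] by (simp_all add: orbit_def h_hom star_hom_def)

lemma orbit_pe: "(v, es) \<in> paths E \<Longrightarrow> orbit t (pe (v, es)) = cis (real (length es) * t) \<odot>\<^bsub>Q\<^esub> h (pe (v, es))"
proof (induction es arbitrary: v)
  case Nil
  then show ?case by (simp add: orbit_def \<gamma>_p p_facts)
next
  case (Cons e es)
  then have e: "e \<in> arcs E" "(tail E e, es) \<in> paths E" by (auto simp: paths_Cons)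
  have "orbit t (pe (v, e # es)) = orbit t (s e) \<otimes>\<^bsub>Q\<^esub> orbit t (pe (tail E e, es))"
    using e Cons.prems by (simp add: pe_Cons orbit_hom)
  also have "\<dots> = (cis t \<odot>\<^bsub>Q\<^esub> h (s e)) \<otimes>\<^bsub>Q\<^esub> (cis (real (length es) * t) \<odot>\<^bsub>Q\<^esub> h (pe (tail E e, es)))"
    using e Cons.IH by (simp add: orbit_def \<gamma>_s)
  also have "\<dots> = (cis (real (length es) * t) * cis t) \<odot>\<^bsub>Q\<^esub> (h (s e) \<otimes>\<^bsub>Q\<^esub> h (pe (tail E e, es)))"
    using e by (simp add: Q.scal_mult_left Q.scal_mult_right Q.scal_scal mult.commute)
  also have "cis (real (length es) * t) * cis t = cis (real (length (e # es)) * t)"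
    by (simp add: cis_mult algebra_simps)
  finally show ?case using e Cons.prems by (simp add: pe_Cons h_hom)
qed

lemma orbit_sig:
  assumes "\<mu> \<in> paths E" "\<nu> \<in> paths E"
  shows "orbit t (sig \<mu> \<nu>) = cis (of_int (int (path_length \<mu>) - int (path_length \<nu>)) * t) \<odot>\<^bsub>Q\<^esub> h (sig \<mu> \<nu>)"
proof -
  have o: "orbit t (pe \<mu>) = cis (real (path_length \<mu>) * t) \<odot>\<^bsub>Q\<^esub> h (pe \<mu>)" if "\<mu> \<in> paths E" for \<mu>
    using orbit_pe[of "fst \<mu>" "snd \<mu>" t] that by (simp add: path_length_def)
  have "orbit t (sig \<mu> \<nu>) = (cis (real (path_length \<mu>) * t) * cis (- (real (path_length \<nu>) * t))) \<odot>\<^bsub>Q\<^esub> h (sig \<mu> \<nu>)"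
    using assms by (simp add: sig_def orbit_hom h_hom o Q.star_scal Q.scal_mult_left Q.scal_mult_right Q.scal_scal cis_cnj mult.commute)
  then show ?thesis by (simp add: cis_mult algebra_simps)
qed

end

locale toeplitz_image = toeplitz_orbit A E p s Q h \<gamma>
  for A :: "'a cstar" (structure) and E :: "('v, 'e) pre_digraph" and p :: "'v \<Rightarrow> 'a" and s :: "'e \<Rightarrow> 'a"
    and Q :: "'b cstar" and h :: "'a \<Rightarrow> 'b" and \<gamma> :: "real \<Rightarrow> 'b \<Rightarrow> 'b" +
  fixes \<psi> :: "'b \<Rightarrow> complex" and r :: real and m :: "'v \<Rightarrow> real"
  assumes onto: "h ` carrier A = carrier Q"
    and \<psi>: "Q.positive_functional \<psi>"
    and \<psi>_bound: "\<And>Z. Z \<in> carrier Q \<Longrightarrow> Re (\<psi> (adj Q Z \<otimes>\<^bsub>Q\<^esub> Z)) \<le> (cnorm Q Z)\<^sup>2"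
    and vals: "kms_values r m (\<lambda>a. \<psi> (h a))" and r: "0 < r"
begin

abbreviation "\<phi> \<equiv> \<lambda>a. \<psi> (h a)"

lemma \<phi>: "positive_functional \<phi>" using vals by (simp add: kms_values_def)

lemma orbit_functional: "positive_functional (\<lambda>a. \<psi> (orbit t a))"
  unfolding positive_functional_def
  by (auto simp: orbit_hom Q.pos_add[OF \<psi>] Q.pos_scal[OF \<psi>] Q.pos_real[OF \<psi>] Q.pos_nonneg[OF \<psi>])

text \<open>
  Off the diagonal \<open>\<psi>\<close> vanishes on the spanning elements, and on the diagonal \<open>\<gamma>\<^sub>t\<close> fixes
  them.
\<close>

theorem invariant:
  assumes "a \<in> carrier A" shows "\<psi> (orbit t a) = \<phi> a"
proof (rule pos_eqI[OF orbit_functional \<phi> _ assms])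
  fix \<mu> \<nu> assume *: "\<mu> \<in> paths E" "\<nu> \<in> paths E"
  then show "\<psi> (orbit t (sig \<mu> \<nu>)) = \<phi> (sig \<mu> \<nu>)"
    using vals by (auto simp: orbit_sig Q.pos_scal[OF \<psi>] kms_values_def)
qed

context
  fixes b assumes b: "b \<in> carrier A"
begin

definition left_fun :: "'a \<Rightarrow> real \<Rightarrow> complex" where "left_fun a t = \<psi> (orbit t a \<otimes>\<^bsub>Q\<^esub> h b)"
definition right_fun :: "'a \<Rightarrow> real \<Rightarrow> complex" where "right_fun a t = \<psi> (h b \<otimes>\<^bsub>Q\<^esub> orbit t a)"
definition K :: real where
  "K = sqrt (Re (\<phi> \<one>) * (Re (\<phi> (adj A b \<otimes> b)) + Re (\<phi> (b \<otimes> adj A b))))"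

text \<open>
  The functions of an element depend on it continuously, uniformly in \<open>t\<close>; the bound comes from the
  Cauchy--Schwarz inequality for \<open>\<psi>\<close> and the invariance of \<open>\<psi>\<close>.
\<close>

lemma fun_bound:
  assumes c: "c \<in> carrier A"
  shows "cmod (left_fun c t) \<le> K * cnorm A c" "cmod (right_fun c t) \<le> K * cnorm A c"
proof -
  have one: "0 \<le> Re (\<phi> \<one>)" using pos_nonneg[OF \<phi>, of \<one>] by simp
  have b1: "0 \<le> Re (\<phi> (adj A b \<otimes> b))" "0 \<le> Re (\<phi> (b \<otimes> adj A b))"
    using pos_nonneg[OF \<phi> b] pos_nonneg[OF \<phi>, of "adj A b"] b by auto
  have KK: "(K * cnorm A c)\<^sup>2 = Re (\<phi> \<one>) * (cnorm A c)\<^sup>2 * (Re (\<phi> (adj A b \<otimes> b)) + Re (\<phi> (b \<otimes> adj A b)))"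
    unfolding K_def power_mult_distrib using one b1 by simp
  have K0: "0 \<le> K * cnorm A c" unfolding K_def using one b1 cnorm_nonneg[OF c] by simp
  have hb: "h b \<in> carrier Q" using b by simp
  have oc: "orbit t c \<in> carrier Q" using c by simp
  have "(cmod (left_fun c t))\<^sup>2 \<le> Re (\<psi> (adj Q (adj Q (orbit t c)) \<otimes>\<^bsub>Q\<^esub> adj Q (orbit t c))) * Re (\<psi> (adj Q (h b) \<otimes>\<^bsub>Q\<^esub> h b))"
    using Q.pos_cauchy_schwarz[OF \<psi>, of "adj Q (orbit t c)" "h b"] hb oc by (simp add: left_fun_def)
  also have "adj Q (adj Q (orbit t c)) \<otimes>\<^bsub>Q\<^esub> adj Q (orbit t c) = orbit t (adj A (adj A c) \<otimes> adj A c)"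
    using c by (simp add: orbit_hom)
  also have "\<psi> (orbit t (adj A (adj A c) \<otimes> adj A c)) = \<phi> (adj A (adj A c) \<otimes> adj A c)" using c by (intro invariant) simp
  also have "adj Q (h b) \<otimes>\<^bsub>Q\<^esub> h b = h (adj A b \<otimes> b)" using b by (simp add: h_hom)
  also have "Re (\<phi> (adj A (adj A c) \<otimes> adj A c)) * Re (\<phi> (adj A b \<otimes> b))
      \<le> (Re (\<phi> \<one>) * (cnorm A c)\<^sup>2) * (Re (\<phi> (adj A b \<otimes> b)) + Re (\<phi> (b \<otimes> adj A b)))"
    using pos_square_le[OF \<phi>, of "adj A c"] c b1 one by (intro mult_mono) (auto simp: norm_star)
  finally show "cmod (left_fun c t) \<le> K * cnorm A c" unfolding KK[symmetric] using K0 by (rule power2_le_imp_le)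
  have "(cmod (right_fun c t))\<^sup>2 \<le> Re (\<psi> (adj Q (adj Q (h b)) \<otimes>\<^bsub>Q\<^esub> adj Q (h b))) * Re (\<psi> (adj Q (orbit t c) \<otimes>\<^bsub>Q\<^esub> orbit t c))"
    using Q.pos_cauchy_schwarz[OF \<psi>, of "adj Q (h b)" "orbit t c"] hb oc by (simp add: right_fun_def)
  also have "adj Q (orbit t c) \<otimes>\<^bsub>Q\<^esub> orbit t c = orbit t (adj A c \<otimes> c)" using c by (simp add: orbit_hom)
  also have "\<psi> (orbit t (adj A c \<otimes> c)) = \<phi> (adj A c \<otimes> c)" using c by (intro invariant) simp
  also have "adj Q (adj Q (h b)) \<otimes>\<^bsub>Q\<^esub> adj Q (h b) = h (b \<otimes> adj A b)" using b by (simp add: h_hom)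
  also have "Re (\<phi> (b \<otimes> adj A b)) * Re (\<phi> (adj A c \<otimes> c))
      \<le> (Re (\<phi> (adj A b \<otimes> b)) + Re (\<phi> (b \<otimes> adj A b))) * (Re (\<phi> \<one>) * (cnorm A c)\<^sup>2)"
    using pos_square_le[OF \<phi> c] b1 one pos_nonneg[OF \<phi> c] by (intro mult_mono) auto
  also have "\<dots> = (K * cnorm A c)\<^sup>2" unfolding KK by simp
  finally show "cmod (right_fun c t) \<le> K * cnorm A c" using K0 by (rule power2_le_imp_le)
qed

lemma fun_linear:
  assumes "a \<in> carrier A" "c \<in> carrier A"
  shows "left_fun (a \<oplus> c) t = left_fun a t + left_fun c t" "right_fun (a \<oplus> c) t = right_fun a t + right_fun c t"
    "left_fun (z \<odot> a) t = z * left_fun a t" "right_fun (z \<odot> a) t = z * right_fun a t"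
  using assms b by (simp_all add: left_fun_def right_fun_def orbit_hom Q.l_distr Q.r_distr Q.scal_mult_left
      Q.scal_mult_right Q.pos_add[OF \<psi>] Q.pos_scal[OF \<psi>])

lemma fun_diff:
  assumes "a \<in> carrier A" "c \<in> carrier A"
  shows "left_fun (a \<ominus> c) t = left_fun a t - left_fun c t" "right_fun (a \<ominus> c) t = right_fun a t - right_fun c t"
  using assms by (simp_all add: diff_eq_scal fun_linear)

text \<open>
  The trace of the KMS condition on Fourier coefficients: the \<open>n\<close>-th coefficient of
  \<open>t \<mapsto> \<psi>(\<gamma>\<^sub>t(a) b)\<close> is \<open>r\<^sup>-\<^sup>n\<close> times that of \<open>t \<mapsto> \<psi>(b \<gamma>\<^sub>t(a))\<close>. This is preserved under
  limits, although analyticity is not.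
\<close>

definition fourier_related :: "'a \<Rightarrow> bool" where
  "fourier_related a \<longleftrightarrow> continuous_on UNIV (left_fun a) \<and> continuous_on UNIV (right_fun a) \<and>
     (\<forall>t. right_fun a (t + 2 * pi) = right_fun a t) \<and> left_fun a 0 = \<psi> (h a \<otimes>\<^bsub>Q\<^esub> h b) \<and>
     (\<forall>n::int. fourier (left_fun a) n
        = of_real r powi (- n) * fourier (right_fun a) n)"

lemma fourier_related_sig:
  assumes \<mu>: "\<mu> \<in> paths E" "\<nu> \<in> paths E" shows "fourier_related (sig \<mu> \<nu>)"
proof -
  define k where "k = int (path_length \<mu>) - int (path_length \<nu>)"
  define x y where "x = \<phi> (sig \<mu> \<nu> \<otimes> b)" and "y = \<phi> (b \<otimes> sig \<mu> \<nu>)"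
  have xy: "x = of_real r powi (- k) * y"
    using kms_commutesD[OF kms_values_commutes_sig[OF vals r \<mu>] b] by (simp add: x_def y_def k_def)
  have l: "left_fun (sig \<mu> \<nu>) = (\<lambda>t. cis (of_int k * t) * x)"
    using \<mu> b by (simp add: fun_eq_iff left_fun_def orbit_sig k_def x_def Q.scal_mult_left Q.pos_scal[OF \<psi>] h_hom)
  have rf: "right_fun (sig \<mu> \<nu>) = (\<lambda>t. cis (of_int k * t) * y)"
    using \<mu> b by (simp add: fun_eq_iff right_fun_def orbit_sig k_def y_def Q.scal_mult_right Q.pos_scal[OF \<psi>] h_hom)
  have int: "integral {-pi..pi} (\<lambda>t. cis (- of_int n * t) * (cis (of_int k * t) * z)) = (if n = k then 2 * pi * z else 0)" for n and z :: complex
  proof -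
    have "(\<lambda>t. cis (- of_int n * t) * (cis (of_int k * t) * z)) = (\<lambda>t. cis (of_int (k - n) * t) * z)"
      by (simp only: fun_eq_iff mult.assoc[symmetric] cis_mult) (simp add: left_diff_distrib)
    then show ?thesis using integral_cis_int[of "k - n"] by simp
  qed
  have cis_per: "cis (of_int k * (t + 2 * pi)) = cis (of_int k * t)" for t
  proof -
    have "cis (of_int k * (t + 2 * pi)) = cis (of_int k * t) * cis (2 * pi * of_int k)" by (simp add: cis_mult algebra_simps)
    then show ?thesis by (simp add: cis_multiple_2pi)
  qed
  show ?thesis unfolding fourier_related_def l rf
  proof (intro conjI allI)
    show "cis (of_int k * 0) * x = \<psi> (h (sig \<mu> \<nu>) \<otimes>\<^bsub>Q\<^esub> h b)" using \<mu> b by (simp add: x_def h_hom)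
    fix n :: int
    show "integral {-pi..pi} (\<lambda>t. cis (- of_int n * t) * (cis (of_int k * t) * x))
        = of_real r powi (- n) * integral {-pi..pi} (\<lambda>t. cis (- of_int n * t) * (cis (of_int k * t) * y))"
    proof (cases "n = k")
      case True
      then show ?thesis using int[of n x] int[of n y] xy by simp
    next
      case False
      then show ?thesis using int[of n x] int[of n y] by simp
    qed
  qed (auto intro!: continuous_intros simp: cis_per)
qed

lemma fourier_related_combination:
  assumes "fourier_related a" "fourier_related c" "a \<in> carrier A" "c \<in> carrier A"
  shows "fourier_related (z \<odot> a \<oplus> c)"
proof -
  have l: "left_fun (z \<odot> a \<oplus> c) = (\<lambda>t. z * left_fun a t + left_fun c t)"
    and rf: "right_fun (z \<odot> a \<oplus> c) = (\<lambda>t. z * right_fun a t + right_fun c t)"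
    using assms(3,4) by (simp_all add: fun_eq_iff fun_linear)
  have cont: "continuous_on S (left_fun a)" "continuous_on S (right_fun a)" "continuous_on S (left_fun c)" "continuous_on S (right_fun c)" for S
    using assms(1,2) unfolding fourier_related_def by (auto intro: continuous_on_subset)
  have int: "integral {-pi..pi} (\<lambda>t. cis (- of_int n * t) * (z * f t + g t))
      = z * fourier f n + fourier g n"
    if "continuous_on {-pi..pi} f" "continuous_on {-pi..pi} g" for f g :: "real \<Rightarrow> complex" and n :: int
  proof -
    have fi: "((\<lambda>t. cis (- of_int n * t) * f t) has_integral fourier f n) {-pi..pi}"
      and gi: "((\<lambda>t. cis (- of_int n * t) * g t) has_integral fourier g n) {-pi..pi}"
      by (intro integrable_integral integrable_continuous_interval continuous_intros that)+
    from has_integral_add[OF has_integral_mult_right[OF fi, of z] gi] show ?thesis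
      by (simp add: integral_unique algebra_simps)
  qed
  have ha: "left_fun a 0 = \<psi> (h a \<otimes>\<^bsub>Q\<^esub> h b)" and hc: "left_fun c 0 = \<psi> (h c \<otimes>\<^bsub>Q\<^esub> h b)"
    and pa: "\<And>t. right_fun a (t + 2 * pi) = right_fun a t" and pc: "\<And>t. right_fun c (t + 2 * pi) = right_fun c t"
    and ia: "\<And>n::int. fourier (left_fun a) n
        = of_real r powi (- n) * fourier (right_fun a) n"
    and ic: "\<And>n::int. fourier (left_fun c) n
        = of_real r powi (- n) * fourier (right_fun c) n"
    using assms(1,2) unfolding fourier_related_def by blast+
  show ?thesis unfolding fourier_related_def l rf int[OF cont(1,3)] int[OF cont(2,4)] ia ic ha hc pa pc
    using assms(3,4) b by (auto intro!: continuous_intros cont simp: h_hom Q.l_distr Q.scal_mult_left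
        Q.pos_add[OF \<psi>] Q.pos_scal[OF \<psi>] algebra_simps)
qed

lemma fourier_related_limit:
  assumes X: "\<And>n. fourier_related (X n)" and lim: "tends X a"
  shows "fourier_related a"
proof -
  have c: "X n \<in> carrier A" "a \<in> carrier A" for n using lim by (auto simp: tends_def)
  have close: "norm (left_fun (X n) t - left_fun a t) \<le> K * cnorm A (X n \<ominus> a)"
    "norm (right_fun (X n) t - right_fun a t) \<le> K * cnorm A (X n \<ominus> a)" for n t
    using fun_bound[of "X n \<ominus> a" t] c by (simp_all add: fun_diff)
  have K0: "(\<lambda>n. K * cnorm A (X n \<ominus> a)) \<longlonglongrightarrow> 0" using lim tendsto_mult_right_zero by (auto simp: tends_def)
  have Xc: "continuous_on S (left_fun (X n))" "continuous_on S (right_fun (X n))" for n S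
    using X[of n] unfolding fourier_related_def by (auto intro: continuous_on_subset)
  have unif: "uniform_limit UNIV F G sequentially" if "\<And>n t. norm (F n t - G t) \<le> K * cnorm A (X n \<ominus> a)"
    for F :: "nat \<Rightarrow> real \<Rightarrow> complex" and G
  proof (rule uniform_limitI)
    fix e :: real assume "0 < e"
    then have "eventually (\<lambda>n. K * cnorm A (X n \<ominus> a) < e) sequentially" by (rule order_tendstoD(2)[OF K0])
    then show "eventually (\<lambda>n. \<forall>t\<in>UNIV. dist (F n t) (G t) < e) sequentially"
      by eventually_elim (use that in \<open>auto simp: dist_norm intro: le_less_trans\<close>)
  qed
  have cont: "continuous_on UNIV (left_fun a)" "continuous_on UNIV (right_fun a)"
    using uniform_limit_theorem[OF always_eventually[OF allI[OF Xc(1)]] unif[OF close(1)]]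
      uniform_limit_theorem[OF always_eventually[OF allI[OF Xc(2)]] unif[OF close(2)]] by auto
  have pw: "(\<lambda>n. left_fun (X n) t) \<longlonglongrightarrow> left_fun a t" "(\<lambda>n. right_fun (X n) t) \<longlonglongrightarrow> right_fun a t" for t
    using tendsto_uniform_limitI[OF unif[OF close(1)], of t] tendsto_uniform_limitI[OF unif[OF close(2)], of t] by auto
  have int: "(\<lambda>n. fourier (F n) k) \<longlonglongrightarrow> fourier G k"
    if F: "\<And>n t. norm (F n t - G t) \<le> K * cnorm A (X n \<ominus> a)" and Fc: "\<And>n. continuous_on {-pi..pi} (F n)" "continuous_on {-pi..pi} G"
    for F :: "nat \<Rightarrow> real \<Rightarrow> complex" and G and k :: int
  proof -
    have b: "norm (fourier (F n) k - fourier G k)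
        \<le> (K * cnorm A (X n \<ominus> a)) * (pi - (- pi))" for n
    proof -
      have "fourier (F n) k - fourier G k
          = integral {-pi..pi} (\<lambda>t. cis (- of_int k * t) * F n t - cis (- of_int k * t) * G t)"
        by (intro integral_diff[symmetric] integrable_continuous_interval continuous_intros Fc)
      also have "norm \<dots> \<le> (K * cnorm A (X n \<ominus> a)) * (pi - (- pi))"
      proof (rule integral_bound)
        fix t
        have "norm (cis (- of_int k * t) * F n t - cis (- of_int k * t) * G t) = norm (F n t - G t)"
          by (simp add: right_diff_distrib[symmetric] norm_mult)
        then show "norm (cis (- of_int k * t) * F n t - cis (- of_int k * t) * G t) \<le> K * cnorm A (X n \<ominus> a)" using F by simp
      qed (auto intro!: continuous_intros Fc)
      finally show ?thesis .
    qed
    have "(\<lambda>n. (K * cnorm A (X n \<ominus> a)) * (pi - (- pi))) \<longlonglongrightarrow> 0" using tendsto_mult_left_zero[OF K0] by simp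
    from Lim_null_comparison[OF always_eventually[OF allI[OF b]] this] have "(\<lambda>n. fourier (F n) k - fourier G k) \<longlonglongrightarrow> 0"
      .
    then show ?thesis by (simp add: LIM_zero_iff)
  qed
  show ?thesis unfolding fourier_related_def
  proof (intro conjI allI cont)
    fix t
    have "right_fun (X n) (t + 2 * pi) = right_fun (X n) t" for n using X[of n] unfolding fourier_related_def by blast
    then have "(\<lambda>n. right_fun (X n) t) \<longlonglongrightarrow> right_fun a (t + 2 * pi)" using pw(2)[of "t + 2 * pi"] by simp
    then show "right_fun a (t + 2 * pi) = right_fun a t" by (rule LIMSEQ_unique[OF _ pw(2)])
  next
    have "(\<lambda>n. \<phi> (X n \<otimes> b)) \<longlonglongrightarrow> \<phi> (a \<otimes> b)" by (intro pos_continuous[OF \<phi>] tends_mult lim tends_const b)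
    moreover have "left_fun (X n) 0 = \<phi> (X n \<otimes> b)" for n using X[of n] c b unfolding fourier_related_def by (simp add: h_hom)
    ultimately have "(\<lambda>n. left_fun (X n) 0) \<longlonglongrightarrow> \<phi> (a \<otimes> b)" by simp
    then show "left_fun a 0 = \<psi> (h a \<otimes>\<^bsub>Q\<^esub> h b)" using LIMSEQ_unique[OF pw(1)[of 0]] c b by (simp add: h_hom)
  next
    fix n :: int
    have "(\<lambda>k. fourier (left_fun (X k)) n) \<longlonglongrightarrow> fourier (left_fun a) n"
      by (intro int close Xc continuous_on_subset[OF cont(1)]) auto
    moreover have "(\<lambda>k. of_real r powi (- n) * fourier (right_fun (X k)) n)
        \<longlonglongrightarrow> of_real r powi (- n) * fourier (right_fun a) n"
      by (intro tendsto_mult tendsto_const int close Xc continuous_on_subset[OF cont(2)]) auto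
    moreover have "fourier (left_fun (X k)) n
        = of_real r powi (- n) * fourier (right_fun (X k)) n" for k
      using X[of k] unfolding fourier_related_def by blast
    ultimately show "fourier (left_fun a) n
        = of_real r powi (- n) * fourier (right_fun a) n"
      using LIMSEQ_unique by simp
  qed
qed

lemma fourier_related: "a \<in> carrier A \<Longrightarrow> fourier_related a"
proof (erule dense_induct)
  fix y assume "y \<in> tspan"
  then show "fourier_related y"
  proof (induction rule: tspan.induct)
    case zero
    have z: "left_fun \<zero> = (\<lambda>_. 0)" "right_fun \<zero> = (\<lambda>_. 0)"
      using fun_linear(3,4)[of \<zero> \<zero> 0] by (auto simp: fun_eq_iff)
    have "\<psi> (h \<zero> \<otimes>\<^bsub>Q\<^esub> h b) = \<phi> (\<zero> \<otimes> b)" using b by (simp only: h_hom zero_closed)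
    then show ?case unfolding fourier_related_def z using b by (simp add: pos_zero[OF \<phi>])
  next
    case (add \<mu> \<nu> x z)
    then show ?case by (intro fourier_related_combination fourier_related_sig) auto
  qed
qed (rule fourier_related_limit)

end

lemma functional_entire:
  assumes Y: "Y \<in> carrier Q" and F: "entire_function Q F"
  shows "(\<lambda>z. \<psi> (Y \<otimes>\<^bsub>Q\<^esub> F z)) holomorphic_on UNIV"
proof -
  have Fc: "F z \<in> carrier Q" for z using F by (simp add: entire_function_def)
  define C where "C = Re (\<psi> (adj Q (adj Q Y) \<otimes>\<^bsub>Q\<^esub> adj Q Y))"
  have C: "0 \<le> C" unfolding C_def using Q.pos_nonneg[OF \<psi>, of "adj Q Y"] Y by simp
  have bound: "cmod (\<psi> (Y \<otimes>\<^bsub>Q\<^esub> Z)) \<le> sqrt C * \<bar>cnorm Q Z\<bar>" if Z: "Z \<in> carrier Q" for Z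
  proof (rule power2_le_imp_le)
    have "(cmod (\<psi> (Y \<otimes>\<^bsub>Q\<^esub> Z)))\<^sup>2 \<le> C * Re (\<psi> (adj Q Z \<otimes>\<^bsub>Q\<^esub> Z))"
      using Q.pos_cauchy_schwarz[OF \<psi>, of "adj Q Y" Z] Y Z by (simp add: C_def)
    also have "\<dots> \<le> C * (cnorm Q Z)\<^sup>2" by (intro mult_left_mono \<psi>_bound Z C)
    finally show "(cmod (\<psi> (Y \<otimes>\<^bsub>Q\<^esub> Z)))\<^sup>2 \<le> (sqrt C * \<bar>cnorm Q Z\<bar>)\<^sup>2" using C by (simp add: power_mult_distrib)
  qed (use C in simp)
  have "\<exists>D. ((\<lambda>z. \<psi> (Y \<otimes>\<^bsub>Q\<^esub> F z)) has_field_derivative D) (at z)" for z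
  proof -
    obtain D where D: "D \<in> carrier Q"
      "((\<lambda>w. cnorm Q ((inverse w \<odot>\<^bsub>Q\<^esub> (F (z + w) \<ominus>\<^bsub>Q\<^esub> F z)) \<ominus>\<^bsub>Q\<^esub> D)) \<longlongrightarrow> 0) (at 0)"
      using F unfolding entire_function_def by blast
    let ?q = "\<lambda>w. (inverse w \<odot>\<^bsub>Q\<^esub> (F (z + w) \<ominus>\<^bsub>Q\<^esub> F z)) \<ominus>\<^bsub>Q\<^esub> D"
    have eq: "(\<psi> (Y \<otimes>\<^bsub>Q\<^esub> F (z + w)) - \<psi> (Y \<otimes>\<^bsub>Q\<^esub> F z)) / w - \<psi> (Y \<otimes>\<^bsub>Q\<^esub> D) = \<psi> (Y \<otimes>\<^bsub>Q\<^esub> ?q w)" for w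
      using Y Fc D by (simp add: Q.mult_diff_right Q.scal_mult_right Q.pos_diff[OF \<psi>] Q.pos_scal[OF \<psi>] divide_inverse mult.commute)
    have "((\<lambda>w. (\<psi> (Y \<otimes>\<^bsub>Q\<^esub> F (z + w)) - \<psi> (Y \<otimes>\<^bsub>Q\<^esub> F z)) / w - \<psi> (Y \<otimes>\<^bsub>Q\<^esub> D)) \<longlongrightarrow> 0) (at 0)"
      unfolding eq
    proof (rule Lim_null_comparison)
      show "((\<lambda>w. sqrt C * \<bar>cnorm Q (?q w)\<bar>) \<longlongrightarrow> 0) (at 0)"
        using tendsto_mult_right_zero[OF tendsto_rabs_zero[OF D(2)]] .
      show "\<forall>\<^sub>F w in at 0. norm (\<psi> (Y \<otimes>\<^bsub>Q\<^esub> ?q w)) \<le> sqrt C * \<bar>cnorm Q (?q w)\<bar>"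
        by (intro always_eventually allI bound Q.minus_closed Q.scal_closed Fc D)
    qed
    then show ?thesis unfolding DERIV_def by (intro exI[of _ "\<psi> (Y \<otimes>\<^bsub>Q\<^esub> D)"]) (simp add: LIM_zero_iff)
  qed
  then show ?thesis
    unfolding holomorphic_on_def field_differentiable_def by simp
qed

text \<open>
  The function \<open>z \<mapsto> \<psi>(Y F z)\<close> is entire and \<open>2\<pi>\<close>-periodic, and its Fourier coefficients
  determine its value at \<open>i ln r\<close>.
\<close>

theorem kms_condition:
  assumes X: "X \<in> carrier Q" and Y: "Y \<in> carrier Q" and F: "analytic_extension Q \<gamma> X F"
  shows "\<psi> (X \<otimes>\<^bsub>Q\<^esub> Y) = \<psi> (Y \<otimes>\<^bsub>Q\<^esub> F (\<i> * of_real (ln r)))"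
proof -
  obtain a b where a: "a \<in> carrier A" "X = h a" and b: "b \<in> carrier A" "Y = h b" using X Y onto by blast
  have rel: "fourier_related b a" by (rule fourier_related[OF b(1) a(1)])
  have ext: "\<psi> (Y \<otimes>\<^bsub>Q\<^esub> F (of_real t)) = right_fun b a t" for t
    using F a b by (simp add: analytic_extension_def right_fun_def[OF b(1)] orbit_def)
  have "left_fun b a 0 = \<psi> (Y \<otimes>\<^bsub>Q\<^esub> F (\<i> * of_real (ln r)))"
  proof (rule entire_value_from_fourier_coefficients[where f = "\<lambda>z. \<psi> (Y \<otimes>\<^bsub>Q\<^esub> F z)", OF _ _ _ r])
    show "(\<lambda>z. \<psi> (Y \<otimes>\<^bsub>Q\<^esub> F z)) holomorphic_on UNIV"
      using F by (intro functional_entire[OF Y]) (simp add: analytic_extension_def)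
  qed (use rel in \<open>simp_all only: ext fourier_related_def[OF b(1)]\<close>)
  then show ?thesis using rel a b by (simp add: fourier_related_def[OF b(1)])
qed

end

context toeplitz
begin

theorem kms_values_imp_kms_state:
  assumes \<alpha>: "gauge_dynamics E A p s \<alpha>" and \<phi>: "kms_values r m \<phi>" and r: "0 < r"
    and m: "(\<Sum>v\<in>verts E. m v) = 1" and out: "\<And>x. x \<notin> carrier A \<Longrightarrow> \<phi> x = 0"
  shows "kms_state A \<alpha> (ln r) \<phi>"
proof -
  have pos: "positive_functional \<phi>" using \<phi> by (simp add: kms_values_def)
  have "\<phi> (p v) = of_real (m v)" if "v \<in> verts E" for v
    using \<phi> that p_facts[OF that] unfolding kms_values_def by (metis paths_Nil path_length_simps list.size(3) power_0 mult_1 path_source_Nil pe_Nil sig_def)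
  then have one: "\<phi> \<one> = 1" using m by (simp add: pos_one_eq_sum[OF pos] flip: of_real_sum)
  then have st: "state A \<phi>" using pos out by (simp add: state_iff)
  interpret I: toeplitz_image A E p s A "\<lambda>x. x" \<alpha> \<phi> r m
  proof unfold_locales
    show "star_hom A A (\<lambda>x. x)" by (simp add: star_hom_def)
    show "gauge_dynamics E A ((\<lambda>x. x) \<circ> p) ((\<lambda>x. x) \<circ> s) \<alpha>" using \<alpha> by (simp add: o_def)
    show "Re (\<phi> (adj A Z \<otimes> Z)) \<le> (cnorm A Z)\<^sup>2" if "Z \<in> carrier A" for Z
      using pos_square_le[OF pos that] one by simp
  qed (use pos \<phi> r in auto)
  show ?thesis unfolding kms_state_def
  proof (intro conjI ballI allI impI st)
    fix a b F G assume "a \<in> carrier A" "b \<in> carrier A" "analytic_extension A \<alpha> a F \<and> analytic_extension A \<alpha> b G"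
    then show "\<phi> (a \<otimes> b) = \<phi> (b \<otimes> F (\<i> * complex_of_real (ln r)))" using I.kms_condition by blast
  next
    fix t a assume "a \<in> carrier A"
    then show "\<phi> (\<alpha> t a) = \<phi> a" using I.invariant by (simp add: I.orbit_def)
  qed
qed

end


context star_algebra
begin

lemma scal_diff_left: "x \<in> carrier A \<Longrightarrow> c \<odot> x \<ominus> d \<odot> x = (c - d) \<odot> x"
  by (simp add: diff_eq_scal scal_scal flip: scal_l_distr)

end

context cstar_algebra
begin

lemma entire_exponential:
  assumes x: "x \<in> carrier A" shows "entire_function A (\<lambda>z. exp (c * z) \<odot> x)"
  unfolding entire_function_def
proof (intro conjI allI)
  fix z :: complex
  have eq: "cnorm A ((inverse w \<odot> (exp (c * (z + w)) \<odot> x \<ominus> exp (c * z) \<odot> x)) \<ominus> (c * exp (c * z)) \<odot> x)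
      = cmod ((exp (c * (z + w)) - exp (c * z)) / w - c * exp (c * z)) * cnorm A x" for w
    using x by (simp add: scal_diff_left scal_scal divide_inverse mult.commute cnorm_smult)
  have "((\<lambda>z. exp (c * z)) has_field_derivative c * exp (c * z)) (at z)"
    by (auto intro!: derivative_eq_intros)
  then have "((\<lambda>w. (exp (c * (z + w)) - exp (c * z)) / w) \<longlongrightarrow> c * exp (c * z)) (at 0)"
    unfolding DERIV_def .
  then have "((\<lambda>w. (exp (c * (z + w)) - exp (c * z)) / w - c * exp (c * z)) \<longlongrightarrow> 0) (at 0)"
    using LIM_zero by blast
  then have lim: "((\<lambda>w. cmod ((exp (c * (z + w)) - exp (c * z)) / w - c * exp (c * z)) * cnorm A x) \<longlongrightarrow> 0) (at 0)"
    by (intro tendsto_mult_left_zero tendsto_norm_zero)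
  show "\<exists>D\<in>carrier A. ((\<lambda>w. cnorm A ((inverse w \<odot> (exp (c * (z + w)) \<odot> x \<ominus> exp (c * z) \<odot> x)) \<ominus> D)) \<longlongrightarrow> 0) (at 0)"
    by (rule bexI[of _ "(c * exp (c * z)) \<odot> x"], unfold eq, rule lim, use x in simp)
qed (use x in simp)

end

text \<open>The spectral subspaces of the dynamics, whose elements have explicit entire orbits.\<close>

definition homogeneous :: "'a cstar \<Rightarrow> (real \<Rightarrow> 'a \<Rightarrow> 'a) \<Rightarrow> int \<Rightarrow> 'a \<Rightarrow> bool" where
  "homogeneous A \<alpha> k x \<longleftrightarrow> x \<in> carrier A \<and> (\<forall>t. \<alpha> t x = cis (of_int k * t) \<odot>\<^bsub>A\<^esub> x)"

context cstar_algebra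
begin

lemma homogeneous_analytic:
  assumes "homogeneous A \<alpha> k x" shows "analytic_extension A \<alpha> x (\<lambda>z. exp (\<i> * of_int k * z) \<odot> x)"
  unfolding analytic_extension_def
  using assms entire_exponential[of x "\<i> * of_int k"]
  by (simp add: homogeneous_def cis_conv_exp mult.assoc)

lemma kms_homogeneous:
  assumes \<theta>: "kms_state A \<alpha> (ln r) \<theta>" and r: "0 < r" and x: "homogeneous A \<alpha> k x" and y: "homogeneous A \<alpha> l y"
  shows "\<theta> (x \<otimes> y) = of_real r powi (- k) * \<theta> (y \<otimes> x)"
proof -
  have xy: "x \<in> carrier A" "y \<in> carrier A" using x y by (auto simp: homogeneous_def)
  have pos: "positive_functional \<theta>" using \<theta> by (simp add: kms_state_def state_iff)
  have "\<theta> (x \<otimes> y) = \<theta> (y \<otimes> (exp (\<i> * of_int k * (\<i> * of_real (ln r))) \<odot> x))"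
    using \<theta> homogeneous_analytic[OF x] homogeneous_analytic[OF y] xy unfolding kms_state_def by blast
  also have "\<dots> = exp (\<i> * of_int k * (\<i> * of_real (ln r))) * \<theta> (y \<otimes> x)"
    using xy by (simp add: scal_mult_right pos_scal[OF pos])
  also have "\<i> * of_int k * (\<i> * of_real (ln r)) = of_real (of_int (- k) * ln r)"
    by (simp add: complex_eq_iff)
  also have "exp (of_real (of_int (- k) * ln r)) = complex_of_real (r powi (- k))"
    unfolding exp_of_real using r powr_real_of_int'[of r "- k"] by (simp add: powr_def)
  finally show ?thesis by simp
qed

end

context toeplitz
begin

lemma sig_homogeneous:
  assumes \<alpha>: "gauge_dynamics E A p s \<alpha>" and "\<mu> \<in> paths E" "\<nu> \<in> paths E"
  shows "homogeneous A \<alpha> (int (path_length \<mu>) - int (path_length \<nu>)) (sig \<mu> \<nu>)"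
proof -
  interpret I: toeplitz_orbit A E p s A "\<lambda>x. x" \<alpha>
    by unfold_locales (use \<alpha> in \<open>simp_all add: star_hom_def o_def\<close>)
  show ?thesis using I.orbit_sig assms(2,3) by (simp add: homogeneous_def I.orbit_def)
qed

lemma s_homogeneous:
  assumes "gauge_dynamics E A p s \<alpha>" "e \<in> arcs E" shows "homogeneous A \<alpha> 1 (s e)"
  using assms by (simp add: homogeneous_def gauge_dynamics_def)

text \<open>
  The \<open>\<alpha>\<^sub>t\<close> are not assumed to be unital, but they fix the vertex projections, whose sum is
  \<open>\<one>\<close>.
\<close>

lemma one_homogeneous:
  assumes \<alpha>: "gauge_dynamics E A p s \<alpha>" shows "homogeneous A \<alpha> 0 \<one>"
proof -
  have hom: "star_hom A A (\<alpha> t)" and p: "\<And>v. v \<in> verts E \<Longrightarrow> \<alpha> t (p v) = p v" for t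
    using \<alpha> by (auto simp: gauge_dynamics_def)
  have "\<alpha> t \<one> = \<one>" for t
  proof -
    have c: "\<alpha> t \<one> \<in> carrier A" using hom[of t] by (auto simp: star_hom_def)
    have pc: "p \<in> verts E \<rightarrow> carrier A" using p_facts(1) by auto
    have "\<alpha> t \<one> \<otimes> p v = p v" if v: "v \<in> verts E" for v
    proof -
      have "\<alpha> t (\<one> \<otimes> p v) = \<alpha> t \<one> \<otimes> \<alpha> t (p v)" using hom[of t] p_facts(1)[OF v] unfolding star_hom_def by blast
      then show ?thesis using p[OF v] p_facts(1)[OF v] by simp
    qed
    then have eq: "(\<Oplus>v\<in>verts E. \<alpha> t \<one> \<otimes> p v) = (\<Oplus>v\<in>verts E. p v)"
      using pc by (intro finsum_cong') auto
    have "\<alpha> t \<one> = \<alpha> t \<one> \<otimes> (\<Oplus>v\<in>verts E. p v)" using c by (simp flip: one_eq_sum_p)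
    also have "\<dots> = (\<Oplus>v\<in>verts E. \<alpha> t \<one> \<otimes> p v)" by (rule finsum_rdistr[OF E.finite_verts c pc])
    finally show ?thesis unfolding eq by (simp flip: one_eq_sum_p)
  qed
  then show ?thesis by (simp add: homogeneous_def)
qed

text \<open>
  For \<open>r \<noteq> 1\<close> commuting the element with \<open>\<one>\<close> multiplies its value by \<open>r\<^sup>-\<^sup>k \<noteq> 1\<close>; for \<open>r = 1\<close>
  the state is \<open>\<alpha>\<close>-invariant by definition, and \<open>t = \<pi>/k\<close> changes the sign.
\<close>

lemma kms_state_degree_nonzero:
  assumes \<alpha>: "gauge_dynamics E A p s \<alpha>" and \<theta>: "kms_state A \<alpha> (ln r) \<theta>" and r: "0 < r"
    and x: "homogeneous A \<alpha> k x" and k: "k \<noteq> 0"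
  shows "\<theta> x = 0"
proof (cases "r = 1")
  case True
  have xc: "x \<in> carrier A" and ax: "\<alpha> (pi / of_int k) x = cis pi \<odot> x"
    using x k by (auto simp: homogeneous_def)
  have pos: "positive_functional \<theta>" using \<theta> by (simp add: kms_state_def state_iff)
  have "\<theta> (\<alpha> (pi / of_int k) x) = \<theta> x" using \<theta> xc True by (simp add: kms_state_def)
  then show ?thesis using xc unfolding ax by (simp add: pos_scal[OF pos])
next
  case False
  have xc: "x \<in> carrier A" using x by (simp add: homogeneous_def)
  have "r powi (- k) = exp (of_int (- k) * ln r)" using r powr_real_of_int'[of r "- k"] by (simp add: powr_def)
  moreover have "of_int (- k) * ln r \<noteq> 0" using r False k by simp
  ultimately have "r powi (- k) \<noteq> 1" using exp_eq_one_iff by metis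
  then have "complex_of_real (r powi (- k)) \<noteq> 1" by (metis of_real_eq_1_iff)
  moreover have "\<theta> x = complex_of_real (r powi (- k)) * \<theta> x"
    using kms_homogeneous[OF \<theta> r x one_homogeneous[OF \<alpha>]] xc by simp
  ultimately show ?thesis by (metis mult_cancel_right1)
qed

text \<open>
  Elements of nonzero degree have value 0. In degree 0 the two paths have the same length, and
  moving the first edge of \<open>\<mu>\<close> to the other side cancels it against the first edge of \<open>\<nu>\<close> at
  the cost of \<open>r\<^sup>-\<^sup>1\<close>.
\<close>

theorem kms_state_imp_kms_values:
  assumes \<alpha>: "gauge_dynamics E A p s \<alpha>" and \<theta>: "kms_state A \<alpha> (ln r) \<theta>" and r: "0 < r"
  shows "kms_values r (\<lambda>v. Re (\<theta> (p v))) \<theta>"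
proof -
  have pos: "positive_functional \<theta>" using \<theta> by (simp add: kms_state_def state_iff)
  have "\<theta> (sig (v, es) (w, fs)) =
      (if (v, es) = (w, fs) then of_real (inverse r ^ length es * Re (\<theta> (p (src (v, es))))) else 0)"
    if "(v, es) \<in> paths E" "(w, fs) \<in> paths E" "length es = length fs" for v es w fs
    using that
  proof (induction es arbitrary: v w fs)
    case Nil
    then have fs: "fs = []" and v: "v \<in> verts E" and w: "w \<in> verts E" by auto
    have "\<theta> (p v) \<in> \<real>" using pos_real[OF pos, of "p v"] v by (simp add: p_facts)
    then have re: "of_real (Re (\<theta> (p v))) = \<theta> (p v)" by (rule of_real_Re)
    show ?case
    proof (cases "v = w")
      case True
      show ?thesis using v re unfolding fs True[symmetric] by (simp add: sig_def p_facts)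
    next
      case False
      then show ?thesis using v w by (simp add: fs sig_def p_facts p_orthogonal pos_zero[OF pos])
    qed
  next
    case (Cons e es)
    then obtain f fs' where fs: "fs = f # fs'" by (cases fs) auto
    note e = Cons.prems[unfolded fs paths_Cons]
    have fp: "(w, f # fs') \<in> paths E" using Cons.prems by (simp add: fs)
    have "homogeneous A \<alpha> (int (length es) - int (length (f # fs'))) (sig (tail E e, es) (w, f # fs'))"
      using sig_homogeneous[OF \<alpha>, of "(tail E e, es)" "(w, f # fs')"] e fp by simp
    from kms_homogeneous[OF \<theta> r s_homogeneous[OF \<alpha>] this, of e]
    have "\<theta> (s e \<otimes> sig (tail E e, es) (w, f # fs')) = inverse (of_real r) * \<theta> (sig (tail E e, es) (w, f # fs') \<otimes> s e)"
      using e by (simp add: power_int_minus)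
    moreover have "s e \<otimes> sig (tail E e, es) (w, f # fs') = sig (v, e # es) (w, fs)"
      using e fp s_sig[of e "tail E e" es "(w, f # fs')"] by (simp add: fs)
    moreover have "sig (tail E e, es) (w, f # fs') \<otimes> s e = adj A (adj A (s e) \<otimes> sig (w, f # fs') (tail E e, es))"
      using e fp by (simp add: star_mult sig_star)
    moreover have "\<dots> = (if e = f then sig (tail E e, es) (tail E e, fs') else \<zero>)"
      using e fp s_star_sig[of e w "f # fs'" "tail E e" es] by (auto simp: sig_star)
    moreover have "\<theta> (sig (tail E e, es) (tail E e, fs')) = (if es = fs' then of_real (inverse r ^ length es * Re (\<theta> (p (src (tail E e, es))))) else 0)"
      if "e = f" using Cons.IH[of "tail E e" "tail E e" fs'] e Cons.prems(3) that by (auto simp: fs)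
    ultimately show ?case using e Cons.prems(3) by (auto simp: fs pos_zero[OF pos])
  qed
  note eq = this
  show ?thesis unfolding kms_values_def
  proof (intro conjI ballI pos)
    fix \<mu> \<nu> assume \<mu>: "\<mu> \<in> paths E" "\<nu> \<in> paths E"
    obtain v es w fs where vw: "\<mu> = (v, es)" "\<nu> = (w, fs)" by (cases \<mu>, cases \<nu>)
    show "\<theta> (sig \<mu> \<nu>) = (if \<mu> = \<nu> then of_real (inverse r ^ path_length \<mu> * Re (\<theta> (p (src \<mu>)))) else 0)"
    proof (cases "length es = length fs")
      case True then show ?thesis using eq[of v es w fs] \<mu> by (simp add: vw)
    next
      case False
      then have "\<theta> (sig \<mu> \<nu>) = 0"
        by (intro kms_state_degree_nonzero[OF \<alpha> \<theta> r sig_homogeneous[OF \<alpha> \<mu>]]) (simp add: vw)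
      then show ?thesis using False by (auto simp: vw)
    qed
  qed
qed

lemma kms_values_p:
  assumes "kms_values r m \<phi>" "v \<in> verts E" shows "\<phi> (p v) = of_real (m v)"
  using assms p_facts[OF assms(2)] unfolding kms_values_def
  by (metis paths_Nil path_length_simps list.size(3) power_0 mult_1 path_source_Nil pe_Nil sig_def)

lemma range_projections_closed: "(\<lambda>e. s e \<otimes> adj A (s e)) \<in> edges_into E v \<rightarrow> carrier A"
  by auto

lemma kms_values_defect:
  assumes \<phi>: "kms_values r m \<phi>" and v: "v \<in> verts E"
  shows "\<phi> (p v \<ominus> (\<Oplus>e\<in>edges_into E v. s e \<otimes> adj A (s e)))
    = of_real (m v - inverse r * (\<Sum>e\<in>edges_into E v. m (tail E e)))"
proof -
  have pos: "positive_functional \<phi>" using \<phi> by (simp add: kms_values_def)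
  have "\<phi> (s e \<otimes> adj A (s e)) = of_real (inverse r * m (tail E e))" if e: "e \<in> arcs E" for e
  proof -
    have "(head E e, [e]) \<in> paths E" using e by (simp add: paths_Cons)
    moreover have "pe (head E e, [e]) = s e" by (simp add: path_elem_def)
    ultimately show ?thesis using \<phi> unfolding kms_values_def sig_def
      by (metis (no_types, lifting) path_length_simps path_source_Cons path_source_Nil length_Cons list.size(3) power_one_right One_nat_def)
  qed
  then have "\<phi> (\<Oplus>e\<in>edges_into E v. s e \<otimes> adj A (s e))
      = of_real (inverse r * (\<Sum>e\<in>edges_into E v. m (tail E e)))"
    by (subst pos_finsum[OF pos _ range_projections_closed]) (auto simp: sum_distrib_left)
  then show ?thesis
    using p_facts(1)[OF v] finsum_closed[OF range_projections_closed] v by (simp add: pos_diff[OF pos] kms_values_p[OF \<phi>])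
qed

text \<open>The defect \<open>p\<^sub>v - \<Sum> s\<^sub>e s\<^sub>e\<^sup>*\<close> is positive.\<close>

lemma kms_values_subinvariant:
  assumes \<phi>: "kms_values r m \<phi>" and v: "v \<in> verts E" and r: "0 < r"
  shows "0 \<le> m v" "(\<Sum>e\<in>edges_into E v. m (tail E e)) \<le> r * m v"
proof -
  have pos: "positive_functional \<phi>" using \<phi> by (simp add: kms_values_def)
  show "0 \<le> m v" using pos_nonneg[OF pos p_facts(1)[OF v]] v by (simp add: p_facts kms_values_p[OF \<phi>])
  obtain c where c: "c \<in> carrier A" "p v \<ominus> (\<Oplus>e\<in>edges_into E v. s e \<otimes> adj A (s e)) = adj A c \<otimes> c"
    using range_sum_le[OF v] unfolding cstar_le_def by blast
  have "0 \<le> m v - inverse r * (\<Sum>e\<in>edges_into E v. m (tail E e))"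
    using pos_nonneg[OF pos c(1)] unfolding c(2)[symmetric] kms_values_defect[OF \<phi> v] Re_complex_of_real .
  then have "inverse r * (\<Sum>e\<in>edges_into E v. m (tail E e)) \<le> m v" by simp
  then have "r * (inverse r * (\<Sum>e\<in>edges_into E v. m (tail E e))) \<le> r * m v"
    using r by (intro mult_left_mono) auto
  then show "(\<Sum>e\<in>edges_into E v. m (tail E e)) \<le> r * m v" using r by (simp add: mult.assoc[symmetric])
qed

end


section \<open>Quotients by closed ideals\<close>

context star_algebra
begin

lemma star_algebra_image:
  fixes B :: "'b cstar"
  assumes hom: "star_hom A B \<pi>" and onto: "\<pi> ` carrier A = carrier B"
    and one: "\<one>\<^bsub>B\<^esub> = \<pi> \<one>" and zero: "\<zero>\<^bsub>B\<^esub> = \<pi> \<zero>"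
  shows "star_algebra B"
proof -
  have pc: "x \<in> carrier A \<Longrightarrow> \<pi> x \<in> carrier B" for x using onto by blast
  have h: "x \<in> carrier A \<Longrightarrow> y \<in> carrier A \<Longrightarrow> \<pi> x \<oplus>\<^bsub>B\<^esub> \<pi> y = \<pi> (x \<oplus> y)"
    "x \<in> carrier A \<Longrightarrow> y \<in> carrier A \<Longrightarrow> \<pi> x \<otimes>\<^bsub>B\<^esub> \<pi> y = \<pi> (x \<otimes> y)"
    "x \<in> carrier A \<Longrightarrow> c \<odot>\<^bsub>B\<^esub> \<pi> x = \<pi> (c \<odot> x)"
    "x \<in> carrier A \<Longrightarrow> adj B (\<pi> x) = \<pi> (adj A x)" for x y c
    using hom unfolding star_hom_def by auto
  have pre: "\<exists>x\<in>carrier A. X = \<pi> x" if "X \<in> carrier B" for X using onto that by blast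
  have "ring B"
  proof (rule ringI)
    show "abelian_group B"
    proof (rule abelian_groupI)
      show "\<exists>Y\<in>carrier B. Y \<oplus>\<^bsub>B\<^esub> X = \<zero>\<^bsub>B\<^esub>" if X: "X \<in> carrier B" for X
      proof -
        obtain x where x: "x \<in> carrier A" "X = \<pi> x" using pre[OF X] by blast
        then have "\<pi> (\<ominus> x) \<oplus>\<^bsub>B\<^esub> X = \<zero>\<^bsub>B\<^esub>" by (simp add: h zero l_neg)
        then show ?thesis using pc x(1) by blast
      qed
    qed (auto dest!: pre simp: h pc zero a_ac)
    show "Group.monoid B"
      by (rule monoidI) (auto dest!: pre simp: h pc one m_assoc)
  qed (auto dest!: pre simp: h l_distr r_distr)
  then show ?thesis
    by (intro star_algebra.intro star_algebra_axioms.intro)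
      (auto dest!: pre simp: h pc scal_l_distr scal_r_distr scal_scal scal_mult_left scal_mult_right star_add star_scal star_mult)
qed

end

text \<open>Invariance under the adjoint makes the *-operation of the quotient well defined.\<close>

locale star_ideal = star_algebra A + ideal I A for A :: "'a cstar" (structure) and I +
  assumes star_I: "x \<in> I \<Longrightarrow> adj A x \<in> I"
begin

abbreviation "Q \<equiv> cstar_quotient A I"
abbreviation coset :: "'a \<Rightarrow> 'a set" where "coset x \<equiv> I +> x"

lemma coset_iff: "y \<in> coset x \<longleftrightarrow> (\<exists>i\<in>I. y = i \<oplus> x)"
  by (auto simp: a_r_coset_def')

lemma coset_Union:
  assumes x: "x \<in> carrier A" and f: "\<And>i. i \<in> I \<Longrightarrow> f (i \<oplus> x) \<in> coset (f x)" and fx: "f x \<in> carrier A"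
  shows "(\<Union>y\<in>coset x. I +> f y) = coset (f x)"
proof -
  have "I +> f y = coset (f x)" if "y \<in> coset x" for y
  proof -
    have "f y \<in> coset (f x)" using that f by (auto simp: coset_iff)
    from a_repr_independence'[OF this fx] show ?thesis by simp
  qed
  moreover have "x \<in> coset x" using x by (rule a_rcos_self)
  ultimately show ?thesis by blast
qed

lemma coset_scal: "x \<in> carrier A \<Longrightarrow> c \<odot>\<^bsub>Q\<^esub> coset x = coset (c \<odot> x)"
proof -
  assume x: "x \<in> carrier A"
  have "c \<odot> (i \<oplus> x) \<in> coset (c \<odot> x)" if i: "i \<in> I" for i
  proof -
    have ic: "i \<in> carrier A" using i a_Hcarr by blast
    have "(c \<odot> \<one>) \<otimes> i \<in> I" using i by (intro I_l_closed) auto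
    then have "c \<odot> i \<in> I" using ic by (simp add: scal_mult_left)
    then show ?thesis using ic x by (auto simp: coset_iff scal_r_distr)
  qed
  then show ?thesis using coset_Union[of x "\<lambda>x. c \<odot> x"] x by (simp add: cstar_quotient_def)
qed

lemma coset_star: "x \<in> carrier A \<Longrightarrow> adj Q (coset x) = coset (adj A x)"
proof -
  assume x: "x \<in> carrier A"
  have "adj A (i \<oplus> x) \<in> coset (adj A x)" if i: "i \<in> I" for i
    using i a_Hcarr[OF i] x star_I[OF i] by (auto simp: coset_iff star_add)
  then show ?thesis using coset_Union[of x "adj A"] x by (simp add: cstar_quotient_def)
qed

lemma carrier_quotient: "carrier Q = coset ` carrier A"
proof -
  have "carrier Q = a_rcosets\<^bsub>A\<^esub> I" by (simp add: cstar_quotient_def FactRing_def)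
  then show ?thesis unfolding A_RCOSETS_def RCOSETS_def a_r_coset_def by auto
qed

lemma coset_hom: "star_hom A Q coset"
  unfolding star_hom_def
proof (intro conjI ballI allI)
  show "coset \<in> carrier A \<rightarrow> carrier Q" using carrier_quotient by auto
  fix x y assume xy: "x \<in> carrier A" "y \<in> carrier A"
  show "coset (x \<oplus> y) = coset x \<oplus>\<^bsub>Q\<^esub> coset y"
    using a_rcos_sum[OF xy] by (simp add: cstar_quotient_def FactRing_def)
  show "coset (x \<otimes> y) = coset x \<otimes>\<^bsub>Q\<^esub> coset y"
    using rcoset_mult_add[OF xy] by (simp add: cstar_quotient_def FactRing_def)
qed (simp_all add: coset_scal coset_star)

lemma star_algebra_quotient: "star_algebra Q"
proof (rule star_algebra_image[OF coset_hom])
  show "\<zero>\<^bsub>Q\<^esub> = coset \<zero>"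
    using a_rcos_const[of \<zero>] additive_subgroup.zero_closed[OF additive_subgroup_axioms]
    by (simp add: cstar_quotient_def FactRing_def)
  show "\<one>\<^bsub>Q\<^esub> = coset \<one>" by (simp add: cstar_quotient_def FactRing_def)
qed (rule carrier_quotient[symmetric])

definition quotient_functional :: "('a \<Rightarrow> complex) \<Rightarrow> 'a set \<Rightarrow> complex" where
  "quotient_functional \<phi> X = (if X \<in> carrier Q then \<phi> (SOME x. x \<in> X) else 0)"

lemma quotient_functional:
  assumes \<phi>: "positive_functional \<phi>" and vanish: "\<And>i. i \<in> I \<Longrightarrow> \<phi> i = 0" and x: "x \<in> carrier A"
  shows "quotient_functional \<phi> (coset x) = \<phi> x"
proof -
  have "x \<in> coset x" using x by (rule a_rcos_self)
  then have "(SOME y. y \<in> coset x) \<in> coset x" by (metis someI)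
  then obtain i where i: "i \<in> I" "(SOME y. y \<in> coset x) = i \<oplus> x" unfolding coset_iff by blast
  then show ?thesis using x vanish[OF i(1)] a_Hcarr[OF i(1)] carrier_quotient
    by (auto simp: quotient_functional_def pos_add[OF \<phi>])
qed

end

context cstar_algebra
begin

text \<open>
  For a closed ideal \<open>J\<close> containing the self-adjoint set \<open>S\<close>, the set of adjoints of \<open>J\<close> is
  another one, so the smallest such ideal is self-adjoint.
\<close>

lemma star_ideal_generated:
  assumes S: "S \<subseteq> carrier A" "\<And>x. x \<in> S \<Longrightarrow> adj A x = x"
  shows "star_ideal A (closed_ideal_generated A S)"
proof -
  let ?F = "{I. ideal I A \<and> norm_closed A I \<and> S \<subseteq> I}"
  have top: "carrier A \<in> ?F" using oneideal S by (auto simp: norm_closed_def)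
  have I: "ideal (closed_ideal_generated A S) A"
    unfolding closed_ideal_generated_def by (rule i_Intersect) (use top in blast)+
  have star: "{x \<in> carrier A. adj A x \<in> J} \<in> ?F" if J: "J \<in> ?F" for J
  proof -
    interpret J: ideal J A using J by blast
    have Jc: "norm_closed A J" "S \<subseteq> J" using J by auto
    have star_minus: "adj A (\<ominus> a) = \<ominus> adj A a" if "a \<in> carrier A" for a
      using that by (simp add: minus_eq_scal star_scal)
    have "ideal {x \<in> carrier A. adj A x \<in> J} A"
    proof (rule idealI[OF ring_axioms])
      show "subgroup {x \<in> carrier A. adj A x \<in> J} (add_monoid A)"
        by (rule add.subgroupI) (auto simp: star_add star_minus J.a_closed J.a_inv_closed intro!: exI[of _ \<zero>])
    qed (auto simp: star_mult J.I_l_closed J.I_r_closed)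
    moreover have "norm_closed A {x \<in> carrier A. adj A x \<in> J}"
      unfolding norm_closed_def
    proof (intro allI impI)
      fix X x assume *: "(\<forall>n::nat. X n \<in> {x \<in> carrier A. adj A x \<in> J}) \<and> x \<in> carrier A \<and> (\<lambda>n. cnorm A (X n \<ominus> x)) \<longlonglongrightarrow> 0"
      then have "tends X x" by (auto simp: tends_def)
      from tends_star[OF this] have "(\<lambda>n. cnorm A (adj A (X n) \<ominus> adj A x)) \<longlonglongrightarrow> 0" by (simp add: tends_def)
      moreover have "\<forall>n. adj A (X n) \<in> J" "adj A x \<in> carrier A" using * by auto
      ultimately have "adj A x \<in> J"
        by (intro Jc(1)[unfolded norm_closed_def, rule_format, of "\<lambda>n. adj A (X n)" "adj A x"] conjI)
      then show "x \<in> {x \<in> carrier A. adj A x \<in> J}" using * by simp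
    qed
    moreover have "S \<subseteq> {x \<in> carrier A. adj A x \<in> J}"
    proof
      fix x assume x: "x \<in> S"
      then show "x \<in> {x \<in> carrier A. adj A x \<in> J}" using S(1) Jc(2) unfolding mem_Collect_eq S(2)[OF x] by blast
    qed
    ultimately show ?thesis by blast
  qed
  have "adj A x \<in> closed_ideal_generated A S" if x: "x \<in> closed_ideal_generated A S" for x
    unfolding closed_ideal_generated_def
  proof (rule InterI)
    fix J assume "J \<in> ?F"
    from InterD[OF x[unfolded closed_ideal_generated_def] star[OF this]] show "adj A x \<in> J" by simp
  qed
  then show ?thesis using I by (intro star_ideal.intro star_ideal_axioms.intro star_algebra_axioms)
qed

end

context toeplitz
begin

text \<open>
  The left kernel of \<open>\<phi>\<close> is also a right ideal because the spanning elements commute with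
  everything under \<open>\<phi>\<close> up to a factor.
\<close>

lemma kms_null_ideal:
  assumes \<phi>: "kms_values r m \<phi>" and r: "0 < r"
  shows "ideal {x \<in> carrier A. \<forall>y\<in>carrier A. \<phi> (y \<otimes> x) = 0} A" (is "ideal ?N A")
    and "norm_closed A {x \<in> carrier A. \<forall>y\<in>carrier A. \<phi> (y \<otimes> x) = 0}"
proof -
  have pos: "positive_functional \<phi>" using \<phi> by (simp add: kms_values_def)
  have right: "\<forall>x\<in>?N. \<phi> (x \<otimes> z) = 0" if z: "z \<in> carrier A" for z
    using z
  proof (rule dense_induct)
    fix z assume "z \<in> tspan"
    then show "\<forall>x\<in>?N. \<phi> (x \<otimes> z) = 0"
    proof (induction rule: tspan.induct)
      case (add \<mu> \<nu> z c)
      show ?case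
      proof
        fix x assume x: "x \<in> ?N"
        then have xc: "x \<in> carrier A" by simp
        have "\<phi> (sig \<mu> \<nu> \<otimes> x) = 0" using x add.hyps by simp
        then have "\<phi> (x \<otimes> sig \<mu> \<nu>) = 0"
          using kms_commutesD[OF kms_values_commutes_sig[OF \<phi> r add.hyps(1,2)] xc] r by simp
        then show "\<phi> (x \<otimes> (c \<odot> sig \<mu> \<nu> \<oplus> z)) = 0"
          using x xc add.hyps add.IH by (simp add: r_distr scal_mult_right pos_add[OF pos] pos_scal[OF pos])
      qed
    qed (simp add: pos_zero[OF pos])
  next
    fix Z z assume Z: "\<And>n. \<forall>x\<in>?N. \<phi> (x \<otimes> Z n) = 0" and lim: "tends Z z"
    show "\<forall>x\<in>?N. \<phi> (x \<otimes> z) = 0"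
    proof
      fix x assume x: "x \<in> ?N"
      have "(\<lambda>n. \<phi> (x \<otimes> Z n)) \<longlonglongrightarrow> \<phi> (x \<otimes> z)" using x by (intro pos_continuous[OF pos] tends_mult tends_const lim) simp
      moreover have "(\<lambda>n. \<phi> (x \<otimes> Z n)) = (\<lambda>n. 0)" using Z x by blast
      ultimately show "\<phi> (x \<otimes> z) = 0" by (simp add: LIMSEQ_const_iff)
    qed
  qed
  have left: "z \<otimes> x \<in> ?N" if x: "x \<in> ?N" and z: "z \<in> carrier A" for x z
    using x z by (simp flip: m_assoc)
  have addN: "x \<oplus> y \<in> ?N" "c \<odot> x \<in> ?N" if "x \<in> ?N" "y \<in> ?N" for x y c
    using that by (auto simp: r_distr pos_add[OF pos] scal_mult_right pos_scal[OF pos])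
  show "ideal ?N A"
  proof (rule idealI[OF ring_axioms])
    show "subgroup ?N (add_monoid A)"
    proof (rule add.subgroupI)
      show "?N \<noteq> {}" by (rule ccontr) (use pos_zero[OF pos] in \<open>auto dest: equals0D[of _ \<zero>]\<close>)
      show "\<ominus> x \<in> ?N" if "x \<in> ?N" for x using addN(2)[OF that that, of "- 1"] that by (simp add: minus_eq_scal)
      show "x \<oplus> y \<in> ?N" if "x \<in> ?N" "y \<in> ?N" for x y using addN(1)[OF that] .
    qed auto
    fix x z assume x: "x \<in> ?N" and z: "z \<in> carrier A"
    show "z \<otimes> x \<in> ?N" by (rule left[OF x z])
    have "\<phi> (y \<otimes> (x \<otimes> z)) = 0" if y: "y \<in> carrier A" for y
    proof -
      have xc: "x \<in> carrier A" using x by simp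
      have "\<phi> ((y \<otimes> x) \<otimes> z) = 0" using right[OF z] left[OF x y] by blast
      then show ?thesis by (simp add: m_assoc[OF y xc z])
    qed
    then show "x \<otimes> z \<in> ?N" using x z by simp
  qed
  show "norm_closed A ?N"
    unfolding norm_closed_def
  proof (intro allI impI)
    fix X x assume *: "(\<forall>n::nat. X n \<in> ?N) \<and> x \<in> carrier A \<and> (\<lambda>n. cnorm A (X n \<ominus> x)) \<longlonglongrightarrow> 0"
    then have lim: "tends X x" by (auto simp: tends_def)
    have "\<phi> (y \<otimes> x) = 0" if y: "y \<in> carrier A" for y
    proof -
      have "(\<lambda>n. \<phi> (y \<otimes> X n)) \<longlonglongrightarrow> \<phi> (y \<otimes> x)" by (intro pos_continuous[OF pos] tends_mult tends_const lim y)
      moreover have "(\<lambda>n. \<phi> (y \<otimes> X n)) = (\<lambda>n. 0)" using * y by auto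
      ultimately show ?thesis by (simp add: LIMSEQ_const_iff)
    qed
    then show "x \<in> ?N" using * by simp
  qed
qed

abbreviation ck_defect :: "'v \<Rightarrow> 'a" where
  "ck_defect v \<equiv> p v \<ominus> (\<Oplus>e\<in>edges_into E v. s e \<otimes> adj A (s e))"

lemma defect_positive:
  assumes v: "v \<in> verts E" shows "\<exists>c\<in>carrier A. ck_defect v = adj A c \<otimes> c"
  using range_sum_le[OF v] unfolding cstar_le_def .

lemma star_ideal_ck: "star_ideal A (ck_ideal E A p s)"
  unfolding ck_ideal_def
proof (rule star_ideal_generated)
  show "{ck_defect v | v. v \<in> verts E \<and> edges_into E v \<noteq> {}} \<subseteq> carrier A"
  proof
    fix x assume "x \<in> {ck_defect v | v. v \<in> verts E \<and> edges_into E v \<noteq> {}}"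
    then obtain v where v: "v \<in> verts E" "x = ck_defect v" by blast
    then obtain c where "c \<in> carrier A" "x = adj A c \<otimes> c" using defect_positive by blast
    then show "x \<in> carrier A" by simp
  qed
  fix x assume "x \<in> {ck_defect v | v. v \<in> verts E \<and> edges_into E v \<noteq> {}}"
  then obtain v where v: "v \<in> verts E" "x = ck_defect v" by blast
  then obtain c where "c \<in> carrier A" "x = adj A c \<otimes> c" using defect_positive by blast
  then show "adj A x = x" by (simp add: star_mult)
qed

text \<open>
  If \<open>m\<close> is invariant at \<open>v\<close>, then \<open>\<phi>\<close> vanishes on the positive element \<open>p\<^sub>v - \<Sum> s\<^sub>e s\<^sub>e\<^sup>*\<close>,
  which by the Cauchy--Schwarz inequality belongs to the left kernel.
\<close>

lemma kms_values_vanish_ck_ideal: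
  assumes \<phi>: "kms_values r m \<phi>" and r: "0 < r"
    and exact: "\<And>v. v \<in> verts E \<Longrightarrow> edges_into E v \<noteq> {} \<Longrightarrow>
      (\<Sum>e\<in>edges_into E v. m (tail E e)) = r * m v"
    and i: "i \<in> ck_ideal E A p s"
  shows "\<phi> i = 0"
proof -
  let ?N = "{x \<in> carrier A. \<forall>y\<in>carrier A. \<phi> (y \<otimes> x) = 0}"
  have pos: "positive_functional \<phi>" using \<phi> by (simp add: kms_values_def)
  have "ck_defect v \<in> ?N" if v: "v \<in> verts E" "edges_into E v \<noteq> {}" for v
  proof -
    obtain c where c: "c \<in> carrier A" "ck_defect v = adj A c \<otimes> c" using defect_positive[OF v(1)] by blast
    have zero: "\<phi> (adj A c \<otimes> c) = 0"
    proof -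
      have "\<phi> (ck_defect v) = of_real (m v - inverse r * (r * m v))"
        unfolding kms_values_defect[OF \<phi> v(1)] exact[OF v] ..
      then show ?thesis using r unfolding c(2) by simp
    qed
    have "\<phi> (y \<otimes> (adj A c \<otimes> c)) = 0" if y: "y \<in> carrier A" for y
    proof -
      have "(cmod (\<phi> (adj A (c \<otimes> adj A y) \<otimes> c)))\<^sup>2 \<le> 0"
        using pos_cauchy_schwarz[OF pos, of "c \<otimes> adj A y" c] c(1) y zero by simp
      then show ?thesis using c(1) y by (simp add: star_mult m_assoc)
    qed
    then show ?thesis unfolding c(2) using c(1) by simp
  qed
  then have "{ck_defect v | v. v \<in> verts E \<and> edges_into E v \<noteq> {}} \<subseteq> ?N" by blast
  then have "ck_ideal E A p s \<subseteq> ?N"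
    unfolding ck_ideal_def closed_ideal_generated_def using kms_null_ideal[OF \<phi> r] by blast
  then have "i \<in> ?N" using i by blast
  then have "i \<in> carrier A" "\<phi> (\<one> \<otimes> i) = 0" by blast+
  then show ?thesis by simp
qed

theorem kms_state_factors:
  assumes \<phi>: "kms_values r m \<phi>" and r: "0 < r" and total: "(\<Sum>v\<in>verts E. m v) = 1"
    and exact: "\<And>v. v \<in> verts E \<Longrightarrow> edges_into E v \<noteq> {} \<Longrightarrow>
      (\<Sum>e\<in>edges_into E v. m (tail E e)) = r * m v"
    and \<gamma>: "gauge_dynamics E (graph_algebra E A p s)
      (graph_quotient_map E A p s \<circ> p) (graph_quotient_map E A p s \<circ> s) \<gamma>"
  shows "\<exists>\<psi>. kms_state (graph_algebra E A p s) \<gamma> (ln r) \<psi> \<and>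
    (\<forall>a\<in>carrier A. \<phi> a = \<psi> (graph_quotient_map E A p s a))"
proof -
  define I where "I = ck_ideal E A p s"
  interpret I: star_ideal A I unfolding I_def by (rule star_ideal_ck)
  let ?Q = "cstar_quotient A I"
  have Q: "graph_algebra E A p s = ?Q" by (simp add: graph_algebra_def I_def)
  have map: "graph_quotient_map E A p s = I.coset" by (simp add: graph_quotient_map_def I_def fun_eq_iff)
  interpret Q: star_algebra ?Q by (rule I.star_algebra_quotient)
  have pos: "positive_functional \<phi>" using \<phi> by (simp add: kms_values_def)
  have one: "\<phi> \<one> = 1" using total by (simp add: pos_one_eq_sum[OF pos] kms_values_p[OF \<phi>] flip: of_real_sum)
  define \<psi> where "\<psi> = I.quotient_functional \<phi>"
  have \<psi>: "\<psi> (I.coset x) = \<phi> x" if "x \<in> carrier A" for x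
    unfolding \<psi>_def using kms_values_vanish_ck_ideal[OF \<phi> r exact] that
    by (intro I.quotient_functional[OF pos]) (auto simp: I_def)
  have pre: "\<exists>x\<in>carrier A. X = I.coset x" if "X \<in> carrier ?Q" for X using that I.carrier_quotient by blast
  have hom: "x \<in> carrier A \<Longrightarrow> y \<in> carrier A \<Longrightarrow> I.coset x \<oplus>\<^bsub>?Q\<^esub> I.coset y = I.coset (x \<oplus> y)"
    "x \<in> carrier A \<Longrightarrow> y \<in> carrier A \<Longrightarrow> I.coset x \<otimes>\<^bsub>?Q\<^esub> I.coset y = I.coset (x \<otimes> y)" for x y
    using I.coset_hom unfolding star_hom_def by simp_all
  have pos_Q: "Q.positive_functional \<psi>"
    unfolding Q.positive_functional_def
    by (auto dest!: pre simp: hom \<psi> I.coset_scal I.coset_star pos_add[OF pos] pos_scal[OF pos] pos_real[OF pos] pos_nonneg[OF pos])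
  have norm: "cnorm ?Q X = Inf (cnorm A ` X)" for X by (simp add: cstar_quotient_def)
  have repr: "y \<in> carrier A \<and> I.coset x = I.coset y" if "x \<in> carrier A" "y \<in> I.coset x" for x y
    using that I.a_repr_independence' I.a_Hcarr by (auto simp: I.coset_iff)
  have bound: "cmod (\<psi> X) \<le> cnorm ?Q X" "Re (\<psi> (adj ?Q X \<otimes>\<^bsub>?Q\<^esub> X)) \<le> (cnorm ?Q X)\<^sup>2" if X: "X \<in> carrier ?Q" for X
  proof -
    obtain x where x: "x \<in> carrier A" "X = I.coset x" using pre[OF X] by blast
    have ne: "cnorm A ` X \<noteq> {}" using I.a_rcos_self[OF x(1)] x(2) by blast
    have le: "cmod (\<psi> X) \<le> cnorm A y" "Re (\<psi> (adj ?Q X \<otimes>\<^bsub>?Q\<^esub> X)) \<le> (cnorm A y)\<^sup>2" "0 \<le> cnorm A y" if "y \<in> X" for y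
    proof -
      have y: "y \<in> carrier A" "X = I.coset y" using repr[OF x(1)] that x(2) by auto
      show "cmod (\<psi> X) \<le> cnorm A y" using pos_bounded[OF pos y(1)] one y by (simp add: \<psi>)
      show "Re (\<psi> (adj ?Q X \<otimes>\<^bsub>?Q\<^esub> X)) \<le> (cnorm A y)\<^sup>2"
        using pos_square_le[OF pos y(1)] one y by (simp add: \<psi> hom I.coset_star)
      show "0 \<le> cnorm A y" using cnorm_nonneg[OF y(1)] .
    qed
    show "cmod (\<psi> X) \<le> cnorm ?Q X" unfolding norm using ne le(1) by (intro cInf_greatest) auto
    have nn: "0 \<le> Re (\<psi> (adj ?Q X \<otimes>\<^bsub>?Q\<^esub> X))" using Q.pos_nonneg[OF pos_Q X] .
    have "sqrt (Re (\<psi> (adj ?Q X \<otimes>\<^bsub>?Q\<^esub> X))) \<le> cnorm ?Q X"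
      unfolding norm using ne le(2,3) by (intro cInf_greatest) (auto intro!: real_le_lsqrt nn)
    then show "Re (\<psi> (adj ?Q X \<otimes>\<^bsub>?Q\<^esub> X)) \<le> (cnorm ?Q X)\<^sup>2"
      by (rule sqrt_le_D)
  qed
  have unit: "I.coset \<one> \<in> carrier ?Q" "cnorm ?Q (I.coset \<one>) \<le> 1" "\<psi> (I.coset \<one>) = 1"
  proof -
    show "I.coset \<one> \<in> carrier ?Q" using I.carrier_quotient by blast
    have "bdd_below (cnorm A ` I.coset \<one>)"
      using repr[of \<one>] cnorm_nonneg by (intro bdd_belowI2[of _ 0]) auto
    then have "Inf (cnorm A ` I.coset \<one>) \<le> cnorm A \<one>"
      using I.a_rcos_self[of \<one>] by (intro cInf_lower) auto
    then show "cnorm ?Q (I.coset \<one>) \<le> 1" unfolding norm using norm_one_le by simp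
    show "\<psi> (I.coset \<one>) = 1" using one by (simp add: \<psi>)
  qed
  have st: "state ?Q \<psi>"
    unfolding state_def
  proof (intro conjI allI ballI impI)
    show "Sup {cmod (\<psi> X) | X. X \<in> carrier ?Q \<and> cnorm ?Q X \<le> 1} = 1"
    proof (rule cSup_eq_maximum)
      show "1 \<in> {cmod (\<psi> X) | X. X \<in> carrier ?Q \<and> cnorm ?Q X \<le> 1}"
        using unit by (intro CollectI exI[of _ "I.coset \<one>"]) simp
    next
      fix y assume "y \<in> {cmod (\<psi> X) | X. X \<in> carrier ?Q \<and> cnorm ?Q X \<le> 1}"
      then show "y \<le> 1" using bound(1) by fastforce
    qed
  next
    show "\<psi> X = 0" if "X \<notin> carrier ?Q" for X using that by (simp add: \<psi>_def I.quotient_functional_def)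
  qed (use bound(1) in \<open>simp_all add: Q.pos_add[OF pos_Q] Q.pos_scal[OF pos_Q] Q.pos_real[OF pos_Q] Q.pos_nonneg[OF pos_Q]\<close>)
  have pos_h: "positive_functional (\<lambda>a. \<psi> (I.coset a))"
    using pos unfolding positive_functional_def by (simp add: \<psi>)
  interpret T: toeplitz_image A E p s ?Q I.coset \<gamma> \<psi> r m
  proof unfold_locales
    show "star_hom A ?Q I.coset" by (rule I.coset_hom)
    show "gauge_dynamics E ?Q (I.coset \<circ> p) (I.coset \<circ> s) \<gamma>" using \<gamma> unfolding Q map .
    show "I.coset ` carrier A = carrier ?Q" using I.carrier_quotient by simp
    show "kms_values r m (\<lambda>a. \<psi> (I.coset a))"
      using \<phi> pos_h unfolding kms_values_def by (simp add: \<psi>)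
  qed (use pos_Q bound(2) r in auto)
  have "kms_state ?Q \<gamma> (ln r) \<psi>"
    unfolding kms_state_def
  proof (intro conjI ballI allI impI st)
    fix a b F G assume "a \<in> carrier ?Q" "b \<in> carrier ?Q" "analytic_extension ?Q \<gamma> a F \<and> analytic_extension ?Q \<gamma> b G"
    then show "\<psi> (a \<otimes>\<^bsub>?Q\<^esub> b) = \<psi> (b \<otimes>\<^bsub>?Q\<^esub> F (\<i> * complex_of_real (ln r)))" using T.kms_condition by blast
  next
    fix t a assume "a \<in> carrier ?Q"
    then obtain x where "x \<in> carrier A" "a = I.coset x" using pre by blast
    then show "\<psi> (\<gamma> t a) = \<psi> a" using T.invariant by (simp add: T.orbit_def)
  qed
  then show ?thesis unfolding Q map using \<psi> by auto
qed

end


section \<open>Linear systems over finite index sets\<close>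

lemma underdetermined_system:
  fixes M :: "'i \<Rightarrow> 'j \<Rightarrow> 'f::field"
  assumes "finite I" "finite J" "card I < card J"
  shows "\<exists>x. (\<exists>j\<in>J. x j \<noteq> 0) \<and> (\<forall>i\<in>I. (\<Sum>j\<in>J. M i j * x j) = 0)"
  using assms
proof (induction I arbitrary: J M rule: finite_induct)
  case empty
  then have "J \<noteq> {}" by auto
  then show ?case by (intro exI[of _ "\<lambda>_. 1"]) auto
next
  case (insert i I)
  show ?case
  proof (cases "\<forall>j\<in>J. M i j = 0")
    case True
    have "card I < card J" using insert by auto
    from insert.IH[OF insert.prems(1) this, of M] True show ?thesis by auto
  next
    case False
    then obtain k where k: "k \<in> J" "M i k \<noteq> 0" by auto
    let ?J = "J - {k}"
    have "card I < card ?J" using insert k by auto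
    from insert.IH[OF _ this, of "\<lambda>l j. M l j - M l k * M i j / M i k"] insert.prems obtain x where
      x: "\<exists>j\<in>?J. x j \<noteq> 0" "\<forall>l\<in>I. (\<Sum>j\<in>?J. (M l j - M l k * M i j / M i k) * x j) = 0" by auto
    define y where "y = x(k := - (\<Sum>j\<in>?J. M i j * x j) / M i k)"
    have sum_y: "(\<Sum>j\<in>J. M l j * y j) = M l k * y k + (\<Sum>j\<in>?J. M l j * x j)" for l
      using k insert.prems by (subst sum.remove[of _ k]) (auto simp: y_def intro!: sum.cong)
    have "(\<Sum>j\<in>J. M i j * y j) = 0"
      unfolding sum_y using k by (simp add: y_def)
    moreover have "(\<Sum>j\<in>J. M l j * y j) = 0" if "l \<in> I" for l
    proof -
      have "0 = (\<Sum>j\<in>?J. (M l j - M l k * M i j / M i k) * x j)" using x that by auto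
      also have "\<dots> = (\<Sum>j\<in>?J. M l j * x j) - (\<Sum>j\<in>?J. M l k / M i k * (M i j * x j))"
        by (simp add: algebra_simps sum_subtractf)
      also have "\<dots> = (\<Sum>j\<in>?J. M l j * x j) - M l k / M i k * (\<Sum>j\<in>?J. M i j * x j)"
        by (simp add: sum_distrib_left)
      finally show ?thesis unfolding sum_y by (simp add: y_def)
    qed
    moreover have "\<exists>j\<in>J. y j \<noteq> 0" using x(1) by (auto simp: y_def)
    ultimately show ?thesis by blast
  qed
qed

lemma eigenvectors_independent:
  fixes l :: "'k \<Rightarrow> 'f::field"
  assumes "finite K" "inj_on l K"
    and "\<And>k. k \<in> K \<Longrightarrow> \<exists>v\<in>D. X k v \<noteq> 0"
    and "\<And>k v. k \<in> K \<Longrightarrow> v \<in> D \<Longrightarrow> (\<Sum>w\<in>D. M v w * X k w) = l k * X k v"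
    and "\<And>v. v \<in> D \<Longrightarrow> (\<Sum>k\<in>K. c k * X k v) = 0"
  shows "\<forall>k\<in>K. c k = 0"
  using assms
proof (induction K arbitrary: c rule: finite_induct)
  case (insert a K)
  have "(\<Sum>k\<in>K. (c k * (l k - l a)) * X k v) = 0" if v: "v \<in> D" for v
  proof -
    have "0 = (\<Sum>w\<in>D. M v w * (\<Sum>k\<in>insert a K. c k * X k w))" using insert.prems(4) by simp
    also have "\<dots> = (\<Sum>k\<in>insert a K. c k * (\<Sum>w\<in>D. M v w * X k w))"
      unfolding sum_distrib_left by (subst sum.swap) (simp add: mult_ac)
    also have "\<dots> = (\<Sum>k\<in>insert a K. c k * (l k * X k v))"
      using insert.prems(3) v by (intro sum.cong) auto
    finally have "(\<Sum>k\<in>insert a K. c k * (l k * X k v)) - l a * (\<Sum>k\<in>insert a K. c k * X k v) = 0"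
      using insert.prems(4)[OF v] by simp
    then show ?thesis using insert.hyps
      by (simp add: algebra_simps sum_distrib_left sum_subtractf)
  qed
  with insert have "\<forall>k\<in>K. c k * (l k - l a) = 0" by (intro insert.IH) auto
  moreover have "l k \<noteq> l a" if "k \<in> K" for k using insert.prems(1) insert.hyps(2) that by (auto simp: inj_on_def)
  ultimately have K: "\<forall>k\<in>K. c k = 0" by auto
  obtain v where "v \<in> D" "X a v \<noteq> 0" using insert.prems(2)[of a] by auto
  with insert.prems(4)[of v] insert.hyps K have "c a = 0" by simp
  with K show ?case by auto
qed auto

lemma finite_mat_eigenvalues:
  assumes C: "finite C"
  shows "finite {l. mat_eigenvalue M C l}"
proof (rule ccontr)
  assume "infinite {l. mat_eigenvalue M C l}"
  then obtain K where K: "finite K" "card K = Suc (card C)" "K \<subseteq> {l. mat_eigenvalue M C l}"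
    using infinite_arbitrarily_large by blast
  then have "\<forall>l\<in>K. \<exists>x :: 'a \<Rightarrow> complex. (\<exists>v\<in>C. x v \<noteq> 0) \<and>
      (\<forall>v\<in>C. (\<Sum>w\<in>C. of_real (M v w) * x w) = l * x v)"
    by (auto simp: mat_eigenvalue_def)
  then obtain X :: "complex \<Rightarrow> 'a \<Rightarrow> complex" where X: "\<forall>l\<in>K. (\<exists>v\<in>C. X l v \<noteq> 0) \<and>
      (\<forall>v\<in>C. (\<Sum>w\<in>C. of_real (M v w) * X l w) = l * X l v)" by metis
  obtain c where c: "\<exists>l\<in>K. c l \<noteq> 0" "\<forall>v\<in>C. (\<Sum>l\<in>K. X l v * c l) = 0"
    using underdetermined_system[OF C K(1), of "\<lambda>v l. X l v"] K by auto
  have "\<forall>l\<in>K. c l = 0"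
    using X c(2)
    by (intro eigenvectors_independent[where l = id and D = C and X = X and M = "\<lambda>v w. of_real (M v w)"] K(1))
       (auto simp: mult.commute)
  with c show False by auto
qed

lemma injective_imp_invertible:
  fixes M :: "'v \<Rightarrow> 'v \<Rightarrow> real"
  assumes D: "finite D"
    and inj: "\<And>x. (\<And>v. v \<in> D \<Longrightarrow> (\<Sum>w\<in>D. M v w * x w) = 0) \<Longrightarrow> \<forall>v\<in>D. x v = 0"
  shows "mat_invertible D M"
proof -
  have solve: "\<exists>x. \<forall>v\<in>D. (\<Sum>w\<in>D. M v w * x w) = b v" for b
  proof -
    \<comment> \<open>Adjoin the right-hand side as one more unknown.\<close>
    let ?J = "insert None (Some ` D)"
    let ?N = "\<lambda>v j. case j of None \<Rightarrow> - b v | Some w \<Rightarrow> M v w"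
    have "card D < card ?J" using D by (simp add: card_image)
    then obtain x where x: "\<exists>j\<in>?J. x j \<noteq> 0" "\<forall>v\<in>D. (\<Sum>j\<in>?J. ?N v j * x j) = 0"
      using underdetermined_system[OF D, of ?J ?N] D by auto
    have eq: "(\<Sum>w\<in>D. M v w * x (Some w)) = b v * x None" if "v \<in> D" for v
      using x(2) that D by (simp add: sum.reindex)
    have "x None \<noteq> 0"
    proof
      assume "x None = 0"
      with eq inj[of "\<lambda>w. x (Some w)"] have "\<forall>w\<in>D. x (Some w) = 0" by auto
      with x(1) \<open>x None = 0\<close> show False by auto
    qed
    then show ?thesis using eq
      by (intro exI[of _ "\<lambda>w. x (Some w) / x None"]) (auto simp: sum_divide_distrib[symmetric] field_simps)
  qed
  then obtain X where X: "\<And>b v. v \<in> D \<Longrightarrow> (\<Sum>w\<in>D. M v w * X b w) = b v" by metis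
  define N where "N u w = X (\<lambda>v. if v = w then 1 else 0) u" for u w
  have MN: "(\<Sum>u\<in>D. M v u * N u w) = (if v = w then 1 else 0)" if "v \<in> D" for v w
    using X[OF that] by (simp add: N_def)
  have NM: "(\<Sum>u\<in>D. N v u * M u w) = (if v = w then 1 else 0)" if "v \<in> D" "w \<in> D" for v w
  proof -
    have "(\<Sum>y\<in>D. M z y * ((\<Sum>u\<in>D. N y u * M u w) - (if y = w then 1 else 0))) = 0" if z: "z \<in> D" for z
    proof -
      have "(\<Sum>y\<in>D. M z y * (\<Sum>u\<in>D. N y u * M u w)) = (\<Sum>u\<in>D. (\<Sum>y\<in>D. M z y * N y u) * M u w)"
        unfolding sum_distrib_left sum_distrib_right by (subst sum.swap) (simp add: mult_ac)
      also have "\<dots> = (\<Sum>u\<in>D. (if z = u then 1 else 0) * M u w)"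
        using MN[OF z] by simp
      also have "\<dots> = (\<Sum>u\<in>D. if u = z then M u w else 0)" by (rule sum.cong) auto
      also have "\<dots> = M z w" using z D by (simp add: sum.delta)
      finally have 1: "(\<Sum>y\<in>D. M z y * (\<Sum>u\<in>D. N y u * M u w)) = M z w" .
      have "(\<Sum>y\<in>D. M z y * (if y = w then 1 else 0)) = (\<Sum>y\<in>D. if y = w then M z y else 0)"
        by (rule sum.cong) auto
      also have "\<dots> = M z w" using \<open>w \<in> D\<close> D by (simp add: sum.delta)
      finally show ?thesis using 1 by (simp add: right_diff_distrib sum_subtractf)
    qed
    from inj[OF this] that show ?thesis by auto
  qed
  show ?thesis unfolding mat_invertible_def mat_is_inverse_def using MN NM by blast
qed

lemma mat_inverse_is_inverse:
  assumes D: "finite D" and inv: "mat_invertible D M"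
  shows "mat_is_inverse D M (mat_inverse D M)"
proof -
  from inv obtain N where N: "mat_is_inverse D M N" by (auto simp: mat_invertible_def)
  let ?P = "\<lambda>N. mat_is_inverse D M N \<and> (\<forall>v w. v \<notin> D \<or> w \<notin> D \<longrightarrow> N v w = 0)"
  have ex: "?P (\<lambda>v w. if v \<in> D \<and> w \<in> D then N v w else 0)"
    using N by (auto simp: mat_is_inverse_def)
  have uniq: "N1 = N2" if 1: "?P N1" and 2: "?P N2" for N1 N2
  proof (intro ext)
    fix v w
    show "N1 v w = N2 v w"
    proof (cases "v \<in> D \<and> w \<in> D")
      case True
      have "N1 v w = (\<Sum>u\<in>D. if u = w then N1 v u else 0)" using True D by (simp add: sum.delta)
      also have "\<dots> = (\<Sum>u\<in>D. N1 v u * (\<Sum>y\<in>D. M u y * N2 y w))"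
        using 2 True by (intro sum.cong) (auto simp: mat_is_inverse_def)
      also have "\<dots> = (\<Sum>y\<in>D. (\<Sum>u\<in>D. N1 v u * M u y) * N2 y w)"
        unfolding sum_distrib_left sum_distrib_right by (subst sum.swap) (simp add: mult_ac)
      also have "\<dots> = (\<Sum>y\<in>D. if y = v then N2 y w else 0)"
        using 1 True by (intro sum.cong) (auto simp: mat_is_inverse_def)
      also have "\<dots> = N2 v w" using True D by (simp add: sum.delta)
      finally show ?thesis .
    qed (use 1 2 in auto)
  qed
  have "?P (THE N. ?P N)" by (rule theI[of ?P, OF ex uniq[OF _ ex]])
  then show ?thesis unfolding mat_inverse_def by blast
qed

lemma mat_inverse_solves:
  assumes D: "finite D" and inv: "mat_invertible D M" and v: "v \<in> D"
  shows "(\<Sum>w\<in>D. M v w * (\<Sum>u\<in>D. mat_inverse D M w u * b u)) = b v"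
proof -
  have "(\<Sum>w\<in>D. M v w * (\<Sum>u\<in>D. mat_inverse D M w u * b u))
      = (\<Sum>u\<in>D. (\<Sum>w\<in>D. M v w * mat_inverse D M w u) * b u)"
    unfolding sum_distrib_left sum_distrib_right by (subst sum.swap) (simp add: mult_ac)
  also have "\<dots> = (\<Sum>u\<in>D. if u = v then b u else 0)"
    using mat_inverse_is_inverse[OF D inv] v by (intro sum.cong) (auto simp: mat_is_inverse_def)
  also have "\<dots> = b v" using v D by (simp add: sum.delta)
  finally show ?thesis .
qed


section \<open>Perron--Frobenius theory\<close>

definition irreducible_on :: "'v set \<Rightarrow> ('v \<Rightarrow> 'v \<Rightarrow> real) \<Rightarrow> bool" where
  "irreducible_on C M \<longleftrightarrow> finite C \<and> C \<noteq> {} \<and> (\<forall>v\<in>C. \<forall>w\<in>C. 0 \<le> M v w) \<and>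
     (\<forall>v\<in>C. \<forall>w\<in>C. (v, w) \<in> {(a, b). a \<in> C \<and> b \<in> C \<and> 0 < M a b}\<^sup>*)"

lemma irreducible_zero_propagates:
  assumes irr: "irreducible_on C M" and x: "\<And>v. v \<in> C \<Longrightarrow> 0 \<le> x v"
    and le: "\<And>v. v \<in> C \<Longrightarrow> (\<Sum>w\<in>C. M v w * x w) \<le> r * x v"
    and v: "v \<in> C" "x v = 0" and w: "w \<in> C"
  shows "x w = 0"
proof -
  have C: "finite C" and M: "\<And>v w. v \<in> C \<Longrightarrow> w \<in> C \<Longrightarrow> 0 \<le> M v w"
    using irr by (auto simp: irreducible_on_def)
  have "(v, w) \<in> {(a, b). a \<in> C \<and> b \<in> C \<and> 0 < M a b}\<^sup>*"
    using irr v w by (auto simp: irreducible_on_def)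
  then show ?thesis
  proof (induction rule: rtrancl_induct)
    case (step a b)
    then have "(\<Sum>w\<in>C. M a w * x w) \<le> 0" using le[of a] by auto
    moreover have "M a b * x b \<le> (\<Sum>w\<in>C. M a w * x w)"
      using step C M x by (intro member_le_sum) auto
    ultimately have "M a b * x b \<le> 0" by simp
    with step x[of b] show ?case by (auto simp: mult_le_0_iff)
  qed (use v in auto)
qed

text \<open>
  Let \<open>t\<close> be the least quotient of \<open>m\<close> by \<open>x\<close>. Then \<open>m - t x\<close> is nonnegative, subinvariant and
  has a zero, which propagates to all of \<open>C\<close>.
\<close>

lemma irreducible_subinvariant_multiple:
  assumes irr: "irreducible_on C M" and x: "\<And>v. v \<in> C \<Longrightarrow> 0 < x v"
    and eq: "\<And>v. v \<in> C \<Longrightarrow> (\<Sum>w\<in>C. M v w * x w) = r * x v"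
    and le: "\<And>v. v \<in> C \<Longrightarrow> (\<Sum>w\<in>C. M v w * m w) \<le> r * m v"
  shows "\<exists>t. \<forall>v\<in>C. m v = t * x v"
proof -
  have C: "finite C" "C \<noteq> {}" using irr by (auto simp: irreducible_on_def)
  define t where "t = Min ((\<lambda>v. m v / x v) ` C)"
  have "t \<in> (\<lambda>v. m v / x v) ` C" unfolding t_def using C by (intro Min_in) auto
  then obtain v where v: "v \<in> C" "t = m v / x v" by auto
  have min: "t \<le> m w / x w" if "w \<in> C" for w unfolding t_def using C that by (intro Min_le) auto
  have "m w - t * x w = 0" if w: "w \<in> C" for w
  proof (rule irreducible_zero_propagates[where x = "\<lambda>u. m u - t * x u" and r = r, OF irr _ _ v(1) _ w])
    fix u assume u: "u \<in> C"
    show "0 \<le> m u - t * x u" using min[OF u] x[OF u] by (simp add: field_simps)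
    have "(\<Sum>w\<in>C. M u w * (m w - t * x w)) = (\<Sum>w\<in>C. M u w * m w) - t * (\<Sum>w\<in>C. M u w * x w)"
      by (simp add: algebra_simps sum_subtractf sum_distrib_left)
    then show "(\<Sum>w\<in>C. M u w * (m w - t * x w)) \<le> r * (m u - t * x u)"
      using eq[OF u] le[OF u] by (simp add: algebra_simps)
  next
    show "m v - t * x v = 0" using v x[of v] by simp
  qed
  then show ?thesis by (intro exI[of _ t]) auto
qed

text \<open>By induction on the number of places where the inequality is not strict.\<close>

lemma irreducible_make_strict:
  assumes irr: "irreducible_on C M" and t: "0 \<le> t"
    and "\<And>v. v \<in> C \<Longrightarrow> 0 \<le> x v"
    and "\<And>v. v \<in> C \<Longrightarrow> t * x v \<le> (\<Sum>w\<in>C. M v w * x w)"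
    and "\<exists>v\<in>C. t * x v \<noteq> (\<Sum>w\<in>C. M v w * x w)"
  shows "\<exists>y. (\<forall>v\<in>C. 0 \<le> y v) \<and> (\<forall>v\<in>C. t * y v < (\<Sum>w\<in>C. M v w * y w))"
  using assms(3-)
proof (induction "card {v \<in> C. t * x v = (\<Sum>w\<in>C. M v w * x w)}" arbitrary: x rule: less_induct)
  case less
  have C: "finite C" and M: "\<And>v w. v \<in> C \<Longrightarrow> w \<in> C \<Longrightarrow> 0 \<le> M v w"
    using irr by (auto simp: irreducible_on_def)
  let ?S = "\<lambda>x. {v \<in> C. t * x v = (\<Sum>w\<in>C. M v w * x w)}"
  show ?case
  proof (cases "?S x = {}")
    case True
    with less.prems show ?thesis by (intro exI[of _ x]) (auto simp: less_le)
  next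
    case False
    then obtain v0 where v0: "v0 \<in> ?S x" by auto
    obtain u0 where u0: "u0 \<in> C" "u0 \<notin> ?S x" using less.prems by auto
    have "(v0, u0) \<in> {(a, b). a \<in> C \<and> b \<in> C \<and> 0 < M a b}\<^sup>*"
      using irr v0 u0 by (auto simp: irreducible_on_def)
    then have "\<exists>v u. v \<in> ?S x \<and> u \<in> C \<and> u \<notin> ?S x \<and> 0 < M v u"
      using v0 u0 by (induction rule: converse_rtrancl_induct) blast+
    then obtain v u where vu: "v \<in> ?S x" "u \<in> C" "u \<notin> ?S x" "0 < M v u" by blast
    \<comment> \<open>Raising the coordinate of a strict vertex a little keeps it strict and makes its predecessors strict.\<close>
    define e where "e = ((\<Sum>w\<in>C. M u w * x w) - t * x u) / (t + 1)"
    have pos: "0 < (\<Sum>w\<in>C. M u w * x w) - t * x u" using less.prems(2)[of u] vu by auto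
    then have e: "0 < e" "t * e < (\<Sum>w\<in>C. M u w * x w) - t * x u"
      using t unfolding e_def by (simp_all add: field_simps)
    define y where "y = x(u := x u + e)"
    have y: "(\<Sum>w\<in>C. M a w * y w) = (\<Sum>w\<in>C. M a w * x w) + M a u * e" for a
    proof -
      have "(\<Sum>w\<in>C. M a w * y w) = (\<Sum>w\<in>C. M a w * x w + (if w = u then M a w * e else 0))"
        by (intro sum.cong) (auto simp: y_def algebra_simps)
      also have "\<dots> = (\<Sum>w\<in>C. M a w * x w) + M a u * e"
        using vu C by (simp add: sum.distrib sum.delta)
      finally show ?thesis .
    qed
    have strict_u: "t * y u < (\<Sum>w\<in>C. M u w * y w)"
      unfolding y using e M[of u u] vu by (simp add: y_def algebra_simps)
        (smt (verit) mult_nonneg_nonneg)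
    have le: "t * y a \<le> (\<Sum>w\<in>C. M a w * y w)" if "a \<in> C" for a
    proof (cases "a = u")
      case False
      have "0 \<le> M a u * e" using M[OF that vu(2)] e by simp
      with False less.prems(2)[OF that] show ?thesis unfolding y by (simp add: y_def)
    qed (use strict_u in simp)
    have sub: "?S y \<subseteq> ?S x"
    proof
      fix a assume a: "a \<in> ?S y"
      then have "a \<noteq> u" using strict_u by auto
      moreover have "0 \<le> M a u * e" using M[of a u] a e vu by simp
      ultimately show "a \<in> ?S x" using a less.prems(2)[of a] unfolding y by (auto simp: y_def)
    qed
    have "v \<notin> ?S y"
    proof
      assume "v \<in> ?S y"
      moreover have "v \<noteq> u" using vu by auto
      moreover have "0 < M v u * e" using vu e by simp
      ultimately show False using vu(1) unfolding y by (auto simp: y_def)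
    qed
    with sub vu(1) have "?S y \<subset> ?S x" by blast
    then have "card (?S y) < card (?S x)" using C by (intro psubset_card_mono) auto
    moreover have "\<And>a. a \<in> C \<Longrightarrow> 0 \<le> y a" using less.prems(1) e vu by (auto simp: y_def add_nonneg_nonneg)
    moreover have "\<exists>a\<in>C. t * y a \<noteq> (\<Sum>w\<in>C. M a w * y w)" using strict_u vu by fastforce
    ultimately show ?thesis using less.hyps[of y] le by blast
  qed
qed

text \<open>A largest \<open>t\<close> exists by compactness of the unit simplex.\<close>

lemma collatz_wielandt_attained:
  fixes M :: "'v \<Rightarrow> 'v \<Rightarrow> real"
  assumes C: "finite C" "C \<noteq> {}" and M: "\<And>v w. v \<in> C \<Longrightarrow> w \<in> C \<Longrightarrow> 0 \<le> M v w"
  obtains t x where "0 \<le> t" "\<forall>v\<in>C. 0 \<le> x v" "\<forall>v. v \<notin> C \<longrightarrow> x v = 0" "(\<Sum>v\<in>C. x v) = 1"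
    "\<forall>v\<in>C. t * x v \<le> (\<Sum>w\<in>C. M v w * x w)"
    "\<forall>s y. (\<forall>v\<in>C. 0 \<le> y v) \<and> (\<exists>v\<in>C. y v \<noteq> 0) \<and>
      (\<forall>v\<in>C. s * y v \<le> (\<Sum>w\<in>C. M v w * y w)) \<longrightarrow> s \<le> t"
proof -
  define T where "T = (\<Sum>v\<in>C. \<Sum>w\<in>C. M v w)"
  define K :: "('v \<Rightarrow> real) set" where "K = PiE UNIV (\<lambda>v. if v \<in> C then {0..1} else {0})"
  define S where "S = {p \<in> {0..T} \<times> K. (\<Sum>v\<in>C. snd p v) = 1 \<and>
      (\<forall>v\<in>C. fst p * snd p v \<le> (\<Sum>w\<in>C. M v w * snd p w))}"
  have "compactin (product_topology (\<lambda>_. euclidean) UNIV) K"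
    unfolding K_def by (subst compactin_PiE) auto
  then have K: "compact K" by (simp add: euclidean_product_topology)
  have cont: "continuous_on UNIV (\<lambda>p::real \<times> ('v \<Rightarrow> real). snd p v)" for v
    by (rule continuous_on_product_then_coordinatewise[OF continuous_on_snd[OF continuous_on_id]])
  have cont_fst: "continuous_on UNIV (\<lambda>p::real \<times> ('v \<Rightarrow> real). fst p)"
    by (rule continuous_on_fst[OF continuous_on_id])
  have "closed {p :: real \<times> ('v \<Rightarrow> real). (\<Sum>v\<in>C. snd p v) = 1}"
    by (intro closed_Collect_eq continuous_on_sum cont continuous_on_const)
  moreover have "closed {p :: real \<times> ('v \<Rightarrow> real). \<forall>v\<in>C. fst p * snd p v \<le> (\<Sum>w\<in>C. M v w * snd p w)}"
  proof -
    have "closed (\<Inter>v\<in>C. {p :: real \<times> ('v \<Rightarrow> real). fst p * snd p v \<le> (\<Sum>w\<in>C. M v w * snd p w)})"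
      by (intro closed_INT ballI closed_Collect_le continuous_on_sum continuous_on_mult cont
          cont_fst continuous_on_const)
    then show ?thesis by (simp add: Collect_ball_eq)
  qed
  ultimately have "compact S"
  proof -
    assume a: "closed {p :: real \<times> ('v \<Rightarrow> real). (\<Sum>v\<in>C. snd p v) = 1}"
      "closed {p :: real \<times> ('v \<Rightarrow> real). \<forall>v\<in>C. fst p * snd p v \<le> (\<Sum>w\<in>C. M v w * snd p w)}"
    have "S = ({0..T} \<times> K) \<inter> ({p. (\<Sum>v\<in>C. snd p v) = 1} \<inter>
        {p. \<forall>v\<in>C. fst p * snd p v \<le> (\<Sum>w\<in>C. M v w * snd p w)})"
      unfolding S_def by auto
    then show ?thesis using a K by (auto intro!: compact_Int_closed compact_Times closed_Int)
  qed
  have normalize: "(max s 0, \<lambda>v. if v \<in> C then y v / (\<Sum>w\<in>C. y w) else 0) \<in> S"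
    if y: "\<forall>v\<in>C. 0 \<le> y v" "\<exists>v\<in>C. y v \<noteq> 0" "\<forall>v\<in>C. s * y v \<le> (\<Sum>w\<in>C. M v w * y w)" for s y
  proof -
    define Y where "Y = (\<Sum>w\<in>C. y w)"
    have Y: "0 < Y" unfolding Y_def using y C
      by (auto simp: less_le sum_nonneg sum_nonneg_eq_0_iff)
    have yY: "y v \<le> Y" if "v \<in> C" for v unfolding Y_def using that y C by (intro member_le_sum) auto
    have le: "max s 0 * y v \<le> (\<Sum>w\<in>C. M v w * y w)" if "v \<in> C" for v
      using y that M by (cases "0 \<le> s") (auto simp: max_def intro!: sum_nonneg)
    have "max s 0 * Y \<le> (\<Sum>v\<in>C. \<Sum>w\<in>C. M v w * y w)"
      unfolding Y_def sum_distrib_left by (intro sum_mono le)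
    also have "\<dots> \<le> (\<Sum>v\<in>C. \<Sum>w\<in>C. M v w * Y)"
      using M yY by (intro sum_mono mult_left_mono) auto
    also have "\<dots> = T * Y" by (simp add: T_def sum_distrib_right)
    finally have "max s 0 \<le> T" using Y by simp
    moreover have "(\<lambda>v. if v \<in> C then y v / Y else 0) \<in> K"
      unfolding K_def using y yY Y by (auto simp: PiE_iff)
    moreover have "(\<Sum>v\<in>C. if v \<in> C then y v / Y else 0) = 1"
    proof -
      have "(\<Sum>v\<in>C. if v \<in> C then y v / Y else 0) = (\<Sum>v\<in>C. y v) / Y"
        by (simp add: sum_divide_distrib)
      also have "\<dots> = 1" using Y unfolding Y_def[symmetric] by simp
      finally show ?thesis .
    qed
    moreover have "max s 0 * (y v / Y) \<le> (\<Sum>w\<in>C. M v w * (if w \<in> C then y w / Y else 0))" if v: "v \<in> C" for v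
    proof -
      have "(\<Sum>w\<in>C. M v w * (if w \<in> C then y w / Y else 0)) = (\<Sum>w\<in>C. M v w * y w) / Y"
        by (simp add: sum_divide_distrib)
      then show ?thesis using le[OF v] Y by (simp add: field_simps)
    qed
    ultimately show ?thesis unfolding S_def Y_def[symmetric] by auto
  qed
  have "(max 0 0, \<lambda>v. if v \<in> C then 1 / (\<Sum>w\<in>C. 1) else 0) \<in> S"
    using C M by (intro normalize) (auto intro!: sum_nonneg)
  then have "S \<noteq> {}" by auto
  then obtain p where p: "p \<in> S" "\<forall>q\<in>S. fst q \<le> fst p"
    using continuous_attains_sup[OF \<open>compact S\<close>, of fst] continuous_on_fst[OF continuous_on_id] by blast
  show ?thesis
  proof (rule that[of "fst p" "snd p"])
    have pK: "snd p \<in> K" using p(1) by (auto simp: S_def)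
    show "\<forall>v\<in>C. 0 \<le> snd p v"
      using pK unfolding K_def PiE_iff by (metis UNIV_I atLeastAtMost_iff)
    show "\<forall>v. v \<notin> C \<longrightarrow> snd p v = 0"
      using pK unfolding K_def PiE_iff by (metis UNIV_I singletonD)
    show "\<forall>s y. (\<forall>v\<in>C. 0 \<le> y v) \<and> (\<exists>v\<in>C. y v \<noteq> 0) \<and>
        (\<forall>v\<in>C. s * y v \<le> (\<Sum>w\<in>C. M v w * y w)) \<longrightarrow> s \<le> fst p"
    proof (intro allI impI)
      fix s y assume "(\<forall>v\<in>C. 0 \<le> y v) \<and> (\<exists>v\<in>C. y v \<noteq> 0) \<and>
        (\<forall>v\<in>C. s * y v \<le> (\<Sum>w\<in>C. M v w * y w))"
      then have "(max s 0, \<lambda>v. if v \<in> C then y v / (\<Sum>w\<in>C. y w) else 0) \<in> S"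
        by (intro normalize) blast+
      from bspec[OF p(2) this] show "s \<le> fst p" by simp
    qed
  qed (use p(1) in \<open>auto simp: S_def\<close>)
qed

text \<open>
  A vector at which the Collatz--Wielandt bound is attained is an eigenvector, since otherwise
  the bound could be improved; and the absolute values of any eigenvector are admissible for
  the bound.
\<close>

theorem perron_frobenius:
  fixes M :: "'v \<Rightarrow> 'v \<Rightarrow> real"
  assumes irr: "irreducible_on C M"
  shows "\<exists>x. (\<forall>v\<in>C. 0 < x v) \<and> (\<forall>v. v \<notin> C \<longrightarrow> x v = 0) \<and> (\<Sum>v\<in>C. x v) = 1 \<and>
      (\<forall>v\<in>C. (\<Sum>w\<in>C. M v w * x w) = mat_spectral_radius M C * x v)"
    and "\<And>s y. (\<And>v. v \<in> C \<Longrightarrow> 0 \<le> y v) \<Longrightarrow> \<exists>v\<in>C. y v \<noteq> 0 \<Longrightarrow>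
      (\<And>v. v \<in> C \<Longrightarrow> s * y v \<le> (\<Sum>w\<in>C. M v w * y w)) \<Longrightarrow> s \<le> mat_spectral_radius M C"
    and "0 \<le> mat_spectral_radius M C"
    and "\<And>l. mat_eigenvalue M C l \<Longrightarrow> cmod l \<le> mat_spectral_radius M C"
proof -
  have C: "finite C" "C \<noteq> {}" and M: "\<And>v w. v \<in> C \<Longrightarrow> w \<in> C \<Longrightarrow> 0 \<le> M v w"
    using irr by (auto simp: irreducible_on_def)
  obtain t x where t: "0 \<le> t" and x0: "\<forall>v\<in>C. 0 \<le> x v" "\<forall>v. v \<notin> C \<longrightarrow> x v = 0" "(\<Sum>v\<in>C. x v) = 1"
    and tx0: "\<forall>v\<in>C. t * x v \<le> (\<Sum>w\<in>C. M v w * x w)"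
    and max0: "\<forall>s y. (\<forall>v\<in>C. 0 \<le> y v) \<and> (\<exists>v\<in>C. y v \<noteq> 0) \<and>
      (\<forall>v\<in>C. s * y v \<le> (\<Sum>w\<in>C. M v w * y w)) \<longrightarrow> s \<le> t"
    by (rule collatz_wielandt_attained[OF C, of M], rule M, assumption, assumption, rule that, assumption+)
  have x: "\<And>v. v \<in> C \<Longrightarrow> 0 \<le> x v" "\<And>v. v \<notin> C \<Longrightarrow> x v = 0" "(\<Sum>v\<in>C. x v) = 1"
    and tx: "\<And>v. v \<in> C \<Longrightarrow> t * x v \<le> (\<Sum>w\<in>C. M v w * x w)" using x0 tx0 by auto
  have max: "s \<le> t" if "\<And>v. v \<in> C \<Longrightarrow> 0 \<le> y v" "\<exists>v\<in>C. y v \<noteq> 0"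
      "\<And>v. v \<in> C \<Longrightarrow> s * y v \<le> (\<Sum>w\<in>C. M v w * y w)" for s y
    using max0 that by blast
  have eq: "(\<Sum>w\<in>C. M v w * x w) = t * x v" if v: "v \<in> C" for v
  proof (rule ccontr)
    assume "(\<Sum>w\<in>C. M v w * x w) \<noteq> t * x v"
    then obtain y where y: "\<forall>v\<in>C. 0 \<le> y v" "\<forall>v\<in>C. t * y v < (\<Sum>w\<in>C. M v w * y w)"
      using irreducible_make_strict[OF irr t x(1) tx] v by metis
    define e where "e = Min ((\<lambda>v. ((\<Sum>w\<in>C. M v w * y w) - t * y v) / (1 + y v)) ` C)"
    have "0 < e" unfolding e_def using C y by (subst Min_gr_iff) (auto simp: add_pos_nonneg)
    have "e \<le> ((\<Sum>w\<in>C. M v w * y w) - t * y v) / (1 + y v)" if "v \<in> C" for v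
      unfolding e_def using C that by (intro Min_le) auto
    moreover have "0 < 1 + y v" if "v \<in> C" for v using y that by (auto simp: add_pos_nonneg)
    ultimately have le: "e * (1 + y v) \<le> (\<Sum>w\<in>C. M v w * y w) - t * y v" if "v \<in> C" for v
      using that by (metis pos_le_divide_eq)
    have "(t + e) * y v \<le> (\<Sum>w\<in>C. M v w * y w)" if "v \<in> C" for v
      using le[OF that] \<open>0 < e\<close> by (simp add: algebra_simps)
    moreover have "\<exists>v\<in>C. y v \<noteq> 0"
    proof (rule ccontr)
      assume "\<not> ?thesis"
      then have "(\<Sum>w\<in>C. M v w * y w) = 0" "y v = 0" using v by auto
      then show False using y(2) v by fastforce
    qed
    ultimately have "t + e \<le> t" using y by (intro max) auto
    with \<open>0 < e\<close> show False by simp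
  qed
  have pos: "0 < x v" if v: "v \<in> C" for v
  proof (rule ccontr)
    assume "\<not> 0 < x v"
    with x(1)[OF v] have "x v = 0" by simp
    then have "x w = 0" if "w \<in> C" for w
      using irreducible_zero_propagates[where r = t and x = x, OF irr x(1) _ v _ that] eq by auto
    with x(3) show False by simp
  qed
  have bound: "cmod l \<le> t" if l: "mat_eigenvalue M C l" for l
  proof -
    from l obtain z where z: "\<exists>v\<in>C. z v \<noteq> 0" "\<And>v. v \<in> C \<Longrightarrow> (\<Sum>w\<in>C. of_real (M v w) * z w) = l * z v"
      unfolding mat_eigenvalue_def by blast
    show ?thesis
    proof (rule max[of "\<lambda>v. cmod (z v)"])
      fix v assume v: "v \<in> C"
      have "cmod l * cmod (z v) = cmod (\<Sum>w\<in>C. of_real (M v w) * z w)"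
        using z(2)[OF v] by (simp add: norm_mult)
      also have "\<dots> \<le> (\<Sum>w\<in>C. M v w * cmod (z w))"
        using M v by (intro sum_norm_le) (simp add: norm_mult)
      finally show "cmod l * cmod (z v) \<le> (\<Sum>w\<in>C. M v w * cmod (z w))" .
    qed (use z in auto)
  qed
  have "mat_eigenvalue M C (of_real t)"
    unfolding mat_eigenvalue_def
  proof (intro exI[of _ "\<lambda>v. of_real (x v)"] conjI ballI)
    show "\<exists>v\<in>C. complex_of_real (x v) \<noteq> 0" using C pos by fastforce
    fix v assume "v \<in> C"
    show "(\<Sum>w\<in>C. of_real (M v w) * complex_of_real (x w)) = of_real t * of_real (x v)"
      using arg_cong[OF eq[OF \<open>v \<in> C\<close>], of complex_of_real] by simp
  qed
  then have "Max (norm ` {l. mat_eigenvalue M C l}) = t"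
    using bound t by (intro Max_eqI finite_imageI finite_mat_eigenvalues C) (auto intro!: image_eqI[of _ _ "of_real t"])
  then have r: "mat_spectral_radius M C = t" using C by (simp add: mat_spectral_radius_def)
  show "\<exists>x. (\<forall>v\<in>C. 0 < x v) \<and> (\<forall>v. v \<notin> C \<longrightarrow> x v = 0) \<and> (\<Sum>v\<in>C. x v) = 1 \<and>
      (\<forall>v\<in>C. (\<Sum>w\<in>C. M v w * x w) = mat_spectral_radius M C * x v)"
    unfolding r using pos x eq by blast
  show "0 \<le> mat_spectral_radius M C" "\<And>l. mat_eigenvalue M C l \<Longrightarrow> cmod l \<le> mat_spectral_radius M C"
    unfolding r using t bound by auto
  show "\<And>s y. (\<And>v. v \<in> C \<Longrightarrow> 0 \<le> y v) \<Longrightarrow> \<exists>v\<in>C. y v \<noteq> 0 \<Longrightarrow>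
      (\<And>v. v \<in> C \<Longrightarrow> s * y v \<le> (\<Sum>w\<in>C. M v w * y w)) \<Longrightarrow> s \<le> mat_spectral_radius M C"
    unfolding r by (rule max)
qed


section \<open>Strongly connected components\<close>

lemma vertex_le_refl: "v \<in> verts E \<Longrightarrow> vertex_le E v v"
  by (auto simp: vertex_le_def intro!: exI[of _ "[]"])

lemma vertex_le_trans: "vertex_le E u v \<Longrightarrow> vertex_le E v w \<Longrightarrow> vertex_le E u w"
  using is_path_append unfolding vertex_le_def by metis

lemma vertex_le_verts:
  assumes "fin_digraph E" "vertex_le E v w"
  shows "v \<in> verts E" "w \<in> verts E"
proof -
  interpret fin_digraph E by fact
  obtain es where "is_path E v es w" using assms by (auto simp: vertex_le_def)
  then show "v \<in> verts E" "w \<in> verts E" by (cases es; auto dest: is_path_verts)+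
qed

lemma vertex_matrix_nonneg: "0 \<le> vertex_matrix E v w"
  by (simp add: vertex_matrix_def)

lemma vertex_matrix_pos_imp_le:
  assumes "fin_digraph E" "vertex_matrix E v w \<noteq> 0"
  shows "vertex_le E v w"
proof -
  interpret fin_digraph E by fact
  have "{e \<in> arcs E. head E e = v \<and> tail E e = w} \<noteq> {}"
  proof
    assume "{e \<in> arcs E. head E e = v \<and> tail E e = w} = {}"
    then show False using assms(2) unfolding vertex_matrix_def by simp
  qed
  then obtain e where "e \<in> arcs E" "head E e = v" "tail E e = w" by auto
  then have "is_path E v [e] w" by auto
  then show ?thesis unfolding vertex_le_def by blast
qed

lemma vertex_matrix_arc_pos:
  assumes "fin_digraph E" "e \<in> arcs E"
  shows "0 < vertex_matrix E (head E e) (tail E e)"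
proof -
  interpret fin_digraph E by fact
  have "finite {f \<in> arcs E. head E f = head E e \<and> tail E f = tail E e}" by simp
  then have "0 < card {f \<in> arcs E. head E f = head E e \<and> tail E f = tail E e}"
    using assms(2) by (auto simp: card_gt_0_iff)
  then show ?thesis by (simp add: vertex_matrix_def)
qed

lemma vertex_matrix_mult_eq_sum_arcs:
  assumes "fin_digraph E"
  shows "(\<Sum>w\<in>verts E. vertex_matrix E v w * m w) = (\<Sum>e\<in>edges_into E v. m (tail E e))"
proof -
  interpret fin_digraph E by fact
  have "(\<Sum>e\<in>edges_into E v. m (tail E e))
     = (\<Sum>w\<in>verts E. \<Sum>e\<in>{e \<in> edges_into E v. tail E e = w}. m (tail E e))"
    by (rule sum.group[symmetric]) auto
  also have "\<dots> = (\<Sum>w\<in>verts E. vertex_matrix E v w * m w)"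
  proof (rule sum.cong)
    fix w
    have "(\<Sum>e\<in>{e \<in> edges_into E v. tail E e = w}. m (tail E e))
        = (\<Sum>e\<in>{e \<in> arcs E. head E e = v \<and> tail E e = w}. m w)" by (rule sum.cong) auto
    then show "(\<Sum>e\<in>{e \<in> edges_into E v. tail E e = w}. m (tail E e)) = vertex_matrix E v w * m w"
      by (simp add: vertex_matrix_def)
  qed simp
  finally show ?thesis ..
qed

definition component_of :: "('v, 'e) pre_digraph \<Rightarrow> 'v \<Rightarrow> 'v set" where
  "component_of E v = {w. vertex_le E v w \<and> vertex_le E w v}"

lemma strong_components_eq:
  assumes "fin_digraph E"
  shows "strong_components E = component_of E ` verts E"
  unfolding strong_components_def quotient_def component_of_def
  using vertex_le_verts[OF assms] by auto

lemma component_of_eq: "w \<in> component_of E v \<Longrightarrow> component_of E w = component_of E v"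
  unfolding component_of_def using vertex_le_trans by fast

lemma mem_component_of: "v \<in> verts E \<Longrightarrow> v \<in> component_of E v"
  by (simp add: component_of_def vertex_le_refl)

lemma strong_componentD:
  assumes "fin_digraph E" "C \<in> strong_components E"
  shows "finite C" "C \<subseteq> verts E" "C \<noteq> {}" "v \<in> C \<Longrightarrow> C = component_of E v"
    "v \<in> C \<Longrightarrow> w \<in> C \<Longrightarrow> vertex_le E v w"
proof -
  interpret fin_digraph E by fact
  from assms obtain u where u: "u \<in> verts E" "C = component_of E u" by (auto simp: strong_components_eq)
  then show sub: "C \<subseteq> verts E" using vertex_le_verts[OF assms(1)] by (auto simp: component_of_def)
  show "finite C" by (rule finite_subset[OF sub]) simp
  show "C \<noteq> {}" using u mem_component_of by fast
  show *: "C = component_of E v" if "v \<in> C" for v using component_of_eq that u by metis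
  show "vertex_le E v w" if "v \<in> C" "w \<in> C" using *[OF that(1)] that(2) by (auto simp: component_of_def)
qed

lemma finite_strong_components:
  assumes "fin_digraph E" shows "finite (strong_components E)"
proof -
  interpret fin_digraph E by fact
  show ?thesis by (simp add: strong_components_eq[OF assms])
qed

lemma strong_component_irreducible:
  assumes E: "fin_digraph E" and C: "C \<in> strong_components E"
  shows "irreducible_on C (vertex_matrix E)"
proof -
  let ?R = "{(a, b). a \<in> C \<and> b \<in> C \<and> 0 < vertex_matrix E a b}"
  note CD = strong_componentD[OF E C]
  have path: "(v, w) \<in> ?R\<^sup>*" if "is_path E v es w" "v \<in> C" "w \<in> C" for v es w
    using that
  proof (induction es arbitrary: v)
    case (Cons e es)
    then have e: "e \<in> arcs E" "head E e = v" "is_path E (tail E e) es w" by auto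
    have "vertex_le E v (tail E e)" using e vertex_matrix_arc_pos[OF E e(1)] vertex_matrix_pos_imp_le[OF E]
      by fastforce
    moreover have "vertex_le E (tail E e) v"
      using e CD(5)[of w v] Cons.prems vertex_le_trans unfolding vertex_le_def
      by (metis is_path_append)
    ultimately have t: "tail E e \<in> C" using CD(4)[of v] Cons.prems by (auto simp: component_of_def)
    then have "(v, tail E e) \<in> ?R" using e Cons.prems vertex_matrix_arc_pos[OF E e(1)] by auto
    then show ?case using Cons.IH[OF e(3) t Cons.prems(3)] by (rule converse_rtrancl_into_rtrancl)
  qed auto
  show ?thesis unfolding irreducible_on_def
  proof (intro conjI ballI)
    fix v w assume "v \<in> C" "w \<in> C"
    then show "(v, w) \<in> ?R\<^sup>*" using CD(5)[of v w] path unfolding vertex_le_def by blast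
  qed (simp_all add: CD(1,3) vertex_matrix_nonneg)
qed

abbreviation component_rho :: "('v, 'e) pre_digraph \<Rightarrow> 'v set \<Rightarrow> real" where
  "component_rho E \<equiv> mat_spectral_radius (vertex_matrix E)"

lemma exists_top_vertex:
  assumes S: "finite S" "S \<noteq> {}" "S \<subseteq> verts E"
  shows "\<exists>v\<in>S. \<forall>w\<in>S. vertex_le E v w \<longrightarrow> vertex_le E w v"
proof -
  let ?up = "\<lambda>v. {u \<in> S. vertex_le E v u}"
  obtain v where v: "v \<in> S" "\<forall>w\<in>S. card (?up v) \<le> card (?up w)"
    using ex_has_least_nat[of "\<lambda>v. v \<in> S" _ "\<lambda>v. card (?up v)"] S by blast
  have "vertex_le E w v" if w: "w \<in> S" "vertex_le E v w" for w
  proof (rule ccontr)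
    assume n: "\<not> vertex_le E w v"
    have "?up w \<subseteq> ?up v" using w(2) vertex_le_trans by fast
    moreover have "v \<in> ?up v" "v \<notin> ?up w" using n v S(3) vertex_le_refl[of v E] by auto
    ultimately have "card (?up w) < card (?up v)" using S by (intro psubset_card_mono) auto
    with v w show False by fastforce
  qed
  with v show ?thesis by blast
qed

text \<open>
  A vector restricted to a component that is maximal among those meeting its support sees only the
  diagonal block: all other nonzero entries that the matrix could pick up lie strictly above.
\<close>

lemma top_component_block:
  fixes x :: "'v \<Rightarrow> 'f::{real_algebra_1, idom}"
  assumes E: "fin_digraph E" and D: "D \<subseteq> verts E" "\<And>v. v \<in> D \<Longrightarrow> component_of E v \<subseteq> D"
    and x: "\<exists>v\<in>D. x v \<noteq> 0"
  shows "\<exists>C\<in>strong_components E. C \<subseteq> D \<and> (\<exists>v\<in>C. x v \<noteq> 0) \<and>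
    (\<forall>v\<in>C. (\<Sum>w\<in>D. of_real (vertex_matrix E v w) * x w) = (\<Sum>w\<in>C. of_real (vertex_matrix E v w) * x w))"
proof -
  interpret fin_digraph E by fact
  have finD: "finite D" by (rule finite_subset[OF D(1)]) simp
  obtain v where v: "v \<in> D" "x v \<noteq> 0" "\<And>w. w \<in> D \<Longrightarrow> x w \<noteq> 0 \<Longrightarrow> vertex_le E v w \<Longrightarrow> vertex_le E w v"
    using exists_top_vertex[of "{v \<in> D. x v \<noteq> 0}" E] finD D(1) x by auto
  let ?C = "component_of E v"
  have "(\<Sum>w\<in>D. of_real (vertex_matrix E u w) * x w) = (\<Sum>w\<in>?C. of_real (vertex_matrix E u w) * x w)"
    if u: "u \<in> ?C" for u
  proof (rule sum.mono_neutral_right)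
    show "\<forall>w\<in>D - ?C. of_real (vertex_matrix E u w) * x w = 0"
    proof (rule ballI, rule ccontr)
      fix w assume w: "w \<in> D - ?C" "of_real (vertex_matrix E u w) * x w \<noteq> 0"
      then have "vertex_le E u w" "x w \<noteq> 0" using vertex_matrix_pos_imp_le[OF E, of u w] by auto
      then have "vertex_le E v w" using u vertex_le_trans by (fastforce simp: component_of_def)
      with w v(3)[of w] \<open>x w \<noteq> 0\<close> show False by (auto simp: component_of_def)
    qed
  qed (use finD D v in auto)
  then show ?thesis using v D mem_component_of[of v E] strong_components_eq[OF E]
    by (intro bexI[of _ ?C]) auto
qed

text \<open>An eigenvector restricts to an eigenvector of the block of a top component.\<close>

lemma graph_eigenvalue_le_component_rho:
  assumes E: "fin_digraph E" and l: "mat_eigenvalue (vertex_matrix E) (verts E) l"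
  shows "\<exists>C\<in>strong_components E. cmod l \<le> component_rho E C"
proof -
  from l obtain x where x: "\<exists>v\<in>verts E. x v \<noteq> 0"
    "\<And>v. v \<in> verts E \<Longrightarrow> (\<Sum>w\<in>verts E. of_real (vertex_matrix E v w) * x w) = l * x v"
    unfolding mat_eigenvalue_def by blast
  obtain C where C: "C \<in> strong_components E" "\<exists>v\<in>C. x v \<noteq> 0"
    "\<forall>v\<in>C. (\<Sum>w\<in>verts E. of_real (vertex_matrix E v w) * x w) = (\<Sum>w\<in>C. of_real (vertex_matrix E v w) * x w)"
    using top_component_block[OF E subset_refl _ x(1)] vertex_le_verts[OF E]
    by (auto simp: component_of_def)
  have "mat_eigenvalue (vertex_matrix E) C l"
    unfolding mat_eigenvalue_def using C x(2) strong_componentD(2)[OF E C(1)] by (metis subsetD)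
  then show ?thesis using perron_frobenius(4)[OF strong_component_irreducible[OF E C(1)]] C(1) by blast
qed

lemma superinvariant_le_component_rho:
  assumes E: "fin_digraph E" and D: "D \<subseteq> verts E" "\<And>v. v \<in> D \<Longrightarrow> component_of E v \<subseteq> D"
    and x: "\<And>v. v \<in> D \<Longrightarrow> 0 \<le> x v" "\<exists>v\<in>D. x v \<noteq> 0"
    and le: "\<And>v. v \<in> D \<Longrightarrow> r * x v \<le> (\<Sum>w\<in>D. vertex_matrix E v w * x w)"
  shows "\<exists>C\<in>strong_components E. C \<subseteq> D \<and> r \<le> component_rho E C"
proof -
  obtain C where C: "C \<in> strong_components E" "C \<subseteq> D" "\<exists>v\<in>C. x v \<noteq> 0"
    "\<forall>v\<in>C. (\<Sum>w\<in>D. vertex_matrix E v w * x w) = (\<Sum>w\<in>C. vertex_matrix E v w * x w)"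
    using top_component_block[OF E D x(2)] by auto
  have "r \<le> component_rho E C"
  proof (rule perron_frobenius(2)[OF strong_component_irreducible[OF E C(1)], of x])
    fix v assume v: "v \<in> C"
    then have "v \<in> D" using C(2) by auto
    then show "0 \<le> x v" by (rule x(1))
    show "r * x v \<le> (\<Sum>w\<in>C. vertex_matrix E v w * x w)"
      using le[OF \<open>v \<in> D\<close>] C(4) v by simp
  qed (use C in auto)
  with C show ?thesis by blast
qed

lemma subinvariant_nonneg:
  assumes E: "fin_digraph E" and D: "D \<subseteq> verts E" "\<And>v. v \<in> D \<Longrightarrow> component_of E v \<subseteq> D"
    and r: "\<And>C. C \<in> strong_components E \<Longrightarrow> C \<subseteq> D \<Longrightarrow> component_rho E C < r"
    and le: "\<And>v. v \<in> D \<Longrightarrow> (\<Sum>w\<in>D. vertex_matrix E v w * x w) \<le> r * x v"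
    and v: "v \<in> D"
  shows "0 \<le> x v"
proof (rule ccontr)
  assume neg: "\<not> 0 \<le> x v"
  \<comment> \<open>The negative part of \<open>x\<close> would be a nonzero superinvariant vector.\<close>
  have "\<exists>C\<in>strong_components E. C \<subseteq> D \<and> r \<le> component_rho E C"
  proof (rule superinvariant_le_component_rho[OF E D, where x = "\<lambda>v. max (- x v) 0"])
    show "\<exists>v\<in>D. max (- x v) 0 \<noteq> 0" using v neg by (intro bexI[of _ v]) auto
    fix u assume u: "u \<in> D"
    show "r * max (- x u) 0 \<le> (\<Sum>w\<in>D. vertex_matrix E u w * max (- x w) 0)"
    proof (cases "x u \<le> 0")
      case True
      then have "r * max (- x u) 0 = - (r * x u)" by (simp add: max_def)
      also have "\<dots> \<le> - (\<Sum>w\<in>D. vertex_matrix E u w * x w)" using le[OF u] by simp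
      also have "\<dots> = (\<Sum>w\<in>D. vertex_matrix E u w * (- x w))" by (simp add: sum_negf)
      also have "\<dots> \<le> (\<Sum>w\<in>D. vertex_matrix E u w * max (- x w) 0)"
        by (intro sum_mono mult_left_mono vertex_matrix_nonneg) auto
      finally show ?thesis .
    next
      case False
      then have "max (- x u) 0 = 0" by simp
      then show ?thesis by (auto intro!: sum_nonneg mult_nonneg_nonneg vertex_matrix_nonneg)
    qed
  qed auto
  with r show False by fastforce
qed

text \<open>The matrix \<open>1 - r\<^sup>-\<^sup>1 A\<^sub>D\<close> for \<open>r\<close> above the spectral radii of all components inside \<open>D\<close>.\<close>

lemma resolvent_invertible:
  assumes E: "fin_digraph E" and D: "D \<subseteq> verts E" "\<And>v. v \<in> D \<Longrightarrow> component_of E v \<subseteq> D"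
    and r: "\<And>C. C \<in> strong_components E \<Longrightarrow> C \<subseteq> D \<Longrightarrow> component_rho E C < r" "0 < r"
  shows "mat_invertible D (\<lambda>v w. (if v = w then 1 else 0) - inverse r * vertex_matrix E v w)"
    (is "mat_invertible D ?M")
proof (rule injective_imp_invertible)
  interpret fin_digraph E by fact
  show finD: "finite D" by (rule finite_subset[OF D(1)]) simp
  fix x assume x: "\<And>v. v \<in> D \<Longrightarrow> (\<Sum>w\<in>D. ?M v w * x w) = 0"
  have eq: "(\<Sum>w\<in>D. vertex_matrix E v w * x w) = r * x v" if v: "v \<in> D" for v
  proof -
    have "(\<Sum>w\<in>D. ?M v w * x w) = (\<Sum>w\<in>D. (if w = v then x w else 0) - inverse r * (vertex_matrix E v w * x w))"
      by (intro sum.cong) (auto simp: algebra_simps)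
    also have "\<dots> = x v - inverse r * (\<Sum>w\<in>D. vertex_matrix E v w * x w)"
      using v finD by (simp add: sum_subtractf sum_distrib_left sum.delta)
    finally show ?thesis using x[OF v] r(2) by (simp add: field_simps)
  qed
  have "0 \<le> x v" if "v \<in> D" for v
    using eq by (intro subinvariant_nonneg[OF E D r(1) _ that]) auto
  moreover have "0 \<le> - x v" if "v \<in> D" for v
    using eq by (intro subinvariant_nonneg[OF E D r(1) _ that]) (auto simp: sum_negf)
  ultimately show "\<forall>v\<in>D. x v = 0" by force
qed

lemma resolvent_solution:
  assumes E: "fin_digraph E" and D: "D \<subseteq> verts E" "\<And>v. v \<in> D \<Longrightarrow> component_of E v \<subseteq> D"
    and r: "\<And>C. C \<in> strong_components E \<Longrightarrow> C \<subseteq> D \<Longrightarrow> component_rho E C < r" "0 < r"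
    and z: "\<And>v. v \<in> D \<Longrightarrow> z v = inverse r * (\<Sum>w\<in>D. mat_inverse D
      (\<lambda>v w. (if v = w then 1 else 0) - inverse r * vertex_matrix E v w) v w * b w)"
    and v: "v \<in> D"
  shows "r * z v = (\<Sum>w\<in>D. vertex_matrix E v w * z w) + b v"
proof -
  interpret fin_digraph E by fact
  have finD: "finite D" by (rule finite_subset[OF D(1)]) simp
  let ?M = "\<lambda>v w. (if v = w then 1 else 0) - inverse r * vertex_matrix E v w"
  define y where "y w = (\<Sum>u\<in>D. mat_inverse D ?M w u * b u)" for w
  have zy: "z w = inverse r * y w" if "w \<in> D" for w using z[OF that] by (simp add: y_def)
  have "b v = (\<Sum>w\<in>D. ?M v w * y w)"
    unfolding y_def by (rule mat_inverse_solves[OF finD resolvent_invertible[OF E D r] v, symmetric])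
  also have "\<dots> = (\<Sum>w\<in>D. (if w = v then y w else 0) - vertex_matrix E v w * (inverse r * y w))"
    by (intro sum.cong) (auto simp: algebra_simps)
  also have "\<dots> = y v - (\<Sum>w\<in>D. vertex_matrix E v w * (inverse r * y w))"
    using v finD by (simp add: sum_subtractf sum.delta)
  also have "(\<Sum>w\<in>D. vertex_matrix E v w * (inverse r * y w)) = (\<Sum>w\<in>D. vertex_matrix E v w * z w)"
    using zy by (intro sum.cong) auto
  also have "y v = r * z v" using zy[OF v] r(2) by simp
  finally show ?thesis by simp
qed


section \<open>Minimal critical components\<close>

text \<open>
  The notions behind \<^const>\<open>mc\<close> and \<^const>\<open>mc_hull\<close> with \<open>r\<close> in place of the spectral radius of the whole
  graph, so that they can be used to show that this spectral radius is the largest of those of the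
  components.
\<close>

definition minimal_components :: "('v, 'e) pre_digraph \<Rightarrow> real \<Rightarrow> 'v set set" where
  "minimal_components E r = {C \<in> strong_components E. component_rho E C = r \<and>
     (\<forall>D\<in>strong_components E. component_rho E D = r \<longrightarrow> component_le E D C \<longrightarrow> D = C)}"

definition minimal_hull :: "('v, 'e) pre_digraph \<Rightarrow> real \<Rightarrow> 'v set" where
  "minimal_hull E r = {v \<in> verts E. \<exists>w\<in>\<Union>(minimal_components E r). vertex_le E w v}"

lemma mc_eq: "mc E = minimal_components E (graph_rho E)"
  unfolding mc_def critical_components_def minimal_components_def by auto

lemma mc_hull_eq: "mc_hull E = minimal_hull E (graph_rho E)"
  unfolding mc_hull_def minimal_hull_def mc_union_def mc_eq ..

lemma minimal_component_below:
  assumes E: "fin_digraph E" and C: "C \<in> strong_components E" "component_rho E C = r"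
  shows "\<exists>C'\<in>minimal_components E r. component_le E C' C"
proof -
  interpret fin_digraph E by fact
  define down where "down = (\<lambda>C. {D \<in> strong_components E. component_rho E D = r \<and> component_le E D C})"
  have trans: "component_le E X Z" if "component_le E X Y" "component_le E Y Z" "Y \<in> strong_components E" for X Y Z
    using that strong_componentD(5)[OF E that(3)] vertex_le_trans unfolding component_le_def by meson
  have refl: "component_le E X X" if "X \<in> strong_components E" for X
    using strong_componentD(3,5)[OF E that] unfolding component_le_def by fast
  have anti: "X = Y" if "component_le E X Y" "component_le E Y X" "X \<in> strong_components E" "Y \<in> strong_components E" for X Y
  proof -
    obtain x y x' y' where *: "x \<in> X" "y \<in> Y" "vertex_le E x y" "x' \<in> X" "y' \<in> Y" "vertex_le E y' x'"
      using \<open>component_le E X Y\<close> \<open>component_le E Y X\<close> unfolding component_le_def by auto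
    have "vertex_le E y x"
      using strong_componentD(5)[OF E that(4) *(2,5)] strong_componentD(5)[OF E that(3) *(4,1)] *(6) vertex_le_trans
      by metis
    then have "y \<in> X" using * strong_componentD(4)[OF E that(3) *(1)] by (auto simp: component_of_def)
    then show ?thesis using strong_componentD(4)[OF E that(3), of y] strong_componentD(4)[OF E that(4) *(2)] by simp
  qed
  have "C \<in> down C" using C refl by (auto simp: down_def)
  then obtain D where D: "D \<in> down C" "\<forall>D'\<in>down C. card (down D) \<le> card (down D')"
    using ex_has_least_nat[of "\<lambda>D. D \<in> down C" C "\<lambda>D. card (down D)"] by blast
  have "D \<in> minimal_components E r"
    unfolding minimal_components_def
  proof (intro CollectI conjI ballI impI)
    fix X assume X: "X \<in> strong_components E" "component_rho E X = r" "component_le E X D"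
    show "X = D"
    proof (rule ccontr)
      assume n: "X \<noteq> D"
      have "down X \<subseteq> down D" using X trans by (auto simp: down_def)
      moreover have "D \<in> down D" "D \<notin> down X" using n D X refl anti by (auto simp: down_def)
      ultimately have "card (down X) < card (down D)"
        using finite_strong_components[OF E] by (intro psubset_card_mono) (auto simp: down_def)
      moreover have "X \<in> down C" using X D trans by (auto simp: down_def)
      ultimately show False using D(2) by fastforce
    qed
  qed (use D in \<open>auto simp: down_def\<close>)
  then show ?thesis using D by (auto simp: down_def)
qed

locale critical_radius =
  fixes E :: "('v, 'e) pre_digraph" and r :: real
  assumes E: "fin_digraph E" and r: "0 < r"
    and component_rho_le: "\<And>C. C \<in> strong_components E \<Longrightarrow> component_rho E C \<le> r"
    and critical_exists: "\<exists>C\<in>strong_components E. component_rho E C = r"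
begin

sublocale fin_digraph E by (rule E)

abbreviation "K \<equiv> minimal_components E r"
abbreviation "H \<equiv> minimal_hull E r"
abbreviation "D \<equiv> verts E - H"
abbreviation "A \<equiv> vertex_matrix E"

lemma K_nonempty: "K \<noteq> {}" using critical_exists minimal_component_below[OF E] by blast

lemma K_finite: "finite K"
  using finite_strong_components[OF E] by (simp add: minimal_components_def)

lemma K_component: "C \<in> K \<Longrightarrow> C \<in> strong_components E" "C \<in> K \<Longrightarrow> component_rho E C = r"
  by (auto simp: minimal_components_def)

lemma K_sub_H: "C \<in> K \<Longrightarrow> C \<subseteq> H"
  using strong_componentD(2,5)[OF E K_component(1)] by (fastforce simp: minimal_hull_def)

lemma H_up: "v \<in> H \<Longrightarrow> vertex_le E v w \<Longrightarrow> w \<in> H"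
  using vertex_le_verts[OF E] vertex_le_trans unfolding minimal_hull_def by fast

lemma K_above:
  assumes C: "C \<in> K" and v: "v \<in> H" "w \<in> C" "vertex_le E v w"
  shows "v \<in> C"
proof -
  obtain C' u where C': "C' \<in> K" "u \<in> C'" "vertex_le E u v" using v by (auto simp: minimal_hull_def)
  then have "component_le E C' C" using v vertex_le_trans unfolding component_le_def by fast
  then have "C' = C" using C C' by (auto simp: minimal_components_def)
  then have "vertex_le E w u" using C C' v strong_componentD(5)[OF E K_component(1)] by blast
  then have "vertex_le E w v" using C' vertex_le_trans by fast
  then show ?thesis using strong_componentD(4)[OF E K_component(1)[OF C] v(2)] v by (auto simp: component_of_def)
qed

lemma K_disjoint: "C \<in> K \<Longrightarrow> C' \<in> K \<Longrightarrow> v \<in> C \<Longrightarrow> v \<in> C' \<Longrightarrow> C = C'"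
  using strong_componentD(4)[OF E K_component(1)] by metis

lemma D_saturated: "v \<in> D \<Longrightarrow> component_of E v \<subseteq> D"
  using H_up vertex_le_verts[OF E] by (auto simp: component_of_def)

lemma D_component_rho_less:
  assumes "C \<in> strong_components E" "C \<subseteq> D"
  shows "component_rho E C < r"
proof (rule ccontr)
  assume "\<not> ?thesis"
  then have "component_rho E C = r" using component_rho_le[OF assms(1)] by simp
  then obtain C' where "C' \<in> K" "component_le E C' C" using minimal_component_below[OF E assms(1)] by blast
  then obtain v w where "v \<in> C'" "w \<in> C" "vertex_le E v w" unfolding component_le_def by auto
  then show False using K_sub_H[OF \<open>C' \<in> K\<close>] H_up assms(2) by blast
qed

lemmas D_facts = E Diff_subset[of "verts E" H] D_saturated D_component_rho_less

definition pf :: "'v set \<Rightarrow> 'v \<Rightarrow> real" where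
  "pf C = (SOME x. (\<forall>v\<in>C. 0 < x v) \<and> (\<forall>v. v \<notin> C \<longrightarrow> x v = 0) \<and> (\<Sum>v\<in>C. x v) = 1 \<and>
      (\<forall>v\<in>C. (\<Sum>w\<in>C. A v w * x w) = r * x v))"

lemma pf:
  assumes "C \<in> K"
  shows "v \<in> C \<Longrightarrow> 0 < pf C v" "v \<notin> C \<Longrightarrow> pf C v = 0" "(\<Sum>v\<in>C. pf C v) = 1"
    "v \<in> C \<Longrightarrow> (\<Sum>w\<in>C. A v w * pf C w) = r * pf C v"
proof -
  have "\<exists>x. (\<forall>v\<in>C. 0 < x v) \<and> (\<forall>v. v \<notin> C \<longrightarrow> x v = 0) \<and> (\<Sum>v\<in>C. x v) = 1 \<and>
      (\<forall>v\<in>C. (\<Sum>w\<in>C. A v w * x w) = r * x v)"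
    using perron_frobenius(1)[OF strong_component_irreducible[OF E K_component(1)[OF assms]]]
    unfolding K_component(2)[OF assms] .
  from someI_ex[OF this, folded pf_def]
  show "v \<in> C \<Longrightarrow> 0 < pf C v" "v \<notin> C \<Longrightarrow> pf C v = 0" "(\<Sum>v\<in>C. pf C v) = 1"
    "v \<in> C \<Longrightarrow> (\<Sum>w\<in>C. A v w * pf C w) = r * pf C v" by auto
qed

lemma pf_vector_eq:
  assumes C: "C \<in> K"
  shows "pf_vector E C = pf C"
  unfolding pf_vector_def K_component(2)[OF C]
proof (rule the_equality)
  show "(\<forall>v\<in>C. 0 < pf C v) \<and> (\<forall>v. v \<notin> C \<longrightarrow> pf C v = 0) \<and>
     (\<forall>v\<in>C. (\<Sum>w\<in>C. A v w * pf C w) = r * pf C v) \<and> (\<Sum>v\<in>C. \<bar>pf C v\<bar>) = 1"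
  proof -
    have "(\<Sum>v\<in>C. \<bar>pf C v\<bar>) = (\<Sum>v\<in>C. pf C v)" using pf(1)[OF C] by (intro sum.cong) (auto simp: less_imp_le)
    then show ?thesis using pf[OF C] by simp
  qed
  fix x assume x: "(\<forall>v\<in>C. 0 < x v) \<and> (\<forall>v. v \<notin> C \<longrightarrow> x v = 0) \<and>
     (\<forall>v\<in>C. (\<Sum>w\<in>C. A v w * x w) = r * x v) \<and> (\<Sum>v\<in>C. \<bar>x v\<bar>) = 1"
  obtain t where t: "\<forall>v\<in>C. x v = t * pf C v"
    using irreducible_subinvariant_multiple[where x = "pf C" and m = x,
        OF strong_component_irreducible[OF E K_component(1)[OF C]] pf(1)[OF C] pf(4)[OF C]] x by auto
  have "(\<Sum>v\<in>C. \<bar>x v\<bar>) = (\<Sum>v\<in>C. x v)" using x by (intro sum.cong) (auto simp: less_imp_le)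
  then have "1 = (\<Sum>v\<in>C. x v)" using x by simp
  also have "\<dots> = t" using t pf(3)[OF C] by (simp add: sum_distrib_left[symmetric])
  finally show "x = pf C" using t x pf(2)[OF C] by (auto simp: fun_eq_iff)
qed

definition zv :: "'v set \<Rightarrow> 'v \<Rightarrow> real" where
  "zv C v = inverse r * (\<Sum>w\<in>D. mat_inverse D
      (\<lambda>v w. (if v = w then 1 else 0) - inverse r * A v w) v w * (\<Sum>u\<in>C. A w u * pf C u))"

lemma zv_eq: "v \<in> D \<Longrightarrow> r * zv C v = (\<Sum>w\<in>D. A v w * zv C w) + (\<Sum>u\<in>C. A v u * pf C u)"
  by (rule resolvent_solution[OF D_facts r]) (simp_all add: zv_def)

lemma zv_nonneg:
  assumes "C \<in> K" "v \<in> D" shows "0 \<le> zv C v"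
proof (rule subinvariant_nonneg[OF D_facts _ assms(2)])
  fix u assume "u \<in> D"
  have "0 \<le> (\<Sum>w\<in>C. A u w * pf C w)" using pf(1)[OF assms(1)]
    by (auto intro!: sum_nonneg mult_nonneg_nonneg simp: vertex_matrix_nonneg less_imp_le)
  then show "(\<Sum>w\<in>D. A u w * zv C w) \<le> r * zv C u" using zv_eq[OF \<open>u \<in> D\<close>] by simp
qed

text \<open>The invariant vector \<open>z\<^sup>C + x\<^sup>C\<close>, before normalization.\<close>

definition mvec :: "'v set \<Rightarrow> 'v \<Rightarrow> real" where
  "mvec C v = (if v \<in> D then zv C v else pf C v)"

lemma sum_verts_split:
  assumes "C \<in> K" "\<And>v. v \<in> H \<Longrightarrow> v \<notin> C \<Longrightarrow> f v = 0"
  shows "(\<Sum>v\<in>verts E. f v) = (\<Sum>v\<in>D. f v) + (\<Sum>v\<in>C. f v :: real)"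
proof -
  have "D \<union> C \<subseteq> verts E" "D \<inter> C = {}"
    using K_sub_H[OF assms(1)] strong_componentD(2)[OF E K_component(1)[OF assms(1)]] by auto
  moreover have "(\<Sum>v\<in>verts E. f v) = (\<Sum>v\<in>D \<union> C. f v)"
    using assms(2) calculation by (intro sum.mono_neutral_right) auto
  ultimately show ?thesis using strong_componentD(1)[OF E K_component(1)[OF assms(1)]]
    by (simp add: sum.union_disjoint)
qed

lemma mvec_nonneg: "C \<in> K \<Longrightarrow> 0 \<le> mvec C v"
  using zv_nonneg pf(1,2) by (cases "v \<in> C") (auto simp: mvec_def less_imp_le)

lemma sum_mvec: "C \<in> K \<Longrightarrow> (\<Sum>v\<in>verts E. mvec C v) = 1 + (\<Sum>v\<in>D. zv C v)"
proof -
  assume C: "C \<in> K"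
  have "(\<Sum>v\<in>verts E. mvec C v) = (\<Sum>v\<in>D. mvec C v) + (\<Sum>v\<in>C. mvec C v)"
    using pf(2)[OF C] by (intro sum_verts_split[OF C]) (auto simp: mvec_def)
  also have "(\<Sum>v\<in>C. mvec C v) = (\<Sum>v\<in>C. pf C v)"
    using K_sub_H[OF C] by (intro sum.cong) (auto simp: mvec_def)
  also have "(\<Sum>v\<in>D. mvec C v) = (\<Sum>v\<in>D. zv C v)" by (simp add: mvec_def)
  finally show ?thesis using pf(3)[OF C] by simp
qed

lemma mvec_invariant:
  assumes C: "C \<in> K" and v: "v \<in> verts E"
  shows "(\<Sum>w\<in>verts E. A v w * mvec C w) = r * mvec C v"
proof -
  have "(\<Sum>w\<in>verts E. A v w * mvec C w) = (\<Sum>w\<in>D. A v w * mvec C w) + (\<Sum>w\<in>C. A v w * mvec C w)"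
    using pf(2)[OF C] by (intro sum_verts_split[OF C]) (auto simp: mvec_def)
  also have "(\<Sum>w\<in>D. A v w * mvec C w) = (\<Sum>w\<in>D. A v w * zv C w)" by (simp add: mvec_def)
  also have "(\<Sum>w\<in>C. A v w * mvec C w) = (\<Sum>w\<in>C. A v w * pf C w)"
    using K_sub_H[OF C] by (intro sum.cong) (auto simp: mvec_def)
  finally have eq: "(\<Sum>w\<in>verts E. A v w * mvec C w)
    = (\<Sum>w\<in>D. A v w * zv C w) + (\<Sum>w\<in>C. A v w * pf C w)" .
  show ?thesis
  proof (cases "v \<in> D")
    case True
    then show ?thesis unfolding eq using zv_eq[of v C] by (simp add: mvec_def)
  next
    case False
    then have vH: "v \<in> H" using v by simp
    have "(\<Sum>w\<in>D. A v w * zv C w) = 0"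
    proof (intro sum.neutral ballI)
      fix w assume "w \<in> D"
      then show "A v w * zv C w = 0" using vertex_matrix_pos_imp_le[OF E, of v w] H_up[OF vH, of w] by auto
    qed
    moreover have "(\<Sum>w\<in>C. A v w * pf C w) = r * pf C v"
    proof (cases "v \<in> C")
      case False
      have "A v w = 0" if "w \<in> C" for w
        using vertex_matrix_pos_imp_le[OF E, of v w] K_above[OF C vH that] False by auto
      then show ?thesis using pf(2)[OF C False] by simp
    qed (rule pf(4)[OF C])
    ultimately show ?thesis unfolding eq using vH by (simp add: mvec_def)
  qed
qed

lemma graph_rho_eq: "graph_rho E = r"
proof -
  obtain C where C: "C \<in> K" using K_nonempty by auto
  obtain v where v: "v \<in> C" "v \<in> verts E"
    using strong_componentD(2,3)[OF E K_component(1)[OF C]] by blast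
  have "mat_eigenvalue A (verts E) (of_real r)"
    unfolding mat_eigenvalue_def
  proof (intro exI[of _ "\<lambda>v. complex_of_real (mvec C v)"] conjI ballI)
    have "mvec C v \<noteq> 0" using v K_sub_H[OF C] pf(1)[OF C v(1)] by (auto simp: mvec_def)
    then show "\<exists>v\<in>verts E. complex_of_real (mvec C v) \<noteq> 0" using v by auto
    fix u assume "u \<in> verts E"
    from arg_cong[OF mvec_invariant[OF C this], of complex_of_real]
    show "(\<Sum>w\<in>verts E. of_real (A u w) * complex_of_real (mvec C w)) = of_real r * of_real (mvec C u)" by simp
  qed
  then have "Max (norm ` {l. mat_eigenvalue A (verts E) l}) = r"
    using graph_eigenvalue_le_component_rho[OF E] component_rho_le r
    by (intro Max_eqI finite_imageI finite_mat_eigenvalues) (auto intro!: image_eqI[of _ _ "of_real r"] intro: order_trans)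
  then show ?thesis using v by (auto simp: graph_rho_def mat_spectral_radius_def)
qed

end

lemma critical_radius_graph_rho:
  assumes E: "fin_digraph E" and cyc: "has_cycle E"
  shows "critical_radius E (graph_rho E)"
proof -
  interpret fin_digraph E by fact
  define r where "r = Max (component_rho E ` strong_components E)"
  have le: "component_rho E C \<le> r" if "C \<in> strong_components E" for C
    unfolding r_def using that finite_strong_components[OF E] by (intro Max_ge) auto
  \<comment> \<open>A cycle lies in a component, which then has positive spectral radius.\<close>
  obtain v e es where p: "is_path E v (e # es) v"
    using cyc by (auto simp: has_cycle_def neq_Nil_conv)
  then have e: "e \<in> arcs E" "head E e = v" "is_path E (tail E e) es v" by auto
  let ?C = "component_of E v"
  have C: "?C \<in> strong_components E" using e strong_components_eq[OF E] by auto
  have v: "v \<in> ?C" using e by (auto intro: mem_component_of)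
  have A: "0 < vertex_matrix E v (tail E e)" using vertex_matrix_arc_pos[OF E e(1)] e by simp
  then have t: "tail E e \<in> ?C" using vertex_matrix_pos_imp_le[OF E, of v "tail E e"] e
    by (auto simp: component_of_def vertex_le_def)
  obtain x where x: "\<forall>v\<in>?C. 0 < x v" "\<forall>u\<in>?C. (\<Sum>w\<in>?C. vertex_matrix E u w * x w) = component_rho E ?C * x u"
    using perron_frobenius(1)[OF strong_component_irreducible[OF E C]] by blast
  have "0 < vertex_matrix E v (tail E e) * x (tail E e)" using A x t by auto
  also have "\<dots> \<le> (\<Sum>w\<in>?C. vertex_matrix E v w * x w)"
    using t x strong_componentD(1)[OF E C]
    by (intro member_le_sum) (auto intro!: mult_nonneg_nonneg simp: vertex_matrix_nonneg less_imp_le)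
  also have "\<dots> = component_rho E ?C * x v" using x v by auto
  finally have "0 < component_rho E ?C" using x v by (auto simp: zero_less_mult_iff)
  then have r: "0 < r" using le[OF C] by simp
  have "r \<in> component_rho E ` strong_components E"
    unfolding r_def using C finite_strong_components[OF E] by (intro Max_in) auto
  then have "critical_radius E r" using E r le by unfold_locales auto
  then show ?thesis using critical_radius.graph_rho_eq by metis
qed


section \<open>Subinvariant vectors\<close>

context critical_radius
begin

lemma arc_positive: "e \<in> arcs E \<Longrightarrow> 0 < A (head E e) (tail E e)"
  by (rule vertex_matrix_arc_pos[OF E])

text \<open>
  On a minimal critical component subinvariance forces a multiple \<open>t\<^sub>C\<close> of the
  Perron--Frobenius vector. There the inequality is an equality, so \<open>m\<close> vanishes on the rest
  of \<open>H\<close>. After subtraction of the invariant vectors \<open>t\<^sub>C (z\<^sup>C + x\<^sup>C)\<close> a subinvariant vector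
  remains that lives on \<open>D\<close>, and it is nonnegative because all components inside \<open>D\<close> have
  spectral radius below \<open>r\<close>.
\<close>

lemma subinvariant_decomposition:
  assumes m: "\<And>v. v \<in> verts E \<Longrightarrow> 0 \<le> m v"
    and sub: "\<And>v. v \<in> verts E \<Longrightarrow> (\<Sum>w\<in>verts E. A v w * m w) \<le> r * m v"
  obtains t where "\<And>C. C \<in> K \<Longrightarrow> 0 \<le> t C"
    and "\<And>v. v \<in> H \<Longrightarrow> m v = (\<Sum>C\<in>K. t C * mvec C v)"
    and "\<And>v. v \<in> D \<Longrightarrow> (\<Sum>C\<in>K. t C * mvec C v) \<le> m v"
    and "\<And>v. v \<in> D \<Longrightarrow> (\<Sum>w\<in>D. A v w * (m w - (\<Sum>C\<in>K. t C * mvec C w))) \<le> r * (m v - (\<Sum>C\<in>K. t C * mvec C v))"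
proof -
  have Cv: "C \<subseteq> verts E" "finite C" "C \<noteq> {}" if "C \<in> K" for C
    using strong_componentD[OF E K_component(1)[OF that]] by auto
  have nn: "0 \<le> A v w * m w" if "w \<in> verts E" for v w
    by (rule mult_nonneg_nonneg[OF vertex_matrix_nonneg m[OF that]])
  have "\<exists>t. \<forall>v\<in>C. m v = t * pf C v" if C: "C \<in> K" for C
  proof (rule irreducible_subinvariant_multiple[OF strong_component_irreducible[OF E K_component(1)[OF C]] pf(1)[OF C] pf(4)[OF C]])
    fix v assume v: "v \<in> C"
    have "(\<Sum>w\<in>C. A v w * m w) \<le> (\<Sum>w\<in>verts E. A v w * m w)"
      using Cv[OF C] nn by (intro sum_mono2) auto
    also have "\<dots> \<le> r * m v" using sub Cv[OF C] v by auto
    finally show "(\<Sum>w\<in>C. A v w * m w) \<le> r * m v" .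
  qed
  then have "\<forall>C\<in>K. \<exists>t. \<forall>v\<in>C. m v = t * pf C v" by blast
  from bchoice[OF this] obtain t where t: "\<And>C v. C \<in> K \<Longrightarrow> v \<in> C \<Longrightarrow> m v = t C * pf C v" by blast
  have t0: "0 \<le> t C" if C: "C \<in> K" for C
  proof -
    obtain v where v: "v \<in> C" using Cv[OF C] by blast
    have "0 \<le> t C * pf C v" using t[OF C v] m Cv[OF C] v by force
    then show ?thesis using pf(1)[OF C v] by (simp add: zero_le_mult_iff)
  qed
  \<comment> \<open>The inequality is exact on \<open>C\<close> already with the entries inside \<open>C\<close>, which leaves nothing for the others.\<close>
  have leave: "m w = 0" if C: "C \<in> K" "v \<in> C" and w: "w \<in> verts E" "w \<notin> C" "0 < A v w" for C v w
  proof -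
    have vE: "v \<in> verts E" using Cv C by blast
    have "r * m v = (\<Sum>w\<in>C. A v w * m w)"
      using pf(4)[OF C(1,2)] t[OF C(1)] C(2) by (simp add: sum_distrib_left[symmetric] mult.left_commute)
    moreover have "(\<Sum>w\<in>verts E. A v w * m w) = (\<Sum>w\<in>C. A v w * m w) + (\<Sum>w\<in>verts E - C. A v w * m w)"
      using Cv[OF C(1)] by (simp add: sum.subset_diff[of C "verts E"])
    moreover have "A v w * m w \<le> (\<Sum>w\<in>verts E - C. A v w * m w)"
      using w nn by (intro member_le_sum) auto
    ultimately have "A v w * m w \<le> 0" using sub[OF vE] by simp
    then show ?thesis using w m[OF w(1)] by (simp add: mult_le_0_iff)
  qed
  have step: "m w = 0" if v: "v \<in> verts E" "m v = 0" and w: "w \<in> verts E" "0 < A v w" for v w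
  proof -
    have "A v w * m w \<le> (\<Sum>w\<in>verts E. A v w * m w)" using w nn by (intro member_le_sum) auto
    also have "\<dots> \<le> 0" using sub[OF v(1)] v(2) by simp
    finally show ?thesis using w m[OF w(1)] by (simp add: mult_le_0_iff)
  qed
  have path: "v \<in> C \<or> m v = 0" if "is_path E u es v" "C \<in> K" "u \<in> C \<or> m u = 0" for u es v C
    using that
  proof (induction es arbitrary: u)
    case (Cons e es)
    then have e: "e \<in> arcs E" "head E e = u" "is_path E (tail E e) es v" by auto
    have ve: "u \<in> verts E" "tail E e \<in> verts E" using e by auto
    have "tail E e \<in> C \<or> m (tail E e) = 0"
      using leave[OF Cons.prems(2) _ ve(2)] step[OF ve(1) _ ve(2)] arc_positive[OF e(1)] e(2) Cons.prems(3) by auto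
    then show ?case using Cons.IH e(3) Cons.prems(2) by blast
  qed auto
  define rest where "rest v = m v - (\<Sum>C\<in>K. t C * mvec C v)" for v
  have H: "rest v = 0" if v: "v \<in> H" for v
  proof (cases "v \<in> \<Union>K")
    case True
    then obtain C where C: "C \<in> K" "v \<in> C" by blast
    have "pf C' v = 0" if "C' \<in> K" "C' \<noteq> C" for C'
      using pf(2)[OF that(1)] K_disjoint[OF that(1) C(1) _ C(2)] that(2) by blast
    then have "(\<Sum>C'\<in>K. t C' * mvec C' v) = (\<Sum>C'\<in>K. if C' = C then t C * pf C v else 0)"
      using v by (intro sum.cong) (auto simp: mvec_def)
    then show ?thesis using C t[OF C] K_finite by (simp add: rest_def)
  next
    case False
    obtain C u es where C: "C \<in> K" "u \<in> C" "is_path E u es v"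
      using v by (auto simp: minimal_hull_def vertex_le_def)
    have "m v = 0" using path[OF C(3,1)] C False by blast
    moreover have "(\<Sum>C'\<in>K. t C' * mvec C' v) = 0"
      using False v pf(2) by (intro sum.neutral) (auto simp: mvec_def)
    ultimately show ?thesis by (simp add: rest_def)
  qed
  have le: "(\<Sum>w\<in>D. A v w * rest w) \<le> r * rest v" if v: "v \<in> D" for v
  proof -
    have vE: "v \<in> verts E" using v by blast
    have "(\<Sum>w\<in>D. A v w * rest w) = (\<Sum>w\<in>verts E. A v w * rest w)"
      using H by (intro sum.mono_neutral_left) auto
    also have "\<dots> = (\<Sum>w\<in>verts E. A v w * m w) - (\<Sum>w\<in>verts E. \<Sum>C\<in>K. t C * (A v w * mvec C w))"
      by (simp add: rest_def right_diff_distrib sum_subtractf sum_distrib_left mult.left_commute)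
    also have "(\<Sum>w\<in>verts E. \<Sum>C\<in>K. t C * (A v w * mvec C w)) = (\<Sum>C\<in>K. t C * (\<Sum>w\<in>verts E. A v w * mvec C w))"
      by (subst sum.swap) (simp add: sum_distrib_left)
    also have "\<dots> = (\<Sum>C\<in>K. t C * (r * mvec C v))"
      using mvec_invariant[OF _ vE] by (intro sum.cong) auto
    also have "\<dots> = r * (\<Sum>C\<in>K. t C * mvec C v)" by (simp add: sum_distrib_left mult.left_commute)
    finally show ?thesis using sub[OF vE] by (simp add: rest_def right_diff_distrib)
  qed
  have "0 \<le> rest v" if v: "v \<in> D" for v by (rule subinvariant_nonneg[OF D_facts le v])
  with t0 H le show thesis by (intro that[of t]) (auto simp: rest_def)
qed

text \<open>The solution of \<open>r x = A\<^sub>D x + 1\<close> is strictly positive.\<close>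

lemma subinvariant_exists:
  assumes "D \<noteq> {}"
  obtains w where "\<And>v. v \<in> D \<Longrightarrow> 0 \<le> w v" "\<And>v. v \<in> D \<Longrightarrow> (\<Sum>u\<in>D. A v u * w u) \<le> r * w v" "(\<Sum>v\<in>D. w v) = 1"
proof -
  have finD: "finite D" by simp
  define x where "x v = inverse r * (\<Sum>w\<in>D. mat_inverse D
      (\<lambda>v w. (if v = w then 1 else 0) - inverse r * A v w) v w * 1)" for v
  have x: "r * x v = (\<Sum>w\<in>D. A v w * x w) + 1" if "v \<in> D" for v
    by (rule resolvent_solution[OF D_facts r x_def that])
  have x0: "0 \<le> x v" if v: "v \<in> D" for v
  proof (rule subinvariant_nonneg[OF D_facts _ v])
    fix u assume "u \<in> D"
    from x[OF this] show "(\<Sum>w\<in>D. A u w * x w) \<le> r * x u" by simp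
  qed
  have "0 < x v" if v: "v \<in> D" for v
  proof -
    have "0 \<le> (\<Sum>w\<in>D. A v w * x w)" using x0 vertex_matrix_nonneg by (intro sum_nonneg mult_nonneg_nonneg) auto
    then have "0 < r * x v" using x[OF v] by simp
    then show ?thesis using r by (simp add: zero_less_mult_iff)
  qed
  then have tot: "0 < (\<Sum>v\<in>D. x v)" using assms finD by (intro sum_pos) auto
  show thesis
  proof (rule that[of "\<lambda>v. x v / (\<Sum>v\<in>D. x v)"])
    fix v assume v: "v \<in> D"
    show "0 \<le> x v / (\<Sum>v\<in>D. x v)" using x0[OF v] tot by simp
    have "(\<Sum>u\<in>D. A v u * (x u / (\<Sum>v\<in>D. x v))) = (\<Sum>u\<in>D. A v u * x u) / (\<Sum>v\<in>D. x v)"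
      by (simp add: sum_divide_distrib)
    also have "\<dots> \<le> r * x v / (\<Sum>v\<in>D. x v)" using x[OF v] tot by (intro divide_right_mono) auto
    finally show "(\<Sum>u\<in>D. A v u * (x u / (\<Sum>v\<in>D. x v))) \<le> r * (x v / (\<Sum>v\<in>D. x v))" by simp
  next
    show "(\<Sum>v\<in>D. x v / (\<Sum>v\<in>D. x v)) = 1" using tot by (simp flip: sum_divide_distrib)
  qed
qed

definition mnorm :: "'v set \<Rightarrow> real" where "mnorm C = 1 + (\<Sum>v\<in>D. zv C v)"

definition mstate :: "'v set \<Rightarrow> 'v \<Rightarrow> real" where "mstate C v = mvec C v / mnorm C"

lemma mnorm_pos: "C \<in> K \<Longrightarrow> 0 < mnorm C"
  using zv_nonneg unfolding mnorm_def by (intro add_pos_nonneg sum_nonneg) auto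

lemma mstate:
  assumes C: "C \<in> K"
  shows "0 \<le> mstate C v" "(\<Sum>v\<in>verts E. mstate C v) = 1"
    "v \<in> verts E \<Longrightarrow> (\<Sum>e\<in>edges_into E v. mstate C (tail E e)) = r * mstate C v"
proof -
  show "0 \<le> mstate C v" using mvec_nonneg[OF C] mnorm_pos[OF C] by (simp add: mstate_def)
  show "(\<Sum>v\<in>verts E. mstate C v) = 1"
    using sum_mvec[OF C] mnorm_pos[OF C] by (simp add: mstate_def mnorm_def flip: sum_divide_distrib)
  show "(\<Sum>e\<in>edges_into E v. mstate C (tail E e)) = r * mstate C v" if "v \<in> verts E"
    using mvec_invariant[OF C that] unfolding vertex_matrix_mult_eq_sum_arcs[OF E, symmetric]
    by (simp add: mstate_def flip: sum_divide_distrib)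
qed

lemma mstate_on_component:
  assumes "C \<in> K" "C' \<in> K" "v \<in> C"
  shows "mstate C' v = 0 \<longleftrightarrow> C' \<noteq> C"
  using assms K_sub_H[of C] K_disjoint[of C C' v] pf(1)[of C v] pf(2)[of C' v] mnorm_pos[of C']
  by (auto simp: mstate_def mvec_def)

end


section \<open>Combinations of KMS states\<close>

context toeplitz
begin

lemma kms_values_zero: "kms_values r (\<lambda>_. 0) (\<lambda>_. 0)"
  by (simp add: kms_values_def positive_functional_def)

lemma kms_values_combination:
  assumes f: "kms_values r m f" and g: "kms_values r n g" and a: "0 \<le> a" and b: "0 \<le> b"
  shows "kms_values r (\<lambda>v. a * m v + b * n v) (\<lambda>x. of_real a * f x + of_real b * g x)"
  using f g positive_functional_scale_add[OF _ _ a b, of f g] unfolding kms_values_def by (simp add: algebra_simps)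

lemma kms_values_sum:
  assumes "finite I" "\<And>i. i \<in> I \<Longrightarrow> kms_values r (m i) (\<phi> i)" "\<And>i. i \<in> I \<Longrightarrow> 0 \<le> t i"
  shows "kms_values r (\<lambda>v. \<Sum>i\<in>I. t i * m i v) (\<lambda>x. \<Sum>i\<in>I. of_real (t i) * \<phi> i x)"
  using assms
proof (induction I rule: finite_induct)
  case empty
  then show ?case using kms_values_zero by simp
next
  case (insert i I)
  have "kms_values r (\<lambda>v. t i * m i v + 1 * (\<Sum>i\<in>I. t i * m i v)) (\<lambda>x. of_real (t i) * \<phi> i x + of_real 1 * (\<Sum>i\<in>I. of_real (t i) * \<phi> i x))"
    using insert by (intro kms_values_combination) auto
  then show ?case using insert.hyps by simp
qed

lemma kms_values_unique:
  assumes f: "kms_values r m f" and g: "kms_values r n g" and mn: "\<And>v. v \<in> verts E \<Longrightarrow> m v = n v" and x: "x \<in> carrier A"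
  shows "f x = g x"
proof (rule pos_eqI[OF _ _ _ x])
  fix \<mu> \<nu> assume *: "\<mu> \<in> paths E" "\<nu> \<in> paths E"
  then have "m (src \<mu>) = n (src \<mu>)" using path_source_in_verts[of "fst \<mu>" "snd \<mu>"] mn by simp
  then show "f (sig \<mu> \<nu>) = g (sig \<mu> \<nu>)"
    using f g * by (cases "\<mu> = \<nu>") (simp_all add: kms_values_def)
qed (use f g in \<open>simp_all add: kms_values_def\<close>)

end

lemma sum_functions_apply:
  fixes f :: "'i \<Rightarrow> 'a \<Rightarrow> 'b::real_vector"
  shows "(\<Sum>i\<in>I. t i *\<^sub>R f i) x = (\<Sum>i\<in>I. t i *\<^sub>R f i x)"
  by (induction I rule: infinite_finite_induct) (simp_all add: zero_fun_def plus_fun_def scaleR_fun_def)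


section \<open>The simplex of the minimal critical components\<close>

locale critical_toeplitz = toeplitz A E p s + G: critical_radius E r
  for A :: "'a cstar" (structure) and E :: "('v, 'e) pre_digraph" and p :: "'v \<Rightarrow> 'a" and s :: "'e \<Rightarrow> 'a" and r :: real +
  fixes \<alpha> :: "real \<Rightarrow> 'a \<Rightarrow> 'a"
  assumes alg: "toeplitz_algebra E A p s" and \<alpha>: "gauge_dynamics E A p s \<alpha>"
begin

definition \<psi> :: "'v set \<Rightarrow> 'a \<Rightarrow> complex" where
  "\<psi> C = (SOME \<phi>. kms_values r (G.mstate C) \<phi> \<and> (\<forall>a. a \<notin> carrier A \<longrightarrow> \<phi> a = 0))"

lemma \<psi>:
  assumes C: "C \<in> G.K"
  shows "kms_values r (G.mstate C) (\<psi> C)" "a \<notin> carrier A \<Longrightarrow> \<psi> C a = 0"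
proof -
  have "\<exists>\<phi>. kms_values r (G.mstate C) \<phi> \<and> (\<forall>a. a \<notin> carrier A \<longrightarrow> \<phi> a = 0)"
    by (rule kms_values_exists[OF fin_digraph alg G.r]) (use G.mstate[OF C] in auto)
  from someI_ex[OF this, folded \<psi>_def]
  show "kms_values r (G.mstate C) (\<psi> C)" "a \<notin> carrier A \<Longrightarrow> \<psi> C a = 0" by auto
qed

abbreviation mix :: "('v set \<Rightarrow> real) \<Rightarrow> 'a \<Rightarrow> complex" where "mix t \<equiv> \<Sum>C\<in>G.K. t C *\<^sub>R \<psi> C"

lemma mix_apply: "mix t a = (\<Sum>C\<in>G.K. of_real (t C) * \<psi> C a)"
  by (simp add: sum_functions_apply scaleR_conv_of_real)

lemma mix_values:
  assumes "\<And>C. C \<in> G.K \<Longrightarrow> 0 \<le> t C"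
  shows "kms_values r (\<lambda>v. \<Sum>C\<in>G.K. t C * G.mstate C v) (mix t)"
proof -
  have "kms_values r (\<lambda>v. \<Sum>C\<in>G.K. t C * G.mstate C v) (\<lambda>x. \<Sum>C\<in>G.K. of_real (t C) * \<psi> C x)"
    by (rule kms_values_sum[OF G.K_finite \<psi>(1) assms])
  moreover have "mix t = (\<lambda>x. \<Sum>C\<in>G.K. of_real (t C) * \<psi> C x)" by (rule ext, rule mix_apply)
  ultimately show ?thesis by simp
qed

lemma mix_zero: "a \<notin> carrier A \<Longrightarrow> mix t a = 0"
  by (simp add: mix_apply \<psi>(2))

lemma mix_total: "(\<Sum>v\<in>verts E. \<Sum>C\<in>G.K. t C * G.mstate C v) = (\<Sum>C\<in>G.K. t C)"
  by (subst sum.swap) (simp add: G.mstate(2) flip: sum_distrib_left)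

lemma mix_kms:
  assumes "t \<in> weights G.K" shows "kms_state A \<alpha> (ln r) (mix t)"
  using assms mix_total[of t]
  by (intro kms_values_imp_kms_state[OF \<alpha> mix_values G.r]) (auto simp: weights_def mix_zero)

lemma \<psi>_kms: "C \<in> G.K \<Longrightarrow> kms_state A \<alpha> (ln r) (\<psi> C)"
  by (rule kms_values_imp_kms_state[OF \<alpha> \<psi>(1) G.r]) (auto simp: G.mstate \<psi>(2))

text \<open>The projections of the vertices of \<open>C\<close> detect the coefficient of \<open>\<psi> C\<close>.\<close>

lemma mix_coefficient:
  assumes C: "C \<in> G.K" and v: "v \<in> C"
  shows "mix t (p v) = of_real (t C * G.mstate C v)" "G.mstate C v \<noteq> 0"
proof -
  have vE: "v \<in> verts E" using strong_componentD(2)[OF fin_digraph G.K_component(1)[OF C]] v by blast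
  have "mix t (p v) = (\<Sum>C'\<in>G.K. if C' = C then of_real (t C * G.mstate C v) else 0)"
    unfolding mix_apply using G.mstate_on_component[OF C _ v]
    by (intro sum.cong) (auto simp: kms_values_p[OF \<psi>(1) vE])
  then show "mix t (p v) = of_real (t C * G.mstate C v)" using C G.K_finite by simp
  show "G.mstate C v \<noteq> 0" using G.mstate_on_component[OF C C v] by simp
qed

lemma mix_inj:
  assumes "mix t = mix t'" "C \<in> G.K" shows "t C = t' C"
proof -
  obtain v where v: "v \<in> C" using strong_componentD(3)[OF fin_digraph G.K_component(1)[OF assms(2)]] by blast
  show ?thesis using mix_coefficient(1)[OF assms(2) v, of t] mix_coefficient(1)[OF assms(2) v, of t'] mix_coefficient(2)[OF assms(2) v] assms(1)
    by (metis mult_cancel_right of_real_eq_iff)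
qed

lemma \<psi>_mix: "C \<in> G.K \<Longrightarrow> \<psi> C = mix (\<lambda>C'. if C' = C then 1 else 0)"
proof (rule ext)
  fix a assume C: "C \<in> G.K"
  have "(\<Sum>C'\<in>G.K. of_real (if C' = C then 1 else 0) * \<psi> C' a) = (\<Sum>C'\<in>G.K. if C' = C then \<psi> C a else 0)"
    by (intro sum.cong) auto
  then show "\<psi> C a = mix (\<lambda>C'. if C' = C then 1 else 0) a" unfolding mix_apply using C G.K_finite by simp
qed

lemma \<psi>_inj: "inj_on \<psi> G.K"
proof (rule inj_onI)
  fix C C' assume *: "C \<in> G.K" "C' \<in> G.K" "\<psi> C = \<psi> C'"
  then have "mix (\<lambda>B. if B = C then 1 else 0) = mix (\<lambda>B. if B = C' then 1 else 0)" by (simp flip: \<psi>_mix)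
  from mix_inj[OF this *(1)] show "C = C'" by (simp split: if_splits)
qed

lemma simplex: "is_simplex (mix ` weights G.K)"
  unfolding is_simplex_def
proof (intro exI conjI)
  show fin: "finite (\<psi> ` G.K)" and "\<psi> ` G.K \<noteq> {}" using G.K_finite G.K_nonempty by auto
  have reindex: "(\<Sum>f\<in>\<psi> ` G.K. u f *\<^sub>R f) = mix (\<lambda>C. u (\<psi> C))" "(\<Sum>f\<in>\<psi> ` G.K. u f) = (\<Sum>C\<in>G.K. u (\<psi> C))" for u :: "('a \<Rightarrow> complex) \<Rightarrow> real"
    by (simp_all add: sum.reindex[OF \<psi>_inj])
  show "\<not> affine_dependent (\<psi> ` G.K)"
    unfolding affine_dependent_explicit_finite[OF fin] reindex
  proof (intro notI, elim exE conjE bexE)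
    fix u f assume u: "mix (\<lambda>C. u (\<psi> C)) = 0" "f \<in> \<psi> ` G.K" "u f \<noteq> 0"
    then obtain C where C: "C \<in> G.K" "f = \<psi> C" by blast
    have "mix (\<lambda>C. u (\<psi> C)) = mix (\<lambda>C. 0)" using u(1) by simp
    from mix_inj[OF this C(1)] u(3) C(2) show False by simp
  qed
  show "mix ` weights G.K = convex hull (\<psi> ` G.K)"
  proof (rule equalityI; rule subsetI)
    fix f assume "f \<in> mix ` weights G.K"
    then obtain t where t: "t \<in> weights G.K" "f = mix t" by blast
    define u where "u = (\<lambda>g. t (inv_into G.K \<psi> g))"
    have u: "u (\<psi> C) = t C" if "C \<in> G.K" for C using that by (simp add: u_def inv_into_f_f[OF \<psi>_inj])
    have "mix (\<lambda>C. u (\<psi> C)) = f" unfolding t(2) using u by (intro sum.cong) auto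
    moreover have "(\<Sum>C\<in>G.K. u (\<psi> C)) = 1" using t(1) u by (simp add: weights_def)
    ultimately show "f \<in> convex hull (\<psi> ` G.K)"
      unfolding convex_hull_finite[OF fin] using t(1) u by (intro CollectI exI[of _ u]) (auto simp: reindex weights_def)
  next
    fix f assume "f \<in> convex hull (\<psi> ` G.K)"
    then obtain u where u: "\<forall>g\<in>\<psi> ` G.K. 0 \<le> u g" "(\<Sum>C\<in>G.K. u (\<psi> C)) = 1" "mix (\<lambda>C. u (\<psi> C)) = f"
      unfolding convex_hull_finite[OF fin] reindex by (auto simp: reindex)
    define t where "t C = (if C \<in> G.K then u (\<psi> C) else 0)" for C
    have "u (\<psi> C) \<le> 1" if C: "C \<in> G.K" for C
    proof -
      have "u (\<psi> C) \<le> (\<Sum>C\<in>G.K. u (\<psi> C))" using C u(1) G.K_finite by (intro member_le_sum) auto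
      then show ?thesis using u(2) by simp
    qed
    then have "t \<in> weights G.K" using u(1,2) by (auto simp: weights_def t_def)
    moreover have "mix t = f" unfolding u(3)[symmetric] by (intro sum.cong) (auto simp: t_def)
    ultimately show "f \<in> mix ` weights G.K" by blast
  qed
qed

lemma mix_affine: "affine_isomorphism (weights G.K) (mix ` weights G.K) mix"
  unfolding affine_isomorphism_def
proof (intro conjI ballI)
  have "inj_on mix (weights G.K)"
  proof (rule inj_onI)
    fix t t' assume *: "t \<in> weights G.K" "t' \<in> weights G.K" "mix t = mix t'"
    show "t = t'"
    proof
      fix C show "t C = t' C" using mix_inj[OF *(3), of C] *(1,2) by (cases "C \<in> G.K") (auto simp: weights_def)
    qed
  qed
  then show "bij_betw mix (weights G.K) (mix ` weights G.K)" by (simp add: bij_betw_def)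
  fix t t' :: "'v set \<Rightarrow> real" and u :: real
  show "mix ((1 - u) *\<^sub>R t + u *\<^sub>R t') = (1 - u) *\<^sub>R mix t + u *\<^sub>R mix t'"
    by (simp add: scaleR_sum_right scaleR_fun_def[of _ t] scaleR_fun_def[of _ t'] scaleR_add_left flip: sum.distrib)
qed

end

section \<open>Quotients by hereditary sets\<close>

lemma is_path_source: "is_path E v es w \<Longrightarrow> path_source E (v, es) = w"
  by (induction es arbitrary: v) auto

lemma path_le_source: "(v, es) \<in> paths E \<Longrightarrow> vertex_le E v (path_source E (v, es))"
  using is_path_source by (fastforce simp: paths_def vertex_le_def)

lemma path_source_graph_minus [simp]: "path_source (graph_minus E H) = path_source E"
  by (simp add: fun_eq_iff path_source_def graph_minus_def)

lemma fin_digraph_graph_minus: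
  assumes E: "fin_digraph E" and H: "\<And>v w. v \<in> H \<Longrightarrow> vertex_le E v w \<Longrightarrow> w \<in> H"
  shows "fin_digraph (graph_minus E H)"
proof -
  interpret fin_digraph E by (rule E)
  show ?thesis
  proof
    fix e assume e: "e \<in> arcs (graph_minus E H)"
    then have "e \<in> arcs E" "tail E e \<in> verts E - H" by (auto simp: graph_minus_def)
    moreover from this have "vertex_le E (head E e) (tail E e)"
      using vertex_matrix_arc_pos[OF E, of e] vertex_matrix_pos_imp_le[OF E] by force
    ultimately show "tail (graph_minus E H) e \<in> verts (graph_minus E H)" "head (graph_minus E H) e \<in> verts (graph_minus E H)"
      using H by (auto simp: graph_minus_def)
  qed (auto simp: graph_minus_def)
qed

text \<open>A hereditary set that a path has entered is not left before its source.\<close>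

lemma paths_graph_minus:
  assumes E: "fin_digraph E" and H: "\<And>v w. v \<in> H \<Longrightarrow> vertex_le E v w \<Longrightarrow> w \<in> H"
  shows "(v, es) \<in> paths (graph_minus E H) \<longleftrightarrow> (v, es) \<in> paths E \<and> path_source E (v, es) \<notin> H"
proof (induction es arbitrary: v)
  case (Cons e es)
  have "tail E e \<notin> H \<and> tail E e \<in> verts E" if "(tail E e, es) \<in> paths E" "path_source E (tail E e, es) \<notin> H"
    using H[OF _ path_le_source[OF that(1)]] that(2) vertex_le_verts(1)[OF E path_le_source[OF that(1)]] by blast
  with Cons.IH[of "tail E e"] show ?case by (auto simp: paths_Cons graph_minus_def)
qed (auto simp: graph_minus_def)

lemma hereditary_quotient_sig:
  fixes A :: "'a cstar" and B :: "'b cstar"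
  assumes A: "toeplitz A E p s" and B: "toeplitz B (graph_minus E H) p' s'"
    and H: "\<And>v w. v \<in> H \<Longrightarrow> vertex_le E v w \<Longrightarrow> w \<in> H"
    and q: "hereditary_quotient_map E H A p s B p' s' q"
    and \<mu>: "\<mu> \<in> paths E" "\<nu> \<in> paths E"
  shows "q (toeplitz.sig A p s \<mu> \<nu>) = (if path_source E \<mu> \<notin> H \<and> path_source E \<nu> \<notin> H then toeplitz.sig B p' s' \<mu> \<nu> else \<zero>\<^bsub>B\<^esub>)"
proof -
  interpret A: toeplitz A E p s by (rule A)
  interpret B: toeplitz B "graph_minus E H" p' s' by (rule B)
  have hom: "x \<in> carrier A \<Longrightarrow> q x \<in> carrier B" "x \<in> carrier A \<Longrightarrow> y \<in> carrier A \<Longrightarrow> q (x \<otimes>\<^bsub>A\<^esub> y) = q x \<otimes>\<^bsub>B\<^esub> q y"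
    "x \<in> carrier A \<Longrightarrow> q (adj A x) = adj B (q x)" for x y
    using q unfolding hereditary_quotient_map_def star_hom_def by blast+
  have gen: "\<And>v. v \<in> verts E \<Longrightarrow> q (p v) = (if v \<notin> H then p' v else \<zero>\<^bsub>B\<^esub>)"
    "\<And>e. e \<in> arcs E \<Longrightarrow> q (s e) = (if tail E e \<notin> H then s' e else \<zero>\<^bsub>B\<^esub>)"
    using q unfolding hereditary_quotient_map_def by blast+
  have pe: "q (A.pe (v, es)) = (if path_source E (v, es) \<notin> H then B.pe (v, es) else \<zero>\<^bsub>B\<^esub>)" if "(v, es) \<in> paths E" for v es
    using that
  proof (induction es arbitrary: v)
    case (Cons e es)
    then have e: "e \<in> arcs E" "(tail E e, es) \<in> paths E" by (auto simp: paths_Cons)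
    have eq: "q (A.pe (v, e # es)) = q (s e) \<otimes>\<^bsub>B\<^esub> q (A.pe (tail E e, es))"
      using e Cons.prems by (simp add: A.pe_Cons hom(2))
    show ?case
    proof (cases "path_source E (tail E e, es) \<in> H")
      case True
      then show ?thesis using Cons.IH[OF e(2)] hom(1)[of "s e"] e by (simp add: eq)
    next
      case False
      then have "tail E e \<notin> H" using H[OF _ path_le_source[OF e(2)]] by blast
      moreover have "(v, e # es) \<in> paths (graph_minus E H)" using paths_graph_minus[OF A.fin_digraph H, where v = v and es = "e # es"] Cons.prems False by simp
      moreover have "tail (graph_minus E H) = tail E" by (simp add: graph_minus_def)
      ultimately show ?thesis using False Cons.IH[OF e(2)] gen(2)[OF e(1)] B.pe_Cons[of v e es] by (simp add: eq)
    qed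
  qed (simp add: gen(1))
  have pe': "q (A.pe \<mu>) = (if path_source E \<mu> \<notin> H then B.pe \<mu> else \<zero>\<^bsub>B\<^esub>)"
    and c: "path_source E \<mu> \<notin> H \<Longrightarrow> B.pe \<mu> \<in> carrier B" if "\<mu> \<in> paths E" for \<mu>
    using pe[of "fst \<mu>" "snd \<mu>"] paths_graph_minus[OF A.fin_digraph H, where v = "fst \<mu>" and es = "snd \<mu>"] that by auto
  show ?thesis using \<mu> pe'[OF \<mu>(1)] pe'[OF \<mu>(2)] c by (auto simp: A.sig_def B.sig_def hom)
qed


section \<open>Decomposition of KMS states\<close>

context critical_toeplitz
begin

text \<open>
  The decomposition of the vector \<open>m\<^sub>v = \<theta>(p\<^sub>v)\<close> into the part on the minimal critical
  components and the rest \<open>w\<close> on \<open>D\<close> is a decomposition of \<open>\<theta>\<close>, as KMS states are determined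
  by their vectors. The total mass of the first part is the weight \<open>U\<close>.
\<close>

theorem kms_state_decomposition:
  assumes \<theta>: "kms_state A \<alpha> (ln r) \<theta>"
    and B: "toeplitz_algebra (graph_minus E G.H) B p' s'" and \<alpha>': "gauge_dynamics (graph_minus E G.H) B p' s' \<alpha>'"
    and q: "hereditary_quotient_map E G.H A p s B p' s' q"
  shows "if G.H = verts E then \<theta> \<in> mix ` weights G.K
     else \<exists>\<phi> \<sigma> u. kms_state B \<alpha>' (ln r) \<phi> \<and> \<sigma> \<in> mix ` weights G.K \<and> u \<in> {0..1} \<and>
       (\<forall>a\<in>carrier A. \<theta> a = of_real (1 - u) * \<phi> (q a) + of_real u * \<sigma> a)"
proof -
  define m where "m v = Re (\<theta> (p v))" for v
  have vals: "kms_values r m \<theta>"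
    unfolding m_def by (rule kms_state_imp_kms_values[OF \<alpha> \<theta> G.r])
  have pos: "positive_functional \<theta>" and one: "\<theta> \<one> = 1" and out: "\<And>a. a \<notin> carrier A \<Longrightarrow> \<theta> a = 0"
    using \<theta> by (simp_all add: kms_state_def state_iff)
  have total: "(\<Sum>v\<in>verts E. m v) = 1"
  proof -
    have "complex_of_real (\<Sum>v\<in>verts E. m v) = \<theta> \<one>"
      by (simp add: pos_one_eq_sum[OF pos] kms_values_p[OF vals])
    then show ?thesis unfolding one by (metis of_real_eq_1_iff)
  qed
  obtain t where t: "\<And>C. C \<in> G.K \<Longrightarrow> 0 \<le> t C"
    "\<And>v. v \<in> G.H \<Longrightarrow> m v = (\<Sum>C\<in>G.K. t C * G.mvec C v)"
    "\<And>v. v \<in> G.D \<Longrightarrow> (\<Sum>C\<in>G.K. t C * G.mvec C v) \<le> m v"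
    "\<And>v. v \<in> G.D \<Longrightarrow> (\<Sum>w\<in>G.D. G.A v w * (m w - (\<Sum>C\<in>G.K. t C * G.mvec C w))) \<le> r * (m v - (\<Sum>C\<in>G.K. t C * G.mvec C v))"
  proof (rule G.subinvariant_decomposition)
    fix v assume v: "v \<in> verts E"
    show "0 \<le> m v" by (rule kms_values_subinvariant(1)[OF vals v G.r])
    show "(\<Sum>w\<in>verts E. G.A v w * m w) \<le> r * m v"
      unfolding vertex_matrix_mult_eq_sum_arcs[OF fin_digraph] by (rule kms_values_subinvariant(2)[OF vals v G.r])
  qed blast
  define c where "c C = (if C \<in> G.K then t C * G.mnorm C else 0)" for C
  define U where "U = (\<Sum>C\<in>G.K. c C)"
  define rest where "rest v = m v - (\<Sum>C\<in>G.K. c C * G.mstate C v)" for v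
  have c0: "0 \<le> c C" for C using t(1)[of C] G.mnorm_pos[of C] by (cases "C \<in> G.K") (simp_all add: c_def)
  have cm: "(\<Sum>C\<in>G.K. c C * G.mstate C v) = (\<Sum>C\<in>G.K. t C * G.mvec C v)" for v
    using G.mnorm_pos by (intro sum.cong) (force simp: c_def G.mstate_def)+
  have rest: "v \<in> G.H \<Longrightarrow> rest v = 0" "v \<in> G.D \<Longrightarrow> 0 \<le> rest v" "v \<in> G.D \<Longrightarrow> (\<Sum>w\<in>G.D. G.A v w * rest w) \<le> r * rest v" for v
    using t(2-4)[of v] by (simp_all add: rest_def cm)
  have "(\<Sum>v\<in>verts E. rest v) = 1 - U" unfolding rest_def sum_subtractf total mix_total U_def ..
  moreover have "(\<Sum>v\<in>verts E. rest v) = (\<Sum>v\<in>G.D. rest v)"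
    using rest(1) by (intro sum.mono_neutral_right) auto
  ultimately have restU: "(\<Sum>v\<in>G.D. rest v) = 1 - U" by simp
  have U: "0 \<le> U" "U \<le> 1"
    using c0 sum_nonneg[of G.D rest] rest(2) restU unfolding U_def by (auto intro: sum_nonneg)
  have cU: "c C \<le> U" for C
  proof (cases "C \<in> G.K")
    case True
    show ?thesis unfolding U_def by (rule member_le_sum[OF True c0 G.K_finite])
  next
    case False
    then show ?thesis using U(1) by (simp add: c_def)
  qed
  \<comment> \<open>If \<open>U = 0\<close>, the second part of the combination is absent and any weights will do.\<close>
  obtain k where k: "k \<in> weights G.K" "\<And>C. C \<in> G.K \<Longrightarrow> U * k C = c C"
  proof (cases "U = 0")
    case True
    obtain C where C: "C \<in> G.K" using G.K_nonempty by blast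
    show thesis
    proof (rule that[of "\<lambda>C'. if C' = C then 1 else 0"])
      show "(\<lambda>C'. if C' = C then 1 else 0) \<in> weights G.K"
        using C G.K_finite by (auto simp: weights_def)
      show "U * (if C' = C then 1 else 0) = c C'" for C' using True c0[of C'] cU[of C'] by auto
    qed
  next
    case False
    show thesis
    proof (rule that[of "\<lambda>C. c C / U"])
      show "(\<lambda>C. c C / U) \<in> weights G.K"
      proof -
        have "0 \<le> c C / U" "c C / U \<le> 1" for C using c0[of C] cU[of C] U(1) False by (auto simp: divide_le_eq_1)
        moreover have "c C / U = 0" if "C \<notin> G.K" for C using that by (simp add: c_def)
        moreover have "(\<Sum>C\<in>G.K. c C / U) = 1" using False by (simp add: U_def sum_divide_distrib[symmetric])
        ultimately show ?thesis unfolding weights_def by blast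
      qed
    qed (use False in simp)
  qed
  have k0: "0 \<le> k C" if "C \<in> G.K" for C using k(1) that by (simp add: weights_def)
  note mixk = mix_values[of k, OF k0]
  show ?thesis
  proof (cases "G.H = verts E")
    case True
    then have "U = 1" using restU by simp
    have "\<theta> = mix k"
    proof
      fix a show "\<theta> a = mix k a"
      proof (cases "a \<in> carrier A")
        case a: True
        show ?thesis
        proof (rule kms_values_unique[OF vals mixk _ a])
          fix v assume v: "v \<in> verts E"
          have "m v = (\<Sum>C\<in>G.K. c C * G.mstate C v)" using rest(1)[of v] v True by (simp add: rest_def)
          then show "m v = (\<Sum>C\<in>G.K. k C * G.mstate C v)" using k(2) \<open>U = 1\<close> by simp
        qed
      qed (simp add: out mix_zero)
    qed
    then show ?thesis using True k(1) by auto
  next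
    case False
    then have "G.D \<noteq> {}" by (auto simp: minimal_hull_def)
    \<comment> \<open>If \<open>U = 1\<close>, the first part is absent and any subinvariant vector will do.\<close>
    obtain w where w: "\<And>v. v \<in> G.D \<Longrightarrow> 0 \<le> w v" "\<And>v. v \<in> G.D \<Longrightarrow> (\<Sum>u\<in>G.D. G.A v u * w u) \<le> r * w v"
      "(\<Sum>v\<in>G.D. w v) = 1" "\<And>v. v \<in> G.D \<Longrightarrow> (1 - U) * w v = rest v"
    proof (cases "U = 1")
      case True
      obtain w where "\<And>v. v \<in> G.D \<Longrightarrow> 0 \<le> w v" "\<And>v. v \<in> G.D \<Longrightarrow> (\<Sum>u\<in>G.D. G.A v u * w u) \<le> r * w v" "(\<Sum>v\<in>G.D. w v) = 1"
        using G.subinvariant_exists[OF \<open>G.D \<noteq> {}\<close>] by blast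
      moreover have "rest v = 0" if "v \<in> G.D" for v
        using restU True sum_nonneg_eq_0_iff[of G.D rest] rest(2) that by simp
      ultimately show thesis using True by (intro that[of w]) auto
    next
      case U1: False
      then have U1: "0 < 1 - U" using U by simp
      show thesis
      proof (rule that[of "\<lambda>v. rest v / (1 - U)"])
        fix v assume v: "v \<in> G.D"
        show "0 \<le> rest v / (1 - U)" using rest(2)[OF v] U1 by simp
        have "(\<Sum>u\<in>G.D. G.A v u * (rest u / (1 - U))) = (\<Sum>u\<in>G.D. G.A v u * rest u) / (1 - U)" by (simp add: sum_divide_distrib)
        also have "\<dots> \<le> r * rest v / (1 - U)" using rest(3)[OF v] U1 by (intro divide_right_mono) auto
        finally show "(\<Sum>u\<in>G.D. G.A v u * (rest u / (1 - U))) \<le> r * (rest v / (1 - U))" by simp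
        show "(1 - U) * (rest v / (1 - U)) = rest v" using U1 by simp
      qed (use restU U1 in \<open>simp flip: sum_divide_distrib\<close>)
    qed
    let ?F = "graph_minus E G.H"
    have F: "fin_digraph ?F" using fin_digraph_graph_minus[OF fin_digraph, of G.H] G.H_up by blast
    interpret B: toeplitz B ?F p' s' by (rule toeplitz_algebra_imp_toeplitz[OF F B])
    have vF: "verts ?F = G.D" and tF: "tail ?F = tail E" and aF: "{e \<in> arcs ?F. head ?F e = v} = {e \<in> arcs E. head E e = v \<and> tail E e \<in> G.D}" for v
      by (auto simp: graph_minus_def)
    have "\<exists>\<phi>. B.kms_values r w \<phi> \<and> (\<forall>a. a \<notin> carrier B \<longrightarrow> \<phi> a = 0)"
    proof (rule kms_values_exists[OF F B G.r])
      fix v assume "v \<in> verts ?F"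
      then have v: "v \<in> G.D" by (simp only: vF)
      show "0 \<le> w v" by (rule w(1)[OF v])
      have "(\<Sum>e\<in>{e \<in> arcs ?F. head ?F e = v}. w (tail ?F e))
          = (\<Sum>e\<in>edges_into E v. if tail E e \<in> G.D then w (tail E e) else 0)"
        unfolding aF tF by (rule sum.mono_neutral_cong_left) auto
      also have "\<dots> = (\<Sum>u\<in>verts E. G.A v u * (if u \<in> G.D then w u else 0))"
        by (rule vertex_matrix_mult_eq_sum_arcs[OF fin_digraph, symmetric])
      also have "\<dots> = (\<Sum>u\<in>G.D. G.A v u * w u)"
        by (rule sum.mono_neutral_cong_right) auto
      finally show "(\<Sum>e\<in>{e \<in> arcs ?F. head ?F e = v}. w (tail ?F e)) \<le> r * w v" using w(2)[OF v] by simp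
    qed
    then obtain \<phi> where \<phi>: "B.kms_values r w \<phi>" "\<And>a. a \<notin> carrier B \<Longrightarrow> \<phi> a = 0" by blast
    have posB: "B.positive_functional \<phi>" using \<phi>(1) by (simp add: B.kms_values_def)
    have \<phi>_kms: "kms_state B \<alpha>' (ln r) \<phi>"
      by (rule B.kms_values_imp_kms_state[OF \<alpha>' \<phi>(1) G.r]) (use w(3) \<phi>(2) in \<open>simp_all only: vF\<close>)
    have hom: "star_hom A B q" using q by (simp add: hereditary_quotient_map_def)
    have \<phi>q: "kms_values r (\<lambda>v. if v \<in> G.D then w v else 0) (\<lambda>a. \<phi> (q a))"
      unfolding kms_values_def
    proof (intro conjI ballI)
      show "positive_functional (\<lambda>a. \<phi> (q a))"
        using hom unfolding positive_functional_def star_hom_def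
        by (auto simp: B.pos_add[OF posB] B.pos_scal[OF posB] B.pos_real[OF posB] B.pos_nonneg[OF posB] Pi_iff)
      fix \<mu> \<nu> assume \<mu>: "\<mu> \<in> paths E" "\<nu> \<in> paths E"
      have qs: "q (sig \<mu> \<nu>) = (if src \<mu> \<notin> G.H \<and> src \<nu> \<notin> G.H then B.sig \<mu> \<nu> else \<zero>\<^bsub>B\<^esub>)"
        by (rule hereditary_quotient_sig[OF toeplitz_axioms B.toeplitz_axioms G.H_up q \<mu>])
      have pF: "\<mu> \<in> paths ?F" if "\<mu> \<in> paths E" "src \<mu> \<notin> G.H" for \<mu>
        using paths_graph_minus[OF fin_digraph G.H_up, where v = "fst \<mu>" and es = "snd \<mu>"] that by simp
      have sv: "src \<mu> \<in> verts E" using path_source_in_verts[of "fst \<mu>" "snd \<mu>"] \<mu>(1) by simp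
      show "\<phi> (q (sig \<mu> \<nu>)) = (if \<mu> = \<nu> then of_real (inverse r ^ path_length \<mu> * (if src \<mu> \<in> G.D then w (src \<mu>) else 0)) else 0)"
      proof (cases "src \<mu> \<notin> G.H \<and> src \<nu> \<notin> G.H")
        case True
        then have "\<phi> (B.sig \<mu> \<nu>) = (if \<mu> = \<nu> then of_real (inverse r ^ path_length \<mu> * w (src \<mu>)) else 0)"
          using \<phi>(1) pF \<mu> unfolding B.kms_values_def by simp
        moreover have "q (sig \<mu> \<nu>) = B.sig \<mu> \<nu>" using True qs by simp
        ultimately show ?thesis using True sv by (cases "\<mu> = \<nu>") simp_all
      next
        case False
        then show ?thesis by (auto simp: qs B.pos_zero[OF posB])
      qed
    qed
    have "\<theta> a = of_real (1 - U) * \<phi> (q a) + of_real U * mix k a" if a: "a \<in> carrier A" for a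
    proof (rule kms_values_unique[OF vals kms_values_combination[OF \<phi>q mixk] _ a])
      show "0 \<le> 1 - U" "0 \<le> U" using U by auto
      fix v assume v: "v \<in> verts E"
      have "U * (\<Sum>C\<in>G.K. k C * G.mstate C v) = (\<Sum>C\<in>G.K. c C * G.mstate C v)"
        using k(2) by (simp add: sum_distrib_left mult.assoc[symmetric])
      moreover have "(1 - U) * (if v \<in> G.D then w v else 0) = rest v"
        using w(4)[of v] rest(1)[of v] v by auto
      ultimately show "m v = (1 - U) * (if v \<in> G.D then w v else 0) + U * (\<Sum>C\<in>G.K. k C * G.mstate C v)"
        by (simp add: rest_def)
    qed
    then have "\<exists>\<phi> \<sigma> u. kms_state B \<alpha>' (ln r) \<phi> \<and> \<sigma> \<in> mix ` weights G.K \<and> u \<in> {0..1} \<and>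
       (\<forall>a\<in>carrier A. \<theta> a = of_real (1 - u) * \<phi> (q a) + of_real u * \<sigma> a)"
      using \<phi>_kms k(1) U by (intro exI[of _ \<phi>] exI[of _ "mix k"] exI[of _ U]) auto
    then show ?thesis using False by simp
  qed
qed

end


theorem theorem4p3:
  fixes E :: "('v, 'e) pre_digraph"
    and A :: "'a cstar" and p :: "'v \<Rightarrow> 'a" and s :: "'e \<Rightarrow> 'a"
    and \<alpha> :: "real \<Rightarrow> 'a \<Rightarrow> 'a" and \<gamma> :: "real \<Rightarrow> 'a set \<Rightarrow> 'a set"
    and B :: "'b cstar" and p' :: "'v \<Rightarrow> 'b" and s' :: "'e \<Rightarrow> 'b"
    and \<alpha>' :: "real \<Rightarrow> 'b \<Rightarrow> 'b" and q :: "'a \<Rightarrow> 'b"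
  assumes "fin_digraph E"
    and "has_cycle E"
    and "toeplitz_algebra E A p s"
    and "gauge_dynamics E A p s \<alpha>"
    and "gauge_dynamics E (graph_algebra E A p s)
           (graph_quotient_map E A p s \<circ> p) (graph_quotient_map E A p s \<circ> s) \<gamma>"
    and "toeplitz_algebra (graph_minus E (mc_hull E)) B p' s'"
    and "gauge_dynamics (graph_minus E (mc_hull E)) B p' s' \<alpha>'"
    and "hereditary_quotient_map E (mc_hull E) A p s B p' s' q"
  shows
    "mat_invertible (verts E - mc_hull E) (z_matrix E) \<and>
     (\<forall>C\<in>mc E. \<forall>v\<in>verts E - mc_hull E. 0 \<le> z_vector E C v) \<and>
     (\<exists>\<psi> :: 'v set \<Rightarrow> 'a \<Rightarrow> complex.
        (\<forall>C\<in>mc E.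
           kms_state A \<alpha> (ln (graph_rho E)) (\<psi> C) \<and>
           (\<forall>\<mu>\<in>paths E. \<forall>\<nu>\<in>paths E.
              \<psi> C (path_elem A p s \<mu> \<otimes>\<^bsub>A\<^esub> adj A (path_elem A p s \<nu>)) =
                of_real ((if \<mu> = \<nu> then 1 else 0) * inverse (graph_rho E) ^ path_length \<mu> *
                  inverse (1 + (\<Sum>v\<in>verts E - mc_hull E. \<bar>z_vector E C v\<bar>)) *
                  (if path_source E \<mu> \<in> verts E - mc_hull E then z_vector E C (path_source E \<mu>)
                   else if path_source E \<mu> \<in> C then pf_vector E C (path_source E \<mu>)
                   else 0))) \<and>
           (\<exists>\<psi>'. kms_state (graph_algebra E A p s) \<gamma> (ln (graph_rho E)) \<psi>' \<and>
              (\<forall>a\<in>carrier A. \<psi> C a = \<psi>' (graph_quotient_map E A p s a)))) \<and>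
        (\<exists>\<Sigma>. is_simplex \<Sigma> \<and>
           (\<forall>\<sigma>\<in>\<Sigma>. kms_state A \<alpha> (ln (graph_rho E)) \<sigma>) \<and>
           affine_isomorphism (weights (mc E)) \<Sigma> (\<lambda>t. \<Sum>C\<in>mc E. t C *\<^sub>R \<psi> C) \<and>
           (\<forall>\<theta>. kms_state A \<alpha> (ln (graph_rho E)) \<theta> \<longrightarrow>
              (if mc_hull E = verts E then \<theta> \<in> \<Sigma>
               else \<exists>\<phi> \<sigma> u. kms_state B \<alpha>' (ln (graph_rho E)) \<phi> \<and> \<sigma> \<in> \<Sigma> \<and> u \<in> {0..1} \<and>
                      (\<forall>a\<in>carrier A. \<theta> a = of_real (1 - u) * \<phi> (q a) + of_real u * \<sigma> a)))))"
proof -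
  define r where "r = graph_rho E"
  interpret G: critical_radius E r unfolding r_def by (rule critical_radius_graph_rho[OF assms(1,2)])
  interpret toeplitz A E p s by (rule toeplitz_algebra_imp_toeplitz[OF assms(1,3)])
  interpret T: critical_toeplitz A E p s r \<alpha> by unfold_locales (rule assms(3,4))+
  have mc: "mc E = G.K" and hull: "mc_hull E = G.H" by (simp_all add: mc_eq mc_hull_eq r_def)
  have zm: "z_matrix E = (\<lambda>v w. (if v = w then 1 else 0) - inverse r * vertex_matrix E v w)"
    by (simp add: fun_eq_iff z_matrix_def r_def)
  have pf: "pf_vector E C = G.pf C" if "C \<in> G.K" for C by (rule G.pf_vector_eq[OF that])
  have zv: "z_vector E C v = G.zv C v" if "C \<in> G.K" for C v
    unfolding z_vector_def G.zv_def zm hull pf[OF that] r_def[symmetric] ..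
  have norm: "1 + (\<Sum>v\<in>verts E - mc_hull E. \<bar>z_vector E C v\<bar>) = G.mnorm C" if "C \<in> G.K" for C
    unfolding G.mnorm_def hull zv[OF that] using G.zv_nonneg[OF that]
    by (intro arg_cong[where f = "(+) 1"] sum.cong) auto
  have val: "inverse (G.mnorm C) * (if v \<in> verts E - mc_hull E then z_vector E C v
      else if v \<in> C then pf_vector E C v else 0) = G.mstate C v" if "C \<in> G.K" for C v
    using G.pf(2)[OF that, of v]
    by (simp add: G.mstate_def G.mvec_def hull zv[OF that] pf[OF that] divide_inverse mult.commute)
  show ?thesis
    unfolding r_def[symmetric] mc
  proof (intro conjI exI[of _ T.\<psi>] exI[of _ "T.mix ` weights G.K"] ballI allI impI)
    show "mat_invertible (verts E - mc_hull E) (z_matrix E)"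
      unfolding hull zm by (rule resolvent_invertible[OF G.D_facts G.r])
    show "is_simplex (T.mix ` weights G.K)" by (rule T.simplex)
    show "affine_isomorphism (weights G.K) (T.mix ` weights G.K) T.mix" by (rule T.mix_affine)
    show "kms_state A \<alpha> (ln r) \<sigma>" if "\<sigma> \<in> T.mix ` weights G.K" for \<sigma>
      using that T.mix_kms by blast
    show "if mc_hull E = verts E then \<theta> \<in> T.mix ` weights G.K
       else \<exists>\<phi> \<sigma> u. kms_state B \<alpha>' (ln r) \<phi> \<and> \<sigma> \<in> T.mix ` weights G.K \<and> u \<in> {0..1} \<and>
         (\<forall>a\<in>carrier A. \<theta> a = of_real (1 - u) * \<phi> (q a) + of_real u * \<sigma> a)"
      if "kms_state A \<alpha> (ln r) \<theta>" for \<theta>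
      using T.kms_state_decomposition[OF that assms(6-8)[unfolded hull]] unfolding hull .
  next
    fix C assume C: "C \<in> G.K"
    show "0 \<le> z_vector E C v" if "v \<in> verts E - mc_hull E" for v
      using G.zv_nonneg[OF C] that by (simp add: hull zv[OF C])
    show "kms_state A \<alpha> (ln r) (T.\<psi> C)" by (rule T.\<psi>_kms[OF C])
    show "\<exists>\<psi>'. kms_state (graph_algebra E A p s) \<gamma> (ln r) \<psi>' \<and>
        (\<forall>a\<in>carrier A. T.\<psi> C a = \<psi>' (graph_quotient_map E A p s a))"
      by (rule kms_state_factors[OF T.\<psi>(1)[OF C] G.r G.mstate(2,3)[OF C] assms(5)])
    fix \<mu> \<nu> assume "\<mu> \<in> paths E" "\<nu> \<in> paths E"
    then show "T.\<psi> C (pe \<mu> \<otimes>\<^bsub>A\<^esub> adj A (pe \<nu>)) =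
        of_real ((if \<mu> = \<nu> then 1 else 0) * inverse r ^ path_length \<mu> *
          inverse (1 + (\<Sum>v\<in>verts E - mc_hull E. \<bar>z_vector E C v\<bar>)) *
          (if src \<mu> \<in> verts E - mc_hull E then z_vector E C (src \<mu>)
           else if src \<mu> \<in> C then pf_vector E C (src \<mu>) else 0))"
      unfolding norm[OF C] mult.assoc val[OF C] using T.\<psi>(1)[OF C] unfolding kms_values_def sig_def by simp
  qed
qed

end
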